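(* Let $T$ be a rank-one automorphism of class $\mathcal{T}_2$, acting on its sigma-finite measure space $(X,\mu)$. Denote also by $T$ the induced unitary operator on $L_2(\mu)$. Then: (1) $T$ is mixing, i.e. $\mu(A\cap T^mB)\to 0$ as $m\to\infty$ for all measurable sets $A,B\subset X$ of finite measure; (2) the spectrum of $T$ does not have Kolmogorov's group property, i.e. if $\sigma$ is a measure of maximal spectral type of the operator $T$ on $L_2(\mu)$, then it is not true that $\sigma*\sigma\ll\sigma$; (3) the symmetric tensor square $T\odot T$, acting on $L_2(\mu)\odot L_2(\mu)$, has simple spectrum, and hence the product $T\otimes T$, acting on $L_2(\mu)\otimes L_2(\mu)$, has homogeneous spectrum of multiplicity $2$.
   Context: **Rank-one constructions.** The parameters are an integer $h_1\ge 4$, a sequence of integers $r_j$ ($j\ge 1$), and vectors of non-negative integers $\bar s_j=(s_j(1),s_j(2),\dots,s_j(r_j))$, $j\ge1$. They determine a measure-preserving transformation $T$ as follows. At stage $1$ a half-interval $E_1$ is given. At stage $j$ there is a system of disjoint half-intervals (the tower of stage $j$) $$E_j,\ TE_j,\ T^2E_j,\ \dots,\ T^{h_j-1}E_j,$$ with union $X_j$, where $T$ acts on $E_j,TE_j,\dots,T^{h_j-2}E_j$ by parallel translation. Represent $E_j$ as a disjoint union of $r_j$ half-intervals $E_j^1,E_j^2,\dots,E_j^{r_j}$ of equal length. For each $i=1,\dots,r_j$ consider the column $E_j^i,TE_j^i,\dots,T^{h_j-1}E_j^i$ and add on top of it $s_j(i)$ new disjoint half-intervals of the same length as $E_j^i$,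 giving $$E_j^i,\ TE_j^i,\ \dots,\ T^{h_j-1}E_j^i,\ T^{h_j}E_j^i,\ \dots,\ T^{h_j+s_j(i)-1}E_j^i$$ (all these sets, over all $i$, being disjoint, with $T$ acting by translation from each one to the next). Put $E_{j+1}=E_j^1$ and, for $i<r_j$, set $T^{h_j+s_j(i)}E_j^i=E_j^{i+1}$ (again by translation). This gives the tower of stage $j+1$: $E_{j+1},TE_{j+1},\dots,T^{h_{j+1}-1}E_{j+1}$, where $$h_{j+1}=h_jr_j+\sum_{i=1}^{r_j}s_j(i).$$ The definition of $T$ made at stage $j$ is preserved at later stages. The result is the space $X=\bigcup_jX_j$ and an (almost everywhere defined) invertible transformation $T:X\to X$ preserving the Lebesgue measure $\mu$ on $X$. **The class $\mathcal{T}_2$.** For natural numbers (positive integers) $r,n$ put $$J(r,n):=\{\,j : r_j=r,\ s_j(r_j-1)=n\,\}.$$ The rank-one automorphism $T$ belongs to the class $\mathcal{T}_2$ if its parameters satisfy all of the following conditions: - $r_j$ is nondecreasing and takes all integer values starting with $r_1$, where $r_1>4$; - $J(r,n)=\varnothing$ for $r<n$; - $\limsup_{r\to\infty}\dfrac{|J(r,n)|}{r^4}=+\infty$ for every $n$; - for every $j$: $s_j(1)\ge 4h_j$, and $s_j(i)\ge 4s_j(i-1)$ for $i=2,\dots,r_j-3$; - for every $j$: $s_j(r_j-2)=0$ and $s_j(r_j)\ge 4s_j(r_j-3)$. (Under these conditions $\mu(X)=\infty$.) **Spectral notions.** The automorphism $T$ and the change-of-variables unitary operator it induces on $L_2(\mu)$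 are denoted by the same letter. A unitary operator $U$ on a separable Hilbert space $H$ has simple spectrum if there is $h\in H$ such that the closed linear span of $\{U^nh: n\in\mathbb{Z}\}$ is $H$. It has homogeneous spectrum of multiplicity $2$ if its spectral multiplicity function equals $2$ almost everywhere with respect to its maximal spectral type (equivalently, $U$ is unitarily equivalent to $V\oplus V$ for some unitary $V$ with simple spectrum). $L_2(\mu)\odot L_2(\mu)$ is the subspace of symmetric tensors in the Hilbert tensor product $L_2(\mu)\otimes L_2(\mu)$, and $T\odot T$ is the restriction of $T\otimes T$ to it. Kolmogorov's group property of the spectrum of $T$ means that the spectral measure $\sigma$ (maximal spectral type of $T$ on $L_2(\mu)$, a measure on the unit circle group) subordinates its convolution square: $\sigma*\sigma\ll\sigma$. *)

theory Defs
  imports "HOL-Analysis.Analysis" "HOL-Library.Function_Algebras"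
begin

section \<open>Rank-one constructions\<close>

definition half_interval :: "real set \<Rightarrow> bool" where
  "half_interval I \<longleftrightarrow> (\<exists>a b. a < b \<and> I = {a..<b})"

definition translates :: "(real \<Rightarrow> real) \<Rightarrow> real set \<Rightarrow> bool" where
  "translates T I \<longleftrightarrow> (\<exists>c. \<forall>x\<in>I. T x = x + c)"

definition rank_one_space :: "(nat \<Rightarrow> nat) \<Rightarrow> (nat \<Rightarrow> real set) \<Rightarrow> (real \<Rightarrow> real) \<Rightarrow> real set" where
  "rank_one_space h E T = (\<Union>j\<in>{1..}. \<Union>k<h j. (T ^^ k) ` E j)"

text \<open>
  The stage \<open>j\<close> tower has base \<open>E j\<close> and height \<open>h j\<close>; \<open>S j i\<close> is the \<open>i\<close>-th piece of \<open>E j\<close>.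
  Stages and pieces are numbered from 1; values at index 0 are irrelevant.
  The positions of the half-intervals on the line, and the order of the pieces inside \<open>E j\<close>, are
  arbitrary. The map \<open>T\<close> is a total function on the reals; its values outside
  \<open>rank_one_space h E T\<close> are irrelevant, and at a point of that space that lies in the top level of
  every sufficiently late tower its value is an arbitrary point of the space.
\<close>

locale rank_one =
  fixes h :: "nat \<Rightarrow> nat" and r :: "nat \<Rightarrow> nat" and s :: "nat \<Rightarrow> nat \<Rightarrow> nat"
    and E :: "nat \<Rightarrow> real set" and S :: "nat \<Rightarrow> nat \<Rightarrow> real set" and T :: "real \<Rightarrow> real"
  assumes h_one: "4 \<le> h 1"
    and r_pos: "j \<ge> 1 \<Longrightarrow> 1 \<le> r j"
    and h_step: "j \<ge> 1 \<Longrightarrow> h (Suc j) = h j * r j + (\<Sum>i=1..r j. s j i)"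
    and base: "j \<ge> 1 \<Longrightarrow> half_interval (E j)"
    and tower_disjoint: "j \<ge> 1 \<Longrightarrow> disjoint_family_on (\<lambda>k. (T ^^ k) ` E j) {..<h j}"
    and tower_translation: "j \<ge> 1 \<Longrightarrow> Suc k < h j \<Longrightarrow> translates T ((T ^^ k) ` E j)"
    and piece: "j \<ge> 1 \<Longrightarrow> i \<in> {1..r j} \<Longrightarrow> half_interval (S j i)"
    and piece_length: "j \<ge> 1 \<Longrightarrow> i \<in> {1..r j} \<Longrightarrow> measure lborel (S j i) = measure lborel (S j 1)"
    and piece_disjoint: "j \<ge> 1 \<Longrightarrow> disjoint_family_on (S j) {1..r j}"
    and piece_union: "j \<ge> 1 \<Longrightarrow> (\<Union>i\<in>{1..r j}. S j i) = E j"
    and column_translation: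
      "j \<ge> 1 \<Longrightarrow> i \<in> {1..r j} \<Longrightarrow> Suc k < h j + s j i \<Longrightarrow> translates T ((T ^^ k) ` S j i)"
    and column_disjoint:
      "j \<ge> 1 \<Longrightarrow>
        disjoint_family_on (\<lambda>(i, k). (T ^^ k) ` S j i) (SIGMA i:{1..r j}. {..<h j + s j i})"
    and next_base: "j \<ge> 1 \<Longrightarrow> E (Suc j) = S j 1"
    and stack:
      "j \<ge> 1 \<Longrightarrow> 1 \<le> i \<Longrightarrow> i < r j \<Longrightarrow>
        (T ^^ (h j + s j i)) ` S j i = S j (Suc i) \<and>
        translates T ((T ^^ (h j + s j i - 1)) ` S j i)"
    and self_map: "T ` rank_one_space h E T \<subseteq> rank_one_space h E T"

definition J :: "(nat \<Rightarrow> nat) \<Rightarrow> (nat \<Rightarrow> nat \<Rightarrow> nat) \<Rightarrow> nat \<Rightarrow> nat \<Rightarrow> nat set" where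
  "J r s q n = {j. j \<ge> 1 \<and> r j = q \<and> s j (r j - 1) = n}"

text \<open>The first two conditions make every set \<open>J r s q n\<close> finite, so \<open>card\<close> is the true cardinality.\<close>

definition class_T2 :: "(nat \<Rightarrow> nat) \<Rightarrow> (nat \<Rightarrow> nat) \<Rightarrow> (nat \<Rightarrow> nat \<Rightarrow> nat) \<Rightarrow> bool" where
  "class_T2 h r s \<longleftrightarrow>
     4 < r 1 \<and> (\<forall>j\<ge>1. r j \<le> r (Suc j)) \<and> r ` {1..} = {r 1..} \<and>
     (\<forall>q n. 1 \<le> q \<and> 1 \<le> n \<and> q < n \<longrightarrow> J r s q n = {}) \<and>
     (\<forall>n\<ge>1. limsup (\<lambda>q. ereal (real (card (J r s q n)) / real q ^ 4)) = \<infinity>) \<and>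
     (\<forall>j\<ge>1. 4 * h j \<le> s j 1 \<and> (\<forall>i\<in>{2..r j - 3}. 4 * s j (i - 1) \<le> s j i)) \<and>
     (\<forall>j\<ge>1. s j (r j - 2) = 0 \<and> 4 * s j (r j - 3) \<le> s j (r j))"

definition mixing :: "'a measure \<Rightarrow> ('a \<Rightarrow> 'a) \<Rightarrow> bool" where
  "mixing M T \<longleftrightarrow>
     (\<forall>A\<in>sets M. \<forall>B\<in>sets M. emeasure M A < \<infinity> \<longrightarrow> emeasure M B < \<infinity> \<longrightarrow>
        (\<forall>m. (T ^^ m) ` B \<in> sets M) \<and>
        (\<lambda>m. measure M (A \<inter> (T ^^ m) ` B)) \<longlonglongrightarrow> 0)"


section \<open>Hilbert spaces\<close>

text \<open>
  A complex Hilbert space is given by a linear subspace \<open>vecs\<close> of a type together with a positive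
  semidefinite inner product (linear in the first argument). Vectors at distance zero are
  identified (relation \<open>heq\<close>), as functions in \<open>L2\<close> that agree almost everywhere are; no quotient
  is formed, and all notions below are invariant under this identification.
\<close>

record 'v hilb =
  vecs :: "'v set"
  scal :: "complex \<Rightarrow> 'v \<Rightarrow> 'v"
  ip :: "'v \<Rightarrow> 'v \<Rightarrow> complex"

definition hnorm :: "'v hilb \<Rightarrow> 'v \<Rightarrow> real" where
  "hnorm H x = sqrt (Re (ip H x x))"

definition heq :: "'v::ab_group_add hilb \<Rightarrow> 'v \<Rightarrow> 'v \<Rightarrow> bool" where
  "heq H x y \<longleftrightarrow> hnorm H (x - y) = 0"

locale hilbert_space =
  fixes H :: "'v::ab_group_add hilb"
  assumes vector_space: "vector_space (scal H)"
    and subspace: "module.subspace (scal H) (vecs H)"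
    and ip_add: "x \<in> vecs H \<Longrightarrow> y \<in> vecs H \<Longrightarrow> z \<in> vecs H \<Longrightarrow> ip H (x + y) z = ip H x z + ip H y z"
    and ip_scal: "x \<in> vecs H \<Longrightarrow> y \<in> vecs H \<Longrightarrow> ip H (scal H c x) y = c * ip H x y"
    and ip_cnj: "x \<in> vecs H \<Longrightarrow> y \<in> vecs H \<Longrightarrow> ip H y x = cnj (ip H x y)"
    and ip_nonneg: "x \<in> vecs H \<Longrightarrow> 0 \<le> Re (ip H x x)"
    and complete:
      "(\<And>n. u n \<in> vecs H) \<Longrightarrow> (\<And>e. e > 0 \<Longrightarrow> \<exists>N. \<forall>m\<ge>N. \<forall>n\<ge>N. hnorm H (u m - u n) < e) \<Longrightarrow>
        \<exists>l\<in>vecs H. (\<lambda>n. hnorm H (u n - l)) \<longlonglongrightarrow> 0"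

definition closed_span :: "'v::ab_group_add hilb \<Rightarrow> 'v set \<Rightarrow> 'v set" where
  "closed_span H B =
     {x \<in> vecs H. \<forall>e>0. \<exists>y\<in>module.span (scal H) B. hnorm H (x - y) < e}"

definition linear_op :: "'v::ab_group_add hilb \<Rightarrow> 'w::ab_group_add hilb \<Rightarrow> ('v \<Rightarrow> 'w) \<Rightarrow> bool" where
  "linear_op H K W \<longleftrightarrow>
     (\<forall>x\<in>vecs H. W x \<in> vecs K) \<and>
     (\<forall>x\<in>vecs H. \<forall>y\<in>vecs H. heq K (W (x + y)) (W x + W y)) \<and>
     (\<forall>c. \<forall>x\<in>vecs H. heq K (W (scal H c x)) (scal K c (W x)))"

definition bounded_op :: "'v::ab_group_add hilb \<Rightarrow> ('v \<Rightarrow> 'v) \<Rightarrow> bool" where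
  "bounded_op H W \<longleftrightarrow> linear_op H H W \<and> (\<exists>C. \<forall>x\<in>vecs H. hnorm H (W x) \<le> C * hnorm H x)"

definition hilbert_iso :: "'v::ab_group_add hilb \<Rightarrow> 'w::ab_group_add hilb \<Rightarrow> ('v \<Rightarrow> 'w) \<Rightarrow> bool" where
  "hilbert_iso H K W \<longleftrightarrow>
     linear_op H K W \<and>
     (\<forall>x\<in>vecs H. \<forall>y\<in>vecs H. ip K (W x) (W y) = ip H x y) \<and>
     (\<forall>y\<in>vecs K. \<exists>x\<in>vecs H. heq K (W x) y)"

definition unitary_op :: "'v::ab_group_add hilb \<Rightarrow> ('v \<Rightarrow> 'v) \<Rightarrow> bool" where
  "unitary_op H U \<longleftrightarrow> hilbert_iso H H U"

definition inv_op :: "'v::ab_group_add hilb \<Rightarrow> ('v \<Rightarrow> 'v) \<Rightarrow> 'v \<Rightarrow> 'v" where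
  "inv_op H U y = (SOME x. x \<in> vecs H \<and> heq H (U x) y)"

definition int_power :: "'v::ab_group_add hilb \<Rightarrow> ('v \<Rightarrow> 'v) \<Rightarrow> int \<Rightarrow> 'v \<Rightarrow> 'v" where
  "int_power H U n = (if 0 \<le> n then U ^^ nat n else inv_op H U ^^ nat (- n))"

definition unitarily_equivalent ::
  "'v::ab_group_add hilb \<Rightarrow> ('v \<Rightarrow> 'v) \<Rightarrow> 'w::ab_group_add hilb \<Rightarrow> ('w \<Rightarrow> 'w) \<Rightarrow> bool" where
  "unitarily_equivalent H U K V \<longleftrightarrow>
     (\<exists>W. hilbert_iso H K W \<and> (\<forall>x\<in>vecs H. heq K (W (U x)) (V (W x))))"

definition direct_sum :: "'v hilb \<Rightarrow> 'w hilb \<Rightarrow> ('v \<times> 'w) hilb" where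
  "direct_sum H K =
     \<lparr>vecs = vecs H \<times> vecs K,
      scal = (\<lambda>c (x, y). (scal H c x, scal K c y)),
      ip = (\<lambda>(x, y) (x', y'). ip H x x' + ip K y y')\<rparr>"

definition tensor_product ::
  "'v::ab_group_add hilb \<Rightarrow> 'w::ab_group_add hilb \<Rightarrow> 'p::ab_group_add hilb \<Rightarrow> ('v \<Rightarrow> 'w \<Rightarrow> 'p) \<Rightarrow> bool" where
  "tensor_product H K P t \<longleftrightarrow>
     hilbert_space P \<and>
     (\<forall>x\<in>vecs H. linear_op K P (t x)) \<and>
     (\<forall>y\<in>vecs K. linear_op H P (\<lambda>x. t x y)) \<and>
     (\<forall>x\<in>vecs H. \<forall>x'\<in>vecs H. \<forall>y\<in>vecs K. \<forall>y'\<in>vecs K.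
        ip P (t x y) (t x' y') = ip H x x' * ip K y y') \<and>
     closed_span P {t x y |x y. x \<in> vecs H \<and> y \<in> vecs K} = vecs P"

text \<open>\<open>W\<close> is the operator \<open>U \<otimes> V\<close>; these conditions determine it up to \<open>heq P\<close>.\<close>

definition tensor_op ::
  "'v::ab_group_add hilb \<Rightarrow> 'w::ab_group_add hilb \<Rightarrow> 'p::ab_group_add hilb \<Rightarrow> ('v \<Rightarrow> 'w \<Rightarrow> 'p) \<Rightarrow>
   ('v \<Rightarrow> 'v) \<Rightarrow> ('w \<Rightarrow> 'w) \<Rightarrow> ('p \<Rightarrow> 'p) \<Rightarrow> bool" where
  "tensor_op H K P t U V W \<longleftrightarrow>
     bounded_op P W \<and> (\<forall>x\<in>vecs H. \<forall>y\<in>vecs K. heq P (W (t x y)) (t (U x) (V y)))"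

definition symmetric_square ::
  "'v::ab_group_add hilb \<Rightarrow> 'p::ab_group_add hilb \<Rightarrow> ('v \<Rightarrow> 'v \<Rightarrow> 'p) \<Rightarrow> 'p hilb" where
  "symmetric_square H P t =
     P\<lparr>vecs := closed_span P {t x y + t y x |x y. x \<in> vecs H \<and> y \<in> vecs H}\<rparr>"


section \<open>Spectral notions\<close>

definition simple_spectrum :: "'v::ab_group_add hilb \<Rightarrow> ('v \<Rightarrow> 'v) \<Rightarrow> bool" where
  "simple_spectrum H U \<longleftrightarrow>
     unitary_op H U \<and> (\<exists>x\<in>vecs H. closed_span H (range (\<lambda>n. int_power H U n x)) = vecs H)"

text \<open>
  It costs no generality that \<open>V\<close> acts on vectors of the same type as \<open>U\<close>: the space of \<open>V\<close> can be
  realised as a closed subspace of \<open>H\<close>.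
\<close>

definition homogeneous_spectrum_two :: "'v::ab_group_add hilb \<Rightarrow> ('v \<Rightarrow> 'v) \<Rightarrow> bool" where
  "homogeneous_spectrum_two H U \<longleftrightarrow>
     unitary_op H U \<and>
     (\<exists>(K :: 'v hilb) V. hilbert_space K \<and> simple_spectrum K V \<and>
        unitarily_equivalent H U (direct_sum K K) (map_prod V V))"

abbreviation circle :: "complex measure" where
  "circle \<equiv> restrict_space borel (sphere 0 1)"

definition circle_measure :: "complex measure \<Rightarrow> bool" where
  "circle_measure \<sigma> \<longleftrightarrow> finite_measure \<sigma> \<and> sets \<sigma> = sets circle"

definition spectral_measure :: "'v::ab_group_add hilb \<Rightarrow> ('v \<Rightarrow> 'v) \<Rightarrow> 'v \<Rightarrow> complex measure \<Rightarrow> bool" where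
  "spectral_measure H U x \<sigma> \<longleftrightarrow>
     circle_measure \<sigma> \<and> (\<forall>n::int. (LINT z|\<sigma>. z powi n) = ip H (int_power H U n x) x)"

text \<open>Note that \<open>absolutely_continuous M N\<close> means \<open>N \<lless> M\<close>.\<close>

definition maximal_spectral_type :: "'v::ab_group_add hilb \<Rightarrow> ('v \<Rightarrow> 'v) \<Rightarrow> complex measure \<Rightarrow> bool" where
  "maximal_spectral_type H U \<sigma> \<longleftrightarrow>
     circle_measure \<sigma> \<and>
     (\<forall>x\<in>vecs H. \<forall>\<rho>. spectral_measure H U x \<rho> \<longrightarrow> absolutely_continuous \<sigma> \<rho>) \<and>
     (\<exists>x\<in>vecs H. \<exists>\<rho>. spectral_measure H U x \<rho> \<and> absolutely_continuous \<rho> \<sigma>)"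

definition circle_convolution :: "complex measure \<Rightarrow> complex measure \<Rightarrow> complex measure" where
  "circle_convolution \<sigma> \<tau> = distr (\<sigma> \<Otimes>\<^sub>M \<tau>) circle (\<lambda>(z, w). z * w)"

definition kolmogorov_group_property :: "'v::ab_group_add hilb \<Rightarrow> ('v \<Rightarrow> 'v) \<Rightarrow> bool" where
  "kolmogorov_group_property H U \<longleftrightarrow>
     (\<exists>\<sigma>. maximal_spectral_type H U \<sigma> \<and> absolutely_continuous \<sigma> (circle_convolution \<sigma> \<sigma>))"


section \<open>The space $L_2$ and the operator induced by a transformation\<close>

definition L2 :: "'a measure \<Rightarrow> ('a \<Rightarrow> complex) hilb" where
  "L2 M =
     \<lparr>vecs = {f \<in> borel_measurable M. integrable M (\<lambda>x. (cmod (f x))\<^sup>2)},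
      scal = (\<lambda>c f x. c * f x),
      ip = (\<lambda>f g. LINT x|M. f x * cnj (g x))\<rparr>"

definition koopman :: "('a \<Rightarrow> 'a) \<Rightarrow> ('a \<Rightarrow> complex) \<Rightarrow> 'a \<Rightarrow> complex" where
  "koopman T f = f \<circ> T"

end

theory Submission
  imports Defs "HOL-Computational_Algebra.Fundamental_Theorem_Algebra" "HOL-Probability.Helly_Selection"
begin

text \<open>
  The proof takes place in the cyclic space of one vector: let \<open>f\<close> be the indicator of the base of the
  first tower, \<open>U\<close> the Koopman operator and \<open>\<kappa> m\<close> the correlation of \<open>U^m f\<close> with \<open>f\<close>.

  Why \<open>\<kappa>\<close> is computable. The base of the first tower is a union of levels of the tower of stage \<open>j\<close>, and
  \<open>\<kappa> m\<close> counts the pairs of these levels at distance \<open>m\<close>. The spacers grow so fast that at distance about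
  \<open>h j\<close> only two pairs of columns are seen: columns \<open>r j - 2\<close> and \<open>r j - 1\<close>, which are stacked without
  spacers, and columns \<open>r j - 1\<close> and \<open>r j\<close>, with \<open>n = s j (r j - 1)\<close> spacers in between. Hence
  \<open>r j * \<kappa> (h j - k) = \<kappa> k + \<kappa> (k + n)\<close> exactly (\<open>K_close_columns\<close>, \<open>return_correlation\<close>), and since at
  most 6 pairs of columns have a given distance, \<open>\<kappa>\<close> tends to \<open>0\<close> (\<open>few_column_pairs\<close>, \<open>\<kappa>_decay\<close>).

  Why \<open>f\<close> is cyclic and \<open>T\<close> is mixing. The base of a tower is the image of the base of the next one under
  a Laurent polynomial in \<open>U\<close>. By decay of correlations \<open>U\<close> has no eigenvalues, so each linear factor of the
  polynomial has dense range (\<open>polynomial_dense\<close>), and the cyclic space of \<open>f\<close> contains the bases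
  (\<open>next_base_cyclic\<close>), hence the indicators of all levels, hence everything (\<open>f_cyclic\<close>). Mixing is the
  decay of correlations spread from \<open>f\<close> to its cyclic space.

  The averaging argument. Fix \<open>n \<ge> 1\<close> and let \<open>a\<close> range over the heights \<open>h j\<close> with \<open>j\<close> in \<open>J r s q n\<close>.
  The exact relation, used once and twice, shows that the vectors \<open>q U^a f\<close> differ from
  \<open>v = f + U^(- n) f\<close> by pairwise orthogonal errors of norm about \<open>q\<close>. There are far more than \<open>q^4\<close> of
  them, so their average is close to \<open>v\<close> (\<open>averaging_sets\<close>, \<open>average_close\<close>).

  No group property. In the spectral representation of \<open>f\<close> on \<open>L2 \<sigma>\<close> the averages of \<open>q z^a\<close>
  tend to \<open>1 + z^(- n)\<close>. In \<open>L2\<close> of the convolution square of \<open>\<sigma>\<close>, where the correlations are squared,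
  the same functions tend to \<open>0\<close>. If \<open>\<sigma>\<close> dominated its convolution square, the latter would live on the
  zeros of \<open>1 + z^(- n)\<close> for every \<open>n\<close> (\<open>convolution_root\<close>), which is absurd already for \<open>n = 1\<close> and
  \<open>n = 2\<close>. That \<open>\<sigma>\<close> has the maximal spectral type is \<open>spectral_ac\<close>.

  Simple spectrum of the symmetric square. The same average in the tensor square, of
  \<open>q\<^sup>2 (U^a f \<otimes> U^a f)\<close>, has errors of norm about \<open>q\<^sup>2\<close>, so it converges to \<open>v \<otimes> v\<close>; this is where the
  exponent \<open>4\<close> is used. So the cyclic space of \<open>f \<otimes> f\<close> contains \<open>v \<otimes> v\<close> and with it
  \<open>f \<otimes> U^(- n) f + U^(- n) f \<otimes> f\<close> for every \<open>n\<close> (\<open>S2_in_diagonal\<close>, \<open>simple_Sq\<close>).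

  Homogeneous spectrum of the full square. In \<open>L2 (\<sigma> \<otimes> \<sigma>)\<close>, multiplication by the sign of
  \<open>Im (z cnj w)\<close> is unitary, commutes with multiplication by \<open>z w\<close>, and exchanges symmetric with
  antisymmetric functions. So both parts of the tensor square carry the same operator (\<open>homogeneous_P\<close>).
\<close>

section \<open>Pre-Hilbert spaces up to distance zero\<close>

text \<open>
  The axioms without completeness. The calculus of closed spans rests on these alone, so it applies to
  \<open>L2 M\<close> for every measure \<open>M\<close> before anything is known about the convergence of Cauchy sequences.
\<close>

locale pre_hilbert =
  fixes H :: "'v::ab_group_add hilb"
  assumes vector_space: "vector_space (scal H)"
    and subspace: "module.subspace (scal H) (vecs H)"
    and ip_add: "x \<in> vecs H \<Longrightarrow> y \<in> vecs H \<Longrightarrow> z \<in> vecs H \<Longrightarrow> ip H (x + y) z = ip H x z + ip H y z"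
    and ip_scal: "x \<in> vecs H \<Longrightarrow> y \<in> vecs H \<Longrightarrow> ip H (scal H c x) y = c * ip H x y"
    and ip_cnj: "x \<in> vecs H \<Longrightarrow> y \<in> vecs H \<Longrightarrow> ip H y x = cnj (ip H x y)"
    and ip_nonneg: "x \<in> vecs H \<Longrightarrow> 0 \<le> Re (ip H x x)"

sublocale hilbert_space \<subseteq> pre_hilbert
  by (rule pre_hilbert.intro) (fact vector_space subspace ip_add ip_scal ip_cnj ip_nonneg)+

sublocale pre_hilbert \<subseteq> V: vector_space "scal H"
  by (rule vector_space)

text \<open>
  The coefficients are a list over the index type, so that one and the same linear combination can be
  formed in two spaces at once.
\<close>

definition lincomb :: "'v::ab_group_add hilb \<Rightarrow> ('i \<Rightarrow> 'v) \<Rightarrow> (complex \<times> 'i) list \<Rightarrow> 'v" where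
  "lincomb H b xs = (\<Sum>(c, i)\<leftarrow>xs. scal H c (b i))"

lemma lincomb_simps [simp]:
  "lincomb H b [] = 0"
  "lincomb H b ((c, i) # xs) = scal H c (b i) + lincomb H b xs"
  by (simp_all add: lincomb_def)

lemma lincomb_append [simp]: "lincomb H b (xs @ ys) = lincomb H b xs + lincomb H b ys"
  by (simp add: lincomb_def)

context pre_hilbert
begin

lemma vecs_zero [simp]: "0 \<in> vecs H"
  using subspace by (simp add: V.subspace_def)

lemma vecs_add [intro, simp]: "x \<in> vecs H \<Longrightarrow> y \<in> vecs H \<Longrightarrow> x + y \<in> vecs H"
  using subspace by (simp add: V.subspace_def)

lemma vecs_scal [intro, simp]: "x \<in> vecs H \<Longrightarrow> scal H c x \<in> vecs H"
  using subspace by (simp add: V.subspace_def)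

lemma vecs_diff [intro, simp]: "x \<in> vecs H \<Longrightarrow> y \<in> vecs H \<Longrightarrow> x - y \<in> vecs H"
  using subspace by (rule V.subspace_diff)

lemma vecs_minus [intro, simp]: "x \<in> vecs H \<Longrightarrow> - x \<in> vecs H"
  using subspace by (rule V.subspace_neg)

lemma vecs_lincomb [intro]: "(\<And>i. b i \<in> vecs H) \<Longrightarrow> lincomb H b xs \<in> vecs H"
  by (induction xs) (auto intro!: vecs_add vecs_scal)

lemma ip_zero_left [simp]: "y \<in> vecs H \<Longrightarrow> ip H 0 y = 0"
  using ip_add[of 0 0 y] by simp

lemma ip_zero_right [simp]: "y \<in> vecs H \<Longrightarrow> ip H y 0 = 0"
  using ip_cnj[of 0 y] by simp

lemma ip_minus: "x \<in> vecs H \<Longrightarrow> y \<in> vecs H \<Longrightarrow> ip H (- x) y = - ip H x y"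
  using ip_scal[of x y "-1"] by simp

lemma ip_diff: "x \<in> vecs H \<Longrightarrow> y \<in> vecs H \<Longrightarrow> z \<in> vecs H \<Longrightarrow> ip H (x - y) z = ip H x z - ip H y z"
  using ip_add[of x "- y" z] ip_minus[of y z] vecs_minus[of y] by simp

lemma ip_add_right: "x \<in> vecs H \<Longrightarrow> y \<in> vecs H \<Longrightarrow> z \<in> vecs H \<Longrightarrow> ip H z (x + y) = ip H z x + ip H z y"
  using ip_add[of x y z] ip_cnj[of "x + y" z] ip_cnj[of x z] ip_cnj[of y z] vecs_add[of x y] by simp

lemma ip_diff_right: "x \<in> vecs H \<Longrightarrow> y \<in> vecs H \<Longrightarrow> z \<in> vecs H \<Longrightarrow> ip H z (x - y) = ip H z x - ip H z y"
  using ip_diff[of x y z] ip_cnj[of "x - y" z] ip_cnj[of x z] ip_cnj[of y z] vecs_diff[of x y] by simp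

lemma ip_scal_right: "x \<in> vecs H \<Longrightarrow> y \<in> vecs H \<Longrightarrow> ip H y (scal H c x) = cnj c * ip H y x"
  using ip_scal[of x y c] ip_cnj[of "scal H c x" y] ip_cnj[of x y] vecs_scal[of x c] by simp

lemma ip_lincomb_left:
  assumes "\<And>i. b i \<in> vecs H" "y \<in> vecs H"
  shows "ip H (lincomb H b xs) y = (\<Sum>(c, i)\<leftarrow>xs. c * ip H (b i) y)"
proof (induction xs)
  case (Cons p xs)
  obtain c i where "p = (c, i)" by (cases p)
  then show ?case using Cons assms
    by (simp add: ip_add ip_scal vecs_scal vecs_lincomb)
qed (use assms in simp)

lemma ip_lincomb_right:
  assumes "\<And>i. b i \<in> vecs H" "y \<in> vecs H"
  shows "ip H y (lincomb H b xs) = (\<Sum>(c, i)\<leftarrow>xs. cnj c * ip H y (b i))"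
proof (induction xs)
  case (Cons p xs)
  obtain c i where "p = (c, i)" by (cases p)
  then show ?case using Cons assms
    by (simp add: ip_add_right ip_scal_right vecs_scal vecs_lincomb)
qed (use assms in simp)

lemma hnorm_sq: "x \<in> vecs H \<Longrightarrow> (hnorm H x)\<^sup>2 = Re (ip H x x)"
  by (simp add: hnorm_def ip_nonneg)

lemma hnorm_nonneg [simp]: "x \<in> vecs H \<Longrightarrow> 0 \<le> hnorm H x"
  by (simp add: hnorm_def ip_nonneg)

lemma ip_self: "x \<in> vecs H \<Longrightarrow> ip H x x = of_real ((hnorm H x)\<^sup>2)"
  using ip_cnj[of x x] hnorm_sq[of x] by (simp add: complex_eq_iff)

lemma hnorm_zero [simp]: "hnorm H 0 = 0"
  by (simp add: hnorm_def)

lemma hnorm_scal: 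
  assumes "x \<in> vecs H" shows "hnorm H (scal H c x) = cmod c * hnorm H x"
proof -
  have "(hnorm H (scal H c x))\<^sup>2 = (cmod c * hnorm H x)\<^sup>2"
  proof -
    have "ip H (scal H c x) (scal H c x) = c * cnj c * ip H x x"
      using assms by (simp add: ip_scal ip_scal_right vecs_scal)
    also have "\<dots> = of_real ((cmod c * hnorm H x)\<^sup>2)"
      using ip_self[OF assms] by (simp only: complex_norm_square[symmetric] power_mult_distrib of_real_mult of_real_power)
    finally show ?thesis using hnorm_sq[of "scal H c x"] assms by (simp add: vecs_scal)
  qed
  then show ?thesis using assms by (simp add: power2_eq_iff_nonneg vecs_scal)
qed

lemma hnorm_minus_commute: "x \<in> vecs H \<Longrightarrow> y \<in> vecs H \<Longrightarrow> hnorm H (x - y) = hnorm H (y - x)"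
  using hnorm_scal[of "x - y" "-1"] vecs_diff[of x y] by simp

lemma hnorm_diff_sq:
  assumes "x \<in> vecs H" "y \<in> vecs H"
  shows "(hnorm H (x - y))\<^sup>2 = (hnorm H x)\<^sup>2 - 2 * Re (ip H x y) + (hnorm H y)\<^sup>2"
  using assms ip_cnj[of x y] by (simp add: hnorm_sq vecs_diff ip_diff ip_diff_right)

lemma hnorm_add_sq:
  assumes "x \<in> vecs H" "y \<in> vecs H"
  shows "(hnorm H (x + y))\<^sup>2 = (hnorm H x)\<^sup>2 + 2 * Re (ip H x y) + (hnorm H y)\<^sup>2"
  using assms ip_cnj[of x y] by (simp add: hnorm_sq vecs_add ip_add ip_add_right)

lemma cauchy_schwarz:
  assumes "x \<in> vecs H" "y \<in> vecs H"
  shows "cmod (ip H x y) \<le> hnorm H x * hnorm H y"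
proof -
  define a where "a = ip H x y"
  \<comment> \<open>the square of the norm of \<open>x - t <x, y> y\<close>\<close>
  have *: "0 \<le> (hnorm H x)\<^sup>2 - 2 * t * (cmod a)\<^sup>2 + t\<^sup>2 * (cmod a)\<^sup>2 * (hnorm H y)\<^sup>2" for t :: real
  proof -
    define u where "u = scal H (of_real t * a) y"
    have u: "u \<in> vecs H" using assms by (auto simp: u_def)
    have "Re (ip H x u) = t * (cmod a)\<^sup>2"
      using assms by (simp add: u_def ip_scal_right a_def[symmetric] cmod_power2) (simp add: power2_eq_square algebra_simps)
    moreover have "(hnorm H u)\<^sup>2 = t\<^sup>2 * (cmod a)\<^sup>2 * (hnorm H y)\<^sup>2"
      using assms by (simp add: u_def hnorm_scal norm_mult power_mult_distrib)
    moreover have "0 \<le> (hnorm H (x - u))\<^sup>2" by simp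
    ultimately show ?thesis using hnorm_diff_sq[OF assms(1) u] by simp
  qed
  have "(cmod a)\<^sup>2 \<le> (hnorm H x * hnorm H y)\<^sup>2"
  proof (cases "hnorm H y = 0")
    case True
    have "a = 0"
    proof (rule ccontr)
      assume "a \<noteq> 0"
      then have "0 < (cmod a)\<^sup>2" by simp
      moreover have "0 \<le> (hnorm H x)\<^sup>2 - 2 * (((hnorm H x)\<^sup>2 + 1) / (cmod a)\<^sup>2) * (cmod a)\<^sup>2"
        using *[of "((hnorm H x)\<^sup>2 + 1) / (cmod a)\<^sup>2"] True by simp
      ultimately have "0 \<le> (hnorm H x)\<^sup>2 - 2 * ((hnorm H x)\<^sup>2 + 1)" by simp
      then show False by (smt (verit) zero_le_power2)
    qed
    then show ?thesis by simp
  next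
    case False
    then have p: "0 < (hnorm H y)\<^sup>2" by simp
    have "(1 / (hnorm H y)\<^sup>2)\<^sup>2 * (cmod a)\<^sup>2 * (hnorm H y)\<^sup>2 = (cmod a)\<^sup>2 / (hnorm H y)\<^sup>2"
      using p by (simp add: power2_eq_square)
    then have "0 \<le> (hnorm H x)\<^sup>2 - (cmod a)\<^sup>2 / (hnorm H y)\<^sup>2"
      using *[of "1 / (hnorm H y)\<^sup>2"] by simp
    then show ?thesis using p by (simp add: field_simps power_mult_distrib)
  qed
  then show ?thesis using assms unfolding a_def
    by (meson power2_le_imp_le mult_nonneg_nonneg hnorm_nonneg)
qed

lemma hnorm_triangle:
  assumes "x \<in> vecs H" "y \<in> vecs H"
  shows "hnorm H (x + y) \<le> hnorm H x + hnorm H y"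
proof (rule power2_le_imp_le)
  have "Re (ip H x y) \<le> hnorm H x * hnorm H y"
    using cauchy_schwarz[OF assms] complex_Re_le_cmod[of "ip H x y"] by linarith
  then show "(hnorm H (x + y))\<^sup>2 \<le> (hnorm H x + hnorm H y)\<^sup>2"
    using hnorm_add_sq[OF assms] by (simp add: power2_sum)
  show "0 \<le> hnorm H x + hnorm H y" using assms by simp
qed

lemma hnorm_triangle_diff:
  assumes "x \<in> vecs H" "y \<in> vecs H" "z \<in> vecs H"
  shows "hnorm H (x - z) \<le> hnorm H (x - y) + hnorm H (y - z)"
  using hnorm_triangle[of "x - y" "y - z"] assms by (simp add: vecs_diff)

lemma hnorm_diff_ineq:
  assumes "x \<in> vecs H" "y \<in> vecs H"
  shows "\<bar>hnorm H x - hnorm H y\<bar> \<le> hnorm H (x - y)"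
  using hnorm_triangle[of "x - y" y] hnorm_triangle[of "y - x" x] assms
    hnorm_minus_commute[of x y] by (simp add: vecs_diff)

lemma heq_refl [simp]: "heq H x x"
  by (simp add: heq_def)

lemma heq_sym: "x \<in> vecs H \<Longrightarrow> y \<in> vecs H \<Longrightarrow> heq H x y \<Longrightarrow> heq H y x"
  by (simp add: heq_def hnorm_minus_commute)

lemma heq_trans:
  assumes "x \<in> vecs H" "y \<in> vecs H" "z \<in> vecs H" "heq H x y" "heq H y z"
  shows "heq H x z"
  using hnorm_triangle_diff[OF assms(1-3)] assms(4,5) hnorm_nonneg[OF vecs_diff[OF assms(1,3)]] unfolding heq_def by linarith

lemma heq_ip_left:
  assumes "x \<in> vecs H" "y \<in> vecs H" "z \<in> vecs H" "heq H x y"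
  shows "ip H x z = ip H y z"
  using cauchy_schwarz[of "x - y" z] assms by (simp add: heq_def vecs_diff ip_diff)

lemma heq_ip_right:
  assumes "x \<in> vecs H" "y \<in> vecs H" "z \<in> vecs H" "heq H x y"
  shows "ip H z x = ip H z y"
  using heq_ip_left[OF assms] ip_cnj[of x z] ip_cnj[of y z] assms by simp

lemma heq_hnorm:
  assumes "x \<in> vecs H" "y \<in> vecs H" "heq H x y"
  shows "hnorm H x = hnorm H y"
  using hnorm_diff_ineq[of x y] assms by (simp add: heq_def)

lemma heq_add:
  assumes "x \<in> vecs H" "y \<in> vecs H" "x' \<in> vecs H" "y' \<in> vecs H" "heq H x y" "heq H x' y'"
  shows "heq H (x + x') (y + y')"
proof -
  have "hnorm H (x - y + (x' - y')) \<le> 0"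
    using hnorm_triangle[of "x - y" "x' - y'"] assms by (simp add: heq_def vecs_diff)
  moreover have "0 \<le> hnorm H (x - y + (x' - y'))"
    using assms by (intro hnorm_nonneg) auto
  ultimately show ?thesis by (simp add: heq_def algebra_simps)
qed

lemma heq_scal:
  assumes "x \<in> vecs H" "y \<in> vecs H" "heq H x y"
  shows "heq H (scal H c x) (scal H c y)"
  using hnorm_scal[of "x - y" c] assms
  by (simp add: heq_def vecs_diff V.scale_right_diff_distrib)

lemma heq_diff:
  assumes "x \<in> vecs H" "y \<in> vecs H" "x' \<in> vecs H" "y' \<in> vecs H" "heq H x y" "heq H x' y'"
  shows "heq H (x - x') (y - y')"
  using heq_add[of x y "- x'" "- y'"] heq_scal[of x' y' "-1"] assms by (simp add: vecs_minus)

lemma heq_lincomb: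
  assumes "\<And>i. b i \<in> vecs H" "\<And>i. b' i \<in> vecs H" "\<And>i. heq H (b i) (b' i)"
  shows "heq H (lincomb H b xs) (lincomb H b' xs)"
proof (induction xs)
  case (Cons p xs)
  obtain c i where "p = (c, i)" by (cases p)
  then show ?case using Cons assms by (auto intro!: heq_add heq_scal)
qed simp

lemma scal_lincomb: "scal H c (lincomb H b xs) = lincomb H b (map (\<lambda>(d, i). (c * d, i)) xs)"
  by (induction xs) (auto simp: V.scale_right_distrib)

lemma span_range_lincomb: "V.span (range b) = range (lincomb H b)"
proof
  show "V.span (range b) \<subseteq> range (lincomb H b)"
  proof (rule V.span_minimal)
    show "range b \<subseteq> range (lincomb H b)"
    proof clarify
      fix i show "b i \<in> range (lincomb H b)" by (rule range_eqI[of _ _ "[(1, i)]"]) simp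
    qed
    show "V.subspace (range (lincomb H b))"
      unfolding V.subspace_def
    proof safe
      show "0 \<in> range (lincomb H b)" by (rule range_eqI[of _ _ "[]"]) simp
      show "lincomb H b xs + lincomb H b ys \<in> range (lincomb H b)" for xs ys
        by (rule range_eqI[of _ _ "xs @ ys"]) simp
      show "scal H c (lincomb H b xs) \<in> range (lincomb H b)" for c xs
        by (rule range_eqI, rule scal_lincomb)
    qed
  qed
  show "range (lincomb H b) \<subseteq> V.span (range b)"
  proof clarify
    fix xs show "lincomb H b xs \<in> V.span (range b)"
    proof (induction xs)
      case (Cons p xs)
      then show ?case by (cases p) (simp add: V.span_add V.span_scale V.span_base)
    qed (simp add: V.span_zero)
  qed
qed

lemma closed_span_subset: "closed_span H B \<subseteq> vecs H"
  by (auto simp: closed_span_def)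

lemma span_subset_vecs: "B \<subseteq> vecs H \<Longrightarrow> V.span B \<subseteq> vecs H"
  using subspace V.span_minimal by blast

lemma span_subset_closed_span: "B \<subseteq> vecs H \<Longrightarrow> V.span B \<subseteq> closed_span H B"
  using span_subset_vecs[of B] by (force simp: closed_span_def intro: bexI)

lemma closed_span_base: "B \<subseteq> vecs H \<Longrightarrow> x \<in> B \<Longrightarrow> x \<in> closed_span H B"
  using span_subset_closed_span[of B] V.span_base[of x B] by auto

lemma closed_span_subspace:
  assumes "B \<subseteq> vecs H" shows "V.subspace (closed_span H B)"
  unfolding V.subspace_def
proof safe
  show "0 \<in> closed_span H B" using span_subset_closed_span[OF assms] V.span_zero by auto
next
  fix x y assume xy: "x \<in> closed_span H B" "y \<in> closed_span H B"
  have "\<exists>z\<in>V.span B. hnorm H (x + y - z) < e" if e: "e > 0" for e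
  proof -
    obtain x' y' where x': "x' \<in> V.span B" "hnorm H (x - x') < e / 2"
      and y': "y' \<in> V.span B" "hnorm H (y - y') < e / 2"
      using xy half_gt_zero[OF e] unfolding closed_span_def by blast
    have "hnorm H ((x - x') + (y - y')) \<le> hnorm H (x - x') + hnorm H (y - y')"
      using xy x' y' span_subset_vecs[OF assms] closed_span_subset by (intro hnorm_triangle) blast+
    also have "\<dots> < e" using x' y' by simp
    finally show ?thesis using x' y' V.span_add
      by (intro bexI[of _ "x' + y'"]) (auto simp: algebra_simps)
  qed
  then show "x + y \<in> closed_span H B" using xy by (auto simp: closed_span_def)
next
  fix c x assume x: "x \<in> closed_span H B"
  have "\<exists>z\<in>V.span B. hnorm H (scal H c x - z) < e" if "e > 0" for e
  proof -
    have pos: "0 < e / (cmod c + 1)" using that by (simp add: add_nonneg_pos)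
    obtain x' where x': "x' \<in> V.span B" "hnorm H (x - x') < e / (cmod c + 1)"
      using x pos unfolding closed_span_def by auto
    have v: "x - x' \<in> vecs H" using x x' span_subset_vecs[OF assms] closed_span_subset by blast
    have "hnorm H (scal H c (x - x')) \<le> (cmod c + 1) * hnorm H (x - x')"
      using hnorm_scal[OF v, of c] hnorm_nonneg[OF v] by (simp add: algebra_simps)
    also have "\<dots> < e" using x'(2) pos_less_divide_eq[of "cmod c + 1" "hnorm H (x - x')" e]
      by (simp add: add_nonneg_pos mult.commute)
    finally show ?thesis using x' V.span_scale
      by (intro bexI[of _ "scal H c x'"]) (auto simp: V.scale_right_diff_distrib)
  qed
  then show "scal H c x \<in> closed_span H B" using x by (auto simp: closed_span_def)
qed

lemma closed_span_limit:
  assumes "B \<subseteq> vecs H" "x \<in> vecs H" "\<And>e. e > 0 \<Longrightarrow> \<exists>y\<in>closed_span H B. hnorm H (x - y) < e"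
  shows "x \<in> closed_span H B"
  unfolding closed_span_def
proof safe
  fix e :: real assume "e > 0"
  then obtain y where y: "y \<in> closed_span H B" "hnorm H (x - y) < e / 2"
    using assms(3)[of "e / 2"] by auto
  then obtain z where z: "z \<in> V.span B" "hnorm H (y - z) < e / 2"
    using \<open>e > 0\<close> unfolding closed_span_def by (auto dest!: spec[of _ "e / 2"])
  have "hnorm H (x - z) \<le> hnorm H (x - y) + hnorm H (y - z)"
    using assms y z span_subset_vecs[OF assms(1)] closed_span_subset by (intro hnorm_triangle_diff) blast+
  then show "\<exists>z\<in>V.span B. hnorm H (x - z) < e" using y z by (intro bexI[of _ z]) auto
qed (use assms in auto)

lemma closed_span_heq:
  assumes "B \<subseteq> vecs H" "x \<in> vecs H" "y \<in> closed_span H B" "heq H x y"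
  shows "x \<in> closed_span H B"
proof (rule closed_span_limit[OF assms(1,2)])
  fix e :: real assume "e > 0"
  then show "\<exists>y\<in>closed_span H B. hnorm H (x - y) < e"
    using assms by (intro bexI[of _ y]) (auto simp: heq_def)
qed

lemma closed_span_minimal:
  assumes "C \<subseteq> vecs H" "B \<subseteq> closed_span H C"
  shows "closed_span H B \<subseteq> closed_span H C"
proof
  fix x assume x: "x \<in> closed_span H B"
  have sub: "V.span B \<subseteq> closed_span H C"
    using assms(2) closed_span_subspace[OF assms(1)] by (rule V.span_minimal)
  show "x \<in> closed_span H C"
  proof (rule closed_span_limit[OF assms(1)])
    show "x \<in> vecs H" using x closed_span_subset by auto
    fix e :: real assume "e > 0"
    then show "\<exists>y\<in>closed_span H C. hnorm H (x - y) < e"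
      using x sub unfolding closed_span_def[of H B] by blast
  qed
qed

lemma closed_span_add: "B \<subseteq> vecs H \<Longrightarrow> x \<in> closed_span H B \<Longrightarrow> y \<in> closed_span H B \<Longrightarrow> x + y \<in> closed_span H B"
  using closed_span_subspace V.subspace_add by blast

lemma closed_span_diff: "B \<subseteq> vecs H \<Longrightarrow> x \<in> closed_span H B \<Longrightarrow> y \<in> closed_span H B \<Longrightarrow> x - y \<in> closed_span H B"
  using closed_span_subspace V.subspace_diff by blast

lemma closed_span_scal: "B \<subseteq> vecs H \<Longrightarrow> x \<in> closed_span H B \<Longrightarrow> scal H c x \<in> closed_span H B"
  using closed_span_subspace V.subspace_scale by blast

lemma closed_span_lincomb:
  "B \<subseteq> vecs H \<Longrightarrow> (\<And>i. b i \<in> closed_span H B) \<Longrightarrow> lincomb H b xs \<in> closed_span H B"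
proof (induction xs)
  case Nil then show ?case using closed_span_subspace[OF Nil(1)] V.subspace_0 by simp
next
  case (Cons p xs)
  obtain c i where "p = (c, i)" by (cases p)
  then show ?case using Cons by (auto intro!: closed_span_add closed_span_scal)
qed

lemma closed_span_iff_lincomb:
  "x \<in> closed_span H (range b) \<longleftrightarrow>
     x \<in> vecs H \<and> (\<forall>e>0. \<exists>xs. hnorm H (x - lincomb H b xs) < e)"
  unfolding closed_span_def span_range_lincomb by blast

lemma hilbert_closed_span:
  assumes "hilbert_space H" "B \<subseteq> vecs H"
  shows "hilbert_space (H\<lparr>vecs := closed_span H B\<rparr>)"
proof -
  interpret hilbert_space H by fact
  have n: "hnorm (H\<lparr>vecs := closed_span H B\<rparr>) = hnorm H" by (rule ext) (simp add: hnorm_def)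
  show ?thesis
  proof (unfold_locales, goal_cases)
    case 1 then show ?case using vector_space[unfolded vector_space_def] by simp
  next
    case 2 then show ?case using vector_space[unfolded vector_space_def] by simp
  next
    case 3 then show ?case using vector_space[unfolded vector_space_def] by simp
  next
    case 4 then show ?case using vector_space[unfolded vector_space_def] by simp
  next
    case 5 then show ?case using closed_span_subspace[OF assms(2)] by simp
  next
    case (6 x y z) then show ?case using closed_span_subset[of B] by (auto intro!: ip_add)
  next
    case (7 x y c) then show ?case using closed_span_subset[of B] by (auto intro!: ip_scal)
  next
    case (8 x y) then show ?case using closed_span_subset[of B] by (auto intro!: ip_cnj)
  next
    case (9 x) then show ?case using closed_span_subset[of B] by (auto intro!: ip_nonneg)
  next
    case (10 u)
    then have u: "u n \<in> closed_span H B" for n by simp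
    then have uv: "u n \<in> vecs H" for n using closed_span_subset by blast
    obtain l where l: "l \<in> vecs H" "(\<lambda>n. hnorm H (u n - l)) \<longlonglongrightarrow> 0"
      using complete[of u] uv 10(2) unfolding n by blast
    have "l \<in> closed_span H B"
    proof (rule closed_span_limit[OF assms(2) l(1)])
      fix e :: real assume "e > 0"
      then obtain k where "hnorm H (u k - l) < e"
        using l(2) by (metis (no_types, lifting) LIMSEQ_iff le_refl diff_zero real_norm_def abs_less_iff)
      then show "\<exists>y\<in>closed_span H B. hnorm H (l - y) < e"
        using u[of k] uv[of k] l by (intro bexI[of _ "u k"]) (auto simp: hnorm_minus_commute)
    qed
    then show ?case using l unfolding n by auto
  qed
qed

end

lemma pre_hilbert_direct_sum:
  assumes "pre_hilbert H" "pre_hilbert K" shows "pre_hilbert (direct_sum H K)"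
proof -
  interpret H: pre_hilbert H by fact
  interpret K: pre_hilbert K by fact
  have vs: "vector_space (scal (direct_sum H K))"
    by unfold_locales
      (auto simp: direct_sum_def H.V.scale_right_distrib K.V.scale_right_distrib H.V.scale_left_distrib K.V.scale_left_distrib)
  then interpret V: vector_space "scal (direct_sum H K)" .
  show ?thesis
  proof (rule pre_hilbert.intro[OF vs])
    show "V.subspace (vecs (direct_sum H K))"
      unfolding V.subspace_def by (auto simp: direct_sum_def zero_prod_def)
  qed (auto simp: direct_sum_def H.ip_add K.ip_add H.ip_scal K.ip_scal H.ip_nonneg K.ip_nonneg algebra_simps
      simp flip: H.ip_cnj K.ip_cnj)
qed

section \<open>Families with equal Gram matrices\<close>

locale gram_pair = H: pre_hilbert H + K: pre_hilbert K
  for H :: "'v::ab_group_add hilb" and K :: "'w::ab_group_add hilb" +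
  fixes b :: "'i \<Rightarrow> 'v" and b' :: "'i \<Rightarrow> 'w"
  assumes b_vecs [simp]: "b i \<in> vecs H"
    and b'_vecs [simp]: "b' i \<in> vecs K"
    and gram: "ip H (b i) (b j) = ip K (b' i) (b' j)"
begin

text \<open>
  The closure of the correspondence \<open>b i \<mapsto> b' i\<close>: the graph of the isometry between the two closed
  spans, without a choice among vectors at distance zero.
\<close>

definition corr :: "'v \<Rightarrow> 'w \<Rightarrow> bool" where
  "corr x y \<longleftrightarrow> x \<in> vecs H \<and> y \<in> vecs K \<and>
     (\<forall>e>0. \<exists>xs. hnorm H (x - lincomb H b xs) < e \<and> hnorm K (y - lincomb K b' xs) < e)"

lemma lincomb_vecs [simp]: "lincomb H b xs \<in> vecs H" "lincomb K b' xs \<in> vecs K"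
  by auto

lemma lincomb_gram:
  "ip H (lincomb H b xs) (lincomb H b ys) = ip K (lincomb K b' xs) (lincomb K b' ys)"
proof -
  have "ip H (b i) (lincomb H b ys) = ip K (b' i) (lincomb K b' ys)" for i
    by (simp add: H.ip_lincomb_right K.ip_lincomb_right gram)
  then show ?thesis by (simp add: H.ip_lincomb_left K.ip_lincomb_left)
qed

lemma lincomb_norm: "hnorm H (lincomb H b xs) = hnorm K (lincomb K b' xs)"
  by (simp add: hnorm_def lincomb_gram)

lemma lincomb_diff:
  "\<exists>zs. lincomb H b xs - lincomb H b ys = lincomb H b zs \<and> lincomb K b' xs - lincomb K b' ys = lincomb K b' zs"
proof -
  let ?zs = "xs @ map (\<lambda>(d, i). (-1 * d, i)) ys"
  have "lincomb H b xs - lincomb H b ys = lincomb H b ?zs"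
    using H.scal_lincomb[of "-1" b ys] by simp
  moreover have "lincomb K b' xs - lincomb K b' ys = lincomb K b' ?zs"
    using K.scal_lincomb[of "-1" b' ys] by simp
  ultimately show ?thesis by blast
qed

lemma lincomb_dist:
  "hnorm H (lincomb H b xs - lincomb H b ys) = hnorm K (lincomb K b' xs - lincomb K b' ys)"
  using lincomb_diff[of xs ys] lincomb_norm by metis

lemma corr_vecs: "corr x y \<Longrightarrow> x \<in> vecs H" "corr x y \<Longrightarrow> y \<in> vecs K"
  by (auto simp: corr_def)

lemma corr_lincomb: "corr (lincomb H b xs) (lincomb K b' xs)"
  unfolding corr_def by (auto intro!: exI[of _ xs])

lemma corr_base: "corr (b i) (b' i)"
  using corr_lincomb[of "[(1, i)]"] by simp

lemma corr_add:
  assumes "corr x y" "corr x' y'" shows "corr (x + x') (y + y')"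
  unfolding corr_def
proof (intro conjI allI impI)
  note v = corr_vecs[OF assms(1)] corr_vecs[OF assms(2)]
  show "x + x' \<in> vecs H" "y + y' \<in> vecs K" using v by auto
  fix e :: real assume "e > 0"
  obtain xs where xs: "hnorm H (x - lincomb H b xs) < e / 2" "hnorm K (y - lincomb K b' xs) < e / 2"
    using assms(1) half_gt_zero[OF \<open>e > 0\<close>] unfolding corr_def by blast
  obtain ys where ys: "hnorm H (x' - lincomb H b ys) < e / 2" "hnorm K (y' - lincomb K b' ys) < e / 2"
    using assms(2) half_gt_zero[OF \<open>e > 0\<close>] unfolding corr_def by blast
  have "hnorm H ((x - lincomb H b xs) + (x' - lincomb H b ys)) < e"
    using H.hnorm_triangle[of "x - lincomb H b xs" "x' - lincomb H b ys"] xs ys v by (simp add: H.vecs_diff)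
  moreover have "hnorm K ((y - lincomb K b' xs) + (y' - lincomb K b' ys)) < e"
    using K.hnorm_triangle[of "y - lincomb K b' xs" "y' - lincomb K b' ys"] xs ys v by (simp add: K.vecs_diff)
  ultimately show "\<exists>xs. hnorm H (x + x' - lincomb H b xs) < e \<and> hnorm K (y + y' - lincomb K b' xs) < e"
    by (intro exI[of _ "xs @ ys"]) (simp add: algebra_simps)
qed

lemma corr_scal:
  assumes "corr x y" shows "corr (scal H c x) (scal K c y)"
  unfolding corr_def
proof (intro conjI allI impI)
  note v = corr_vecs[OF assms(1)]
  show "scal H c x \<in> vecs H" "scal K c y \<in> vecs K" using v by auto
  fix e :: real assume "e > 0"
  then have pos: "0 < e / (cmod c + 1)" by (simp add: add_nonneg_pos)
  obtain xs where xs: "hnorm H (x - lincomb H b xs) < e / (cmod c + 1)" "hnorm K (y - lincomb K b' xs) < e / (cmod c + 1)"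
    using assms(1) pos unfolding corr_def by blast
  let ?ys = "map (\<lambda>(d, i). (c * d, i)) xs"
  have *: "cmod c * t < e" if "t < e / (cmod c + 1)" "0 \<le> t" for t
  proof -
    have "cmod c * t \<le> (cmod c + 1) * t" using that by (simp add: algebra_simps)
    also have "\<dots> < e" using that(1) pos_less_divide_eq[of "cmod c + 1" t e]
      by (simp add: add_nonneg_pos mult.commute)
    finally show ?thesis .
  qed
  have "hnorm H (scal H c x - lincomb H b ?ys) < e"
    using H.hnorm_scal[of "x - lincomb H b xs" c] *[OF xs(1)] v
    by (simp add: H.scal_lincomb[symmetric] H.V.scale_right_diff_distrib H.vecs_diff)
  moreover have "hnorm K (scal K c y - lincomb K b' ?ys) < e"
    using K.hnorm_scal[of "y - lincomb K b' xs" c] *[OF xs(2)] v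
    by (simp add: K.scal_lincomb[symmetric] K.V.scale_right_diff_distrib K.vecs_diff)
  ultimately show "\<exists>xs. hnorm H (scal H c x - lincomb H b xs) < e \<and> hnorm K (scal K c y - lincomb K b' xs) < e"
    by blast
qed

lemma corr_diff:
  assumes "corr x y" "corr x' y'" shows "corr (x - x') (y - y')"
  using corr_add[OF assms(1) corr_scal[OF assms(2), of "-1"]] by simp

lemma corr_zero: "corr 0 0"
  using corr_lincomb[of "[]"] by simp

lemma corr_norm:
  assumes "corr x y" shows "hnorm H x = hnorm K y"
proof (rule ccontr)
  note v = corr_vecs[OF assms]
  assume "hnorm H x \<noteq> hnorm K y"
  then have "\<bar>hnorm H x - hnorm K y\<bar> / 2 > 0" by simp
  then obtain xs where xs: "hnorm H (x - lincomb H b xs) < \<bar>hnorm H x - hnorm K y\<bar> / 2"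
      "hnorm K (y - lincomb K b' xs) < \<bar>hnorm H x - hnorm K y\<bar> / 2"
    using assms unfolding corr_def by blast
  have A: "\<bar>hnorm H x - hnorm H (lincomb H b xs)\<bar> < \<bar>hnorm H x - hnorm K y\<bar> / 2"
    using H.hnorm_diff_ineq[of x "lincomb H b xs"] xs v by simp
  have B: "\<bar>hnorm K y - hnorm K (lincomb K b' xs)\<bar> < \<bar>hnorm H x - hnorm K y\<bar> / 2"
    using K.hnorm_diff_ineq[of y "lincomb K b' xs"] xs v by simp
  have "\<bar>hnorm H x - hnorm K y\<bar> \<le> \<bar>hnorm H x - hnorm H (lincomb H b xs)\<bar> + \<bar>hnorm K y - hnorm K (lincomb K b' xs)\<bar>"
    using lincomb_norm[of xs] by simp
  with add_strict_mono[OF A B] show False by simp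
qed

lemma corr_ip:
  assumes "corr x y" "corr x' y'" shows "ip H x x' = ip K y y'"
proof -
  have re: "Re (ip H x x') = Re (ip K y y')" if "corr x' y'" for x' y'
    using corr_norm[OF corr_add[OF assms(1) that]] corr_norm[OF assms(1)] corr_norm[OF that]
      H.hnorm_add_sq[of x x'] K.hnorm_add_sq[of y y'] corr_vecs[OF assms(1)] corr_vecs[OF that] by simp
  have "Re (ip H x (scal H \<i> x')) = Re (ip K y (scal K \<i> y'))"
    using re[OF corr_scal[OF assms(2)]] .
  then have "Im (ip H x x') = Im (ip K y y')"
    using corr_vecs[OF assms(1)] corr_vecs[OF assms(2)] by (simp add: H.ip_scal_right K.ip_scal_right)
  with re[OF assms(2)] show ?thesis by (simp add: complex_eq_iff)
qed

lemma corr_unique: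
  assumes "corr x y" "corr x y'" shows "heq K y y'"
  using corr_norm[OF corr_diff[OF assms]] by (simp add: heq_def)

lemma corr_swap: "gram_pair K H b' b" "gram_pair.corr K H b' b y x \<longleftrightarrow> corr x y"
proof -
  show g: "gram_pair K H b' b"
    by unfold_locales (auto simp: gram)
  show "gram_pair.corr K H b' b y x \<longleftrightarrow> corr x y"
    unfolding gram_pair.corr_def[OF g] corr_def by blast
qed

text \<open>
  Approximate \<open>x\<close> by linear combinations; the same combinations on the other side have the same mutual
  distances, and completeness provides their limit.
\<close>

lemma corr_right_total:
  assumes "hilbert_space K" "x \<in> closed_span H (range b)"
  obtains y where "corr x y"
proof -
  interpret KH: hilbert_space K by fact
  have xv: "x \<in> vecs H" and "\<forall>n. \<exists>xs. hnorm H (x - lincomb H b xs) < 1 / real (Suc n)"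
    using assms(2) unfolding H.closed_span_iff_lincomb by auto
  then obtain s where s: "\<And>n. hnorm H (x - lincomb H b (s n)) < 1 / real (Suc n)" by metis
  have cau: "\<exists>N. \<forall>m\<ge>N. \<forall>n\<ge>N. hnorm K (lincomb K b' (s m) - lincomb K b' (s n)) < e" if e: "e > 0" for e
  proof -
    obtain N where N: "1 / real (Suc N) < e / 2"
      using reals_Archimedean[OF half_gt_zero[OF e]] by (auto simp: inverse_eq_divide)
    have close: "hnorm H (x - lincomb H b (s n)) < e / 2" if "n \<ge> N" for n
    proof -
      have "1 / real (Suc n) \<le> 1 / real (Suc N)" using that by (simp add: frac_le)
      then show ?thesis using s[of n] N by linarith
    qed
    have "hnorm K (lincomb K b' (s m) - lincomb K b' (s n)) < e" if "m \<ge> N" "n \<ge> N" for m n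
    proof -
      have "hnorm H (lincomb H b (s m) - lincomb H b (s n)) \<le>
          hnorm H (lincomb H b (s m) - x) + hnorm H (x - lincomb H b (s n))"
        using xv by (intro H.hnorm_triangle_diff) auto
      also have "\<dots> < e"
        using close[OF that(1)] close[OF that(2)] H.hnorm_minus_commute[OF xv, of "lincomb H b (s m)"] by simp
      finally show ?thesis by (simp add: lincomb_dist)
    qed
    then show ?thesis by blast
  qed
  obtain l where l: "l \<in> vecs K" "(\<lambda>n. hnorm K (lincomb K b' (s n) - l)) \<longlonglongrightarrow> 0"
    using KH.complete[of "\<lambda>n. lincomb K b' (s n)"] cau by auto
  have "corr x l"
    unfolding corr_def
  proof (intro conjI allI impI)
    fix e :: real assume "e > 0"
    obtain N where N: "1 / real (Suc N) < e" using reals_Archimedean[OF \<open>e > 0\<close>] by (auto simp: inverse_eq_divide)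
    have "\<forall>\<^sub>F n in sequentially. hnorm K (lincomb K b' (s n) - l) < e"
      using order_tendstoD(2)[OF l(2) \<open>e > 0\<close>] .
    then obtain M where M: "\<And>n. n \<ge> M \<Longrightarrow> hnorm K (lincomb K b' (s n) - l) < e"
      by (auto simp: eventually_sequentially)
    let ?n = "max M N"
    have "1 / real (Suc ?n) \<le> 1 / real (Suc N)" by (intro frac_le) auto
    then have "hnorm H (x - lincomb H b (s ?n)) < e" using s[of ?n] N by linarith
    moreover have "hnorm K (l - lincomb K b' (s ?n)) < e"
      using M[of ?n] l by (simp add: K.hnorm_minus_commute)
    ultimately show "\<exists>xs. hnorm H (x - lincomb H b xs) < e \<and> hnorm K (l - lincomb K b' xs) < e" by blast
  qed (use xv l in auto)
  then show thesis by (rule that)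
qed

lemma corr_left_total:
  assumes "hilbert_space H" "y \<in> closed_span K (range b')"
  obtains x where "corr x y"
  using gram_pair.corr_right_total[OF corr_swap(1) assms] corr_swap(2) by metis

lemma gram_iso:
  assumes "hilbert_space H" "hilbert_space K"
    "closed_span H (range b) = vecs H" "closed_span K (range b') = vecs K"
  obtains W where "hilbert_iso H K W" "\<And>x. x \<in> vecs H \<Longrightarrow> corr x (W x)"
proof -
  have "\<forall>x\<in>vecs H. \<exists>y. corr x y" using corr_right_total assms by metis
  then obtain W where W: "\<And>x. x \<in> vecs H \<Longrightarrow> corr x (W x)" by metis
  have "hilbert_iso H K W"
    unfolding hilbert_iso_def linear_op_def
  proof (intro conjI ballI allI)
    fix x y c assume x: "x \<in> vecs H"
    show "W x \<in> vecs K" using W[OF x] corr_vecs by blast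
    show "heq K (W (scal H c x)) (scal K c (W x))"
      by (rule corr_unique[OF W corr_scal[OF W]]) (use x in auto)
    assume y: "y \<in> vecs H"
    show "heq K (W (x + y)) (W x + W y)"
      by (rule corr_unique[OF W corr_add[OF W W]]) (use x y in auto)
    show "ip K (W x) (W y) = ip H x y"
      using corr_ip[OF W W] x y by simp
  next
    fix y assume "y \<in> vecs K"
    then obtain x where x: "corr x y" using corr_left_total assms by metis
    show "\<exists>x\<in>vecs H. heq K (W x) y"
      using corr_unique[OF W x] corr_vecs[OF x] by blast
  qed
  then show thesis using W that by blast
qed

end

lemma (in pre_hilbert) linear_op_lincomb:
  assumes W: "linear_op H K W" and "pre_hilbert K" and b: "\<And>i. b i \<in> vecs H"
  shows "heq K (W (lincomb H b xs)) (lincomb K (\<lambda>i. W (b i)) xs)"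
proof (induction xs)
  interpret K: pre_hilbert K by fact
  have Wv: "W x \<in> vecs K" if "x \<in> vecs H" for x using W that by (auto simp: linear_op_def)
  case Nil
  have "heq K (W (scal H 0 0)) (scal K 0 (W 0))" using W vecs_zero unfolding linear_op_def by blast
  then show ?case by simp
next
  interpret K: pre_hilbert K by fact
  have Wv: "W x \<in> vecs K" if "x \<in> vecs H" for x using W that by (auto simp: linear_op_def)
  case (Cons p xs)
  obtain c i where p: "p = (c, i)" by (cases p)
  have "heq K (W (scal H c (b i) + lincomb H b xs)) (W (scal H c (b i)) + W (lincomb H b xs))"
    using W b vecs_lincomb[of b xs] vecs_scal[of "b i" c] by (simp add: linear_op_def)
  moreover have "heq K (W (scal H c (b i)) + W (lincomb H b xs)) (scal K c (W (b i)) + lincomb K (\<lambda>i. W (b i)) xs)"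
    using W b by (intro K.heq_add Cons) (auto simp: linear_op_def intro!: Wv K.vecs_scal K.vecs_lincomb vecs_lincomb)
  ultimately show ?case
    unfolding p lincomb_simps
    by (intro K.heq_trans[OF _ _ _ \<open>heq K (W (scal H c (b i) + lincomb H b xs)) _\<close>])
      (auto intro!: Wv K.vecs_add K.vecs_scal K.vecs_lincomb vecs_add vecs_scal vecs_lincomb b)
qed

lemma (in pre_hilbert) linear_op_lincomb_heq:
  assumes W: "linear_op H K W" and K: "pre_hilbert K" and b: "\<And>i. b i \<in> vecs H"
    and b': "\<And>i. b' i \<in> vecs K" "\<And>i. heq K (W (b i)) (b' i)"
  shows "heq K (W (lincomb H b xs)) (lincomb K b' xs)"
proof -
  interpret K: pre_hilbert K by fact
  have Wv: "W x \<in> vecs K" if "x \<in> vecs H" for x using W that by (auto simp: linear_op_def)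
  show ?thesis
  proof (rule K.heq_trans)
    show "W (lincomb H b xs) \<in> vecs K" by (rule Wv[OF vecs_lincomb[OF b]])
    show "lincomb K (\<lambda>i. W (b i)) xs \<in> vecs K" by (rule K.vecs_lincomb) (rule Wv[OF b])
    show "lincomb K b' xs \<in> vecs K" by (rule K.vecs_lincomb[OF b'(1)])
    show "heq K (W (lincomb H b xs)) (lincomb K (\<lambda>i. W (b i)) xs)" by (rule linear_op_lincomb[OF W K b])
    show "heq K (lincomb K (\<lambda>i. W (b i)) xs) (lincomb K b' xs)"
      by (rule K.heq_lincomb[OF Wv[OF b] b'])
  qed
qed

lemma (in pre_hilbert) linear_op_diff:
  assumes L: "linear_op H K L" and K: "pre_hilbert K"
    and bd: "\<And>x. x \<in> vecs H \<Longrightarrow> hnorm K (L x) \<le> C * hnorm H x"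
    and xy: "x \<in> vecs H" "y \<in> vecs H"
  shows "hnorm K (L x - L y) \<le> C * hnorm H (x - y)"
proof -
  interpret K: pre_hilbert K by fact
  have Lv: "L x \<in> vecs K" if "x \<in> vecs H" for x using L that by (auto simp: linear_op_def)
  have "heq K (L ((x - y) + y)) (L (x - y) + L y)" using L xy vecs_diff[OF xy] unfolding linear_op_def by blast
  then have "heq K (L x - L y) (L (x - y) + L y - L y)"
    using xy by (intro K.heq_diff) (auto intro!: Lv)
  then have "hnorm K (L x - L y) = hnorm K (L (x - y))"
    using xy by (intro K.heq_hnorm) (auto intro!: Lv)
  then show ?thesis using bd[OF vecs_diff[OF xy]] by simp
qed

lemma (in pre_hilbert) bounded_op_diff:
  assumes W: "bounded_op H W" 
  obtains C where "C > 0" "\<And>x y. x \<in> vecs H \<Longrightarrow> y \<in> vecs H \<Longrightarrow> hnorm H (W x - W y) \<le> C * hnorm H (x - y)"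
proof -
  obtain C where C: "\<And>x. x \<in> vecs H \<Longrightarrow> hnorm H (W x) \<le> C * hnorm H x" and lin: "linear_op H H W"
    using W unfolding bounded_op_def by auto
  have "hnorm H (W x) \<le> (\<bar>C\<bar> + 1) * hnorm H x" if "x \<in> vecs H" for x
  proof (rule order_trans[OF C[OF that]])
    show "C * hnorm H x \<le> (\<bar>C\<bar> + 1) * hnorm H x" using that by (intro mult_right_mono) auto
  qed
  from linear_op_diff[OF lin pre_hilbert_axioms this] show thesis by (intro that[of "\<bar>C\<bar> + 1"]) auto
qed

text \<open>
  Operators that act on the two families by the same relabelling \<open>\<tau>\<close> of the indices are intertwined.
\<close>

lemma (in gram_pair) corr_shift:
  assumes W: "bounded_op H W" and W': "bounded_op K W'"
    and b: "\<And>i. heq H (W (b i)) (b (\<tau> i))" and b': "\<And>i. heq K (W' (b' i)) (b' (\<tau> i))"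
    and xy: "corr x y"
  shows "corr (W x) (W' y)"
  unfolding corr_def
proof (intro conjI allI impI)
  have lin: "linear_op H H W" "linear_op K K W'" using W W' by (auto simp: bounded_op_def)
  have Wv: "W x \<in> vecs H" if "x \<in> vecs H" for x using lin that by (auto simp: linear_op_def)
  have Wv': "W' x \<in> vecs K" if "x \<in> vecs K" for x using lin that by (auto simp: linear_op_def)
  note v = corr_vecs[OF xy]
  show "W x \<in> vecs H" "W' y \<in> vecs K" using v Wv Wv' by auto
  fix e :: real assume "e > 0"
  obtain C where C: "C > 0" "\<And>x y. x \<in> vecs H \<Longrightarrow> y \<in> vecs H \<Longrightarrow> hnorm H (W x - W y) \<le> C * hnorm H (x - y)"
    using H.bounded_op_diff[OF W] by blast
  obtain C' where C': "C' > 0" "\<And>x y. x \<in> vecs K \<Longrightarrow> y \<in> vecs K \<Longrightarrow> hnorm K (W' x - W' y) \<le> C' * hnorm K (x - y)"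
    using K.bounded_op_diff[OF W'] by blast
  have "0 < min (e / C) (e / C')" using \<open>e > 0\<close> C(1) C'(1) by simp
  then obtain xs where xs: "hnorm H (x - lincomb H b xs) < min (e / C) (e / C')"
      "hnorm K (y - lincomb K b' xs) < min (e / C) (e / C')"
    using xy unfolding corr_def by blast
  let ?ys = "map (\<lambda>(c, i). (c, \<tau> i)) xs"
  have sh: "lincomb H b ?ys = lincomb H (\<lambda>i. b (\<tau> i)) xs" "lincomb K b' ?ys = lincomb K (\<lambda>i. b' (\<tau> i)) xs"
    by (simp_all add: lincomb_def comp_def split_def)
  have 1: "heq H (W (lincomb H b xs)) (lincomb H b ?ys)"
    unfolding sh by (rule H.linear_op_lincomb_heq[OF lin(1) H.pre_hilbert_axioms]) (use b in auto)
  have 2: "heq K (W' (lincomb K b' xs)) (lincomb K b' ?ys)"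
    unfolding sh by (rule K.linear_op_lincomb_heq[OF lin(2) K.pre_hilbert_axioms]) (use b' in auto)
  have "hnorm H (W x - lincomb H b ?ys) \<le> C * hnorm H (x - lincomb H b xs)"
    using H.hnorm_triangle_diff[of "W x" "W (lincomb H b xs)" "lincomb H b ?ys"] 1 v C(2)[of x "lincomb H b xs"]
    by (simp add: heq_def Wv)
  moreover have "C * hnorm H (x - lincomb H b xs) < e" using xs C(1) by (simp add: field_simps)
  moreover have "hnorm K (W' y - lincomb K b' ?ys) \<le> C' * hnorm K (y - lincomb K b' xs)"
    using K.hnorm_triangle_diff[of "W' y" "W' (lincomb K b' xs)" "lincomb K b' ?ys"] 2 v C'(2)[of y "lincomb K b' xs"]
    by (simp add: heq_def Wv')
  moreover have "C' * hnorm K (y - lincomb K b' xs) < e" using xs C'(1) by (simp add: field_simps)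
  ultimately show "\<exists>xs. hnorm H (W x - lincomb H b xs) < e \<and> hnorm K (W' y - lincomb K b' xs) < e"
    by (intro exI[of _ ?ys]) linarith
qed

text \<open>
  The graph of \<open>W\<close> is contained in the correspondence between the total families \<open>b\<close> and \<open>b'\<close>, and that
  correspondence is a surjective isometry.
\<close>

lemma bounded_op_unitary:
  assumes H: "hilbert_space H" and W: "bounded_op H W"
    and b: "\<And>i. b i \<in> vecs H" "closed_span H (range b) = vecs H"
    and b': "\<And>i. b' i \<in> vecs H" "closed_span H (range b') = vecs H"
    and Wb: "\<And>i. heq H (W (b i)) (b' i)"
    and gram: "\<And>i j. ip H (b i) (b j) = ip H (b' i) (b' j)"
  shows "unitary_op H W"
proof -
  interpret H: hilbert_space H by fact
  interpret gram_pair H H b b' by unfold_locales (use b b' gram in auto)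
  have lin: "linear_op H H W" using W by (auto simp: bounded_op_def)
  have Wv: "W x \<in> vecs H" if "x \<in> vecs H" for x using lin that by (auto simp: linear_op_def)
  obtain C where C: "C > 0" "\<And>x y. x \<in> vecs H \<Longrightarrow> y \<in> vecs H \<Longrightarrow> hnorm H (W x - W y) \<le> C * hnorm H (x - y)"
    using H.bounded_op_diff[OF W] by blast
  have corr: "corr x (W x)" if x: "x \<in> vecs H" for x
    unfolding corr_def
  proof (intro conjI allI impI)
    fix e :: real assume "e > 0"
    have "0 < min e (e / C)" using \<open>e > 0\<close> C(1) by simp
    then obtain xs where xs: "hnorm H (x - lincomb H b xs) < min e (e / C)"
      using x b(2) H.closed_span_iff_lincomb by blast
    have "heq H (W (lincomb H b xs)) (lincomb H b' xs)"
      by (rule H.linear_op_lincomb_heq[OF lin H.pre_hilbert_axioms b(1) b'(1) Wb])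
    then have "hnorm H (W x - lincomb H b' xs) \<le> C * hnorm H (x - lincomb H b xs)"
      using H.hnorm_triangle_diff[of "W x" "W (lincomb H b xs)" "lincomb H b' xs"] x C(2)[of x "lincomb H b xs"]
      by (simp add: heq_def Wv)
    moreover have "C * hnorm H (x - lincomb H b xs) < e" using xs C(1) by (simp add: field_simps)
    ultimately show "\<exists>xs. hnorm H (x - lincomb H b xs) < e \<and> hnorm H (W x - lincomb H b' xs) < e"
      using xs by (intro exI[of _ xs]) auto
  qed (use x Wv in auto)
  have "\<exists>x\<in>vecs H. heq H (W x) y" if "y \<in> vecs H" for y
  proof -
    have "y \<in> closed_span H (range b')" using b'(2) that by simp
    then obtain x where x: "corr x y" by (rule corr_left_total[OF H])
    have xv: "x \<in> vecs H" by (rule corr_vecs(1)[OF x])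
    show ?thesis using corr_unique[OF corr[OF xv] x] xv by blast
  qed
  moreover have "ip H (W x) (W y) = ip H x y" if "x \<in> vecs H" "y \<in> vecs H" for x y
    using corr_ip[OF corr corr] that by simp
  ultimately show ?thesis using lin by (auto simp: unitary_op_def hilbert_iso_def)
qed

section \<open>Orbits of a unitary operator\<close>

context pre_hilbert
begin

lemma vecs_sum [intro]: "(\<And>i. i \<in> A \<Longrightarrow> x i \<in> vecs H) \<Longrightarrow> (\<Sum>i\<in>A. x i) \<in> vecs H"
  by (induction A rule: infinite_finite_induct) auto

lemma ip_sum: "(\<And>i. i \<in> A \<Longrightarrow> x i \<in> vecs H) \<Longrightarrow> y \<in> vecs H \<Longrightarrow> ip H (\<Sum>i\<in>A. x i) y = (\<Sum>i\<in>A. ip H (x i) y)"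
  by (induction A rule: infinite_finite_induct) (auto simp: ip_add vecs_sum)

lemma ip_sum_right: "(\<And>i. i \<in> A \<Longrightarrow> x i \<in> vecs H) \<Longrightarrow> y \<in> vecs H \<Longrightarrow> ip H y (\<Sum>i\<in>A. x i) = (\<Sum>i\<in>A. ip H y (x i))"
  by (induction A rule: infinite_finite_induct) (auto simp: ip_add_right vecs_sum)

lemma heq_sum:
  assumes "\<And>i. i \<in> A \<Longrightarrow> x i \<in> vecs H" "\<And>i. i \<in> A \<Longrightarrow> y i \<in> vecs H" "\<And>i. i \<in> A \<Longrightarrow> heq H (x i) (y i)"
  shows "heq H (\<Sum>i\<in>A. x i) (\<Sum>i\<in>A. y i)"
  using assms by (induction A rule: infinite_finite_induct) (auto intro!: heq_add)

lemma heq_of_ip: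
  assumes "x \<in> vecs H" "y \<in> vecs H" "ip H x x = a" "ip H x y = a" "ip H y y = a"
  shows "heq H x y"
proof -
  have "(hnorm H (x - y))\<^sup>2 = 0"
    unfolding hnorm_diff_sq[OF assms(1,2)] hnorm_sq[OF assms(1)] hnorm_sq[OF assms(2)] assms(3-5) by simp
  then show ?thesis by (simp add: heq_def)
qed

lemma closed_span_sum:
  assumes "B \<subseteq> vecs H" "\<And>i. i \<in> A \<Longrightarrow> x i \<in> closed_span H B"
  shows "(\<Sum>i\<in>A. x i) \<in> closed_span H B"
  using closed_span_subspace[OF assms(1)] assms(2) V.subspace_sum by blast

text \<open>
  Modulo the closed span, \<open>v 0\<close> is congruent to every \<open>a^k v k\<close>, hence to the average of these over
  the multiples \<open>k\<close> of a large number. As the correlations tend to zero, the averaged vectors are almost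
  orthogonal and their average is small.
\<close>

lemma telescoping_closed_span:
  fixes v :: "nat \<Rightarrow> 'v"
  assumes B: "B \<subseteq> vecs H" and v: "\<And>k. v k \<in> vecs H" and a: "cmod a \<le> 1"
    and step: "\<And>k. v k - scal H a (v (Suc k)) \<in> closed_span H B"
    and corr: "\<And>k l. k \<le> l \<Longrightarrow> cmod (ip H (v k) (v l)) \<le> c (l - k)" and c: "c \<longlonglongrightarrow> (0::real)"
  shows "v 0 \<in> closed_span H B"
proof (rule closed_span_limit[OF B v])
  fix e :: real assume e: "e > 0"
  define d where "d = e\<^sup>2 / 4"
  have d: "d > 0" using e by (simp add: d_def)
  obtain D where D: "\<And>m. m \<ge> D \<Longrightarrow> c m < d"
    using order_tendstoD(2)[OF c d] by (auto simp: eventually_sequentially)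
  obtain N where N: "c 0 / d < real N" using reals_Archimedean2 by blast
  have c0: "0 \<le> c 0" using order_trans[OF norm_ge_zero corr[of 0 0]] by simp
  have N0: "0 < real N" using N c0 d by (smt (verit) divide_nonneg_pos)
  have Nd: "c 0 \<le> real N * d" using N d by (simp add: field_simps)
  define E where "E = Suc D"
  have pow: "v 0 - scal H (a ^ k) (v k) \<in> closed_span H B" for k
  proof (induction k)
    case 0 then show ?case using closed_span_subspace[OF B] V.subspace_0 by simp
  next
    case (Suc k)
    have "(v 0 - scal H (a ^ k) (v k)) + scal H (a ^ k) (v k - scal H a (v (Suc k))) \<in> closed_span H B"
      by (intro closed_span_add closed_span_scal B Suc step)
    then show ?case by (simp add: V.scale_right_diff_distrib mult.commute)
  qed
  \<comment> \<open>an average over multiples of \<open>E\<close>: distinct terms have correlations below \<open>d\<close>\<close>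
  define z where "z = (\<Sum>i<N. scal H (a ^ (E * i) / of_nat N) (v (E * i)))"
  have zv: "z \<in> vecs H" unfolding z_def by (intro vecs_sum vecs_scal v)
  have "(\<Sum>i<N. scal H (1 / of_nat N) (v 0 - scal H (a ^ (E * i)) (v (E * i)))) \<in> closed_span H B"
    by (intro closed_span_sum B closed_span_scal pow)
  also have "(\<Sum>i<N. scal H (1 / of_nat N) (v 0 - scal H (a ^ (E * i)) (v (E * i)))) =
     (\<Sum>i<N. scal H (1 / of_nat N) (v 0)) - z"
    unfolding z_def sum_subtractf[symmetric] by (simp add: V.scale_right_diff_distrib)
  also have "(\<Sum>i<N. scal H (1 / of_nat N) (v 0)) = v 0"
    using N0 by (simp add: V.scale_sum_left[symmetric])
  finally have mem: "v 0 - z \<in> closed_span H B" .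
  have pa: "cmod a ^ k \<le> 1" for k using a by (simp add: power_le_one)
  have small: "cmod (ip H (v (E * i)) (v (E * j))) \<le> (if i = j then c 0 else d)" for i j
  proof -
    have main: "cmod (ip H (v (E * i)) (v (E * j))) \<le> (if i = j then c 0 else d)" if "i \<le> j" for i j
    proof (cases "i = j")
      case False
      then have "j - i \<ge> 1" using that by simp
      then have "E * 1 \<le> E * (j - i)" by (rule mult_le_mono2)
      then have "D \<le> E * j - E * i" by (simp add: E_def diff_mult_distrib2)
      then have "c (E * j - E * i) < d" by (rule D)
      moreover have "E * i \<le> E * j" using that by simp
      ultimately show ?thesis using corr[of "E * i" "E * j"] False by simp
    qed (use corr[of "E * i" "E * i"] in simp)
    show ?thesis
    proof (cases "i \<le> j")
      case False
      then show ?thesis using main[of j i] ip_cnj[OF v v, of "E * i" "E * j"] by simp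
    qed (rule main)
  qed
  have "(hnorm H z)\<^sup>2 \<le> cmod (ip H z z)"
    using hnorm_sq[OF zv] complex_Re_le_cmod by simp
  also have "\<dots> = cmod (\<Sum>i<N. \<Sum>j<N. a ^ (E * i) / of_nat N * cnj (a ^ (E * j) / of_nat N) * ip H (v (E * i)) (v (E * j)))"
    unfolding z_def using v
    by (simp add: ip_sum ip_sum_right vecs_sum vecs_scal ip_scal ip_scal_right sum_distrib_left)
      (subst sum.swap, simp add: mult_ac)
  also have "\<dots> \<le> (\<Sum>i<N. \<Sum>j<N. 1 / (real N)\<^sup>2 * (if i = j then c 0 else d))"
  proof (intro order_trans[OF norm_sum] sum_mono)
    fix i j
    have "cmod (a ^ (E * i) / of_nat N * cnj (a ^ (E * j) / of_nat N) * ip H (v (E * i)) (v (E * j))) =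
      1 / (real N)\<^sup>2 * (cmod a ^ (E * i) * cmod a ^ (E * j) * cmod (ip H (v (E * i)) (v (E * j))))"
      by (simp add: norm_mult norm_divide norm_power power2_eq_square)
    also have "\<dots> \<le> 1 / (real N)\<^sup>2 * (1 * 1 * (if i = j then c 0 else d))"
      by (intro mult_left_mono mult_mono pa small) auto
    finally show "cmod (a ^ (E * i) / of_nat N * cnj (a ^ (E * j) / of_nat N) * ip H (v (E * i)) (v (E * j))) \<le>
      1 / (real N)\<^sup>2 * (if i = j then c 0 else d)" by simp
  qed
  also have "\<dots> \<le> (\<Sum>i<N. \<Sum>j<N. 1 / (real N)\<^sup>2 * ((if i = j then c 0 else 0) + d))"
    using d by (intro sum_mono mult_left_mono) auto
  also have "\<dots> = 1 / (real N)\<^sup>2 * (real N * (c 0 + real N * d))"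
    by (simp add: sum_divide_distrib[symmetric] sum.distrib)
  also have "\<dots> = c 0 / real N + d" using N0 by (simp add: power2_eq_square field_simps)
  also have "\<dots> \<le> 2 * d" using Nd N0 by (simp add: field_simps)
  also have "\<dots> < e\<^sup>2" using e by (simp add: d_def)
  finally have "hnorm H z < e" using e by (simp add: power2_less_imp_less)
  then show "\<exists>y\<in>closed_span H B. hnorm H (v 0 - y) < e"
    using mem by (intro bexI[of _ "v 0 - z"]) auto
qed

end

locale unitary_pre = pre_hilbert H for H :: "'v::ab_group_add hilb" +
  fixes U :: "'v \<Rightarrow> 'v"
  assumes unitary: "unitary_op H U"
begin

abbreviation "orb x n \<equiv> int_power H U n x"

lemma U_vecs [intro]: "x \<in> vecs H \<Longrightarrow> U x \<in> vecs H"
  using unitary by (simp add: unitary_op_def hilbert_iso_def linear_op_def)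

lemma U_ip: "x \<in> vecs H \<Longrightarrow> y \<in> vecs H \<Longrightarrow> ip H (U x) (U y) = ip H x y"
  using unitary by (simp add: unitary_op_def hilbert_iso_def)

lemma U_dist: "x \<in> vecs H \<Longrightarrow> y \<in> vecs H \<Longrightarrow> hnorm H (U x - U y) = hnorm H (x - y)"
proof -
  assume v: "x \<in> vecs H" "y \<in> vecs H"
  have "(hnorm H (U x - U y))\<^sup>2 = (hnorm H (x - y))\<^sup>2"
    using v by (simp add: hnorm_sq ip_diff ip_diff_right U_vecs U_ip)
  then show ?thesis using v by (simp add: power2_eq_iff_nonneg vecs_diff U_vecs)
qed

lemma U_heq_iff: "x \<in> vecs H \<Longrightarrow> y \<in> vecs H \<Longrightarrow> heq H (U x) (U y) \<longleftrightarrow> heq H x y"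
  by (simp add: heq_def U_dist)

lemma inv_op: assumes "y \<in> vecs H" shows "inv_op H U y \<in> vecs H" "heq H (U (inv_op H U y)) y"
proof -
  have "\<exists>x. x \<in> vecs H \<and> heq H (U x) y"
    using unitary assms by (auto simp: unitary_op_def hilbert_iso_def)
  from someI_ex[OF this] show "inv_op H U y \<in> vecs H" "heq H (U (inv_op H U y)) y"
    by (simp_all add: inv_op_def)
qed

lemma orb_zero [simp]: "orb x 0 = x"
  by (simp add: int_power_def)

lemma orb_nonneg: "orb x (int n) = (U ^^ n) x"
  by (simp add: int_power_def)

lemma orb_vecs [intro, simp]:
  assumes "x \<in> vecs H" shows "orb x n \<in> vecs H"
proof -
  have "(U ^^ k) x \<in> vecs H" for k using assms by (induction k) auto
  moreover have "(inv_op H U ^^ k) x \<in> vecs H" for k using assms by (induction k) (auto intro: inv_op)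
  ultimately show ?thesis by (simp add: int_power_def)
qed

lemma orb_step:
  assumes "x \<in> vecs H" shows "heq H (U (orb x n)) (orb x (n + 1))"
proof (cases "0 \<le> n")
  case True
  then have "nat (n + 1) = Suc (nat n)" by simp
  then show ?thesis using True by (simp add: int_power_def)
next
  case False
  define m where "m = nat (- n - 1)"
  have m: "n = - int (Suc m)" using False by (simp add: m_def)
  have "orb x n = inv_op H U ((inv_op H U ^^ m) x)"
    by (simp add: int_power_def m nat_add_distrib)
  moreover have "orb x (n + 1) = (inv_op H U ^^ m) x"
    unfolding m by (cases m) (simp_all add: int_power_def nat_add_distrib)
  ultimately show ?thesis using inv_op(2)[OF orb_vecs[OF assms], of "n + 1"] by simp
qed

lemma orb_ip_step:
  assumes "x \<in> vecs H" "y \<in> vecs H"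
  shows "ip H (orb x (n + 1)) (orb y (m + 1)) = ip H (orb x n) (orb y m)"
proof -
  have "ip H (orb x (n + 1)) (orb y (m + 1)) = ip H (U (orb x n)) (orb y (m + 1))"
    using orb_step[OF assms(1)] assms by (intro heq_ip_left[symmetric]) auto
  also have "\<dots> = ip H (U (orb x n)) (U (orb y m))"
    using orb_step[OF assms(2)] assms by (intro heq_ip_right[symmetric]) auto
  finally show ?thesis using U_ip assms by auto
qed

lemma orb_ip_shift:
  assumes "x \<in> vecs H" "y \<in> vecs H"
  shows "ip H (orb x (n + k)) (orb y (m + k)) = ip H (orb x n) (orb y m)"
proof (induction k rule: int_induct[where k = 0])
  case (step1 i)
  then show ?case using orb_ip_step[OF assms, of "n + i" "m + i"] by (simp add: algebra_simps)
next
  case (step2 i)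
  then show ?case using orb_ip_step[OF assms, of "n + i - 1" "m + i - 1"] by (simp add: algebra_simps)
qed simp

lemma orb_ip: "x \<in> vecs H \<Longrightarrow> y \<in> vecs H \<Longrightarrow> ip H (orb x n) (orb y m) = ip H (orb x (n - m)) y"
  using orb_ip_shift[of x y "n - m" m 0] by simp

lemma orb_ip_same: "x \<in> vecs H \<Longrightarrow> y \<in> vecs H \<Longrightarrow> ip H (orb x n) (orb y n) = ip H x y"
  using orb_ip[of x y n n] by simp

lemma orb_norm: "x \<in> vecs H \<Longrightarrow> hnorm H (orb x n) = hnorm H x"
  by (simp add: hnorm_def orb_ip_same)

lemma orb_dist: "x \<in> vecs H \<Longrightarrow> y \<in> vecs H \<Longrightarrow> hnorm H (orb x n - orb y n) = hnorm H (x - y)"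
proof -
  assume v: "x \<in> vecs H" "y \<in> vecs H"
  have "(hnorm H (orb x n - orb y n))\<^sup>2 = (hnorm H (x - y))\<^sup>2"
    using v by (simp add: hnorm_diff_sq orb_norm orb_ip_same)
  then show ?thesis using v by (simp add: power2_eq_iff_nonneg vecs_diff)
qed

lemma orb_heq: "x \<in> vecs H \<Longrightarrow> y \<in> vecs H \<Longrightarrow> heq H x y \<Longrightarrow> heq H (orb x n) (orb y n)"
  by (simp add: heq_def orb_dist)

lemma orb_lincomb:
  assumes b: "\<And>i. b i \<in> vecs H"
  shows "heq H (orb (lincomb H b xs) n) (lincomb H (\<lambda>i. orb (b i) n) xs)"
proof (rule heq_of_ip[where a = "ip H (lincomb H b xs) (lincomb H b xs)"])
  have v: "lincomb H b xs \<in> vecs H" "\<And>i. orb (b i) n \<in> vecs H"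
    "lincomb H (\<lambda>i. orb (b i) n) xs \<in> vecs H" using b by auto
  show "orb (lincomb H b xs) n \<in> vecs H" "lincomb H (\<lambda>i. orb (b i) n) xs \<in> vecs H" using v by auto
  show "ip H (orb (lincomb H b xs) n) (orb (lincomb H b xs) n) = ip H (lincomb H b xs) (lincomb H b xs)"
    using v by (simp add: orb_ip_same)
  show "ip H (orb (lincomb H b xs) n) (lincomb H (\<lambda>i. orb (b i) n) xs) = ip H (lincomb H b xs) (lincomb H b xs)"
    using b v ip_lincomb_right[OF b v(1)] by (simp add: ip_lincomb_right orb_ip_same)
  have "ip H (orb (b i) n) (lincomb H (\<lambda>i. orb (b i) n) xs) = ip H (b i) (lincomb H b xs)" for i
    using b v by (simp add: ip_lincomb_right orb_ip_same)
  then show "ip H (lincomb H (\<lambda>i. orb (b i) n) xs) (lincomb H (\<lambda>i. orb (b i) n) xs) = ip H (lincomb H b xs) (lincomb H b xs)"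
    using b v by (simp add: ip_lincomb_left)
qed

lemma orb_orb:
  assumes x: "x \<in> vecs H" shows "heq H (orb (orb x m) n) (orb x (n + m))"
proof (induction n rule: int_induct[where k = 0])
  case (step1 i)
  have h1: "heq H (orb (orb x m) (i + 1)) (U (orb (orb x m) i))"
    by (rule heq_sym[OF _ _ orb_step]) (use x in auto)
  have h2: "heq H (U (orb (orb x m) i)) (U (orb x (i + m)))"
    using x step1 by (simp add: U_heq_iff)
  have h3: "heq H (U (orb x (i + m))) (orb x (i + m + 1))" using x by (rule orb_step)
  have "heq H (orb (orb x m) (i + 1)) (orb x (i + m + 1))"
    by (rule heq_trans[OF _ _ _ h1 heq_trans[OF _ _ _ h2 h3]]) (use x in auto)
  then show ?case by (simp add: algebra_simps)
next
  case (step2 i)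
  have h1: "heq H (U (orb (orb x m) (i - 1))) (orb (orb x m) i)"
    using orb_step[of "orb x m" "i - 1"] x by simp
  have h2: "heq H (orb x (i + m)) (U (orb x (i + m - 1)))"
    using heq_sym[OF _ _ orb_step[of x "i + m - 1"]] x by auto
  have "heq H (U (orb (orb x m) (i - 1))) (U (orb x (i + m - 1)))"
    by (rule heq_trans[OF _ _ _ h1 heq_trans[OF _ _ _ step2(2) h2]]) (use x in auto)
  then show ?case using x by (simp add: U_heq_iff algebra_simps)
qed simp

lemma orb_unique:
  assumes x: "x \<in> vecs H" and e: "\<And>n. e n \<in> vecs H" "heq H x (e 0)" "\<And>n. heq H (U (e n)) (e (n + 1))"
  shows "heq H (orb x n) (e n)"
proof (induction n rule: int_induct[where k = 0])
  case (step1 i)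
  have h1: "heq H (orb x (i + 1)) (U (orb x i))" by (rule heq_sym[OF _ _ orb_step]) (use x in auto)
  have h2: "heq H (U (orb x i)) (U (e i))" using x e(1) step1 by (simp add: U_heq_iff)
  show ?case
    by (rule heq_trans[OF _ _ _ h1 heq_trans[OF _ _ _ h2 e(3)]]) (use x e(1) in auto)
next
  case (step2 i)
  have h1: "heq H (U (orb x (i - 1))) (orb x i)" using orb_step[OF x, of "i - 1"] by simp
  have h2: "heq H (e i) (U (e (i - 1)))" by (rule heq_sym) (use x e(1) e(3)[of "i - 1"] in auto)
  have "heq H (U (orb x (i - 1))) (U (e (i - 1)))"
    by (rule heq_trans[OF _ _ _ h1 heq_trans[OF _ _ _ step2(2) h2]]) (use x e(1) in auto)
  then show ?case using x e(1) by (simp add: U_heq_iff)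
qed (use e in simp)

lemma orb_diff_scal:
  assumes x: "x \<in> vecs H" and y: "y \<in> vecs H"
  shows "heq H (orb (x - scal H c y) n) (orb x n - scal H c (orb y n))"
proof -
  define b where "b = (\<lambda>i. if i then x else y)"
  have b: "b True = x" "b False = y" by (simp_all add: b_def)
  have "heq H (orb (lincomb H b [(1, True), (- c, False)]) n) (lincomb H (\<lambda>i. orb (b i) n) [(1, True), (- c, False)])"
    by (rule orb_lincomb) (simp add: b_def x y)
  then show ?thesis by (simp add: b)
qed

abbreviation "cyc x \<equiv> closed_span H (range (orb x))"

lemma orb_range_vecs: "x \<in> vecs H \<Longrightarrow> range (orb x) \<subseteq> vecs H"
  by auto

lemma orb_in_cyc: "x \<in> vecs H \<Longrightarrow> orb x n \<in> cyc x"
  by (intro closed_span_base orb_range_vecs) auto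

lemma cyc_orb:
  assumes x: "x \<in> vecs H" and y: "y \<in> cyc x" shows "orb y k \<in> cyc x"
proof (rule closed_span_limit[OF orb_range_vecs[OF x]])
  have yv: "y \<in> vecs H" using y closed_span_subset by auto
  then show "orb y k \<in> vecs H" by simp
  fix e :: real assume "e > 0"
  then obtain xs where xs: "hnorm H (y - lincomb H (orb x) xs) < e"
    using y unfolding closed_span_iff_lincomb by auto
  have lv: "lincomb H (orb x) xs \<in> vecs H" using x by auto
  let ?z = "lincomb H (\<lambda>i. orb (orb x i) k) xs"
  have zv: "?z \<in> vecs H" using x by auto
  have "?z \<in> cyc x"
  proof (intro closed_span_lincomb orb_range_vecs x)
    fix i show "orb (orb x i) k \<in> cyc x"
      by (rule closed_span_heq[OF orb_range_vecs[OF x] _ orb_in_cyc[OF x] orb_orb[OF x]]) (use x in auto)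
  qed
  moreover have "hnorm H (orb y k - ?z) < e"
  proof -
    have "heq H (orb (lincomb H (orb x) xs) k) ?z" using x by (intro orb_lincomb) auto
    then show ?thesis
      using hnorm_triangle_diff[of "orb y k" "orb (lincomb H (orb x) xs) k" ?z] xs x yv lv zv
      by (simp add: heq_def orb_dist)
  qed
  ultimately show "\<exists>z\<in>cyc x. hnorm H (orb y k - z) < e" by blast
qed

lemma cyc_minimal:
  assumes "x \<in> vecs H" "y \<in> cyc x" shows "cyc y \<subseteq> cyc x"
  using cyc_orb[OF assms] by (intro closed_span_minimal orb_range_vecs assms) auto

text \<open>First for two translates of \<open>x\<close>, then by linearity, then by approximation.\<close>

lemma correlations_decay:
  assumes x: "x \<in> vecs H" and c: "(\<lambda>k. ip H (orb x (int k)) x) \<longlonglongrightarrow> 0"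
    and y: "y \<in> cyc x" and z: "z \<in> cyc x"
  shows "(\<lambda>k. ip H (orb y (int k)) z) \<longlonglongrightarrow> 0"
proof -
  have yv: "y \<in> vecs H" "z \<in> vecs H" using y z closed_span_subset by auto
  have base: "(\<lambda>k. ip H (orb (orb x i) (int k)) (orb x j)) \<longlonglongrightarrow> 0" for i j
  proof -
    have "ip H (orb (orb x i) (int k)) (orb x j) = ip H (orb x (int k + (i - j))) x" for k
      using heq_ip_left[OF _ _ _ orb_orb[OF x, where m = i and n = "int k"], of "orb x j"] orb_ip[OF x x, of "int k + i" j] x
      by (simp add: add_diff_eq)
    moreover have "(\<lambda>k. ip H (orb x (int k + (i - j))) x) \<longlonglongrightarrow> 0"
    proof -
      have "\<forall>\<^sub>F k in sequentially. ip H (orb x (int k + (i - j))) x = ip H (orb x (int (nat (int k + (i - j))))) x"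
        using eventually_ge_at_top[of "nat \<bar>i - j\<bar>"] by eventually_elim (simp add: int_nat_eq, linarith)
      moreover have "filterlim (\<lambda>k. nat (int k + (i - j))) sequentially sequentially"
        unfolding filterlim_at_top
      proof
        fix Z :: nat
        show "\<forall>\<^sub>F k in sequentially. Z \<le> nat (int k + (i - j))"
          using eventually_ge_at_top[of "Z + nat \<bar>i - j\<bar>"] by eventually_elim linarith
      qed
      ultimately show ?thesis using filterlim_compose[OF c, of "\<lambda>k. nat (int k + (i - j))"] by (simp only: tendsto_cong)
    qed
    ultimately show ?thesis by simp
  qed
  have lin1: "(\<lambda>k. ip H (orb (orb x i) (int k)) (lincomb H (orb x) ys)) \<longlonglongrightarrow> 0" for i ys
  proof -
    have "(\<lambda>k. \<Sum>(c, j)\<leftarrow>ys. cnj c * ip H (orb (orb x i) (int k)) (orb x j)) \<longlonglongrightarrow> 0"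
    proof (induction ys)
      case (Cons p ys)
      obtain c j where "p = (c, j)" by (cases p)
      then show ?case using tendsto_add[OF tendsto_mult_right_zero[OF base[of i j], of "cnj c"] Cons] by simp
    qed simp
    then show ?thesis using x by (simp add: ip_lincomb_right)
  qed
  have lin: "(\<lambda>k. ip H (orb (lincomb H (orb x) xs) (int k)) (lincomb H (orb x) ys)) \<longlonglongrightarrow> 0" for xs ys
  proof -
    have "(\<lambda>k. \<Sum>(c, j)\<leftarrow>xs. c * ip H (orb (orb x j) (int k)) (lincomb H (orb x) ys)) \<longlonglongrightarrow> 0"
    proof (induction xs)
      case (Cons p xs)
      obtain c j where "p = (c, j)" by (cases p)
      then show ?case using tendsto_add[OF tendsto_mult_right_zero[OF lin1[of j ys], of c] Cons] by simp
    qed simp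
    moreover have "ip H (orb (lincomb H (orb x) xs) (int k)) (lincomb H (orb x) ys) =
      (\<Sum>(c, j)\<leftarrow>xs. c * ip H (orb (orb x j) (int k)) (lincomb H (orb x) ys))" for k
      using heq_ip_left[OF _ _ _ orb_lincomb[where b = "orb x" and xs = xs and n = "int k"], of "lincomb H (orb x) ys"] x
      by (auto simp: ip_lincomb_left vecs_lincomb)
    ultimately show ?thesis by simp
  qed
  show ?thesis
  proof (rule LIMSEQ_I)
    fix e :: real assume e: "0 < e"
    define C where "C = hnorm H y + hnorm H z + 1"
    have C: "C > 0" using yv by (simp add: C_def add_nonneg_pos)
    define d where "d = min 1 (e / (3 * C))"
    have d: "d > 0" "d \<le> 1" "C * d \<le> e / 3" using e C by (auto simp: d_def min_def field_simps)
    obtain xs where xs: "hnorm H (y - lincomb H (orb x) xs) < d"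
      using y d(1) unfolding closed_span_iff_lincomb by auto
    obtain ys where ys: "hnorm H (z - lincomb H (orb x) ys) < d"
      using z d(1) unfolding closed_span_iff_lincomb by auto
    let ?y = "lincomb H (orb x) xs" and ?z = "lincomb H (orb x) ys"
    have v: "?y \<in> vecs H" "?z \<in> vecs H" using x by auto
    obtain N where N: "\<And>k. k \<ge> N \<Longrightarrow> cmod (ip H (orb ?y (int k)) ?z) < e / 3"
      using LIMSEQ_D[OF lin[of xs ys], of "e / 3"] e by auto
    have "cmod (ip H (orb y (int k)) z) < e" if "k \<ge> N" for k
    proof -
      have "ip H (orb y (int k)) z = ip H (orb y (int k) - orb ?y (int k)) z + ip H (orb ?y (int k)) (z - ?z) + ip H (orb ?y (int k)) ?z"
        using v yv by (simp add: ip_diff ip_diff_right)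
      moreover have "cmod (ip H (orb y (int k) - orb ?y (int k)) z) \<le> d * C"
      proof (rule order_trans[OF cauchy_schwarz])
        show "hnorm H (orb y (int k) - orb ?y (int k)) * hnorm H z \<le> d * C"
          using xs yv v d by (intro mult_mono) (auto simp: orb_dist C_def)
      qed (use yv v in auto)
      moreover have "cmod (ip H (orb ?y (int k)) (z - ?z)) \<le> C * d"
      proof (rule order_trans[OF cauchy_schwarz])
        have "hnorm H ?y \<le> C" using hnorm_diff_ineq[OF yv(1) v(1)] xs d(2) hnorm_nonneg[OF yv(2)] unfolding C_def by linarith
        then show "hnorm H (orb ?y (int k)) * hnorm H (z - ?z) \<le> C * d"
          using ys yv v d C by (intro mult_mono) (auto simp: orb_norm)
      qed (use yv v in auto)
      ultimately show ?thesis
        using N[OF that] d(3) norm_triangle_ineq[of "ip H (orb y (int k) - orb ?y (int k)) z + ip H (orb ?y (int k)) (z - ?z)" "ip H (orb ?y (int k)) ?z"]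
          norm_triangle_ineq[of "ip H (orb y (int k) - orb ?y (int k)) z" "ip H (orb ?y (int k)) (z - ?z)"]
        by (simp add: mult.commute)
    qed
    then show "\<exists>N. \<forall>k\<ge>N. cmod (ip H (orb y (int k)) z - 0) < e" by auto
  qed
qed

text \<open>
  A unitary operator with decaying correlations has no eigenvalues, so \<open>U - a\<close> has dense range on
  every cyclic space. Iterating \<open>U w \<approx> a w\<close>, backwards if \<open>\<bar>a\<bar> \<le> 1\<close> and forwards otherwise, keeps the
  powers of the factor bounded.
\<close>

lemma linear_factor_dense:
  assumes w: "w \<in> vecs H" and c: "(\<lambda>k. ip H (orb w (int k)) w) \<longlonglongrightarrow> 0"
  shows "w \<in> cyc (orb w 1 - scal H a w)"
proof -
  define y where "y = orb w 1 - scal H a w"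
  have yv: "y \<in> vecs H" using w by (auto simp: y_def)
  have y: "heq H (orb w (n + 1) - scal H a (orb w n)) (orb y n)" for n
  proof (rule heq_sym)
    have h1: "heq H (orb (orb w 1 - scal H a w) n) (orb (orb w 1) n - scal H a (orb w n))"
      using w by (intro orb_diff_scal) auto
    have h2: "heq H (orb (orb w 1) n - scal H a (orb w n)) (orb w (n + 1) - scal H a (orb w n))"
      using w by (intro heq_diff orb_orb) auto
    show "heq H (orb y n) (orb w (n + 1) - scal H a (orb w n))"
      unfolding y_def by (rule heq_trans[OF _ _ _ h1 h2]) (use w in auto)
  qed (use w yv in auto)
  have mem: "orb w (n + 1) - scal H a (orb w n) \<in> cyc y" for n
    by (rule closed_span_heq[OF orb_range_vecs[OF yv] _ orb_in_cyc[OF yv] y]) (use w in auto)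
  have c': "(\<lambda>k. cmod (ip H (orb w (int k)) w)) \<longlonglongrightarrow> 0" using c by (rule tendsto_norm_zero)
  show ?thesis
  proof (cases "cmod a \<le> 1")
    case True
    have "orb w (- int 0) \<in> cyc y"
    proof (rule telescoping_closed_span[where v = "\<lambda>k. orb w (- int k)" and a = a])
      show "orb w (- int k) - scal H a (orb w (- int (Suc k))) \<in> cyc y" for k
        using mem[of "- int (Suc k)"] by simp
      show "cmod (ip H (orb w (- int k)) (orb w (- int l))) \<le> cmod (ip H (orb w (int (l - k))) w)" if "k \<le> l" for k l
        using orb_ip[OF w w, of "- int k" "- int l"] that by (simp add: of_nat_diff)
    qed (use w yv True c' in auto)
    then show ?thesis by (simp add: y_def)
  next
    case False
    then have a0: "a \<noteq> 0" by auto
    have "orb w (int 0) \<in> cyc y"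
    proof (rule telescoping_closed_span[where v = "\<lambda>k. orb w (int k)" and a = "inverse a"])
      fix k
      have "scal H (- inverse a) (orb w (int k + 1) - scal H a (orb w (int k))) \<in> cyc y"
        using yv mem by (intro closed_span_scal) auto
      then show "orb w (int k) - scal H (inverse a) (orb w (int (Suc k))) \<in> cyc y"
        using a0 by (simp add: V.scale_right_diff_distrib add.commute)
    next
      fix k l :: nat assume "k \<le> l"
      then have "ip H (orb w (int l)) (orb w (int k)) = ip H (orb w (int (l - k))) w"
        using orb_ip[OF w w, of "int l" "int k"] by (simp add: of_nat_diff)
      then show "cmod (ip H (orb w (int k)) (orb w (int l))) \<le> cmod (ip H (orb w (int (l - k))) w)"
        using ip_cnj[of "orb w (int l)" "orb w (int k)"] w by simp
    qed (use w yv False c' in \<open>auto simp: norm_inverse inverse_le_1_iff\<close>)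
    then show ?thesis by (simp add: y_def)
  qed
qed

definition poly_orb :: "complex poly \<Rightarrow> 'v \<Rightarrow> 'v" where
  "poly_orb p x = (\<Sum>i\<le>degree p. scal H (coeff p i) (orb x (int i)))"

lemma poly_orb_vecs [simp]: "x \<in> vecs H \<Longrightarrow> poly_orb p x \<in> vecs H"
  unfolding poly_orb_def by auto

lemma poly_orb_eq: 
  assumes "degree p \<le> n" shows "poly_orb p x = (\<Sum>i\<le>n. scal H (coeff p i) (orb x (int i)))"
  unfolding poly_orb_def
  by (rule sum.mono_neutral_left) (use assms in \<open>auto simp: coeff_eq_0\<close>)

lemma poly_orb_in_cyc: "x \<in> vecs H \<Longrightarrow> poly_orb p x \<in> cyc x"
  unfolding poly_orb_def by (intro closed_span_sum orb_range_vecs closed_span_scal orb_in_cyc)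

lemma orb_sum_scal:
  assumes x: "x \<in> vecs H"
  shows "heq H (orb (\<Sum>i\<in>A. scal H (f i) (orb x (g i))) n) (\<Sum>i\<in>A. scal H (f i) (orb x (n + g i)))"
proof (rule heq_of_ip[where a = "\<Sum>i\<in>A. \<Sum>j\<in>A. f i * cnj (f j) * ip H (orb x (g i - g j)) x"])
  let ?z = "\<Sum>i\<in>A. scal H (f i) (orb x (g i))" and ?y = "\<Sum>i\<in>A. scal H (f i) (orb x (n + g i))"
  have ev: "ip H (\<Sum>i\<in>A. scal H (f i) (orb x (m + g i))) (\<Sum>i\<in>A. scal H (f i) (orb x (m + g i))) =
     (\<Sum>i\<in>A. \<Sum>j\<in>A. f i * cnj (f j) * ip H (orb x (g i - g j)) x)" for m
    using x by (simp add: ip_sum ip_sum_right vecs_sum vecs_scal ip_scal ip_scal_right sum_distrib_left orb_ip)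
      (subst sum.swap, simp add: mult_ac)
  show zv: "orb ?z n \<in> vecs H" "?y \<in> vecs H" using x by (auto intro!: orb_vecs)
  show "ip H (orb ?z n) (orb ?z n) = (\<Sum>i\<in>A. \<Sum>j\<in>A. f i * cnj (f j) * ip H (orb x (g i - g j)) x)"
    using ev[of 0] x by (subst orb_ip_same) (auto intro!: vecs_sum)
  show "ip H ?y ?y = (\<Sum>i\<in>A. \<Sum>j\<in>A. f i * cnj (f j) * ip H (orb x (g i - g j)) x)"
    using ev[of n] by simp
  have z: "?z \<in> vecs H" using x by auto
  have "ip H (orb ?z n) ?y = (\<Sum>j\<in>A. cnj (f j) * ip H (orb ?z n) (orb x (n + g j)))"
    using x z by (simp add: ip_sum_right vecs_scal ip_scal_right)
  also have "\<dots> = (\<Sum>j\<in>A. cnj (f j) * ip H ?z (orb x (g j)))"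
    using orb_ip_shift[OF z x, of 0 n] by (simp only: add.commute[of n] add_0_left orb_zero)
  also have "\<dots> = (\<Sum>j\<in>A. \<Sum>i\<in>A. f i * cnj (f j) * ip H (orb x (g i - g j)) x)"
    using x by (simp add: ip_sum vecs_scal ip_scal orb_ip sum_distrib_left mult_ac)
  also have "\<dots> = (\<Sum>i\<in>A. \<Sum>j\<in>A. f i * cnj (f j) * ip H (orb x (g i - g j)) x)" by (rule sum.swap)
  finally show "ip H (orb ?z n) ?y = (\<Sum>i\<in>A. \<Sum>j\<in>A. f i * cnj (f j) * ip H (orb x (g i - g j)) x)" .
qed

lemma poly_orb_linear_factor:
  assumes x: "x \<in> vecs H"
  shows "heq H (poly_orb ([:- a, 1:] * q) x) (orb (poly_orb q x) 1 - scal H a (poly_orb q x))"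
proof -
  let ?n = "Suc (degree q)"
  have deg: "degree ([:- a, 1:] * q) \<le> ?n"
    using degree_mult_le[of "[:- a, 1:]" q] by simp
  have co: "coeff ([:- a, 1:] * q) i = (if i = 0 then 0 else coeff q (i - 1)) - a * coeff q i" for i
    by (cases i) auto
  have "poly_orb ([:- a, 1:] * q) x =
    (\<Sum>i\<le>?n. scal H (if i = 0 then 0 else coeff q (i - 1)) (orb x (int i))) - (\<Sum>i\<le>?n. scal H (a * coeff q i) (orb x (int i)))"
    unfolding poly_orb_eq[OF deg] co by (simp add: V.scale_left_diff_distrib sum_subtractf del: sum.atMost_Suc)
  also have "(\<Sum>i\<le>?n. scal H (if i = 0 then 0 else coeff q (i - 1)) (orb x (int i))) = (\<Sum>i\<le>degree q. scal H (coeff q i) (orb x (1 + int i)))"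
    by (subst sum.atMost_Suc_shift) (simp add: add.commute)
  also have "(\<Sum>i\<le>?n. scal H (a * coeff q i) (orb x (int i))) = scal H a (poly_orb q x)"
    by (subst poly_orb_eq[of q ?n]) (simp_all add: V.scale_sum_right del: sum.atMost_Suc)
  finally have eq: "poly_orb ([:- a, 1:] * q) x =
    (\<Sum>i\<le>degree q. scal H (coeff q i) (orb x (1 + int i))) - scal H a (poly_orb q x)" .
  have "heq H (orb (poly_orb q x) 1) (\<Sum>i\<le>degree q. scal H (coeff q i) (orb x (1 + int i)))"
    unfolding poly_orb_def using x by (rule orb_sum_scal)
  then have "heq H (\<Sum>i\<le>degree q. scal H (coeff q i) (orb x (1 + int i))) (orb (poly_orb q x) 1)"
    by (rule heq_sym[rotated 2]) (use x in auto)
  then show ?thesis unfolding eq using x by (intro heq_diff) auto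
qed

lemma cyc_heq:
  assumes "x \<in> vecs H" "y \<in> vecs H" "heq H x y" shows "cyc x \<subseteq> cyc y"
proof (rule cyc_minimal[OF assms(2)])
  show "x \<in> cyc y"
    using closed_span_heq[OF orb_range_vecs[OF assms(2)] assms(1) orb_in_cyc[OF assms(2), of 0]] assms by simp
qed

text \<open>
  Split the polynomial into linear factors; correlations decay on the whole cyclic space of \<open>x\<close>, so each
  factor can be removed in turn.
\<close>

lemma polynomial_dense:
  assumes x: "x \<in> vecs H" and c: "(\<lambda>k. ip H (orb x (int k)) x) \<longlonglongrightarrow> 0" and p: "p \<noteq> 0"
  shows "x \<in> cyc (poly_orb p x)"
  using p
proof (induction "degree p" arbitrary: p)
  case 0
  then obtain a where a: "p = [:a:]" "a \<noteq> 0" using degree_eq_zeroE by (metis pCons_0_0)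
  have "scal H (inverse a) (poly_orb p x) \<in> cyc (poly_orb p x)"
    using x orb_in_cyc[of "poly_orb p x" 0] by (intro closed_span_scal) auto
  then show ?case using a by (simp add: poly_orb_def)
next
  case (Suc n)
  then have "\<not> constant (poly p)" by (simp add: constant_degree)
  then obtain a where "poly p a = 0" using fundamental_theorem_of_algebra by blast
  then obtain q where q: "p = [:- a, 1:] * q" by (auto simp: poly_eq_0_iff_dvd)
  have "q \<noteq> 0" using Suc q by auto
  then have "degree p = degree [:- a, 1:] + degree q" unfolding q by (intro degree_mult_eq) auto
  then have "x \<in> cyc (poly_orb q x)" using Suc \<open>q \<noteq> 0\<close> by (intro Suc(1)) auto
  let ?w = "poly_orb q x"
  have w: "?w \<in> vecs H" using x by simp
  have "?w \<in> cyc (orb ?w 1 - scal H a ?w)"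
    by (intro linear_factor_dense w correlations_decay[OF x c] poly_orb_in_cyc x)
  moreover have "cyc (orb ?w 1 - scal H a ?w) \<subseteq> cyc (poly_orb p x)"
    unfolding q using w x by (intro cyc_heq heq_sym[OF _ _ poly_orb_linear_factor] vecs_diff vecs_scal orb_vecs poly_orb_vecs)
  ultimately have "cyc ?w \<subseteq> cyc (poly_orb p x)" using x by (intro cyc_minimal) auto
  then show ?case using \<open>x \<in> cyc ?w\<close> by blast
qed

end

section \<open>The space of square integrable functions\<close>

lemma L2_simps [simp]:
  "f \<in> vecs (L2 M) \<longleftrightarrow> f \<in> borel_measurable M \<and> integrable M (\<lambda>x. (cmod (f x))\<^sup>2)"
  "scal (L2 M) c f = (\<lambda>x. c * f x)"
  "ip (L2 M) f g = (LINT x|M. f x * cnj (g x))"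
  by (auto simp: L2_def)

lemma borel_measurable_cnj [measurable]: "f \<in> borel_measurable M \<Longrightarrow> (\<lambda>x. cnj (f x)) \<in> borel_measurable M"
  by (rule measurable_compose[OF _ borel_measurable_continuous_onI[OF continuous_on_cnj[OF continuous_on_id]]])

lemma integrable_mult_cnj:
  assumes "f \<in> vecs (L2 M)" "g \<in> vecs (L2 M)"
  shows "integrable M (\<lambda>x. f x * cnj (g x))"
proof (rule Bochner_Integration.integrable_bound)
  show "integrable M (\<lambda>x. (cmod (f x))\<^sup>2 + (cmod (g x))\<^sup>2)" using assms by auto
  have [measurable]: "f \<in> borel_measurable M" "g \<in> borel_measurable M" using assms by auto
  show "(\<lambda>x. f x * cnj (g x)) \<in> borel_measurable M" by measurable
  have "a * b \<le> a\<^sup>2 + b\<^sup>2" if "0 \<le> a" "0 \<le> b" for a b :: real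
    using sum_squares_bound[of a b] mult_nonneg_nonneg[OF that] by linarith
  then show "AE x in M. norm (f x * cnj (g x)) \<le> norm ((cmod (f x))\<^sup>2 + (cmod (g x))\<^sup>2)"
    by (auto simp: norm_mult)
qed

lemma pre_hilbert_L2: "pre_hilbert (L2 M)"
proof -
  have vs: "vector_space (scal (L2 M))"
    by unfold_locales (auto simp: fun_eq_iff algebra_simps)
  interpret V: vector_space "scal (L2 M)" by fact
  have add: "f + g \<in> vecs (L2 M)" if "f \<in> vecs (L2 M)" "g \<in> vecs (L2 M)" for f g
  proof -
    have [measurable]: "f \<in> borel_measurable M" "g \<in> borel_measurable M" using that by auto
    have "integrable M (\<lambda>x. (cmod (f x + g x))\<^sup>2)"
    proof (rule Bochner_Integration.integrable_bound)
      show "integrable M (\<lambda>x. 2 * (cmod (f x))\<^sup>2 + 2 * (cmod (g x))\<^sup>2)" using that by auto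
      have "(cmod (a + b))\<^sup>2 \<le> 2 * (cmod a)\<^sup>2 + 2 * (cmod b)\<^sup>2" for a b
      proof -
        have "(cmod (a + b))\<^sup>2 \<le> (cmod a + cmod b)\<^sup>2" by (intro power_mono norm_triangle_ineq) auto
        also have "\<dots> \<le> 2 * (cmod a)\<^sup>2 + 2 * (cmod b)\<^sup>2"
          using sum_squares_bound[of "cmod a" "cmod b"] by (simp add: power2_sum)
        finally show ?thesis .
      qed
      then show "AE x in M. norm ((cmod (f x + g x))\<^sup>2) \<le> norm (2 * (cmod (f x))\<^sup>2 + 2 * (cmod (g x))\<^sup>2)"
        by auto
    qed measurable
    then show ?thesis using that by (simp add: plus_fun_def)
  qed
  show ?thesis
  proof (rule pre_hilbert.intro[OF vs])
    show "V.subspace (vecs (L2 M))"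
      unfolding V.subspace_def using add by (auto simp: zero_fun_def norm_mult power_mult_distrib)
  next
    fix f g k assume v: "f \<in> vecs (L2 M)" "g \<in> vecs (L2 M)" "k \<in> vecs (L2 M)"
    show "ip (L2 M) (f + g) k = ip (L2 M) f k + ip (L2 M) g k"
      using integrable_mult_cnj[OF v(1,3)] integrable_mult_cnj[OF v(2,3)]
      by (simp add: distrib_right)
  next
    fix f g c assume v: "f \<in> vecs (L2 M)" "g \<in> vecs (L2 M)"
    show "ip (L2 M) (scal (L2 M) c f) g = c * ip (L2 M) f g" by (simp add: mult.assoc)
    have "ip (L2 M) g f = (LINT x|M. cnj (f x * cnj (g x)))" by (simp add: mult.commute)
    also have "\<dots> = cnj (ip (L2 M) f g)" using integral_bounded_linear[OF bounded_linear_cnj integrable_mult_cnj[OF v]] by (simp only: L2_simps)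
    finally show "ip (L2 M) g f = cnj (ip (L2 M) f g)" .
  next
    fix f assume v: "f \<in> vecs (L2 M)"
    have "ip (L2 M) f f = of_real (LINT x|M. (cmod (f x))\<^sup>2)"
      by (simp add: complex_norm_square[symmetric] flip: of_real_power)
    then show "0 \<le> Re (ip (L2 M) f f)" by simp
  qed
qed

interpretation L2: pre_hilbert "L2 M" for M
  by (rule pre_hilbert_L2)

lemma hnorm_L2_sq: "(hnorm (L2 M) f)\<^sup>2 = (LINT x|M. (cmod (f x))\<^sup>2)"
proof -
  have "ip (L2 M) f f = of_real (LINT x|M. (cmod (f x))\<^sup>2)"
    by (simp add: complex_norm_square[symmetric] flip: of_real_power)
  then show ?thesis by (simp add: hnorm_def)
qed

lemma heq_L2: "(AE x in M. f x = g x) \<Longrightarrow> heq (L2 M) f g"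
proof -
  assume "AE x in M. f x = g x"
  then have "(LINT x|M. (cmod ((f - g) x))\<^sup>2) = 0"
    by (intro integral_eq_zero_AE) auto
  then show ?thesis using hnorm_L2_sq[of M "f - g"] by (simp add: heq_def)
qed

lemma (in finite_measure) bounded_in_L2:
  assumes "f \<in> borel_measurable M" "\<And>x. x \<in> space M \<Longrightarrow> cmod (f x) \<le> B"
  shows "f \<in> vecs (L2 M)"
proof -
  have [measurable]: "f \<in> borel_measurable M" by fact
  have "integrable M (\<lambda>x. (cmod (f x))\<^sup>2)"
  proof (rule integrable_const_bound[where B = "B\<^sup>2"])
    show "AE x in M. norm ((cmod (f x))\<^sup>2) \<le> B\<^sup>2"
      using assms(2) by (auto intro!: power_mono)
  qed measurable
  then show ?thesis using assms by simp
qed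

lemma lincomb_L2: "lincomb (L2 M) b xs x = (\<Sum>(c, i)\<leftarrow>xs. c * b i x)"
  by (induction xs) (auto simp: lincomb_def)

lemma L2_dominated_limit:
  assumes fn: "\<And>n. f n \<in> vecs (L2 M)" and f: "f' \<in> vecs (L2 M)"
    and lim: "AE x in M. (\<lambda>n. f n x) \<longlonglongrightarrow> f' x"
    and w: "w \<in> vecs (L2 M)" and dom: "\<And>n. AE x in M. cmod (f n x) \<le> cmod (w x)"
  shows "(\<lambda>n. hnorm (L2 M) (f n - f')) \<longlonglongrightarrow> 0"
proof -
  have [measurable]: "f n \<in> borel_measurable M" "f' \<in> borel_measurable M" "w \<in> borel_measurable M" for n
    using fn f w by auto
  have "(\<lambda>n. LINT x|M. (cmod ((f n - f') x))\<^sup>2) \<longlonglongrightarrow> (LINT x|M. 0)"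
  proof (rule integral_dominated_convergence[where w = "\<lambda>x. 2 * (cmod (w x))\<^sup>2 + 2 * (cmod (f' x))\<^sup>2"])
    show "integrable M (\<lambda>x. 2 * (cmod (w x))\<^sup>2 + 2 * (cmod (f' x))\<^sup>2)" using w f by auto
    show "AE x in M. (\<lambda>n. (cmod ((f n - f') x))\<^sup>2) \<longlonglongrightarrow> 0"
      using lim
    proof eventually_elim
      case (elim x)
      then have "(\<lambda>n. (cmod (f n x - f' x))\<^sup>2) \<longlonglongrightarrow> (cmod (f' x - f' x))\<^sup>2"
        by (intro tendsto_intros)
      then show ?case by simp
    qed
    fix n
    show "AE x in M. norm ((cmod ((f n - f') x))\<^sup>2) \<le> 2 * (cmod (w x))\<^sup>2 + 2 * (cmod (f' x))\<^sup>2"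
      using dom[of n]
    proof eventually_elim
      case (elim x)
      have "(cmod (f n x - f' x))\<^sup>2 \<le> (cmod (w x) + cmod (f' x))\<^sup>2"
        using elim norm_triangle_ineq4[of "f n x" "f' x"] by (intro power_mono) auto
      also have "\<dots> \<le> 2 * (cmod (w x))\<^sup>2 + 2 * (cmod (f' x))\<^sup>2"
        using sum_squares_bound[of "cmod (w x)" "cmod (f' x)"] by (simp add: power2_sum)
      finally show ?case by simp
    qed
  qed auto
  then have "(\<lambda>n. sqrt (LINT x|M. (cmod ((f n - f') x))\<^sup>2)) \<longlonglongrightarrow> sqrt 0"
    by (intro tendsto_real_sqrt) simp
  moreover have "sqrt (LINT x|M. (cmod ((f n - f') x))\<^sup>2) = hnorm (L2 M) (f n - f')" for n
    unfolding hnorm_L2_sq[symmetric] using L2.hnorm_nonneg[OF L2.vecs_diff[OF fn[of n] f]] by (simp del: minus_apply)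
  ultimately show ?thesis by simp
qed

section \<open>Trigonometric polynomials and spectral measures\<close>

definition trig_poly :: "(complex \<times> int) list \<Rightarrow> complex \<Rightarrow> complex" where
  "trig_poly xs z = (\<Sum>(c, k)\<leftarrow>xs. c * z powi k)"

lemma trig_poly_simps [simp]:
  "trig_poly [] z = 0"
  "trig_poly ((c, k) # xs) z = c * z powi k + trig_poly xs z"
  "trig_poly (xs @ ys) z = trig_poly xs z + trig_poly ys z"
  by (auto simp: trig_poly_def)

lemma trig_poly_product:
  assumes "z \<noteq> 0"
  shows "trig_poly (concat (map (\<lambda>(c, k). map (\<lambda>(d, l). (c * d, k + l)) ys) xs)) z = trig_poly xs z * trig_poly ys z"
proof (induction xs)
  case (Cons p xs)
  obtain c k where p: "p = (c, k)" by (cases p)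
  have "trig_poly (map (\<lambda>(d, l). (c * d, k + l)) ys) z = c * z powi k * trig_poly ys z"
    using assms by (induction ys) (auto simp: power_int_add algebra_simps)
  then show ?case using Cons p by (simp add: distrib_right)
qed simp

text \<open>
  On the circle \<open>cnj z\<close> is the power \<open>z powi -1\<close>, so the real linear functions, from which polynomial
  functions are built, are trigonometric polynomials.
\<close>

lemma real_polynomial_is_trig_poly:
  assumes "real_polynomial_function (g :: complex \<Rightarrow> real)"
  shows "\<exists>xs. \<forall>z\<in>sphere 0 1. trig_poly xs z = of_real (g z)"
  using assms
proof induction
  case (linear f)
  have "of_real (f z) = trig_poly [((of_real (f 1) - \<i> * of_real (f \<i>)) / 2, 1), ((of_real (f 1) + \<i> * of_real (f \<i>)) / 2, -1)] z"
    if "z \<in> sphere 0 1" for z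
  proof -
    interpret f: bounded_linear f by fact
    have "f z = f (Re z *\<^sub>R 1 + Im z *\<^sub>R \<i>)" by (rule arg_cong[where f = f]) (simp add: complex_eq_iff)
    also have "\<dots> = Re z * f 1 + Im z * f \<i>" by (simp only: f.add f.scaleR real_scaleR_def)
    finally have "f z = Re z * f 1 + Im z * f \<i>" .
    moreover have "inverse z = cnj z" using that by (simp add: inverse_complex_def complex_eq_iff cmod_def)
    moreover have "(of_real a - \<i> * of_real b) / 2 * z + (of_real a + \<i> * of_real b) / 2 * cnj z = of_real (Re z * a + Im z * b)" for a b
      by (rule complex_eqI) (simp_all add: field_simps)
    ultimately show ?thesis by (simp add: power_int_minus)
  qed
  then show ?case by metis
next
  case (const c)
  show ?case by (rule exI[of _ "[(of_real c, 0)]"]) simp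
next
  case (add f g)
  then obtain xs ys where "\<forall>z\<in>sphere 0 1. trig_poly xs z = of_real (f z)" "\<forall>z\<in>sphere 0 1. trig_poly ys z = of_real (g z)"
    by blast
  then show ?case by (intro exI[of _ "xs @ ys"]) simp
next
  case (mult f g)
  then obtain xs ys where xs: "\<forall>z\<in>sphere 0 1. trig_poly xs z = of_real (f z)" "\<forall>z\<in>sphere 0 1. trig_poly ys z = of_real (g z)"
    by blast
  have "trig_poly (concat (map (\<lambda>(c, k). map (\<lambda>(d, l). (c * d, k + l)) ys) xs)) z = of_real (f z * g z)"
    if "z \<in> sphere 0 1" for z
  proof -
    have "z \<noteq> 0" using that by auto
    then show ?thesis using xs that by (simp add: trig_poly_product)
  qed
  then show ?case by blast
qed

lemma trig_poly_dense:
  assumes "continuous_on (sphere 0 1) (f :: complex \<Rightarrow> real)" "0 < e"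
  obtains xs where "\<And>z. z \<in> sphere 0 1 \<Longrightarrow> cmod (trig_poly xs z - of_real (f z)) < e"
proof -
  obtain g where g: "real_polynomial_function g" "\<And>z. z \<in> sphere 0 1 \<Longrightarrow> \<bar>f z - g z\<bar> < e"
    using Stone_Weierstrass_real_polynomial_function[OF compact_sphere assms] by metis
  obtain xs where xs: "\<forall>z\<in>sphere 0 1. trig_poly xs z = of_real (g z)"
    using real_polynomial_is_trig_poly[OF g(1)] by blast
  have "cmod (trig_poly xs z - of_real (f z)) < e" if "z \<in> sphere 0 1" for z
    using g(2)[OF that] xs that by (simp add: norm_minus_commute flip: of_real_diff)
  then show thesis by (rule that)
qed

lemma has_vector_derivative_cis_multiple:
  assumes "n \<noteq> 0"
  shows "((\<lambda>x. cis (of_int n * x) / (\<i> * of_int n)) has_vector_derivative cis (of_int n * x)) (at x within S)"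
proof -
  have "((\<lambda>x. of_int n * x) has_vector_derivative of_int n) (at x within S)"
    by (auto intro!: derivative_eq_intros simp: has_vector_derivative_def)
  moreover have "(cis has_vector_derivative \<i> * cis y) (at y within T)" for y T
    using has_derivative_cis[of "\<lambda>x. x" "\<lambda>x. x" y T] by (simp add: has_vector_derivative_def)
  ultimately have "((\<lambda>x. cis (of_int n * x)) has_vector_derivative (of_int n *\<^sub>R (\<i> * cis (of_int n * x)))) (at x within S)"
    using vector_diff_chain_within[of "\<lambda>x. of_int n * x" "of_int n" x S cis] by (simp add: comp_def)
  then have "((\<lambda>x. cis (of_int n * x) * (1 / (\<i> * of_int n))) has_vector_derivative (of_int n *\<^sub>R (\<i> * cis (of_int n * x))) * (1 / (\<i> * of_int n))) (at x within S)"
    by (rule has_vector_derivative_mult_left)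
  then show ?thesis using assms by (simp add: scaleR_conv_of_real)
qed

lemma integral_cis_period:
  "has_bochner_integral lborel (\<lambda>\<theta>. indicator {0..2*pi} \<theta> *\<^sub>R cis (of_int n * \<theta>)) (if n = 0 then 2 * pi else 0)"
proof (cases "n = 0")
  case True
  have "has_bochner_integral lborel (indicator {0..2*pi} :: real \<Rightarrow> real) (measure lborel {0..2*pi})"
    by (rule has_bochner_integral_real_indicator) auto
  then have "has_bochner_integral lborel (\<lambda>x. indicator {0..2*pi} x *\<^sub>R (1::complex)) ((2 * pi) *\<^sub>R 1)"
    by (intro has_bochner_integral_scaleR_left) simp
  then show ?thesis using True by (simp add: scaleR_conv_of_real)
next
  case False
  have "has_bochner_integral lborel (\<lambda>x. indicator {0..2*pi} x *\<^sub>R cis (of_int n * x))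
      (cis (of_int n * (2*pi)) / (\<i> * of_int n) - cis (of_int n * 0) / (\<i> * of_int n))"
  proof (rule has_bochner_integral_FTC_Icc)
    fix x :: real
    show "((\<lambda>x. cis (of_int n * x) / (\<i> * of_int n)) has_vector_derivative cis (of_int n * x)) (at x within {0..2*pi})"
      using False by (rule has_vector_derivative_cis_multiple)
  qed (auto intro!: continuous_intros)
  moreover have "cis (of_int n * (2*pi)) = 1" using cis_multiple_2pi[of "of_int n"] by (simp add: mult_ac)
  ultimately show ?thesis using False by simp
qed

lemma cis_powi: "cis x powi n = cis (of_int n * x)"
  by (cases n rule: int_cases4) (simp_all add: power_int_minus Complex.DeMoivre cis_inverse)

lemma card_fixed_difference:
  "(\<Sum>k<N. \<Sum>l<N. if int k - int l = m then 1 else 0 :: real) = (if \<bar>m\<bar> \<le> int N then real N - \<bar>real_of_int m\<bar> else 0)"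
proof -
  have "(\<Sum>l<N. if int k - int l = m then 1 else 0 :: real) = (if 0 \<le> int k - m \<and> int k - m < int N then 1 else 0)" for k
  proof -
    have "(\<Sum>l<N. if int k - int l = m then 1 else 0 :: real) = (\<Sum>l<N. if l = nat (int k - m) then (if 0 \<le> int k - m then 1 else 0) else 0)"
      by (intro sum.cong) auto
    then show ?thesis by auto
  qed
  then have "(\<Sum>k<N. \<Sum>l<N. if int k - int l = m then 1 else 0 :: real) = real (card {k. k < N \<and> 0 \<le> int k - m \<and> int k - m < int N})"
    by (simp add: sum.If_cases Collect_conj_eq lessThan_def)
  also have "{k. k < N \<and> 0 \<le> int k - m \<and> int k - m < int N} = (if m \<ge> 0 then {nat m..<N} else {0..<nat (int N + m)})"
    by auto
  also have "real (card \<dots>) = (if \<bar>m\<bar> \<le> int N then real N - \<bar>real_of_int m\<bar> else 0)"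
    by auto
  finally show ?thesis .
qed

text \<open>
  The Fejer sums of a positive definite sequence are nonnegative. Divided by \<open>N\<close> they are densities on
  \<open>{0..2*pi}\<close> with Fourier coefficients \<open>c m * (1 - \<bar>m\<bar> / N)\<close>. The selection theorem provides a weak limit
  on the line, whose image under \<open>cis\<close> is the measure sought. The condition \<open>c 0 \<noteq> 0\<close> allows
  normalisation to probability measures.
\<close>

theorem herglotz:
  fixes c :: "int \<Rightarrow> complex"
  assumes pd: "\<And>N \<theta>. \<exists>t\<ge>0. (\<Sum>k<N. \<Sum>l<N. c (int k - int l) * cis (- of_int (int k - int l) * \<theta>)) = of_real t"
    and c0: "c 0 \<noteq> 0"
  obtains \<sigma> where "circle_measure \<sigma>" "\<And>n. (LINT z|\<sigma>. z powi n) = c n"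
proof -
  define g where "g N \<theta> = Re (\<Sum>k<N. \<Sum>l<N. c (int k - int l) * cis (- of_int (int k - int l) * \<theta>))" for N \<theta>
  have g0: "0 \<le> g N \<theta>" and gc: "of_real (g N \<theta>) = (\<Sum>k<N. \<Sum>l<N. c (int k - int l) * cis (- of_int (int k - int l) * \<theta>))" for N \<theta>
  proof -
    obtain t where t: "t \<ge> 0" "(\<Sum>k<N. \<Sum>l<N. c (int k - int l) * cis (- of_int (int k - int l) * \<theta>)) = of_real t"
      using pd by blast
    show "0 \<le> g N \<theta>" "of_real (g N \<theta>) = (\<Sum>k<N. \<Sum>l<N. c (int k - int l) * cis (- of_int (int k - int l) * \<theta>))"
      unfolding g_def t(2) using t(1) by simp_all
  qed
  define a where "a = Re (c 0)"
  obtain t where "t \<ge> 0" "c 0 = of_real t" using pd[where N = 1 and \<theta> = 0] by auto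
  then have a: "c 0 = of_real a" "a > 0" using c0 by (auto simp: a_def)
  have [measurable]: "g N \<in> borel_measurable borel" for N
    unfolding g_def by (intro borel_measurable_continuous_onI continuous_intros)
  have gm: "has_bochner_integral lborel (\<lambda>\<theta>. indicator {0..2*pi} \<theta> *\<^sub>R (cis (of_int m * \<theta>) * of_real (g N \<theta>)))
      (2 * pi * c m * (if \<bar>m\<bar> \<le> int N then real N - \<bar>real_of_int m\<bar> else 0))" for N m
  proof -
    have "has_bochner_integral lborel (\<lambda>\<theta>. \<Sum>k<N. \<Sum>l<N. c (int k - int l) * (indicator {0..2*pi} \<theta> *\<^sub>R cis (of_int (m - (int k - int l)) * \<theta>)))
        (\<Sum>k<N. \<Sum>l<N. c (int k - int l) * (if m - (int k - int l) = 0 then 2 * pi else 0))"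
      by (intro has_bochner_integral_sum has_bochner_integral_mult_right integral_cis_period)
    also have "(\<lambda>\<theta>. \<Sum>k<N. \<Sum>l<N. c (int k - int l) * (indicator {0..2*pi} \<theta> *\<^sub>R cis (of_int (m - (int k - int l)) * \<theta>))) =
      (\<lambda>\<theta>. indicator {0..2*pi} \<theta> *\<^sub>R (cis (of_int m * \<theta>) * of_real (g N \<theta>)))"
      unfolding gc by (auto simp: fun_eq_iff sum_distrib_left scaleR_sum_right cis_mult algebra_simps intro!: sum.cong)
    also have "(\<Sum>k<N. \<Sum>l<N. c (int k - int l) * (if m - (int k - int l) = 0 then 2 * pi else 0)) =
      2 * pi * c m * of_real (\<Sum>k<N. \<Sum>l<N. if int k - int l = m then 1 else 0 :: real)"
      by (auto simp: sum_distrib_left intro!: sum.cong)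
    finally show ?thesis unfolding card_fixed_difference by (simp add: if_distrib)
  qed
  define \<mu> where "\<mu> N = density lborel (\<lambda>\<theta>. ennreal (indicator {0..2*pi} \<theta> * g (Suc N) \<theta> / (2 * pi * a * real (Suc N))))" for N
  have dens: "(LINT \<theta>|\<mu> N. cis (of_int m * \<theta>)) = c m / a * (if \<bar>m\<bar> \<le> int (Suc N) then 1 - \<bar>real_of_int m\<bar> / real (Suc N) else 0)" for N m
  proof -
    have "(LINT \<theta>|\<mu> N. cis (of_int m * \<theta>)) =
      (LINT \<theta>|lborel. (indicator {0..2*pi} \<theta> * g (Suc N) \<theta> / (2 * pi * a * real (Suc N))) *\<^sub>R cis (of_int m * \<theta>))"
      unfolding \<mu>_def by (rule integral_density) (use a g0 in \<open>auto intro!: borel_measurable_continuous_onI continuous_intros\<close>)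
    also have "\<dots> = (LINT \<theta>|lborel. (1 / (2 * pi * a * real (Suc N))) *\<^sub>R (indicator {0..2*pi} \<theta> *\<^sub>R (cis (of_int m * \<theta>) * of_real (g (Suc N) \<theta>))))"
      by (intro Bochner_Integration.integral_cong) (auto simp: scaleR_conv_of_real)
    also have "\<dots> = (1 / (2 * pi * a * real (Suc N))) *\<^sub>R (2 * pi * c m * (if \<bar>m\<bar> \<le> int (Suc N) then real (Suc N) - \<bar>real_of_int m\<bar> else 0))"
      by (subst integral_scaleR_right) (simp only: has_bochner_integral_integral_eq[OF gm])
    also have "\<dots> = c m / a * (if \<bar>m\<bar> \<le> int (Suc N) then 1 - \<bar>real_of_int m\<bar> / real (Suc N) else 0)"
      using a by (simp add: scaleR_conv_of_real field_simps del: of_nat_Suc)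
    finally show ?thesis .
  qed
  have em: "emeasure (\<mu> N) B = 1" if B: "B \<in> sets borel" "{0..2*pi} \<subseteq> B" for N B
  proof -
    have "emeasure (\<mu> N) B = (\<integral>\<^sup>+\<theta>. ennreal (indicator {0..2*pi} \<theta> * g (Suc N) \<theta> / (2 * pi * a * real (Suc N))) * indicator B \<theta> \<partial>lborel)"
      unfolding \<mu>_def using B by (subst emeasure_density) auto
    also have "\<dots> = (\<integral>\<^sup>+\<theta>. ennreal (1 / (2 * pi * a * real (Suc N)) * (indicator {0..2*pi} \<theta> * g (Suc N) \<theta>)) \<partial>lborel)"
      using B by (intro nn_integral_cong) (auto simp: indicator_def)
    also have "\<dots> = ennreal (LINT \<theta>|lborel. 1 / (2 * pi * a * real (Suc N)) * (indicator {0..2*pi} \<theta> * g (Suc N) \<theta>))"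
    proof (rule nn_integral_eq_integral)
      have "integrable lborel (\<lambda>\<theta>. Re (indicator {0..2*pi} \<theta> *\<^sub>R (cis (of_int 0 * \<theta>) * of_real (g (Suc N) \<theta>))))"
        using gm[of 0 "Suc N"] by (intro integrable_Re) (auto simp: has_bochner_integral_iff)
      then show "integrable lborel (\<lambda>\<theta>. 1 / (2 * pi * a * real (Suc N)) * (indicator {0..2*pi} \<theta> * g (Suc N) \<theta>))"
        by (intro integrable_mult_right) simp
    qed (use a g0 in auto)
    also have "(LINT \<theta>|lborel. 1 / (2 * pi * a * real (Suc N)) * (indicator {0..2*pi} \<theta> * g (Suc N) \<theta>)) = 1"
    proof -
      have "has_bochner_integral lborel (\<lambda>\<theta>. Re (indicator {0..2*pi} \<theta> *\<^sub>R (cis (of_int 0 * \<theta>) * of_real (g (Suc N) \<theta>)))) (Re (2 * pi * c 0 * real (Suc N)))"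
        using gm[of 0 "Suc N"] by (intro has_bochner_integral_bounded_linear[OF bounded_linear_Re]) simp
      then have "(LINT \<theta>|lborel. indicator {0..2*pi} \<theta> * g (Suc N) \<theta>) = 2 * pi * a * real (Suc N)"
        using a by (auto dest!: has_bochner_integral_integral_eq)
      then show ?thesis using a by simp
    qed
    finally show ?thesis by simp
  qed
  have rd: "real_distribution (\<mu> N)" for N
  proof -
    have "emeasure (\<mu> N) (space (\<mu> N)) = 1" using em[of UNIV N] by (simp add: \<mu>_def)
    then interpret prob_space "\<mu> N" by (rule prob_spaceI)
    show ?thesis by unfold_locales (simp add: \<mu>_def)
  qed
  have "tight \<mu>"
    unfolding tight_def
  proof (intro conjI allI impI rd)
    fix e :: real assume "e > 0"
    have "measure (\<mu> n) {- 1<..2*pi} = 1" for n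
    proof -
      have "{0..2*pi} \<subseteq> {- 1<..2*pi}" by auto
      then have "emeasure (\<mu> n) {- 1<..2*pi} = 1" by (intro em) auto
      then show ?thesis by (simp add: Sigma_Algebra.measure_def)
    qed
    then show "\<exists>a b. a < b \<and> (\<forall>n. 1 - e < measure (\<mu> n) {a<..b})"
      using \<open>e > 0\<close> by (intro exI[of _ "-1"] exI[of _ "2*pi"]) (auto intro: less_trans[of _ 0])
  qed
  then obtain s M where s: "strict_mono (s :: nat \<Rightarrow> nat)" and M: "real_distribution M" and wc: "weak_conv_m (\<mu> \<circ> id \<circ> s) M"
    using tight_imp_convergent_subsubsequence[of \<mu> id] strict_mono_id by (auto simp: id_def strict_mono_def)
  interpret M: real_distribution M by fact
  have lim: "(LINT \<theta>|M. cis (of_int m * \<theta>)) = c m / a" for m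
  proof (rule LIMSEQ_unique)
    have "continuous_on UNIV (\<lambda>\<theta>::real. cis (of_int m * \<theta>))" by (intro continuous_intros)
    then show "(\<lambda>n. LINT \<theta>|(\<mu> \<circ> id \<circ> s) n. cis (of_int m * \<theta>)) \<longlonglongrightarrow> (LINT \<theta>|M. cis (of_int m * \<theta>))"
      by (intro weak_conv_imp_integral_bdd_continuous_conv[OF _ M wc, where B = 1])
        (auto intro!: rd simp: continuous_on_eq_continuous_at)
    have "(\<lambda>N. LINT \<theta>|\<mu> N. cis (of_int m * \<theta>)) \<longlonglongrightarrow> c m / a * of_real 1"
    proof -
      have "(\<lambda>N. 1 - \<bar>real_of_int m\<bar> / real (Suc N)) \<longlonglongrightarrow> 1 - 0"
        by (intro tendsto_diff tendsto_const LIMSEQ_Suc[OF lim_const_over_n])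
      moreover have "\<forall>\<^sub>F N in sequentially. 1 - \<bar>real_of_int m\<bar> / real (Suc N) = (if \<bar>m\<bar> \<le> int (Suc N) then 1 - \<bar>real_of_int m\<bar> / real (Suc N) else 0)"
        using eventually_ge_at_top[of "nat \<bar>m\<bar>"] by eventually_elim auto
      ultimately have "(\<lambda>N. (if \<bar>m\<bar> \<le> int (Suc N) then 1 - \<bar>real_of_int m\<bar> / real (Suc N) else 0)) \<longlonglongrightarrow> 1"
        by (simp add: tendsto_cong)
      then show ?thesis unfolding dens by (intro tendsto_intros)
    qed
    then show "(\<lambda>n. LINT \<theta>|(\<mu> \<circ> id \<circ> s) n. cis (of_int m * \<theta>)) \<longlonglongrightarrow> c m / a"
      using LIMSEQ_subseq_LIMSEQ[OF _ s] by (fastforce simp: comp_def)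
  qed
  define \<sigma> where "\<sigma> = distr (density M (\<lambda>_. ennreal a)) circle cis"
  have cis_b: "cis \<in> borel_measurable borel"
    using continuous_on_cis[OF continuous_on_id] by (intro borel_measurable_continuous_onI) simp
  have cis_m: "cis \<in> measurable (density M (\<lambda>_. ennreal a)) circle"
    using cis_b by (intro measurable_restrict_space2) (auto cong: measurable_cong_sets)
  have "circle_measure \<sigma>"
    unfolding circle_measure_def
  proof
    have "emeasure M UNIV = 1" using M.emeasure_space_1 by simp
    then have "emeasure (density M (\<lambda>_. ennreal a)) (space M) < \<infinity>"
      by (subst emeasure_density) (auto simp: M.emeasure_space_1 ennreal_mult_less_top nn_integral_cmult)
    then have "finite_measure (density M (\<lambda>_. ennreal a))" by (intro finite_measureI) simp
    then show "finite_measure \<sigma>" unfolding \<sigma>_def by (rule finite_measure.finite_measure_distr[OF _ cis_m])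
    show "sets \<sigma> = sets circle" by (simp add: \<sigma>_def)
  qed
  moreover have "(LINT z|\<sigma>. z powi n) = c n" for n
  proof -
    have "(LINT z|\<sigma>. z powi n) = (LINT \<theta>|density M (\<lambda>_. ennreal a). cis \<theta> powi n)"
      unfolding \<sigma>_def
      by (rule integral_distr[OF cis_m]) (auto intro!: borel_measurable_continuous_on_restrict continuous_intros simp: power_int_not_zero)
    also have "\<dots> = (LINT \<theta>|M. a *\<^sub>R (cis \<theta> powi n))"
    proof (rule integral_density)
      have "(\<lambda>\<theta>. cis (of_int n * \<theta>)) \<in> borel_measurable borel"
        by (intro borel_measurable_continuous_onI continuous_intros)
      then show "(\<lambda>\<theta>. cis \<theta> powi n) \<in> borel_measurable M"
        by (simp add: cis_powi cong: measurable_cong_sets)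
    qed (use a in auto)
    also have "\<dots> = a *\<^sub>R (c n / a)" by (simp add: cis_powi lim)
    also have "\<dots> = c n" using a by (simp add: scaleR_conv_of_real)
    finally show ?thesis .
  qed
  ultimately show thesis by (rule that)
qed

section \<open>Cyclic vectors and the maximal spectral type\<close>

lemma circle_measureD:
  assumes "circle_measure \<sigma>"
  shows "finite_measure \<sigma>" "sets \<sigma> = sets circle" "space \<sigma> = sphere 0 1"
  using assms sets_eq_imp_space_eq[of \<sigma> circle] by (auto simp: circle_measure_def space_restrict_space)

lemma measurable_powi_circle: 
  assumes "circle_measure \<sigma>" shows "(\<lambda>z. z powi k) \<in> borel_measurable \<sigma>"
proof -
  have "(\<lambda>z::complex. z powi k) \<in> borel_measurable circle"
    by (intro borel_measurable_continuous_on_restrict continuous_intros) auto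
  then show ?thesis using circle_measureD(2)[OF assms] by (simp cong: measurable_cong_sets)
qed

lemma norm_powi_circle: "z \<in> sphere 0 1 \<Longrightarrow> cmod (z powi k) = 1"
  by (simp add: norm_power_int)

lemma powi_cnj_circle: 
  assumes "z \<in> sphere 0 1" shows "z powi a * cnj (z powi b) = z powi (a - b)"
proof -
  have z: "z \<noteq> 0" using assms by auto
  have "cnj z = inverse z" using assms by (simp add: inverse_complex_def complex_eq_iff cmod_def)
  then show ?thesis using z by (simp add: power_int_diff power_int_inverse divide_inverse)
qed

lemma powi_in_L2: 
  assumes "circle_measure \<sigma>" shows "(\<lambda>z. z powi k) \<in> vecs (L2 \<sigma>)"
  using circle_measureD[OF assms] measurable_powi_circle[OF assms]
  by (intro finite_measure.bounded_in_L2[where B = 1]) (auto simp: norm_powi_circle)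

lemma trig_poly_measurable: 
  assumes "circle_measure \<sigma>" shows "trig_poly xs \<in> borel_measurable \<sigma>"
proof (induction xs)
  case Nil
  have "trig_poly [] = (\<lambda>z. 0)" by (rule ext) simp
  then show ?case by simp
next
  case (Cons p xs)
  obtain c k where "p = (c, k)" by (cases p)
  then have "trig_poly (p # xs) = (\<lambda>z. c * z powi k + trig_poly xs z)" by (intro ext) simp
  then show ?case using Cons measurable_powi_circle[OF assms] by simp
qed

lemma lincomb_powi: "lincomb (L2 M) (\<lambda>k z. z powi k) xs = trig_poly xs"
  by (rule ext) (simp add: lincomb_L2 trig_poly_def)

lemma ip_powi:
  assumes "circle_measure \<sigma>"
  shows "ip (L2 \<sigma>) (\<lambda>z. z powi a) (\<lambda>z. z powi b) = (LINT z|\<sigma>. z powi (a - b))"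
  unfolding L2_simps
  by (rule Bochner_Integration.integral_cong[OF refl]) (rule powi_cnj_circle, simp only: circle_measureD(3)[OF assms])

context unitary_pre
begin

lemma spectral_gram:
  assumes x: "x \<in> vecs H" and \<rho>: "spectral_measure H U x \<rho>"
  shows "gram_pair H (L2 \<rho>) (orb x) (\<lambda>k z. z powi k)"
proof -
  have c: "circle_measure \<rho>" and i: "\<And>n. (LINT z|\<rho>. z powi n) = ip H (orb x n) x"
    using \<rho> by (auto simp: spectral_measure_def)
  show ?thesis
  proof (intro gram_pair.intro gram_pair_axioms.intro pre_hilbert_axioms pre_hilbert_L2)
    show "orb x i \<in> vecs H" for i using x by simp
    show "(\<lambda>z. z powi i) \<in> vecs (L2 \<rho>)" for i by (rule powi_in_L2[OF c])
    show "ip H (orb x i) (orb x j) = ip (L2 \<rho>) (\<lambda>z. z powi i) (\<lambda>z. z powi j)" for i j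
      unfolding ip_powi[OF c] i by (rule orb_ip[OF x x])
  qed
qed

lemma spectral_norm:
  assumes "x \<in> vecs H" "spectral_measure H U x \<rho>"
  shows "(hnorm H (lincomb H (orb x) xs))\<^sup>2 = (LINT z|\<rho>. (cmod (trig_poly xs z))\<^sup>2)"
proof -
  interpret gram_pair H "L2 \<rho>" "orb x" "\<lambda>k z. z powi k" by (rule spectral_gram[OF assms])
  show ?thesis unfolding lincomb_norm hnorm_L2_sq lincomb_powi ..
qed

lemma spectral_ip:
  assumes "x \<in> vecs H" "spectral_measure H U x \<rho>"
  shows "ip H (lincomb H (orb x) xs) x = (LINT z|\<rho>. trig_poly xs z)"
proof -
  interpret gram_pair H "L2 \<rho>" "orb x" "\<lambda>k z. z powi k" by (rule spectral_gram[OF assms])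
  show ?thesis using lincomb_gram[of xs "[(1, 0)]"]
    by (simp add: lincomb_powi)
qed

text \<open>
  The Fejer sums of the correlations are the squared norms of the vectors obtained by summing
  \<open>cis (- k \<theta>) U^k x\<close> over \<open>k < N\<close>.
\<close>

lemma spectral_measure_exists:
  assumes x: "x \<in> vecs H" and x0: "ip H x x \<noteq> 0"
  obtains \<sigma> where "spectral_measure H U x \<sigma>"
proof (rule herglotz[of "\<lambda>n. ip H (orb x n) x"])
  fix N \<theta>
  define z where "z = (\<Sum>k<N. scal H (cis (- of_int (int k) * \<theta>)) (orb x (int k)))"
  have zv: "z \<in> vecs H" using x by (auto simp: z_def)
  have "ip H z z = (\<Sum>k<N. \<Sum>l<N. ip H (orb x (int l - int k)) x * (cis (- of_int (int l) * \<theta>) * cnj (cis (- of_int (int k) * \<theta>))))"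
    unfolding z_def using x
    by (simp add: ip_sum ip_sum_right vecs_sum ip_scal ip_scal_right sum_distrib_left orb_ip mult_ac)
  also have "\<dots> = (\<Sum>l<N. \<Sum>k<N. ip H (orb x (int l - int k)) x * (cis (- of_int (int l) * \<theta>) * cnj (cis (- of_int (int k) * \<theta>))))"
    by (rule sum.swap)
  also have "\<dots> = (\<Sum>k<N. \<Sum>l<N. ip H (orb x (int k - int l)) x * cis (- of_int (int k - int l) * \<theta>))"
    by (intro sum.cong refl arg_cong2[where f = "(*)"]) (simp add: cis_cnj cis_mult algebra_simps)
  finally show "\<exists>t\<ge>0. (\<Sum>k<N. \<Sum>l<N. ip H (orb x (int k - int l)) x * cis (- of_int (int k - int l) * \<theta>)) = of_real t"
    using ip_self[OF zv] by (intro exI[of _ "(hnorm H z)\<^sup>2"]) simp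
next
  show "ip H (orb x 0) x \<noteq> 0" using x0 by simp
next
  fix \<sigma> assume "circle_measure \<sigma>" "\<And>n. (LINT z|\<sigma>. z powi n) = ip H (orb x n) x"
  then show thesis by (intro that[of \<sigma>]) (simp add: spectral_measure_def)
qed

text \<open>
  A compact set \<open>K\<close> that is null for the spectral measure of the cyclic vector \<open>f\<close> is null for that
  of \<open>x\<close>: take trigonometric polynomials \<open>p\<close> close to the indicator of \<open>K\<close>. Then \<open>p(U) x\<close> is bounded
  and asymptotically orthogonal to every \<open>orb f k\<close>, because \<open>p(U) f\<close> is small; by
  cyclicity its inner product with \<open>x\<close> tends to \<open>0\<close>, but this inner product tends to the mass of \<open>K\<close>.
\<close>

lemma spectral_ac:
  assumes f: "f \<in> vecs H" "cyc f = vecs H" and \<sigma>: "spectral_measure H U f \<sigma>"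
    and x: "x \<in> vecs H" and \<rho>: "spectral_measure H U x \<rho>"
  shows "absolutely_continuous \<sigma> \<rho>"
proof -
  have c: "circle_measure \<sigma>" "circle_measure \<rho>" using \<sigma> \<rho> by (auto simp: spectral_measure_def)
  interpret \<sigma>: finite_measure \<sigma> using circle_measureD[OF c(1)] by simp
  interpret \<rho>: finite_measure \<rho> using circle_measureD[OF c(2)] by simp
  note sp = circle_measureD(3)[OF c(1)] circle_measureD(3)[OF c(2)]
  note se = circle_measureD(2)[OF c(1)] circle_measureD(2)[OF c(2)]
  have sets_iff: "B \<in> sets circle \<longleftrightarrow> B \<subseteq> sphere 0 1 \<and> B \<in> sets borel" for B :: "complex set"
    by (subst sets_restrict_space_iff) auto
  have compact_null: "measure \<rho> K = 0" if K: "compact K" "K \<subseteq> sphere 0 1" and K0: "emeasure \<sigma> K = 0" for K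
  proof (cases "K = {}")
    case False
    have Kb: "K \<in> sets circle" using K by (auto simp: sets_iff compact_imp_closed)
    \<comment> \<open>continuous functions decreasing to the indicator of \<open>K\<close>\<close>
    define \<phi> where "\<phi> n z = max 0 (1 - real n * infdist z K)" for n z
    have "continuous_on (sphere 0 1) (\<phi> n)" for n
      unfolding \<phi>_def by (intro continuous_intros)
    then have "\<exists>xs. \<forall>z\<in>sphere 0 1. cmod (trig_poly xs z - of_real (\<phi> n z)) < 1 / real (Suc n)" for n
      using trig_poly_dense[of "\<phi> n" "1 / real (Suc n)"] by (metis zero_less_divide_1_iff of_nat_0_less_iff zero_less_Suc)
    then obtain p where p: "\<And>n z. z \<in> sphere 0 1 \<Longrightarrow> cmod (trig_poly (p n) z - of_real (\<phi> n z)) < 1 / real (Suc n)"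
      by metis
    have bound: "cmod (trig_poly (p n) z) \<le> 2" if "z \<in> sphere 0 1" for n z
    proof -
      have "cmod (complex_of_real (\<phi> n z)) \<le> 1" by (simp add: \<phi>_def infdist_nonneg)
      moreover have "1 / real (Suc n) \<le> 1" by simp
      ultimately show ?thesis
        using p[OF that, of n] norm_triangle_sub[of "trig_poly (p n) z" "of_real (\<phi> n z)"] by linarith
    qed
    have \<phi>lim: "(\<lambda>n. \<phi> n z) \<longlonglongrightarrow> indicator K z" for z
    proof (cases "z \<in> K")
      case True then show ?thesis by (simp add: \<phi>_def)
    next
      case notin: False
      then have d: "infdist z K > 0"
        using K False in_closed_iff_infdist_zero[OF compact_imp_closed] infdist_nonneg[of z K] by force
      have "\<forall>\<^sub>F n in sequentially. 1 / infdist z K \<le> real n"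
        using filterlim_real_sequentially by (simp add: filterlim_at_top)
      then have "\<forall>\<^sub>F n in sequentially. \<phi> n z = 0"
      proof eventually_elim
        case (elim n) then show ?case using d by (simp add: \<phi>_def field_simps)
      qed
      then show ?thesis using notin by (simp add: tendsto_eventually)
    qed
    have plim: "(\<lambda>n. trig_poly (p n) z) \<longlonglongrightarrow> of_real (indicator K z)" if "z \<in> sphere 0 1" for z
    proof -
      have "(\<lambda>n. trig_poly (p n) z - of_real (\<phi> n z)) \<longlonglongrightarrow> 0"
      proof (rule Lim_null_comparison)
        show "\<forall>\<^sub>F n in sequentially. cmod (trig_poly (p n) z - of_real (\<phi> n z)) \<le> 1 / real (Suc n)"
          using p[OF that] by (auto intro: always_eventually less_imp_le)
        show "(\<lambda>n. 1 / real (Suc n)) \<longlonglongrightarrow> 0" using LIMSEQ_Suc[OF lim_const_over_n[of 1]] .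
      qed
      then have "(\<lambda>n. (trig_poly (p n) z - of_real (\<phi> n z)) + of_real (\<phi> n z)) \<longlonglongrightarrow> 0 + of_real (indicator K z)"
        by (intro tendsto_add tendsto_of_real \<phi>lim)
      then show ?thesis by simp
    qed
    note meas = trig_poly_measurable[OF c(1)] trig_poly_measurable[OF c(2)]
    define y where "y n = lincomb H (orb x) (p n)" for n
    have yv: "y n \<in> vecs H" for n using x by (auto simp: y_def)
    define B where "B = sqrt (4 * measure \<rho> (space \<rho>)) + 1"
    have B: "hnorm H (y n) \<le> B" "B > 0" for n
    proof -
      have "(hnorm H (y n))\<^sup>2 = (LINT z|\<rho>. (cmod (trig_poly (p n) z))\<^sup>2)"
        unfolding y_def by (rule spectral_norm[OF x \<rho>])
      also have "\<dots> \<le> (LINT z|\<rho>. 4)"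
      proof (rule integral_mono)
        show "integrable \<rho> (\<lambda>z. (cmod (trig_poly (p n) z))\<^sup>2)"
          using \<rho>.bounded_in_L2[OF meas(2) bound] sp by simp
        show "(cmod (trig_poly (p n) z))\<^sup>2 \<le> 4" if "z \<in> space \<rho>" for z
          using power_mono[OF bound[of z n], of 2] that sp by simp
      qed simp
      also have "\<dots> = 4 * measure \<rho> (space \<rho>)" by simp
      finally have "hnorm H (y n) \<le> sqrt (4 * measure \<rho> (space \<rho>))" by (rule real_le_rsqrt)
      then show "hnorm H (y n) \<le> B" by (simp add: B_def)
      show "B > 0" by (simp add: B_def add_nonneg_pos)
    qed
    have orth: "(\<lambda>n. ip H (y n) (orb f k)) \<longlonglongrightarrow> 0" for k
    proof -
      \<comment> \<open>the coefficients of \<open>z powi k * cnj (p n z)\<close>: the adjoint of \<open>p(U)\<close>, moved to the other argument\<close>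
      define q where "q n = map (\<lambda>(c, i). (cnj c, k - i)) (p n)" for n
      have qeval: "trig_poly (q n) z = z powi k * cnj (trig_poly (p n) z)" if "z \<in> sphere 0 1" for n z
      proof -
        have "trig_poly (map (\<lambda>(c, i). (cnj c, k - i)) xs) z = z powi k * cnj (trig_poly xs z)" for xs
          by (induction xs) (auto simp: powi_cnj_circle[OF that, symmetric] algebra_simps simp del: complex_cnj_power_int)
        then show ?thesis by (simp add: q_def)
      qed
      have move: "ip H (y n) (orb f k) = ip H x (lincomb H (orb f) (q n))" for n
      proof -
        have "ip H (lincomb H (orb x) xs) (orb f k) = ip H x (lincomb H (orb f) (map (\<lambda>(c, i). (cnj c, k - i)) xs))" for xs
        proof (induction xs)
          case (Cons a xs)
          obtain d i where "a = (d, i)" by (cases a)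
          moreover have "ip H (orb x i) (orb f k) = ip H x (orb f (k - i))"
            using orb_ip_shift[OF x f(1), of 0 i "k - i"] by simp
          ultimately show ?case using Cons x f by (auto simp: ip_add ip_add_right ip_scal ip_scal_right vecs_lincomb)
        qed (use x f in simp)
        then show ?thesis by (simp add: y_def q_def)
      qed
      have "(\<lambda>n. (hnorm H (lincomb H (orb f) (q n)))\<^sup>2) \<longlonglongrightarrow> 0"
      proof -
        have "(\<lambda>n. LINT z|\<sigma>. (cmod (trig_poly (q n) z))\<^sup>2) \<longlonglongrightarrow> (LINT z|\<sigma>. (cmod (complex_of_real (indicator K z)))\<^sup>2)"
        proof (rule integral_dominated_convergence[where w = "\<lambda>_. 4"])
          show "(\<lambda>z. (cmod (complex_of_real (indicator K z)))\<^sup>2) \<in> borel_measurable \<sigma>"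
            using Kb se by measurable
          show "(\<lambda>z. (cmod (trig_poly (q n) z))\<^sup>2) \<in> borel_measurable \<sigma>" for n
            using meas(1)[of "q n"] by measurable
          show "AE z in \<sigma>. (\<lambda>n. (cmod (trig_poly (q n) z))\<^sup>2) \<longlonglongrightarrow> (cmod (complex_of_real (indicator K z)))\<^sup>2"
          proof (rule AE_I2)
            fix z assume "z \<in> space \<sigma>"
            then have z: "z \<in> sphere 0 1" using sp by simp
            show "(\<lambda>n. (cmod (trig_poly (q n) z))\<^sup>2) \<longlonglongrightarrow> (cmod (complex_of_real (indicator K z)))\<^sup>2"
              unfolding qeval[OF z] norm_mult norm_powi_circle[OF z] complex_mod_cnj mult_1
              by (intro tendsto_intros plim z)
          qed
          show "AE z in \<sigma>. norm ((cmod (trig_poly (q n) z))\<^sup>2) \<le> 4" for n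
          proof (rule AE_I2)
            fix z assume "z \<in> space \<sigma>"
            then have z: "z \<in> sphere 0 1" using sp by simp
            show "norm ((cmod (trig_poly (q n) z))\<^sup>2) \<le> 4"
              using power_mono[OF bound[OF z, of n], of 2] by (simp add: qeval[OF z] norm_mult norm_powi_circle[OF z])
          qed
        qed simp
        moreover have "(LINT z|\<sigma>. (cmod (complex_of_real (indicator K z)))\<^sup>2) = 0"
        proof -
          have "AE z in \<sigma>. z \<notin> K" using K0 Kb se by (intro AE_not_in) (auto simp: null_sets_def)
          then show ?thesis by (intro integral_eq_zero_AE) (auto elim!: eventually_mono)
        qed
        ultimately show ?thesis unfolding spectral_norm[OF f(1) \<sigma>] by simp
      qed
      then have n0: "(\<lambda>n. sqrt ((hnorm H (lincomb H (orb f) (q n)))\<^sup>2)) \<longlonglongrightarrow> sqrt 0" by (rule tendsto_real_sqrt)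
      have n1: "(\<lambda>n. hnorm H x * hnorm H (lincomb H (orb f) (q n))) \<longlonglongrightarrow> 0"
      proof -
        have "sqrt ((hnorm H (lincomb H (orb f) (q n)))\<^sup>2) = hnorm H (lincomb H (orb f) (q n))" for n
          using hnorm_nonneg[OF vecs_lincomb[of "orb f" "q n"]] f by simp
        then show ?thesis using tendsto_mult_right_zero n0 by simp
      qed
      show ?thesis
      proof (rule Lim_null_comparison[OF _ n1])
        show "\<forall>\<^sub>F n in sequentially. cmod (ip H (y n) (orb f k)) \<le> hnorm H x * hnorm H (lincomb H (orb f) (q n))"
          unfolding move by (intro always_eventually allI cauchy_schwarz x vecs_lincomb) (use f in auto)
      qed
    qed
    have "(\<lambda>n. ip H (y n) x) \<longlonglongrightarrow> 0"
    proof (rule LIMSEQ_I)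
      fix e :: real assume e: "0 < e"
      have "0 < e / (2 * B)" using e B(2) by simp
      moreover have "x \<in> cyc f" using x f by simp
      ultimately obtain ys where ys: "hnorm H (x - lincomb H (orb f) ys) < e / (2 * B)"
        unfolding closed_span_iff_lincomb by blast
      have lv: "lincomb H (orb f) ys \<in> vecs H" using f by auto
      have "(\<lambda>n. \<Sum>(c, i)\<leftarrow>ys. cnj c * ip H (y n) (orb f i)) \<longlonglongrightarrow> 0"
      proof (induction ys)
        case (Cons a ys)
        obtain d i where "a = (d, i)" by (cases a)
        then show ?case using tendsto_add[OF tendsto_mult_right_zero[OF orth[of i], of "cnj d"] Cons] by simp
      qed simp
      then have "(\<lambda>n. ip H (y n) (lincomb H (orb f) ys)) \<longlonglongrightarrow> 0"
        using yv f by (simp add: ip_lincomb_right)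
      then obtain N where N: "\<And>n. n \<ge> N \<Longrightarrow> cmod (ip H (y n) (lincomb H (orb f) ys)) < e / 2"
        using LIMSEQ_D[of _ 0 "e / 2"] e by auto
      have "cmod (ip H (y n) x) < e" if "n \<ge> N" for n
      proof -
        have "cmod (ip H (y n) (x - lincomb H (orb f) ys)) \<le> hnorm H (y n) * hnorm H (x - lincomb H (orb f) ys)"
          using yv x lv by (intro cauchy_schwarz) auto
        also have "\<dots> \<le> B * (e / (2 * B))"
          using B ys yv[of n] x lv by (intro mult_mono) auto
        also have "\<dots> = e / 2" using B(2) by simp
        finally show ?thesis
          using N[OF that] yv[of n] x lv norm_triangle_ineq[of "ip H (y n) (x - lincomb H (orb f) ys)" "ip H (y n) (lincomb H (orb f) ys)"]
          by (simp add: ip_diff_right)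
      qed
      then show "\<exists>N. \<forall>n\<ge>N. cmod (ip H (y n) x - 0) < e" by auto
    qed
    moreover have "(\<lambda>n. ip H (y n) x) \<longlonglongrightarrow> of_real (measure \<rho> K)"
    proof -
      have "(\<lambda>n. LINT z|\<rho>. trig_poly (p n) z) \<longlonglongrightarrow> (LINT z|\<rho>. complex_of_real (indicator K z))"
      proof (rule integral_dominated_convergence[where w = "\<lambda>_. 2"])
        show "(\<lambda>z. complex_of_real (indicator K z)) \<in> borel_measurable \<rho>" using Kb se by measurable
        show "AE z in \<rho>. (\<lambda>n. trig_poly (p n) z) \<longlonglongrightarrow> complex_of_real (indicator K z)"
          using plim sp by (intro AE_I2) auto
        show "AE z in \<rho>. norm (trig_poly (p n) z) \<le> 2" for n using bound sp by (intro AE_I2) auto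
      qed (use meas in auto)
      moreover have "(LINT z|\<rho>. complex_of_real (indicator K z)) = of_real (measure \<rho> K)"
        using Kb se by simp
      ultimately show ?thesis unfolding y_def spectral_ip[OF x \<rho>] by simp
    qed
    ultimately show ?thesis using LIMSEQ_unique by (metis of_real_eq_0_iff)
  qed simp
  show ?thesis
    unfolding absolutely_continuous_def
  proof
    fix B assume B: "B \<in> null_sets \<sigma>"
    then have Bs: "B \<in> sets circle" using se by auto
    \<comment> \<open>inner regularity reduces an arbitrary null set to its compact subsets\<close>
    define \<rho>' where "\<rho>' = distr \<rho> borel (\<lambda>z. z)"
    have m: "(\<lambda>z. z) \<in> measurable \<rho> borel"
      using se(2) by (subst measurable_cong_sets[OF se(2) refl]) (rule measurable_restrict_space1, simp)
    have em: "emeasure \<rho>' A = emeasure \<rho> (A \<inter> sphere 0 1)" if "A \<in> sets borel" for A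
      unfolding \<rho>'_def using that by (subst emeasure_distr[OF m]) (auto simp: sp)
    have "emeasure \<rho>' B = (SUP K \<in> {K. K \<subseteq> B \<and> compact K}. emeasure \<rho>' K)"
      using Bs em[of UNIV] \<rho>.emeasure_finite by (intro inner_regular) (auto simp: sets_iff \<rho>'_def)
    also have "\<dots> \<le> 0"
    proof (rule SUP_least)
      fix K assume "K \<in> {K. K \<subseteq> B \<and> compact K}"
      then have K: "K \<subseteq> B" "compact K" by auto
      then have Ks: "K \<subseteq> sphere 0 1" "K \<in> sets borel" using Bs by (auto simp: sets_iff compact_imp_closed)
      then have "K \<in> sets \<sigma>" by (simp add: se sets_iff)
      then have "emeasure \<sigma> K = 0" using null_sets_subset[OF B _ K(1)] by auto
      then have "measure \<rho> K = 0" by (rule compact_null[OF K(2) Ks(1)])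
      then have "emeasure \<rho> K = 0" by (simp add: \<rho>.emeasure_eq_measure)
      then show "emeasure \<rho>' K \<le> 0" using em[OF Ks(2)] Ks(1) by (simp add: Int_absorb2)
    qed
    finally have "emeasure \<rho>' B = 0" by simp
    moreover have "emeasure \<rho>' B = emeasure \<rho> B" using em[of B] Bs by (simp add: sets_iff Int_absorb2)
    ultimately show "B \<in> null_sets \<rho>" using Bs se by (simp add: null_sets_def)
  qed
qed

end

section \<open>Failure of the group property\<close>

context pre_hilbert
begin

lemma ip_average:
  assumes F: "finite F" "F \<noteq> {}" and u: "\<And>a. a \<in> F \<Longrightarrow> u a \<in> vecs H"
    and D: "\<And>a. a \<in> F \<Longrightarrow> ip H (u a) (u a) = of_real D"
    and G: "\<And>a b. a \<in> F \<Longrightarrow> b \<in> F \<Longrightarrow> a \<noteq> b \<Longrightarrow> ip H (u a) (u b) = of_real G"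
  shows "ip H (scal H (1 / of_nat (card F)) (sum u F)) (scal H (1 / of_nat (card F)) (sum u F)) =
    of_real ((D - G) / card F + G)"
proof -
  have N: "real (card F) \<noteq> 0" using F by simp
  have "ip H (sum u F) (sum u F) = (\<Sum>a\<in>F. \<Sum>b\<in>F. ip H (u b) (u a))"
    using u by (simp add: ip_sum ip_sum_right vecs_sum)
  also have "\<dots> = (\<Sum>a\<in>F. \<Sum>b\<in>F. of_real ((if b = a then D - G else 0) + G))"
    using D G by (intro sum.cong) auto
  also have "\<dots> = of_real (card F * (D - G) + (card F)\<^sup>2 * G)"
    using F by (simp add: sum.distrib power2_eq_square distrib_left if_distrib[of complex_of_real] cong: if_cong)
  finally have "ip H (scal H (1 / of_nat (card F)) (sum u F)) (scal H (1 / of_nat (card F)) (sum u F)) =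
    of_real ((card F * (D - G) + (card F)\<^sup>2 * G) / (card F)\<^sup>2)"
    using vecs_sum[of F u] u N by (simp add: ip_scal ip_scal_right power2_eq_square)
  also have "(card F * (D - G) + (card F)\<^sup>2 * G) / (card F)\<^sup>2 = (D - G) / card F + G"
    using N by (simp add: field_simps power2_eq_square)
  finally show ?thesis .
qed

text \<open>
  The conditions say that the errors \<open>u a - v\<close> are pairwise orthogonal with squared norm \<open>D - G\<close>, so the
  squared norm of their average is smaller by the factor \<open>card F\<close>.
\<close>

lemma average_close:
  assumes F: "finite F" "F \<noteq> {}" and u: "\<And>a. a \<in> F \<Longrightarrow> u a \<in> vecs H" and v: "v \<in> vecs H"
    and D: "\<And>a. a \<in> F \<Longrightarrow> ip H (u a) (u a) = of_real D"
    and G: "\<And>a b. a \<in> F \<Longrightarrow> b \<in> F \<Longrightarrow> a \<noteq> b \<Longrightarrow> ip H (u a) (u b) = of_real G"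
    and uv: "\<And>a. a \<in> F \<Longrightarrow> ip H (u a) v = of_real G" and vv: "ip H v v = of_real G"
  shows "(hnorm H (scal H (1 / of_nat (card F)) (sum u F) - v))\<^sup>2 = (D - G) / card F"
proof -
  let ?w = "scal H (1 / of_nat (card F)) (sum u F)"
  have N: "card F \<noteq> 0" using F by simp
  have sv: "sum u F \<in> vecs H" using u by auto
  have wv: "?w \<in> vecs H" using sv by auto
  have "ip H ?w v = of_real G"
    using u v N by (simp add: ip_scal ip_sum sv uv)
  moreover have "ip H ?w ?w = of_real ((D - G) / card F + G)"
    by (rule ip_average[OF F u D G])
  ultimately show ?thesis
    unfolding hnorm_diff_sq[OF wv v] hnorm_sq[OF wv] hnorm_sq[OF v] using vv by simp
qed

end

lemma L2_sum: "sum f A x = (\<Sum>a\<in>A. f a (x::'b)::complex)"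
  by (induction A rule: infinite_finite_induct) auto

lemma measurable_circle_mult:
  assumes c: "circle_measure \<sigma>"
  shows "(\<lambda>(z, w). z * w) \<in> measurable (\<sigma> \<Otimes>\<^sub>M \<sigma>) circle"
proof (rule measurable_restrict_space2)
  show "(\<lambda>(z, w). z * w) \<in> space (\<sigma> \<Otimes>\<^sub>M \<sigma>) \<rightarrow> sphere 0 1"
    by (auto simp: space_pair_measure circle_measureD(3)[OF c] norm_mult)
  have [measurable]: "(\<lambda>z. z) \<in> borel_measurable \<sigma>"
    using measurable_powi_circle[OF c, of 1] by simp
  show "(\<lambda>(z, w). z * w) \<in> borel_measurable (\<sigma> \<Otimes>\<^sub>M \<sigma>)" by measurable
qed

lemma circle_square_finite:
  assumes c: "circle_measure \<sigma>" shows "finite_measure (\<sigma> \<Otimes>\<^sub>M \<sigma>)"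
proof -
  interpret finite_measure \<sigma> using circle_measureD[OF c] by simp
  show ?thesis by (rule finite_measure_pair_measure) unfold_locales
qed

lemma circle_square_monomials:
  assumes c: "circle_measure \<sigma>"
  shows "(\<lambda>p. fst p powi a * snd p powi b) \<in> borel_measurable (\<sigma> \<Otimes>\<^sub>M \<sigma>)"
    and "integrable (\<sigma> \<Otimes>\<^sub>M \<sigma>) (\<lambda>p. fst p powi a * snd p powi b)"
    and "(LINT p|(\<sigma> \<Otimes>\<^sub>M \<sigma>). fst p powi a * snd p powi b) = (LINT z|\<sigma>. z powi a) * (LINT z|\<sigma>. z powi b)"
proof -
  interpret finite_measure \<sigma> using circle_measureD[OF c] by simp
  interpret pair_sigma_finite \<sigma> \<sigma> ..
  have [measurable]: "(\<lambda>z. z powi k) \<in> borel_measurable \<sigma>" for k by (rule measurable_powi_circle[OF c])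
  show m: "(\<lambda>p. fst p powi a * snd p powi b) \<in> borel_measurable (\<sigma> \<Otimes>\<^sub>M \<sigma>)" by measurable
  show i: "integrable (\<sigma> \<Otimes>\<^sub>M \<sigma>) (\<lambda>p. fst p powi a * snd p powi b)"
  proof (rule finite_measure.integrable_const_bound[OF circle_square_finite[OF c], where B = 1])
    show "AE p in \<sigma> \<Otimes>\<^sub>M \<sigma>. norm (fst p powi a * snd p powi b) \<le> 1"
      by (intro AE_I2) (auto simp: space_pair_measure circle_measureD(3)[OF c] norm_mult norm_powi_circle)
  qed (rule m)
  show "(LINT p|(\<sigma> \<Otimes>\<^sub>M \<sigma>). fst p powi a * snd p powi b) = (LINT z|\<sigma>. z powi a) * (LINT z|\<sigma>. z powi b)"
    using integral_fst'[OF i] by simp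
qed

lemma convolution_coefficients:
  assumes c: "circle_measure \<sigma>"
  shows "circle_measure (circle_convolution \<sigma> \<sigma>)"
    and "(LINT z|circle_convolution \<sigma> \<sigma>. z powi k) = (LINT z|\<sigma>. z powi k)\<^sup>2"
proof -
  note mult = measurable_circle_mult[OF c]
  show "circle_measure (circle_convolution \<sigma> \<sigma>)"
    unfolding circle_measure_def circle_convolution_def
    using finite_measure.finite_measure_distr[OF circle_square_finite[OF c] mult] by simp
  have "(LINT z|circle_convolution \<sigma> \<sigma>. z powi k) = (LINT p|(\<sigma> \<Otimes>\<^sub>M \<sigma>). (fst p * snd p) powi k)"
    unfolding circle_convolution_def
    by (subst integral_distr[OF mult]) (auto simp: case_prod_beta intro!: borel_measurable_continuous_on_restrict continuous_intros)
  also have "\<dots> = (LINT p|(\<sigma> \<Otimes>\<^sub>M \<sigma>). fst p powi k * snd p powi k)" by (simp add: power_int_mult_distrib)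
  also have "\<dots> = (LINT z|\<sigma>. z powi k)\<^sup>2"
    unfolding circle_square_monomials(3)[OF c] by (simp add: power2_eq_square)
  finally show "(LINT z|circle_convolution \<sigma> \<sigma>. z powi k) = (LINT z|\<sigma>. z powi k)\<^sup>2" .
qed

text \<open>
  By Fubini's theorem, almost all sections of a null set of \<open>\<tau> \<otimes> \<tau>\<close> are null sets of \<open>\<tau>\<close>, and both kinds of
  null sets pass to \<open>\<sigma>\<close>.
\<close>

lemma convolution_ac:
  assumes c: "circle_measure \<sigma>" "circle_measure \<tau>" and ac: "absolutely_continuous \<tau> \<sigma>"
  shows "absolutely_continuous (circle_convolution \<tau> \<tau>) (circle_convolution \<sigma> \<sigma>)"
proof -
  interpret \<sigma>: finite_measure \<sigma> using circle_measureD[OF c(1)] by simp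
  interpret \<tau>: finite_measure \<tau> using circle_measureD[OF c(2)] by simp
  have sets: "sets \<tau> = sets \<sigma>" using circle_measureD(2) c by metis
  have spc: "space \<tau> = space \<sigma>" using sets by (rule sets_eq_imp_space_eq)
  have sets2: "sets (\<tau> \<Otimes>\<^sub>M \<tau>) = sets (\<sigma> \<Otimes>\<^sub>M \<sigma>)" using sets by (intro sets_pair_measure_cong)
  have pair: "A \<in> null_sets (\<sigma> \<Otimes>\<^sub>M \<sigma>)" if "A \<in> null_sets (\<tau> \<Otimes>\<^sub>M \<tau>)" for A
  proof -
    have A: "A \<in> sets (\<tau> \<Otimes>\<^sub>M \<tau>)" "A \<in> sets (\<sigma> \<Otimes>\<^sub>M \<sigma>)" using that sets2 by auto
    have "(\<integral>\<^sup>+ x. emeasure \<tau> (Pair x -` A) \<partial>\<tau>) = 0"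
      using that \<tau>.emeasure_pair_measure_alt[OF A(1)] by auto
    then have "AE x in \<tau>. emeasure \<tau> (Pair x -` A) = 0"
      using \<tau>.measurable_emeasure_Pair[OF A(1)] by (simp add: nn_integral_0_iff_AE)
    then have "AE x in \<sigma>. emeasure \<tau> (Pair x -` A) = 0"
      by (rule absolutely_continuous_AE[OF sets[symmetric] ac])
    then have "AE x in \<sigma>. emeasure \<sigma> (Pair x -` A) = 0"
    proof eventually_elim
      case (elim x)
      then have "Pair x -` A \<in> null_sets \<tau>" using sets_Pair1[OF A(1)] by auto
      then show ?case using ac by (auto simp: absolutely_continuous_def)
    qed
    then have "(\<integral>\<^sup>+ x. emeasure \<sigma> (Pair x -` A) \<partial>\<sigma>) = 0"
      using \<sigma>.measurable_emeasure_Pair[OF A(2)] by (simp add: nn_integral_0_iff_AE)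
    then show ?thesis using \<sigma>.emeasure_pair_measure_alt[OF A(2)] A by auto
  qed
  note mult = measurable_circle_mult
  have spc2: "space (\<tau> \<Otimes>\<^sub>M \<tau>) = space (\<sigma> \<Otimes>\<^sub>M \<sigma>)" using sets2 by (rule sets_eq_imp_space_eq)
  show ?thesis
    unfolding absolutely_continuous_def circle_convolution_def
  proof
    fix B assume B: "B \<in> null_sets (distr (\<tau> \<Otimes>\<^sub>M \<tau>) circle (\<lambda>(z, w). z * w))"
    then have "(\<lambda>(z, w). z * w) -` B \<inter> space (\<tau> \<Otimes>\<^sub>M \<tau>) \<in> null_sets (\<tau> \<Otimes>\<^sub>M \<tau>)"
      using null_sets_distr_iff[OF mult[OF c(2)]] by auto
    from pair[OF this] show "B \<in> null_sets (distr (\<sigma> \<Otimes>\<^sub>M \<sigma>) circle (\<lambda>(z, w). z * w))"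
      using B null_sets_distr_iff[OF mult[OF c(1)]] spc2 by auto
  qed
qed

text \<open>
  All that the spectral part uses of the class: a cyclic vector \<open>f\<close> with decaying real correlations
  \<open>\<kappa>\<close>, and the relations \<open>avg\<close>. Put \<open>v = orb f 0 + orb f (- n)\<close>. The relations say that the vectors
  \<open>r * orb f a\<close>, for \<open>a\<close> in \<open>F\<close>, have the same inner product with \<open>v\<close> and with one another as \<open>v\<close> has
  with itself; so they are \<open>v\<close> plus pairwise orthogonal errors. The bound on \<open>card F\<close> makes the average of
  the errors small even in the tensor square, where their squared norms are of order \<open>r^4\<close>.
\<close>

locale averaging_unitary = unitary_pre H U for H :: "'v::ab_group_add hilb" and U +
  fixes f :: 'v and \<kappa> :: "int \<Rightarrow> real"
  assumes f: "f \<in> vecs H" and cyclic: "cyc f = vecs H"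
    and corr: "ip H (orb f m) f = of_real (\<kappa> m)"
    and pos: "\<kappa> 0 > 0"
    and decay: "(\<lambda>k. \<kappa> (int k)) \<longlonglongrightarrow> 0"
    and avg: "n \<ge> 1 \<Longrightarrow> \<exists>F r. finite F \<and> F \<noteq> {} \<and> M \<le> r \<and> 1 \<le> r \<and> M * r ^ 4 \<le> real (card F) \<and>
        (\<forall>a\<in>F. r * \<kappa> a = \<kappa> 0 + \<kappa> n \<and> r * \<kappa> (a + n) = \<kappa> 0 + \<kappa> n) \<and>
        (\<forall>a\<in>F. \<forall>b\<in>F. a \<noteq> b \<longrightarrow> r\<^sup>2 * \<kappa> (a - b) = 2 * \<kappa> 0 + 2 * \<kappa> n)"
begin

lemma \<kappa>_minus: "\<kappa> (- m) = \<kappa> m"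
proof -
  have "ip H (orb f (- m)) f = ip H f (orb f m)"
    using orb_ip_shift[OF f f, of "- m" m 0] by simp
  also have "\<dots> = cnj (ip H (orb f m) f)" using ip_cnj[of "orb f m" f] f by simp
  finally show ?thesis by (simp add: corr)
qed

lemma orb_corr: "ip H (orb f a) (orb f b) = of_real (\<kappa> (a - b))"
  using orb_ip[OF f f] corr by simp

lemma spectral_exists: obtains \<sigma> where "spectral_measure H U f \<sigma>"
  using spectral_measure_exists[OF f] corr[of 0] pos by auto

lemma avg_sequence:
  assumes "n \<ge> 1"
  obtains F r where "\<And>m. finite (F m)" "\<And>m. F m \<noteq> {}" "\<And>m. real (Suc m) \<le> r m"
    "\<And>m. real (Suc m) * r m ^ 4 \<le> real (card (F m))"
    "\<And>m a. a \<in> F m \<Longrightarrow> r m * \<kappa> a = \<kappa> 0 + \<kappa> n" "\<And>m a. a \<in> F m \<Longrightarrow> r m * \<kappa> (a + n) = \<kappa> 0 + \<kappa> n"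
    "\<And>m a b. a \<in> F m \<Longrightarrow> b \<in> F m \<Longrightarrow> a \<noteq> b \<Longrightarrow> (r m)\<^sup>2 * \<kappa> (a - b) = 2 * \<kappa> 0 + 2 * \<kappa> n"
proof -
  have "\<forall>m. \<exists>F r. finite F \<and> F \<noteq> {} \<and> real (Suc m) \<le> r \<and> 1 \<le> r \<and> real (Suc m) * r ^ 4 \<le> real (card F) \<and>
        (\<forall>a\<in>F. r * \<kappa> a = \<kappa> 0 + \<kappa> n \<and> r * \<kappa> (a + n) = \<kappa> 0 + \<kappa> n) \<and>
        (\<forall>a\<in>F. \<forall>b\<in>F. a \<noteq> b \<longrightarrow> r\<^sup>2 * \<kappa> (a - b) = 2 * \<kappa> 0 + 2 * \<kappa> n)"
    using avg[OF assms] by blast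
  then obtain F r where "\<And>m. finite (F m) \<and> F m \<noteq> {} \<and> real (Suc m) \<le> r m \<and> 1 \<le> r m \<and> real (Suc m) * r m ^ 4 \<le> real (card (F m)) \<and>
        (\<forall>a\<in>F m. r m * \<kappa> a = \<kappa> 0 + \<kappa> n \<and> r m * \<kappa> (a + n) = \<kappa> 0 + \<kappa> n) \<and>
        (\<forall>a\<in>F m. \<forall>b\<in>F m. a \<noteq> b \<longrightarrow> (r m)\<^sup>2 * \<kappa> (a - b) = 2 * \<kappa> 0 + 2 * \<kappa> n)"
    by metis
  then show thesis by (intro that[of F r]) blast+
qed

lemma ratio_small:
  assumes "real (Suc m) \<le> r" "real (Suc m) * r ^ 4 \<le> real N"
  shows "r ^ 4 / N \<le> 1 / real (Suc m)" "r\<^sup>2 / N \<le> 1 / real (Suc m)"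
proof -
  have r1: "1 \<le> r" using assms(1) by simp
  have p: "0 < real (Suc m) * r ^ 4" using r1 by simp
  then have N: "0 < real N" using assms(2) by linarith
  show 4: "r ^ 4 / N \<le> 1 / real (Suc m)"
    using assms(2) N by (simp add: field_simps)
  have "r\<^sup>2 \<le> r ^ 4" using r1 by (intro power_increasing) auto
  then have "r\<^sup>2 / N \<le> r ^ 4 / N" by (rule divide_right_mono) simp
  with 4 show "r\<^sup>2 / N \<le> 1 / real (Suc m)" by linarith
qed

text \<open>
  The averages of \<open>r z^a\<close> over \<open>a\<close> in \<open>F\<close> tend to \<open>1 + z^(-n)\<close> in \<open>L2 \<sigma>\<close>, but to \<open>0\<close> in the \<open>L2\<close>
  space of the convolution square, where the correlations are those of \<open>\<sigma>\<close> squared: the inner products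
  \<open>r\<^sup>2 * (\<kappa> (a - b))\<^sup>2\<close> are of order \<open>1 / r\<^sup>2\<close> instead of constant. By absolute continuity a subsequence
  converges to both limits almost everywhere.
\<close>

lemma convolution_root:
  assumes n: "n \<ge> 1" and \<sigma>: "spectral_measure H U f \<sigma>"
    and ac: "absolutely_continuous \<sigma> (circle_convolution \<sigma> \<sigma>)"
  shows "AE z in circle_convolution \<sigma> \<sigma>. 1 + z powi (- n) = 0"
proof -
  define \<nu> where "\<nu> = circle_convolution \<sigma> \<sigma>"
  have c: "circle_measure \<sigma>" and co: "(LINT z|\<sigma>. z powi k) = of_real (\<kappa> k)" for k
    using \<sigma> corr by (auto simp: spectral_measure_def)
  have c\<nu>: "circle_measure \<nu>" and co\<nu>: "(LINT z|\<nu>. z powi k) = of_real ((\<kappa> k)\<^sup>2)" for k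
    using convolution_coefficients[OF c] co by (auto simp: \<nu>_def)
  obtain F r where F: "\<And>m. finite (F m)" "\<And>m. F m \<noteq> {}" and r: "\<And>m. real (Suc m) \<le> r m"
    and N: "\<And>m. real (Suc m) * r m ^ 4 \<le> real (card (F m))"
    and e1: "\<And>m a. a \<in> F m \<Longrightarrow> r m * \<kappa> a = \<kappa> 0 + \<kappa> n" and e2: "\<And>m a. a \<in> F m \<Longrightarrow> r m * \<kappa> (a + n) = \<kappa> 0 + \<kappa> n"
    and e3: "\<And>m a b. a \<in> F m \<Longrightarrow> b \<in> F m \<Longrightarrow> a \<noteq> b \<Longrightarrow> (r m)\<^sup>2 * \<kappa> (a - b) = 2 * \<kappa> 0 + 2 * \<kappa> n"
    using avg_sequence[OF n] by blast
  define G where "G = 2 * \<kappa> 0 + 2 * \<kappa> n"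
  have r0: "r m > 0" for m using r[of m] by (smt (verit) of_nat_0_less_iff zero_less_Suc)
  define u where "u m a = (\<lambda>z::complex. of_real (r m) * z powi a)" for m a
  define v where "v = (\<lambda>z::complex. z powi 0) + (\<lambda>z. z powi (- n))"
  define Q where "Q m = scal (L2 \<sigma>) (1 / of_nat (card (F m))) (sum (u m) (F m))" for m
  have Q\<nu>: "Q m = scal (L2 \<nu>) (1 / of_nat (card (F m))) (sum (u m) (F m))" for m by (simp add: Q_def)
  have us: "u m a = scal (L2 \<tau>) (of_real (r m)) (\<lambda>z. z powi a)" for m a \<tau> by (simp add: u_def)
  have p: "(\<lambda>z. z powi k) \<in> vecs (L2 \<sigma>)" "(\<lambda>z. z powi k) \<in> vecs (L2 \<nu>)" for k
    using powi_in_L2[OF c] powi_in_L2[OF c\<nu>] by auto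
  have uv: "u m a \<in> vecs (L2 \<sigma>)" "u m a \<in> vecs (L2 \<nu>)" "v \<in> vecs (L2 \<sigma>)" for m a
  proof -
    show "u m a \<in> vecs (L2 \<sigma>)" unfolding us[of m a \<sigma>] by (rule L2.vecs_scal[OF p(1)])
    show "u m a \<in> vecs (L2 \<nu>)" unfolding us[of m a \<nu>] by (rule L2.vecs_scal[OF p(2)])
    show "v \<in> vecs (L2 \<sigma>)" unfolding v_def by (rule L2.vecs_add[OF p(1) p(1)])
  qed
  have Qv: "Q m \<in> vecs (L2 \<sigma>)" "Q m \<in> vecs (L2 \<nu>)" for m
  proof -
    show "Q m \<in> vecs (L2 \<sigma>)" unfolding Q_def by (intro L2.vecs_scal L2.vecs_sum uv)
    show "Q m \<in> vecs (L2 \<nu>)" unfolding Q\<nu> by (intro L2.vecs_scal L2.vecs_sum uv)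
  qed
  have ipu: "ip (L2 \<sigma>) (u m a) (u m b) = of_real ((r m)\<^sup>2 * \<kappa> (a - b))" for m a b
    unfolding us[of m _ \<sigma>] using p
    by (simp del: L2_simps add: L2.ip_scal L2.ip_scal_right ip_powi[OF c] co power2_eq_square mult.assoc)
  have ipu\<nu>: "ip (L2 \<nu>) (u m a) (u m b) = of_real ((r m)\<^sup>2 * (\<kappa> (a - b))\<^sup>2)" for m a b
    unfolding us[of m _ \<nu>] using p
    by (simp del: L2_simps add: L2.ip_scal L2.ip_scal_right ip_powi[OF c\<nu>] co\<nu> power2_eq_square mult.assoc)
  have close: "(hnorm (L2 \<sigma>) (Q m - v))\<^sup>2 \<le> (\<kappa> 0 + \<bar>G\<bar>) / real (Suc m)" for m
  proof -
    have "(hnorm (L2 \<sigma>) (Q m - v))\<^sup>2 = ((r m)\<^sup>2 * \<kappa> 0 - G) / card (F m)"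
      unfolding Q_def
    proof (rule L2.average_close[OF F uv(1,3)])
      show "ip (L2 \<sigma>) (u m a) (u m a) = of_real ((r m)\<^sup>2 * \<kappa> 0)" for a using ipu[of m a a] by simp
      show "ip (L2 \<sigma>) (u m a) (u m b) = of_real G" if "a \<in> F m" "b \<in> F m" "a \<noteq> b" for a b
        using ipu[of m a b] e3[OF that] by (simp add: G_def)
      show "ip (L2 \<sigma>) (u m a) v = of_real G" if "a \<in> F m" for a
      proof -
        have "ip (L2 \<sigma>) (u m a) v = of_real (r m * \<kappa> a + r m * \<kappa> (a + n))"
          unfolding us[of m _ \<sigma>] v_def using p
          by (simp del: L2_simps power_int_0_right add: L2.ip_scal L2.ip_add_right ip_powi[OF c] co distrib_left)
        then show ?thesis using e1[OF that] e2[OF that] by (simp add: G_def)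
      qed
      have "ip (L2 \<sigma>) v v = of_real (\<kappa> 0 + \<kappa> n + (\<kappa> (- n) + \<kappa> 0))"
        unfolding v_def using p
        by (simp del: L2_simps power_int_0_right add: L2.ip_add L2.ip_add_right ip_powi[OF c] co)
      then show "ip (L2 \<sigma>) v v = of_real G" by (simp add: G_def \<kappa>_minus)
    qed
    also have "\<dots> = (r m)\<^sup>2 / card (F m) * \<kappa> 0 - 1 / card (F m) * G" by (simp add: diff_divide_distrib)
    also have "\<dots> \<le> 1 / real (Suc m) * \<kappa> 0 + 1 / real (Suc m) * \<bar>G\<bar>"
    proof -
      have "1 / card (F m) \<le> 1 / real (Suc m)"
      proof -
        have "real (Suc m) * 1 \<le> real (Suc m) * r m ^ 4"
          using r[of m] by (intro mult_left_mono one_le_power) auto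
        then have "real (Suc m) \<le> card (F m)" using order_trans[OF _ N[of m]] by (simp only: mult_1_right)
        then show ?thesis by (intro frac_le) auto
      qed
      then have "1 / card (F m) * (- G) \<le> 1 / real (Suc m) * \<bar>G\<bar>"
        by (intro order_trans[OF mult_left_mono[of "- G" "\<bar>G\<bar>"] mult_right_mono]) auto
      moreover have "(r m)\<^sup>2 / card (F m) * \<kappa> 0 \<le> 1 / real (Suc m) * \<kappa> 0"
        using pos ratio_small(2)[OF r N] by (intro mult_right_mono) auto
      ultimately show ?thesis by simp
    qed
    finally show ?thesis by (simp add: add_divide_distrib)
  qed
  have small: "(hnorm (L2 \<nu>) (Q m))\<^sup>2 \<le> ((\<kappa> 0)\<^sup>2 + G\<^sup>2) / real (Suc m)" for m
  proof -
    have "ip (L2 \<nu>) (Q m) (Q m) = of_real (((r m)\<^sup>2 * (\<kappa> 0)\<^sup>2 - G\<^sup>2 / (r m)\<^sup>2) / card (F m) + G\<^sup>2 / (r m)\<^sup>2)"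
      unfolding Q\<nu>
    proof (rule L2.ip_average[OF F uv(2)])
      show "ip (L2 \<nu>) (u m a) (u m a) = of_real ((r m)\<^sup>2 * (\<kappa> 0)\<^sup>2)" for a using ipu\<nu>[of m a a] by simp
      show "ip (L2 \<nu>) (u m a) (u m b) = of_real (G\<^sup>2 / (r m)\<^sup>2)" if "a \<in> F m" "b \<in> F m" "a \<noteq> b" for a b
      proof -
        have "\<kappa> (a - b) = G / (r m)\<^sup>2" using e3[OF that] r0[of m] by (simp add: G_def field_simps)
        then have "(r m)\<^sup>2 * (\<kappa> (a - b))\<^sup>2 = G\<^sup>2 / (r m)\<^sup>2" using r0[of m] by (simp add: power2_eq_square)
        then show ?thesis using ipu\<nu>[of m a b] by simp
      qed
    qed
    then have "(hnorm (L2 \<nu>) (Q m))\<^sup>2 = ((r m)\<^sup>2 * (\<kappa> 0)\<^sup>2 - G\<^sup>2 / (r m)\<^sup>2) / card (F m) + G\<^sup>2 / (r m)\<^sup>2"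
      unfolding L2.hnorm_sq[OF Qv(2)] by simp
    also have "\<dots> \<le> (r m)\<^sup>2 * (\<kappa> 0)\<^sup>2 / card (F m) + G\<^sup>2 / (r m)\<^sup>2"
      by (simp add: divide_right_mono)
    also have "\<dots> \<le> 1 / real (Suc m) * (\<kappa> 0)\<^sup>2 + G\<^sup>2 / real (Suc m)"
    proof (rule add_mono)
      show "(r m)\<^sup>2 * (\<kappa> 0)\<^sup>2 / card (F m) \<le> 1 / real (Suc m) * (\<kappa> 0)\<^sup>2"
        using mult_right_mono[OF ratio_small(2)[OF r N], of "(\<kappa> 0)\<^sup>2" m] by simp
      have "real (Suc m) * 1 \<le> r m * r m" using r[of m] by (intro mult_mono) auto
      then show "G\<^sup>2 / (r m)\<^sup>2 \<le> G\<^sup>2 / real (Suc m)"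
        by (intro divide_left_mono) (auto simp: power2_eq_square r0)
    qed
    finally show ?thesis by (simp add: add_divide_distrib)
  qed
  have lim0: "(\<lambda>m. C / real (Suc m)) \<longlonglongrightarrow> 0" for C
    using LIMSEQ_Suc[OF lim_const_over_n[of C]] .
  have "(\<lambda>m. (hnorm (L2 \<sigma>) (Q m - v))\<^sup>2) \<longlonglongrightarrow> 0"
    by (rule tendsto_sandwich[OF _ _ tendsto_const lim0[of "\<kappa> 0 + \<bar>G\<bar>"]]) (use close in auto)
  then have l1: "(\<lambda>m. LINT z|\<sigma>. norm ((cmod ((Q m - v) z))\<^sup>2)) \<longlonglongrightarrow> 0" by (simp add: hnorm_L2_sq)
  have i1: "integrable \<sigma> (\<lambda>z. (cmod ((Q m - v) z))\<^sup>2)" for m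
    using L2.vecs_diff[OF Qv(1) uv(3), of m] by simp
  obtain s1 where s1: "strict_mono s1" "AE z in \<sigma>. (\<lambda>m. (cmod ((Q (s1 m) - v) z))\<^sup>2) \<longlonglongrightarrow> 0"
    using tendsto_L1_AE_subseq[OF i1 l1] by blast
  have "(\<lambda>m. (hnorm (L2 \<nu>) (Q m))\<^sup>2) \<longlonglongrightarrow> 0"
    by (rule tendsto_sandwich[OF _ _ tendsto_const lim0[of "(\<kappa> 0)\<^sup>2 + G\<^sup>2"]]) (use small in auto)
  from LIMSEQ_subseq_LIMSEQ[OF this s1(1)]
  have l2: "(\<lambda>m. LINT z|\<nu>. norm ((cmod (Q (s1 m) z))\<^sup>2)) \<longlonglongrightarrow> 0" by (simp add: hnorm_L2_sq comp_def)
  have i2: "integrable \<nu> (\<lambda>z. (cmod (Q (s1 m) z))\<^sup>2)" for m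
    using Qv(2)[of "s1 m"] by simp
  obtain s2 where s2: "strict_mono s2" "AE z in \<nu>. (\<lambda>m. (cmod (Q (s1 (s2 m)) z))\<^sup>2) \<longlonglongrightarrow> 0"
    using tendsto_L1_AE_subseq[OF i2 l2] by blast
  have "AE z in \<nu>. (\<lambda>m. (cmod ((Q (s1 m) - v) z))\<^sup>2) \<longlonglongrightarrow> 0"
    by (rule absolutely_continuous_AE[OF _ ac[folded \<nu>_def] s1(2)])
      (simp add: circle_measureD(2)[OF c] circle_measureD(2)[OF c\<nu>])
  then show ?thesis
    using s2(2) unfolding \<nu>_def[symmetric]
  proof eventually_elim
    case (elim z)
    have sq: "(\<lambda>m. X m) \<longlonglongrightarrow> 0" if "(\<lambda>m. (cmod (X m))\<^sup>2) \<longlonglongrightarrow> 0" for X :: "nat \<Rightarrow> complex"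
    proof -
      have "(\<lambda>m. sqrt ((cmod (X m))\<^sup>2)) \<longlonglongrightarrow> sqrt 0" using that by (rule tendsto_real_sqrt)
      then show ?thesis by (simp add: tendsto_norm_zero_iff)
    qed
    have "(\<lambda>m. (Q (s1 m) - v) z) \<longlonglongrightarrow> 0" by (rule sq[OF elim(1)])
    from LIMSEQ_subseq_LIMSEQ[OF this s2(1)] have "(\<lambda>m. Q (s1 (s2 m)) z - v z) \<longlonglongrightarrow> 0" by (simp add: comp_def)
    moreover have "(\<lambda>m. Q (s1 (s2 m)) z - v z) \<longlonglongrightarrow> 0 - v z"
      by (intro tendsto_diff sq[OF elim(2)] tendsto_const)
    ultimately have "v z = 0" using LIMSEQ_unique by fastforce
    then show ?case by (simp add: v_def)
  qed
qed

text \<open>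
  For \<open>n = 1\<close> and \<open>n = 2\<close> the convolution square would be carried by the points with \<open>z = -1\<close> and
  \<open>z\<^sup>2 = -1\<close>, hence vanish.
\<close>

theorem no_group_property: "\<not> kolmogorov_group_property H U"
proof
  assume "kolmogorov_group_property H U"
  then obtain \<tau> where max: "maximal_spectral_type H U \<tau>"
    and conv: "absolutely_continuous \<tau> (circle_convolution \<tau> \<tau>)"
    by (auto simp: kolmogorov_group_property_def)
  obtain \<sigma> where \<sigma>: "spectral_measure H U f \<sigma>" by (rule spectral_exists)
  obtain x \<rho> where x: "x \<in> vecs H" "spectral_measure H U x \<rho>" "absolutely_continuous \<rho> \<tau>"
    using max by (auto simp: maximal_spectral_type_def)
  have c: "circle_measure \<sigma>" "circle_measure \<tau>"
    using \<sigma> max by (auto simp: spectral_measure_def maximal_spectral_type_def)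
  have \<sigma>\<tau>: "absolutely_continuous \<tau> \<sigma>" using max f \<sigma> by (auto simp: maximal_spectral_type_def)
  have "absolutely_continuous \<sigma> \<rho>" by (rule spectral_ac[OF f cyclic \<sigma> x(1,2)])
  then have ac: "absolutely_continuous \<sigma> (circle_convolution \<sigma> \<sigma>)"
    using x(3) conv convolution_ac[OF c \<sigma>\<tau>] unfolding absolutely_continuous_def by blast
  let ?\<nu> = "circle_convolution \<sigma> \<sigma>"
  have "AE z in ?\<nu>. 1 + z powi (- 1) = 0" "AE z in ?\<nu>. 1 + z powi (- 2) = 0"
    using convolution_root[OF _ \<sigma> ac, of 1] convolution_root[OF _ \<sigma> ac, of 2] by auto
  then have "AE z in ?\<nu>. False"
  proof eventually_elim
    case (elim z)
    have "z powi (- 2) = (z powi (- 1))\<^sup>2" by (simp add: power_int_minus power_inverse)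
    moreover have "z powi (- 1) = - 1" using elim(1) by (simp add: add_eq_0_iff)
    ultimately show ?case using elim(2) by simp
  qed
  then have "(LINT z|?\<nu>. z powi 0) = (LINT z|?\<nu>. 0)"
    by (intro integral_cong_AE) auto
  moreover have "(LINT z|\<sigma>. z powi 0) = of_real (\<kappa> 0)"
    using \<sigma> corr[of 0] unfolding spectral_measure_def by metis
  ultimately have "(complex_of_real (\<kappa> 0))\<^sup>2 = 0"
    unfolding convolution_coefficients(2)[OF c(1)] by (simp only: integral_zero)
  then show False using pos by simp
qed

end

section \<open>Linear images and direct sums\<close>

context pre_hilbert
begin

text \<open>
  Used to check membership in a closed subspace on a generating family only.
\<close>

lemma linear_image_closed_span:
  assumes L: "linear_op H K L" and K: "pre_hilbert K"
    and C: "0 \<le> C" and bd: "\<And>x. x \<in> vecs H \<Longrightarrow> hnorm K (L x) \<le> C * hnorm H x"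
    and b: "\<And>i. b i \<in> vecs H" and B: "B \<subseteq> vecs K" and Lb: "\<And>i. L (b i) \<in> closed_span K B"
    and x: "x \<in> closed_span H (range b)"
  shows "L x \<in> closed_span K B"
proof -
  interpret K: pre_hilbert K by fact
  have Lv: "L x \<in> vecs K" if "x \<in> vecs H" for x using L that by (auto simp: linear_op_def)
  have xv: "x \<in> vecs H" using x closed_span_subset by auto
  show ?thesis
  proof (rule K.closed_span_limit[OF B Lv[OF xv]])
    fix e :: real assume "e > 0"
    then have "0 < e / (C + 1)" using C by simp
    then obtain xs where xs: "hnorm H (x - lincomb H b xs) < e / (C + 1)"
      using x unfolding closed_span_iff_lincomb by blast
    have lv: "lincomb H b xs \<in> vecs H" using b by (rule vecs_lincomb)
    have "lincomb K (\<lambda>i. L (b i)) xs \<in> closed_span K B"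
      by (rule K.closed_span_lincomb[OF B Lb])
    then have "L (lincomb H b xs) \<in> closed_span K B"
      by (rule K.closed_span_heq[OF B Lv[OF lv] _ linear_op_lincomb[OF L K b]])
    moreover have "hnorm K (L x - L (lincomb H b xs)) < e"
    proof -
      have "hnorm K (L x - L (lincomb H b xs)) \<le> C * hnorm H (x - lincomb H b xs)"
        by (rule linear_op_diff[OF L K bd xv lv])
      also have "\<dots> \<le> (C + 1) * hnorm H (x - lincomb H b xs)"
        using xv lv by (intro mult_right_mono) auto
      also have "\<dots> < e" using xs C pos_less_divide_eq[of "C + 1" "hnorm H (x - lincomb H b xs)" e]
        by (simp add: mult.commute)
      finally show ?thesis .
    qed
    ultimately show "\<exists>y\<in>closed_span K B. hnorm K (L x - y) < e" by blast
  qed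
qed

lemma linear_op_add:
  assumes L: "linear_op H K L" "linear_op H K L'" and K: "pre_hilbert K"
  shows "linear_op H K (\<lambda>x. L x + L' x)"
proof -
  interpret K: pre_hilbert K by fact
  have v: "L x \<in> vecs K" "L' x \<in> vecs K" if "x \<in> vecs H" for x using L that by (auto simp: linear_op_def)
  show ?thesis
    unfolding linear_op_def
  proof (intro conjI ballI allI)
    fix x c assume x: "x \<in> vecs H"
    show "L x + L' x \<in> vecs K" using v[OF x] by auto
    have "heq K (L (scal H c x) + L' (scal H c x)) (scal K c (L x) + scal K c (L' x))"
      using L x v[OF x] v[of "scal H c x"] by (intro K.heq_add) (auto simp: linear_op_def)
    then show "heq K (L (scal H c x) + L' (scal H c x)) (scal K c (L x + L' x))"
      by (simp add: K.V.scale_right_distrib)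
    fix y assume y: "y \<in> vecs H"
    have "heq K (L (x + y) + L' (x + y)) ((L x + L y) + (L' x + L' y))"
      using L x y v[OF x] v[OF y] v[of "x + y"] by (intro K.heq_add) (auto simp: linear_op_def)
    then show "heq K (L (x + y) + L' (x + y)) (L x + L' x + (L y + L' y))"
      by (simp add: algebra_simps)
  qed
qed

lemma closed_span_orthogonal:
  assumes B: "B \<subseteq> vecs H" and z: "z \<in> vecs H" "\<And>b. b \<in> B \<Longrightarrow> ip H b z = 0" and x: "x \<in> closed_span H B"
  shows "ip H x z = 0"
proof (rule ccontr)
  assume "ip H x z \<noteq> 0"
  then have e: "0 < cmod (ip H x z) / (hnorm H z + 1)" using z by (simp add: add_nonneg_pos)
  then obtain y where y: "y \<in> V.span B" "hnorm H (x - y) < cmod (ip H x z) / (hnorm H z + 1)"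
    using x unfolding closed_span_def by blast
  have xv: "x \<in> vecs H" "y \<in> vecs H" using x y span_subset_vecs[OF B] closed_span_subset by blast+
  have "V.span B \<subseteq> {w \<in> vecs H. ip H w z = 0}"
    using B z by (intro V.span_minimal) (auto simp: V.subspace_def ip_add ip_scal)
  then have "ip H x z = ip H (x - y) z" using y xv z by (auto simp: ip_diff)
  then have "cmod (ip H x z) \<le> hnorm H (x - y) * hnorm H z"
    using cauchy_schwarz[of "x - y" z] xv z by simp
  also have "\<dots> \<le> hnorm H (x - y) * (hnorm H z + 1)" using xv by (intro mult_left_mono) auto
  also have "\<dots> < cmod (ip H x z)"
    using y(2) z pos_less_divide_eq[of "hnorm H z + 1" "hnorm H (x - y)"] by (simp add: add_nonneg_pos)
  finally show False by simp
qed

end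

lemma (in gram_pair) corr_lincomb_of_corr:
  assumes "\<And>i. corr (g i) (k i)" shows "corr (lincomb H g xs) (lincomb K k xs)"
proof (induction xs)
  case Nil show ?case using corr_zero by simp
next
  case (Cons p xs)
  obtain c i where "p = (c, i)" by (cases p)
  then show ?case using corr_add[OF corr_scal[OF assms[of i], of c] Cons] by simp
qed

lemma (in gram_pair) corr_left_unique:
  assumes "corr x y" "corr x' y'" "heq K y y'" shows "heq H x x'"
  using corr_norm[OF corr_diff[OF assms(1,2)]] assms(3) by (simp add: heq_def)

lemma hnorm_direct_sum: "hnorm (direct_sum H K) (x, y) = sqrt (Re (ip H x x) + Re (ip K y y))"
  by (simp add: hnorm_def direct_sum_def)

lemma direct_sum_simps [simp]:
  "vecs (direct_sum H K) = vecs H \<times> vecs K"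
  "scal (direct_sum H K) c (x, y) = (scal H c x, scal K c y)"
  "ip (direct_sum H K) (x, y) (x', y') = ip H x x' + ip K y y'"
  by (simp_all add: direct_sum_def)

lemma heq_direct_sum:
  assumes "pre_hilbert H" "pre_hilbert K" "x \<in> vecs H" "x' \<in> vecs H" "y \<in> vecs K" "y' \<in> vecs K"
  shows "heq (direct_sum H K) (x, y) (x', y') \<longleftrightarrow> heq H x x' \<and> heq K y y'"
proof -
  interpret H: pre_hilbert H by fact
  interpret K: pre_hilbert K by fact
  have "hnorm (direct_sum H K) ((x, y) - (x', y')) = sqrt ((hnorm H (x - x'))\<^sup>2 + (hnorm K (y - y'))\<^sup>2)"
    using assms by (simp add: hnorm_direct_sum H.hnorm_sq K.hnorm_sq)
  then show ?thesis by (simp add: heq_def sum_power2_eq_zero_iff)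
qed

lemma hilbert_direct_sum:
  assumes "hilbert_space H" "hilbert_space K" shows "hilbert_space (direct_sum H K)"
proof -
  interpret H: hilbert_space H by fact
  interpret K: hilbert_space K by fact
  interpret D: pre_hilbert "direct_sum H K"
    by (rule pre_hilbert_direct_sum) unfold_locales
  show ?thesis
  proof (rule hilbert_space.intro)
    fix u :: "nat \<Rightarrow> _" assume u: "\<And>n. u n \<in> vecs (direct_sum H K)"
      and cau: "\<And>e. e > 0 \<Longrightarrow> \<exists>N. \<forall>m\<ge>N. \<forall>n\<ge>N. hnorm (direct_sum H K) (u m - u n) < e"
    have uv: "fst (u n) \<in> vecs H" "snd (u n) \<in> vecs K" for n using u[of n] by (auto simp: mem_Times_iff)
    have nrm: "hnorm (direct_sum H K) p = sqrt ((hnorm H (fst p))\<^sup>2 + (hnorm K (snd p))\<^sup>2)"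
      if "fst p \<in> vecs H" "snd p \<in> vecs K" for p
      using that by (cases p) (simp add: hnorm_direct_sum H.hnorm_sq K.hnorm_sq)
    have le: "hnorm H (fst p) \<le> hnorm (direct_sum H K) p" "hnorm K (snd p) \<le> hnorm (direct_sum H K) p"
      if "fst p \<in> vecs H" "snd p \<in> vecs K" for p
      using nrm[OF that] by (auto intro!: real_le_rsqrt)
    obtain l where l: "l \<in> vecs H" "(\<lambda>n. hnorm H (fst (u n) - l)) \<longlonglongrightarrow> 0"
    proof (rule bexE[OF H.complete[of "\<lambda>n. fst (u n)"]])
      fix e :: real assume "e > 0"
      then obtain N where N: "\<forall>m\<ge>N. \<forall>n\<ge>N. hnorm (direct_sum H K) (u m - u n) < e" using cau by blast
      have "hnorm H (fst (u m) - fst (u n)) < e" if "m \<ge> N" "n \<ge> N" for m n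
        using le(1)[of "u m - u n"] N that uv by (smt (verit) H.vecs_diff K.vecs_diff fst_diff snd_diff)
      then show "\<exists>N. \<forall>m\<ge>N. \<forall>n\<ge>N. hnorm H (fst (u m) - fst (u n)) < e" by blast
    qed (use uv in auto)
    obtain k where k: "k \<in> vecs K" "(\<lambda>n. hnorm K (snd (u n) - k)) \<longlonglongrightarrow> 0"
    proof (rule bexE[OF K.complete[of "\<lambda>n. snd (u n)"]])
      fix e :: real assume "e > 0"
      then obtain N where N: "\<forall>m\<ge>N. \<forall>n\<ge>N. hnorm (direct_sum H K) (u m - u n) < e" using cau by blast
      have "hnorm K (snd (u m) - snd (u n)) < e" if "m \<ge> N" "n \<ge> N" for m n
        using le(2)[of "u m - u n"] N that uv by (smt (verit) H.vecs_diff K.vecs_diff fst_diff snd_diff)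
      then show "\<exists>N. \<forall>m\<ge>N. \<forall>n\<ge>N. hnorm K (snd (u m) - snd (u n)) < e" by blast
    qed (use uv in auto)
    have "(\<lambda>n. sqrt ((hnorm H (fst (u n) - l))\<^sup>2 + (hnorm K (snd (u n) - k))\<^sup>2)) \<longlonglongrightarrow> sqrt (0\<^sup>2 + 0\<^sup>2)"
      by (intro tendsto_intros l k)
    moreover have "hnorm (direct_sum H K) (u n - (l, k)) = sqrt ((hnorm H (fst (u n) - l))\<^sup>2 + (hnorm K (snd (u n) - k))\<^sup>2)" for n
      using nrm[of "u n - (l, k)"] uv l k by simp
    ultimately show "\<exists>l\<in>vecs (direct_sum H K). (\<lambda>n. hnorm (direct_sum H K) (u n - l)) \<longlonglongrightarrow> 0"
      using l k by (intro bexI[of _ "(l, k)"]) auto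
  qed (fact D.vector_space D.subspace D.ip_add D.ip_scal D.ip_cnj D.ip_nonneg)+
qed

section \<open>The symmetric tensor square\<close>

locale averaging_square = averaging_unitary H U f \<kappa>
  for H :: "'v::ab_group_add hilb" and U f \<kappa> +
  fixes P :: "'p::ab_group_add hilb" and t :: "'v \<Rightarrow> 'v \<Rightarrow> 'p" and W :: "'p \<Rightarrow> 'p"
  assumes tensor: "tensor_product H H P t" and tensor_op: "tensor_op H H P t U U W"

sublocale averaging_square \<subseteq> P: hilbert_space P
  using tensor by (simp add: tensor_product_def)

context averaging_square
begin

lemma t_linear: "x \<in> vecs H \<Longrightarrow> linear_op H P (t x)" "y \<in> vecs H \<Longrightarrow> linear_op H P (\<lambda>x. t x y)"
  using tensor by (auto simp: tensor_product_def)

lemma t_vecs [simp, intro]: "x \<in> vecs H \<Longrightarrow> y \<in> vecs H \<Longrightarrow> t x y \<in> vecs P"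
  using t_linear by (auto simp: linear_op_def)

lemma t_ip: "x \<in> vecs H \<Longrightarrow> x' \<in> vecs H \<Longrightarrow> y \<in> vecs H \<Longrightarrow> y' \<in> vecs H \<Longrightarrow> ip P (t x y) (t x' y') = ip H x x' * ip H y y'"
  using tensor by (auto simp: tensor_product_def)

lemma t_norm:
  assumes "x \<in> vecs H" "y \<in> vecs H" shows "hnorm P (t x y) = hnorm H x * hnorm H y"
proof -
  have "(hnorm P (t x y))\<^sup>2 = (hnorm H x * hnorm H y)\<^sup>2"
    using assms by (simp add: P.hnorm_sq t_ip ip_self power_mult_distrib)
  then show ?thesis using assms by (simp add: power2_eq_iff_nonneg)
qed

lemma t_heq:
  assumes v: "x \<in> vecs H" "x' \<in> vecs H" "y \<in> vecs H" "y' \<in> vecs H" and h: "heq H x x'" "heq H y y'"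
  shows "heq P (t x y) (t x' y')"
proof (rule P.heq_of_ip[where a = "ip H x x * ip H y y"])
  have "ip H x x' = ip H x x" "ip H x' x' = ip H x x" "ip H y y' = ip H y y" "ip H y' y' = ip H y y"
    using heq_ip_left[OF v(1,2) _ h(1)] heq_ip_right[OF v(1,2) _ h(1)]
      heq_ip_left[OF v(3,4) _ h(2)] heq_ip_right[OF v(3,4) _ h(2)] v by metis+
  then show "ip P (t x y) (t x y) = ip H x x * ip H y y" "ip P (t x y) (t x' y') = ip H x x * ip H y y"
    "ip P (t x' y') (t x' y') = ip H x x * ip H y y" using v by (simp_all add: t_ip)
qed (use v in auto)

lemma W_bounded: "bounded_op P W"
  using tensor_op by (simp add: tensor_op_def)

lemma W_linear: "linear_op P P W"
  using W_bounded by (simp add: bounded_op_def)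

lemma W_vecs [simp, intro]: "x \<in> vecs P \<Longrightarrow> W x \<in> vecs P"
  using W_linear by (auto simp: linear_op_def)

definition T2 :: "int \<times> int \<Rightarrow> 'p" where
  "T2 = (\<lambda>(a, b). t (orb f a) (orb f b))"

definition S2 :: "int \<times> int \<Rightarrow> 'p" where
  "S2 = (\<lambda>(a, b). T2 (a, b) + T2 (b, a))"

definition shift :: "int \<times> int \<Rightarrow> int \<times> int" where
  "shift = (\<lambda>(a, b). (a + 1, b + 1))"

lemma shift_simp [simp]: "shift (a, b) = (a + 1, b + 1)"
  by (simp add: shift_def)

lemma range_shift: "range (\<lambda>p. g (shift p)) = range g"
proof -
  have "surj shift" by (rule surjI[of _ "\<lambda>p. (fst p - 1, snd p - 1)"]) simp
  then show ?thesis using image_image[of g shift UNIV] by simp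
qed

lemma T2_apply: "T2 (a, b) = t (orb f a) (orb f b)"
  by (simp add: T2_def)

lemma S2_apply: "S2 (a, b) = T2 (a, b) + T2 (b, a)"
  by (simp add: S2_def)

lemma T2_vecs [simp, intro]: "T2 p \<in> vecs P"
  using f by (cases p) (simp add: T2_def)

lemma S2_vecs [simp, intro]: "S2 p \<in> vecs P"
  by (cases p) (simp add: S2_def)

lemma T2_ip: "ip P (T2 (a, b)) (T2 (a', b')) = of_real (\<kappa> (a - a') * \<kappa> (b - b'))"
  using f by (simp add: T2_def t_ip orb_corr)

lemma W_T2: "heq P (W (T2 p)) (T2 (shift p))"
proof -
  obtain a b where p: "p = (a, b)" by (cases p)
  have "heq P (W (t (orb f a) (orb f b))) (t (U (orb f a)) (U (orb f b)))"
    using tensor_op f by (simp add: tensor_op_def)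
  moreover have "heq P (t (U (orb f a)) (U (orb f b))) (t (orb f (a + 1)) (orb f (b + 1)))"
    using f by (intro t_heq orb_step) auto
  ultimately have "heq P (W (t (orb f a) (orb f b))) (t (orb f (a + 1)) (orb f (b + 1)))"
    by (rule P.heq_trans[rotated 3]) (use f in auto)
  then show ?thesis by (simp add: p T2_def)
qed

lemma W_S2: "heq P (W (S2 p)) (S2 (shift p))"
proof -
  obtain a b where p: "p = (a, b)" by (cases p)
  have "heq P (W (T2 (a, b) + T2 (b, a))) (W (T2 (a, b)) + W (T2 (b, a)))"
    using W_linear by (simp add: linear_op_def)
  moreover have "heq P (W (T2 (a, b)) + W (T2 (b, a))) (T2 (shift (a, b)) + T2 (shift (b, a)))"
    by (intro P.heq_add W_T2) auto
  ultimately have "heq P (W (T2 (a, b) + T2 (b, a))) (T2 (shift (a, b)) + T2 (shift (b, a)))"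
    by (rule P.heq_trans[rotated 3]) auto
  then show ?thesis by (simp add: p S2_def)
qed

lemma cyclic_mem: "x \<in> vecs H \<Longrightarrow> x \<in> closed_span H (range (orb f))"
  using cyclic by simp

text \<open>By cyclicity of \<open>f\<close>, membership on pairs of translates of \<open>f\<close> extends first in one argument, then in the other.\<close>

lemma bilinear_closed_span:
  assumes B: "B \<subseteq> vecs P" and base: "\<And>a b. \<beta> (orb f a) (orb f b) \<in> closed_span P B"
    and lin: "\<And>x. x \<in> vecs H \<Longrightarrow> linear_op H P (\<beta> x)" "\<And>y. y \<in> vecs H \<Longrightarrow> linear_op H P (\<lambda>x. \<beta> x y)"
    and bd: "\<And>x y. x \<in> vecs H \<Longrightarrow> y \<in> vecs H \<Longrightarrow> hnorm P (\<beta> x y) \<le> C * (hnorm H x * hnorm H y)" "0 \<le> C"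
    and x: "x \<in> vecs H" and y: "y \<in> vecs H"
  shows "\<beta> x y \<in> closed_span P B"
proof -
  have "\<beta> x (orb f b) \<in> closed_span P B" for b
  proof (rule linear_image_closed_span[OF lin(2) P.pre_hilbert_axioms, where b = "orb f" and C = "C * hnorm H (orb f b)"])
    show "hnorm P (\<beta> x (orb f b)) \<le> C * hnorm H (orb f b) * hnorm H x" if "x \<in> vecs H" for x
      using bd(1)[OF that, of "orb f b"] f by (simp add: mult_ac)
  qed (use f B base bd(2) cyclic_mem[OF x] in auto)
  then have base': "\<And>b. \<beta> x (orb f b) \<in> closed_span P B" .
  show ?thesis
  proof (rule linear_image_closed_span[OF lin(1)[OF x] P.pre_hilbert_axioms, where b = "orb f" and C = "C * hnorm H x"])
    show "hnorm P (\<beta> x y) \<le> C * hnorm H x * hnorm H y" if "y \<in> vecs H" for y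
      using bd(1)[OF x that] by (simp add: mult_ac)
  qed (use f B base' bd(2) x cyclic_mem[OF y] in auto)
qed

lemma T2_total: "closed_span P (range T2) = vecs P"
proof
  have "closed_span P {t x y |x y. x \<in> vecs H \<and> y \<in> vecs H} \<subseteq> closed_span P (range T2)"
  proof (rule P.closed_span_minimal)
    have "t x y \<in> closed_span P (range T2)" if "x \<in> vecs H" "y \<in> vecs H" for x y
    proof (rule bilinear_closed_span[where C = 1])
      show "t (orb f a) (orb f b) \<in> closed_span P (range T2)" for a b
        using P.closed_span_base[of "range T2", OF _ rangeI[of T2 "(a, b)"]] by (auto simp: T2_apply)
    qed (use that t_linear t_norm in auto)
    then show "{t x y |x y. x \<in> vecs H \<and> y \<in> vecs H} \<subseteq> closed_span P (range T2)" by auto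
  qed auto
  then show "vecs P \<subseteq> closed_span P (range T2)" using tensor by (simp add: tensor_product_def)
qed (rule P.closed_span_subset)

lemma W_unitary: "unitary_op P W"
proof (rule bounded_op_unitary[OF P.hilbert_space_axioms W_bounded, where b = T2 and b' = "\<lambda>p. T2 (shift p)"])
  show "closed_span P (range (\<lambda>p. T2 (shift p))) = vecs P" by (simp add: range_shift T2_total)
  show "ip P (T2 p) (T2 q) = ip P (T2 (shift p)) (T2 (shift q))" for p q
    by (cases p; cases q) (simp add: T2_ip)
qed (auto simp: T2_total W_T2)

abbreviation "Sq \<equiv> symmetric_square H P t"

lemma Sq_eqs [simp]: "ip Sq = ip P" "scal Sq = scal P" "hnorm Sq = hnorm P" "heq Sq = heq P"
  by (auto simp: symmetric_square_def hnorm_def heq_def fun_eq_iff)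

lemma Sq_vecs: "vecs Sq = closed_span P (range S2)"
proof
  have sub: "{t x y + t y x |x y. x \<in> vecs H \<and> y \<in> vecs H} \<subseteq> vecs P" by auto
  have "t x y + t y x \<in> closed_span P (range S2)" if "x \<in> vecs H" "y \<in> vecs H" for x y
  proof (rule bilinear_closed_span[where C = 2 and \<beta> = "\<lambda>x y. t x y + t y x"])
    show "t (orb f a) (orb f b) + t (orb f b) (orb f a) \<in> closed_span P (range S2)" for a b
      using P.closed_span_base[of "range S2", OF _ rangeI[of S2 "(a, b)"]] by (auto simp: S2_apply T2_apply)
    show "linear_op H P (\<lambda>y. t x y + t y x)" "linear_op H P (\<lambda>y. t y x + t x y)" if "x \<in> vecs H" for x
      by (intro linear_op_add P.pre_hilbert_axioms t_linear that)+
    show "hnorm P (t x y + t y x) \<le> 2 * (hnorm H x * hnorm H y)" if "x \<in> vecs H" "y \<in> vecs H" for x y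
      using P.hnorm_triangle[of "t x y" "t y x"] that by (simp add: t_norm mult.commute)
  qed (use that in auto)
  then show "vecs Sq \<subseteq> closed_span P (range S2)"
    unfolding symmetric_square_def by simp (rule P.closed_span_minimal, auto)
  have "S2 p \<in> {t x y + t y x |x y. x \<in> vecs H \<and> y \<in> vecs H}" for p
    using f by (cases p) (auto simp: S2_def T2_def)
  then show "closed_span P (range S2) \<subseteq> vecs Sq"
    unfolding symmetric_square_def using P.closed_span_base[OF sub] by simp (rule P.closed_span_minimal[OF sub], auto)
qed

lemma Sq_vecs_P: "x \<in> vecs Sq \<Longrightarrow> x \<in> vecs P"
  using Sq_vecs P.closed_span_subset by auto

lemma S2_Sq [simp, intro]: "S2 p \<in> vecs Sq"
  unfolding Sq_vecs by (rule P.closed_span_base) auto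

lemma Sq_hilbert: "hilbert_space Sq"
  unfolding symmetric_square_def by (rule P.hilbert_closed_span[OF P.hilbert_space_axioms]) auto

lemma closed_span_Sq:
  assumes "B \<subseteq> vecs Sq" shows "closed_span Sq B = closed_span P B"
proof -
  have "closed_span P B \<subseteq> vecs Sq"
    using assms unfolding Sq_vecs by (intro P.closed_span_minimal) auto
  moreover have "closed_span Sq B \<subseteq> closed_span P B" "closed_span P B \<inter> vecs Sq \<subseteq> closed_span Sq B"
    using Sq_vecs_P unfolding closed_span_def by auto
  ultimately show ?thesis by blast
qed

lemma W_Sq: "x \<in> vecs Sq \<Longrightarrow> W x \<in> vecs Sq"
proof -
  assume x: "x \<in> vecs Sq"
  obtain C where C: "\<forall>x\<in>vecs P. hnorm P (W x) \<le> C * hnorm P x"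
    using W_bounded by (auto simp: bounded_op_def)
  have bd: "hnorm P (W x) \<le> \<bar>C\<bar> * hnorm P x" if "x \<in> vecs P" for x
    using C that mult_right_mono[OF abs_ge_self, of "hnorm P x" C] by fastforce
  show ?thesis
    unfolding Sq_vecs
  proof (rule P.linear_image_closed_span[OF W_linear P.pre_hilbert_axioms _ bd, where b = S2])
    show "W (S2 p) \<in> closed_span P (range S2)" for p
      by (rule P.closed_span_heq[OF _ _ _ W_S2]) (auto intro!: P.closed_span_base)
  qed (use x Sq_vecs in auto)
qed

lemma W_bounded_Sq: "bounded_op Sq W"
proof -
  obtain C where "\<forall>x\<in>vecs P. hnorm P (W x) \<le> C * hnorm P x"
    using W_bounded by (auto simp: bounded_op_def)
  then have "\<forall>x\<in>vecs Sq. hnorm Sq (W x) \<le> C * hnorm Sq x" using Sq_vecs_P by auto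
  moreover have "linear_op Sq Sq W" using W_linear W_Sq Sq_vecs_P by (auto simp: linear_op_def)
  ultimately show ?thesis unfolding bounded_op_def by blast
qed

lemma W_unitary_Sq: "unitary_op Sq W"
proof (rule bounded_op_unitary[OF Sq_hilbert W_bounded_Sq, where b = S2 and b' = "\<lambda>p. S2 (shift p)"])
  show "closed_span Sq (range S2) = vecs Sq" by (subst closed_span_Sq) (auto simp: Sq_vecs[symmetric])
  then show "closed_span Sq (range (\<lambda>p. S2 (shift p))) = vecs Sq" by (simp add: range_shift)
  show "ip Sq (S2 p) (S2 q) = ip Sq (S2 (shift p)) (S2 (shift q))" for p q
    by (cases p; cases q) (simp add: S2_def P.ip_add P.ip_add_right T2_ip)
qed (auto simp: W_S2)

text \<open>
  The averages of \<open>r\<^sup>2 T2 (a + j, a + j)\<close> over \<open>j\<close> converge to the tensor square of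
  \<open>orb f a + orb f (a - n)\<close>, by the averaging relations squared. The difference of this vector and its
  two diagonal terms is \<open>S2 (a, a - n)\<close>.
\<close>

lemma S2_in_diagonal: "S2 (a, b) \<in> closed_span P (range (\<lambda>k. T2 (k, k)))"
proof -
  let ?Z = "closed_span P (range (\<lambda>k. T2 (k, k)))"
  have sub: "range (\<lambda>k. T2 (k, k)) \<subseteq> vecs P" by auto
  have diag: "T2 (k, k) \<in> ?Z" for k by (rule P.closed_span_base[OF sub]) auto
  have main: "S2 (a, a - n) \<in> ?Z" if n: "n \<ge> 1" for a n
  proof -
    define v where "v = T2 (a, a) + S2 (a, a - n) + T2 (a - n, a - n)"
    have vv: "v \<in> vecs P" by (auto simp: v_def)
    define G where "G = 2 * \<kappa> 0 + 2 * \<kappa> n"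
    have "v \<in> ?Z"
    proof (rule P.closed_span_limit[OF sub vv])
      fix e :: real assume e: "e > 0"
      obtain F r where F: "\<And>m. finite (F m)" "\<And>m. F m \<noteq> {}" and r: "\<And>m. real (Suc m) \<le> r m"
        and N: "\<And>m. real (Suc m) * r m ^ 4 \<le> real (card (F m))"
        and e1: "\<And>m a. a \<in> F m \<Longrightarrow> r m * \<kappa> a = \<kappa> 0 + \<kappa> n" and e2: "\<And>m a. a \<in> F m \<Longrightarrow> r m * \<kappa> (a + n) = \<kappa> 0 + \<kappa> n"
        and e3: "\<And>m a b. a \<in> F m \<Longrightarrow> b \<in> F m \<Longrightarrow> a \<noteq> b \<Longrightarrow> (r m)\<^sup>2 * \<kappa> (a - b) = 2 * \<kappa> 0 + 2 * \<kappa> n"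
        using avg_sequence[OF n] by blast
      obtain m where m: "(\<kappa> 0)\<^sup>2 / e\<^sup>2 < real m" using reals_Archimedean2 by blast
      define u where "u j = scal P (of_real ((r m)\<^sup>2)) (T2 (a + j, a + j))" for j
      let ?w = "scal P (1 / of_nat (card (F m))) (sum u (F m))"
      have uv: "u j \<in> vecs P" for j by (auto simp: u_def)
      have wZ: "?w \<in> ?Z" unfolding u_def by (intro P.closed_span_scal P.closed_span_sum sub diag)
      have "(hnorm P (?w - v))\<^sup>2 = (r m ^ 4 * (\<kappa> 0)\<^sup>2 - G\<^sup>2) / card (F m)"
      proof (rule P.average_close[OF F uv vv])
        show "ip P (u j) (u j) = of_real (r m ^ 4 * (\<kappa> 0)\<^sup>2)" for j
          by (simp add: u_def P.ip_scal P.ip_scal_right T2_ip power2_eq_square eval_nat_numeral)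
        show "ip P (u j) (u k) = of_real (G\<^sup>2)" if "j \<in> F m" "k \<in> F m" "j \<noteq> k" for j k
        proof -
          have "ip P (u j) (u k) = of_real (((r m)\<^sup>2 * \<kappa> (j - k))\<^sup>2)"
            by (simp add: u_def P.ip_scal P.ip_scal_right T2_ip power2_eq_square)
          then show ?thesis using e3[OF that] by (simp add: G_def)
        qed
        show "ip P (u j) v = of_real (G\<^sup>2)" if "j \<in> F m" for j
        proof -
          have "ip P (u j) v = of_real ((r m * \<kappa> j + r m * \<kappa> (j + n))\<^sup>2)"
            by (simp add: u_def v_def S2_def P.ip_scal P.ip_add_right T2_ip power2_eq_square algebra_simps)
          then show ?thesis using e1[OF that] e2[OF that] by (simp add: G_def)
        qed
        show "ip P v v = of_real (G\<^sup>2)"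
          by (simp add: v_def S2_def P.ip_add P.ip_add_right T2_ip G_def power2_eq_square algebra_simps \<kappa>_minus)
      qed
      also have "\<dots> \<le> r m ^ 4 * (\<kappa> 0)\<^sup>2 / card (F m)" by (intro divide_right_mono) auto
      also have "\<dots> \<le> 1 / real (Suc m) * (\<kappa> 0)\<^sup>2"
        using mult_right_mono[OF ratio_small(1)[OF r N], of "(\<kappa> 0)\<^sup>2" m] by simp
      also have "\<dots> < e\<^sup>2"
      proof -
        have "(\<kappa> 0)\<^sup>2 < real m * e\<^sup>2" using m e by (simp add: pos_divide_less_eq)
        also have "\<dots> \<le> real (Suc m) * e\<^sup>2" by (intro mult_right_mono) auto
        finally show ?thesis by (simp add: field_simps)
      qed
      finally have "hnorm P (?w - v) < e" using e by (simp add: power2_less_imp_less)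
      moreover have "?w \<in> vecs P" using wZ P.closed_span_subset by blast
      ultimately have "hnorm P (v - ?w) < e"
        using P.hnorm_minus_commute[OF vv, of ?w] by simp
      then show "\<exists>y\<in>?Z. hnorm P (v - y) < e" using wZ by blast
    qed
    then have "v - T2 (a, a) - T2 (a - n, a - n) \<in> ?Z" by (intro P.closed_span_diff sub diag)
    then show ?thesis by (simp add: v_def algebra_simps)
  qed
  have swap: "S2 (a, b) = S2 (b, a)" by (simp add: S2_def add.commute)
  consider "a = b" | "a - b \<ge> 1" | "b - a \<ge> 1" by linarith
  then show ?thesis
  proof cases
    case 1 then show ?thesis by (auto simp: S2_def intro!: P.closed_span_add sub diag)
  next
    case 2 then show ?thesis using main[of "a - b" a] by simp
  next
    case 3 then show ?thesis using main[of "b - a" b] swap by simp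
  qed
qed

text \<open>
  The orbit of \<open>T2 (0, 0)\<close> is the diagonal family \<open>T2 (k, k)\<close>, so this vector is cyclic.
\<close>

theorem simple_Sq: "simple_spectrum Sq W"
proof -
  interpret Q: hilbert_space Sq by (rule Sq_hilbert)
  interpret Q: unitary_pre Sq W by unfold_locales (rule W_unitary_Sq)
  have dS: "T2 (k, k) \<in> vecs Sq" for k
  proof -
    have "scal P (1 / 2) (S2 (k, k)) = T2 (k, k)"
      by (simp add: S2_def P.V.scale_right_distrib P.V.scale_left_distrib[symmetric])
    then show ?thesis using Q.vecs_scal[OF S2_Sq, of "1/2" "(k, k)"] by simp
  qed
  have orb: "heq P (Q.orb (T2 (0, 0)) k) (T2 (k, k))" for k
    using Q.orb_unique[OF dS, of "\<lambda>k. T2 (k, k)" 0 k] dS W_T2 by fastforce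
  have rv: "range (Q.orb (T2 (0, 0))) \<subseteq> vecs Sq" by (rule Q.orb_range_vecs[OF dS])
  have "T2 (k, k) \<in> closed_span Sq (range (Q.orb (T2 (0, 0))))" for k
  proof (rule Q.closed_span_heq[OF rv dS Q.orb_in_cyc[OF dS]])
    show "heq Sq (T2 (k, k)) (Q.orb (T2 (0, 0)) k)"
      using orb[of k] Q.heq_sym[of "Q.orb (T2 (0, 0)) k" "T2 (k, k)"] dS by simp
  qed
  then have "closed_span Sq (range (\<lambda>k. T2 (k, k))) \<subseteq> closed_span Sq (range (Q.orb (T2 (0, 0))))"
    by (intro Q.closed_span_minimal rv) auto
  moreover have "vecs Sq \<subseteq> closed_span Sq (range (\<lambda>k. T2 (k, k)))"
  proof -
    have "vecs Sq \<subseteq> closed_span P (range (\<lambda>k. T2 (k, k)))"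
      unfolding Sq_vecs using S2_in_diagonal by (intro P.closed_span_minimal) auto
    then show ?thesis using dS by (subst closed_span_Sq) auto
  qed
  ultimately have "closed_span Sq (range (Q.orb (T2 (0, 0)))) = vecs Sq"
    using Q.closed_span_subset by blast
  then show ?thesis
    unfolding simple_spectrum_def using W_unitary_Sq dS[of 0] by blast
qed

end

section \<open>The tensor square as two copies of the symmetric square\<close>

lemma (in finite_measure) bounded_multiplier:
  assumes g: "g \<in> borel_measurable M" "\<And>p. p \<in> space M \<Longrightarrow> cmod (g p) \<le> 1"
  shows "linear_op (L2 M) (L2 M) (\<lambda>f p. g p * f p)"
    and "\<And>f. f \<in> vecs (L2 M) \<Longrightarrow> hnorm (L2 M) (\<lambda>p. g p * f p) \<le> 1 * hnorm (L2 M) f"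
proof -
  have [measurable]: "g \<in> borel_measurable M" by fact
  have le: "(cmod (g p * f p))\<^sup>2 \<le> (cmod (f p))\<^sup>2" if "p \<in> space M" for f p
    using mult_right_mono[OF g(2)[OF that], of "cmod (f p)"] by (intro power_mono) (auto simp: norm_mult)
  have v: "(\<lambda>p. g p * f p) \<in> vecs (L2 M)" if f: "f \<in> vecs (L2 M)" for f
  proof -
    have [measurable]: "f \<in> borel_measurable M" using f by simp
    have "integrable M (\<lambda>p. (cmod (g p * f p))\<^sup>2)"
    proof (rule Bochner_Integration.integrable_bound)
      show "integrable M (\<lambda>p. (cmod (f p))\<^sup>2)" using f by simp
      show "AE p in M. norm ((cmod (g p * f p))\<^sup>2) \<le> norm ((cmod (f p))\<^sup>2)"
        using le by (intro AE_I2) simp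
    qed measurable
    then show ?thesis by simp
  qed
  show "linear_op (L2 M) (L2 M) (\<lambda>f p. g p * f p)"
    unfolding linear_op_def
  proof (intro conjI ballI allI)
    fix f k c assume f: "f \<in> vecs (L2 M)"
    show "(\<lambda>p. g p * f p) \<in> vecs (L2 M)" by (rule v[OF f])
    show "heq (L2 M) (\<lambda>p. g p * scal (L2 M) c f p) (scal (L2 M) c (\<lambda>p. g p * f p))"
      by (rule heq_L2) (simp add: mult_ac)
    show "heq (L2 M) (\<lambda>p. g p * (f + k) p) ((\<lambda>p. g p * f p) + (\<lambda>p. g p * k p))"
      by (rule heq_L2) (simp add: distrib_left)
  qed
  show "hnorm (L2 M) (\<lambda>p. g p * f p) \<le> 1 * hnorm (L2 M) f" if f: "f \<in> vecs (L2 M)" for f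
  proof -
    have "(hnorm (L2 M) (\<lambda>p. g p * f p))\<^sup>2 \<le> (hnorm (L2 M) f)\<^sup>2"
      unfolding hnorm_L2_sq
    proof (rule integral_mono)
      show "integrable M (\<lambda>p. (cmod (g p * f p))\<^sup>2)" using v[OF f] by simp
      show "integrable M (\<lambda>p. (cmod (f p))\<^sup>2)" using f by simp
    qed (rule le)
    from power2_le_imp_le[OF this L2.hnorm_nonneg[OF f]] show ?thesis by (simp only: mult_1_left)
  qed
qed

text \<open>
  The Newton-Schulz iteration for the sign. Its steps are odd polynomials, and it converges on the interval
  from -1 to 1.
\<close>

fun sgn_iter :: "nat \<Rightarrow> real \<Rightarrow> real" where
  "sgn_iter 0 x = x"
| "sgn_iter (Suc n) x = (3 * sgn_iter n x - sgn_iter n x ^ 3) / 2"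

lemma sgn_iter_minus: "sgn_iter n (- x) = - sgn_iter n x"
  by (induction n) (auto simp: power3_eq_cube field_simps)

lemma sgn_iter_bounds:
  assumes "0 < x" "x \<le> 1"
  shows "0 < sgn_iter n x \<and> sgn_iter n x \<le> 1"
proof (induction n)
  case (Suc n)
  define y where "y = sgn_iter n x"
  have y: "0 < y" "y \<le> 1" using Suc by (auto simp: y_def)
  have "y ^ 3 \<le> y" using y power_decreasing[of 1 3 y] by simp
  moreover have "0 \<le> (1 - y)\<^sup>2 * (y + 2)" using y by simp
  moreover have "(1 - y)\<^sup>2 * (y + 2) = y ^ 3 - 3 * y + 2"
    by (simp add: power2_eq_square power3_eq_cube algebra_simps)
  ultimately show ?case using y by (simp add: y_def[symmetric])
qed (use assms in simp)

lemma sgn_iter_lim: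
  assumes "\<bar>x\<bar> \<le> 1" shows "(\<lambda>n. sgn_iter n x) \<longlonglongrightarrow> sgn x"
proof -
  have main: "(\<lambda>n. sgn_iter n x) \<longlonglongrightarrow> 1" if x: "0 < x" "x \<le> 1" for x
  proof -
    note b = sgn_iter_bounds[OF x]
    have inc: "sgn_iter n x \<le> sgn_iter (Suc n) x" for n
    proof -
      have "sgn_iter n x ^ 3 \<le> sgn_iter n x" using b[of n] power_decreasing[of 1 3 "sgn_iter n x"] by simp
      then show ?thesis by simp
    qed
    obtain L where L: "(\<lambda>n. sgn_iter n x) \<longlonglongrightarrow> L" "\<And>n. sgn_iter n x \<le> L"
      using incseq_convergent[of "\<lambda>n. sgn_iter n x" 1] b inc by (auto simp: incseq_Suc_iff)
    have "(\<lambda>n. (3 * sgn_iter n x - sgn_iter n x ^ 3) / 2) \<longlonglongrightarrow> (3 * L - L ^ 3) / 2"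
      by (intro tendsto_intros L) auto
    moreover have "(\<lambda>n. (3 * sgn_iter n x - sgn_iter n x ^ 3) / 2) \<longlonglongrightarrow> L"
      using LIMSEQ_Suc[OF L(1)] by simp
    ultimately have "(3 * L - L ^ 3) / 2 = L" by (rule LIMSEQ_unique)
    then have "L * (1 - L) * (1 + L) = 0" by (simp add: power3_eq_cube algebra_simps)
    moreover have "0 < L" using L(2)[of 0] x by simp
    ultimately show ?thesis using L(1) by (auto simp: add_eq_0_iff)
  qed
  consider "x = 0" | "x > 0" | "x < 0" by linarith
  then show ?thesis
  proof cases
    case 1
    have "sgn_iter n 0 = 0" for n by (induction n) auto
    then show ?thesis using 1 by simp
  next
    case 2 then show ?thesis using main[of x] assms by simp
  next
    case 3
    then have "(\<lambda>n. - sgn_iter n (- x)) \<longlonglongrightarrow> - 1" using main[of "- x"] assms by (intro tendsto_minus) auto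
    then show ?thesis using 3 by (simp add: sgn_iter_minus)
  qed
qed

lemma sgn_iter_abs: "\<bar>x\<bar> \<le> 1 \<Longrightarrow> \<bar>sgn_iter n x\<bar> \<le> 1"
  using sgn_iter_bounds[of x n] sgn_iter_bounds[of "- x" n] sgn_iter_minus[of n x]
  by (cases "x = 0"; cases "x > 0") (auto simp: abs_le_iff less_le)

text \<open>
  The two copies are the symmetric and the antisymmetric part. In the spectral representation on
  \<open>\<sigma> \<otimes> \<sigma>\<close> they are exchanged by \<open>phase\<close>, the sign of \<open>Im (z cnj w)\<close>. Multiplication by the
  trigonometric polynomial \<open>imag = Im (z cnj w)\<close> exchanges the two parts already on the level of
  monomials; so does every odd polynomial of \<open>imag\<close>, and \<open>phase\<close> is a limit of such.
\<close>

locale circle_square =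
  fixes \<sigma> :: "complex measure" and \<kappa> :: "int \<Rightarrow> real"
  assumes circle: "circle_measure \<sigma>" and coeff: "(LINT z|\<sigma>. z powi k) = of_real (\<kappa> k)"
    and decay: "(\<lambda>k. \<kappa> (int k)) \<longlonglongrightarrow> 0" and symm: "\<kappa> (- k) = \<kappa> k"
begin

abbreviation "M \<equiv> \<sigma> \<Otimes>\<^sub>M \<sigma>"

definition mono2 :: "int \<times> int \<Rightarrow> complex \<times> complex \<Rightarrow> complex" where
  "mono2 = (\<lambda>(a, b) p. fst p powi a * snd p powi b)"

definition sym2 :: "int \<times> int \<Rightarrow> complex \<times> complex \<Rightarrow> complex" where
  "sym2 = (\<lambda>(a, b). mono2 (a, b) + mono2 (b, a))"

definition alt2 :: "int \<times> int \<Rightarrow> complex \<times> complex \<Rightarrow> complex" where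
  "alt2 = (\<lambda>(a, b). mono2 (a, b) - mono2 (b, a))"

definition imag :: "complex \<times> complex \<Rightarrow> real" where
  "imag p = Im (fst p * cnj (snd p))"

sublocale finite_measure M by (rule circle_square_finite[OF circle])

lemma space_M: "p \<in> space M \<longleftrightarrow> fst p \<in> sphere 0 1 \<and> snd p \<in> sphere 0 1"
  by (cases p) (simp add: space_pair_measure circle_measureD(3)[OF circle])

lemma mono2_bound: "p \<in> space M \<Longrightarrow> cmod (mono2 i p) = 1"
  by (cases i) (simp add: mono2_def space_M norm_mult norm_powi_circle)

lemma mono2_vecs [simp, intro]: "mono2 i \<in> vecs (L2 M)"
proof (rule bounded_in_L2[where B = 1])
  show "mono2 i \<in> borel_measurable M"
    using circle_square_monomials(1)[OF circle, of "fst i" "snd i"] by (simp add: mono2_def case_prod_beta)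
qed (simp add: mono2_bound)

lemma mono2_ip: "ip (L2 M) (mono2 (a, b)) (mono2 (a', b')) = of_real (\<kappa> (a - a') * \<kappa> (b - b'))"
proof -
  have "mono2 (a, b) p * cnj (mono2 (a', b') p) = fst p powi (a - a') * snd p powi (b - b')" if "p \<in> space M" for p
  proof -
    have "mono2 (a, b) p * cnj (mono2 (a', b') p) = (fst p powi a * cnj (fst p powi a')) * (snd p powi b * cnj (snd p powi b'))"
      by (simp add: mono2_def)
    then show ?thesis using that by (simp only: powi_cnj_circle space_M)
  qed
  then have "ip (L2 M) (mono2 (a, b)) (mono2 (a', b')) = (LINT p|M. fst p powi (a - a') * snd p powi (b - b'))"
    unfolding L2_simps by (intro Bochner_Integration.integral_cong) auto
  then show ?thesis using circle_square_monomials(3)[OF circle] coeff by simp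
qed

lemma sym2_alt2_vecs [simp, intro]: "sym2 i \<in> vecs (L2 M)" "alt2 i \<in> vecs (L2 M)"
  unfolding sym2_def alt2_def case_prod_beta by (intro L2.vecs_add L2.vecs_diff mono2_vecs)+

lemmas sym2_alt2_L2 [simp] = sym2_alt2_vecs[unfolded L2_simps] mono2_vecs[unfolded L2_simps]

lemma imag_bound: "p \<in> space M \<Longrightarrow> \<bar>imag p\<bar> \<le> 1"
  using abs_Im_le_cmod[of "fst p * cnj (snd p)"] by (simp add: imag_def space_M norm_mult)

lemma imag_measurable [measurable]: "imag \<in> borel_measurable M"
proof -
  have [measurable]: "(\<lambda>z. z) \<in> borel_measurable \<sigma>"
    using measurable_powi_circle[OF circle, of 1] by simp
  have "(\<lambda>p. Im (fst p * cnj (snd p))) \<in> borel_measurable M"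
    by measurable
  then show ?thesis by (simp add: imag_def[abs_def])
qed

lemma imag_mono2:
  assumes p: "p \<in> space M"
  shows "of_real (imag p) * mono2 (a, b) p = (mono2 (a + 1, b - 1) p - mono2 (a - 1, b + 1) p) / (2 * \<i>)"
proof -
  define z w where "z = fst p" and "w = snd p"
  have zw: "z \<in> sphere 0 1" "w \<in> sphere 0 1" using p by (auto simp: z_def w_def space_M)
  have nz: "z \<noteq> 0" "w \<noteq> 0" using zw by auto
  have inv: "cnj z = inverse z" "cnj w = inverse w"
    using zw by (simp_all add: inverse_complex_def complex_eq_iff cmod_def)
  have im: "of_real (Im u) = (u - cnj u) / (2 * \<i>)" for u by (simp add: complex_eq_iff)
  have "of_real (imag p) = (z * cnj w - cnj (z * cnj w)) / (2 * \<i>)"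
    unfolding imag_def z_def w_def by (rule im)
  also have "\<dots> = (z * cnj w - cnj z * w) / (2 * \<i>)" by simp
  finally have "of_real (imag p) = (z * inverse w - inverse z * w) / (2 * \<i>)" by (simp only: inv)
  moreover have "mono2 (a + 1, b - 1) p = z * inverse w * mono2 (a, b) p" "mono2 (a - 1, b + 1) p = inverse z * w * mono2 (a, b) p"
    using nz by (simp_all add: mono2_def z_def[symmetric] w_def[symmetric] power_int_add power_int_diff divide_inverse)
  ultimately show ?thesis by (simp only: times_divide_eq_left left_diff_distrib)
qed

abbreviation "cs b \<equiv> closed_span (L2 M) (range b)"

lemma range_vecs: "range sym2 \<subseteq> vecs (L2 M)" "range alt2 \<subseteq> vecs (L2 M)"
  by auto

lemma imag_exchange:
  "(\<lambda>p. of_real (imag p) * sym2 i p) \<in> cs alt2" "(\<lambda>p. of_real (imag p) * alt2 i p) \<in> cs sym2"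
proof -
  obtain a b where i: "i = (a, b)" by (cases i)
  have c: "of_real c * x = c *\<^sub>R (x::complex)" for c x by (simp add: scaleR_conv_of_real)
  let ?L = "\<lambda>f p. of_real (imag p) * f p"
  have L: "?L f \<in> vecs (L2 M)" if "f \<in> vecs (L2 M)" for f
    using bounded_multiplier(1)[of "\<lambda>p. of_real (imag p)"] that imag_bound by (auto simp: linear_op_def)
  let ?s = "scal (L2 M) (1 / (2 * \<i>)) (alt2 (a + 1, b - 1) - alt2 (a - 1, b + 1))"
  have "?s \<in> cs alt2"
    by (intro L2.closed_span_scal L2.closed_span_diff L2.closed_span_base range_vecs rangeI)
  moreover have "heq (L2 M) (?L (sym2 i)) ?s"
    by (rule heq_L2, rule AE_I2)
      (simp add: i sym2_def alt2_def distrib_left imag_mono2 diff_divide_distrib add_divide_distrib algebra_simps)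
  ultimately show "?L (sym2 i) \<in> cs alt2"
    by (intro L2.closed_span_heq[OF range_vecs(2) L]) auto
  let ?s = "scal (L2 M) (1 / (2 * \<i>)) (sym2 (a + 1, b - 1) - sym2 (a - 1, b + 1))"
  have "?s \<in> cs sym2"
    by (intro L2.closed_span_scal L2.closed_span_diff L2.closed_span_base range_vecs rangeI)
  moreover have "heq (L2 M) (?L (alt2 i)) ?s"
    by (rule heq_L2, rule AE_I2)
      (simp add: i sym2_def alt2_def right_diff_distrib imag_mono2 diff_divide_distrib add_divide_distrib algebra_simps)
  ultimately show "?L (alt2 i) \<in> cs sym2"
    by (intro L2.closed_span_heq[OF range_vecs(1) L]) auto
qed

text \<open>
  Three exchanges in a row are an exchange again, so the exchange passes from \<open>X\<close> to \<open>(3 X - X\<^sup>3) / 2\<close>.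
\<close>

lemma sgn_iter_exchange:
  "(f \<in> cs sym2 \<longrightarrow> (\<lambda>p. of_real (sgn_iter n (imag p)) * f p) \<in> cs alt2) \<and>
   (f \<in> cs alt2 \<longrightarrow> (\<lambda>p. of_real (sgn_iter n (imag p)) * f p) \<in> cs sym2)"
proof (induction n arbitrary: f)
  case 0
  have bd: "cmod (of_real (imag p)) \<le> 1" if "p \<in> space M" for p using imag_bound[OF that] by simp
  have m: "(\<lambda>p. complex_of_real (imag p)) \<in> borel_measurable M" by measurable
  note mult = bounded_multiplier[OF m bd]
  have "(\<lambda>p. of_real (imag p) * f p) \<in> cs alt2" if "f \<in> cs sym2"
    by (rule L2.linear_image_closed_span[OF mult(1) pre_hilbert_L2 _ mult(2) _ range_vecs(2) imag_exchange(1) that]) auto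
  moreover have "(\<lambda>p. of_real (imag p) * f p) \<in> cs sym2" if "f \<in> cs alt2"
    by (rule L2.linear_image_closed_span[OF mult(1) pre_hilbert_L2 _ mult(2) _ range_vecs(1) imag_exchange(2) that]) auto
  ultimately show ?case by simp
next
  case (Suc n)
  let ?X = "\<lambda>f p. complex_of_real (sgn_iter n (imag p)) * f p"
  have eq: "(\<lambda>p. complex_of_real (sgn_iter (Suc n) (imag p)) * f p) = scal (L2 M) (3 / 2) (?X f) - scal (L2 M) (1 / 2) (?X (?X (?X f)))" for f
    by (rule ext) (simp add: power3_eq_cube field_simps)
  have step: "scal (L2 M) (3 / 2) x - scal (L2 M) (1 / 2) y \<in> closed_span (L2 M) B"
    if "B \<subseteq> vecs (L2 M)" "x \<in> closed_span (L2 M) B" "y \<in> closed_span (L2 M) B" for x y B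
    by (intro L2.closed_span_diff L2.closed_span_scal that)
  show ?case
    unfolding eq using Suc by (intro conjI impI step range_vecs) blast+
qed

definition phase :: "complex \<times> complex \<Rightarrow> complex" where
  "phase p = of_real (sgn (imag p))"

lemma phase_measurable [measurable]: "phase \<in> borel_measurable M"
proof -
  have "(\<lambda>p. complex_of_real (sgn (imag p))) \<in> borel_measurable M" by measurable
  then show ?thesis by (simp add: phase_def[abs_def])
qed

lemma phase_bound: "cmod (phase p) \<le> 1"
  by (simp add: phase_def sgn_if)

lemmas phase_multiplier = bounded_multiplier[OF phase_measurable phase_bound]

lemma phase_vecs: "f \<in> vecs (L2 M) \<Longrightarrow> (\<lambda>p. phase p * f p) \<in> vecs (L2 M)"
  using phase_multiplier(1) by (auto simp: linear_op_def)

lemma phase_limit: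
  assumes f: "f \<in> vecs (L2 M)" and B: "B \<subseteq> vecs (L2 M)"
    and mem: "\<And>n. (\<lambda>p. of_real (sgn_iter n (imag p)) * f p) \<in> closed_span (L2 M) B"
  shows "(\<lambda>p. phase p * f p) \<in> closed_span (L2 M) B"
proof (rule L2.closed_span_limit[OF B phase_vecs[OF f]])
  fix e :: real assume e: "e > 0"
  let ?f = "\<lambda>n p. of_real (sgn_iter n (imag p)) * f p"
  have fv: "?f n \<in> vecs (L2 M)" for n using mem L2.closed_span_subset by blast
  have "(\<lambda>n. hnorm (L2 M) (?f n - (\<lambda>p. phase p * f p))) \<longlonglongrightarrow> 0"
  proof (rule L2_dominated_limit[OF fv phase_vecs[OF f] _ f])
    show "AE p in M. (\<lambda>n. ?f n p) \<longlonglongrightarrow> phase p * f p"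
      unfolding phase_def using imag_bound by (intro AE_I2 tendsto_intros sgn_iter_lim) auto
    show "AE p in M. cmod (?f n p) \<le> cmod (f p)" for n
      using sgn_iter_abs[OF imag_bound] by (intro AE_I2) (auto simp: norm_mult intro!: mult_left_le_one_le)
  qed
  from order_tendstoD(2)[OF this e] obtain n where "hnorm (L2 M) (?f n - (\<lambda>p. phase p * f p)) < e"
    by (auto simp: eventually_sequentially)
  then have "hnorm (L2 M) ((\<lambda>p. phase p * f p) - ?f n) < e"
    using L2.hnorm_minus_commute[OF fv phase_vecs[OF f]] by simp
  then show "\<exists>y\<in>closed_span (L2 M) B. hnorm (L2 M) ((\<lambda>p. phase p * f p) - y) < e"
    using mem by blast
qed

lemma phase_exchange:
  "f \<in> cs sym2 \<Longrightarrow> (\<lambda>p. phase p * f p) \<in> cs alt2"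
  "f \<in> cs alt2 \<Longrightarrow> (\<lambda>p. phase p * f p) \<in> cs sym2"
proof -
  show "f \<in> cs sym2 \<Longrightarrow> (\<lambda>p. phase p * f p) \<in> cs alt2"
    using sgn_iter_exchange[of f] L2.closed_span_subset by (intro phase_limit range_vecs) blast+
  show "f \<in> cs alt2 \<Longrightarrow> (\<lambda>p. phase p * f p) \<in> cs sym2"
    using sgn_iter_exchange[of f] L2.closed_span_subset by (intro phase_limit range_vecs) blast+
qed

text \<open>
  On the zero set \<open>Z\<close> of \<open>imag\<close> the square of \<open>z cnj w\<close> is 1, so the indicator of \<open>Z\<close> is orthogonal to
  all differences of consecutive powers of this square. By decay of the coefficients these
  differences span the constants.
\<close>

lemma imag_nonzero: "AE p in M. imag p \<noteq> 0"
proof -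
  define Z where "Z = {p \<in> space M. imag p = 0}"
  have Z: "Z \<in> sets M" unfolding Z_def by measurable
  define v where "v k = mono2 (2 * int k, - 2 * int k)" for k :: nat
  have indv: "(\<lambda>p. indicator Z p :: complex) \<in> vecs (L2 M)"
    using Z by (intro bounded_in_L2[where B = 1]) (auto simp: indicator_def)
  have vZ: "v k p = 1" if "p \<in> Z" for k p
  proof -
    define z w where "z = fst p" and "w = snd p"
    have zw: "z \<in> sphere 0 1" "w \<in> sphere 0 1" and im: "Im (z * cnj w) = 0"
      using that by (auto simp: z_def w_def space_M Z_def imag_def)
    define u where "u = z * cnj w"
    have "cmod u = 1" using zw by (simp add: u_def norm_mult)
    moreover have ur: "u = of_real (Re u)" using im by (simp add: u_def complex_eq_iff)
    ultimately have "\<bar>Re u\<bar> = 1" by (metis norm_of_real)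
    then have "(Re u)\<^sup>2 = 1" by (metis power2_abs one_power2)
    then have "u\<^sup>2 = 1" by (subst ur, subst of_real_power[symmetric]) simp
    then have "(z * cnj w)\<^sup>2 = 1" by (simp only: u_def)
    moreover have "cnj w = inverse w" using zw(2) by (simp add: inverse_complex_def complex_eq_iff cmod_def)
    ultimately have sq: "z\<^sup>2 * inverse w ^ 2 = 1" by (simp add: power_mult_distrib)
    have "v k p = (z powi 2) ^ k * (w powi (- 2)) ^ k"
      by (simp only: v_def mono2_def prod.case z_def w_def power_int_mult power_int_of_nat)
    also have "w powi (- 2) = inverse w ^ 2" by (simp add: power_int_minus power_inverse)
    finally have "v k p = (z\<^sup>2 * inverse w ^ 2) ^ k" by (simp add: power_mult_distrib)
    then show ?thesis by (simp add: sq)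
  qed
  have vv: "v k \<in> vecs (L2 M)" for k by (simp add: v_def del: L2_simps)
  let ?B = "range (\<lambda>k. v k - scal (L2 M) 1 (v (Suc k)))"
  have B: "?B \<subseteq> vecs (L2 M)" using vv by (auto simp del: L2_simps)
  have "v 0 \<in> closed_span (L2 M) ?B"
  proof (rule L2.telescoping_closed_span[OF B vv, where a = 1 and c = "\<lambda>k. (\<kappa> (int (2 * k)))\<^sup>2"])
    show "v k - scal (L2 M) 1 (v (Suc k)) \<in> closed_span (L2 M) ?B" for k
      by (rule L2.closed_span_base[OF B]) auto
    show "cmod (ip (L2 M) (v k) (v l)) \<le> (\<kappa> (int (2 * (l - k))))\<^sup>2" if "k \<le> l" for k l
    proof -
      have "2 * int k - 2 * int l = - int (2 * (l - k))" "- 2 * int k - - 2 * int l = int (2 * (l - k))"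
        using that by (simp_all add: of_nat_diff)
      then show ?thesis unfolding v_def mono2_ip by (simp only: symm) (simp add: power2_eq_square norm_mult del: of_nat_mult)
    qed
    have "(\<lambda>k. \<kappa> (int (2 * k))) \<longlonglongrightarrow> 0"
    proof -
      have "strict_mono (\<lambda>k::nat. 2 * k)" by (simp add: strict_mono_def)
      from LIMSEQ_subseq_LIMSEQ[OF decay this] show ?thesis by (simp add: comp_def)
    qed
    from tendsto_power[OF this, of 2] show "(\<lambda>k. (\<kappa> (int (2 * k)))\<^sup>2) \<longlonglongrightarrow> 0" by simp
  qed simp
  then have "ip (L2 M) (v 0) (\<lambda>p. indicator Z p) = 0"
  proof (rule L2.closed_span_orthogonal[OF B indv, rotated])
    fix b assume "b \<in> ?B"
    then obtain k where b: "b = v k - scal (L2 M) 1 (v (Suc k))" by auto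
    have "b p * cnj (indicator Z p :: complex) = 0" for p
      using vZ[of p k] vZ[of p "Suc k"] by (cases "p \<in> Z") (auto simp: b)
    then have "(\<lambda>p. b p * cnj (indicator Z p :: complex)) = (\<lambda>p. 0)" by (rule ext)
    then show "ip (L2 M) b (\<lambda>p. indicator Z p) = 0" by (simp only: L2_simps integral_zero)
  qed
  moreover have "v 0 p * cnj (indicator Z p) = of_real (indicator Z p)" for p
    by (simp add: v_def mono2_def indicator_def)
  ultimately have "(LINT p|M. of_real (indicator Z p)) = (0::complex)" by (simp only: L2_simps)
  then have "measure M Z = 0" using Z by simp
  then have "Z \<in> null_sets M" using Z by (simp add: null_sets_def emeasure_eq_measure)
  then have "AE p in M. p \<notin> Z" by (rule AE_not_in)
  then show ?thesis using AE_space by eventually_elim (simp add: Z_def)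
qed

lemma phase_square: "AE p in M. phase p * phase p = 1"
  using imag_nonzero by eventually_elim (auto simp: phase_def sgn_if)

lemma phase_isometry:
  assumes "f \<in> vecs (L2 M)" "g \<in> vecs (L2 M)"
  shows "ip (L2 M) (\<lambda>p. phase p * f p) (\<lambda>p. phase p * g p) = ip (L2 M) f g"
  unfolding L2_simps
proof (rule integral_cong_AE)
  have [measurable]: "f \<in> borel_measurable M" "g \<in> borel_measurable M" using assms by auto
  show "(\<lambda>p. phase p * f p * cnj (phase p * g p)) \<in> borel_measurable M" "(\<lambda>p. f p * cnj (g p)) \<in> borel_measurable M"
    by measurable
  have c: "cnj (phase p) = phase p" for p by (simp add: phase_def)
  show "AE p in M. phase p * f p * cnj (phase p * g p) = f p * cnj (g p)"
    using phase_square
  proof eventually_elim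
    case (elim p)
    have "phase p * f p * cnj (phase p * g p) = (phase p * phase p) * (f p * cnj (g p))" by (simp add: c)
    then show ?case using elim by simp
  qed
qed

text \<open>
  The square of \<open>phase\<close> is 1, so \<open>sym2 i\<close> is \<open>phase\<close> times a limit of antisymmetric functions.
\<close>

lemma sym2_from_phase: "sym2 i \<in> cs (\<lambda>i p. phase p * alt2 i p)"
proof -
  have r: "range (\<lambda>i p. phase p * alt2 i p) \<subseteq> vecs (L2 M)" using phase_vecs sym2_alt2_vecs by blast
  have "sym2 i \<in> cs sym2" by (rule L2.closed_span_base[OF range_vecs(1)]) simp
  then have h: "(\<lambda>p. phase p * sym2 i p) \<in> cs alt2" by (rule phase_exchange)
  have "(\<lambda>p. phase p * (phase p * sym2 i p)) \<in> cs (\<lambda>i p. phase p * alt2 i p)"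
  proof (rule L2.linear_image_closed_span[OF phase_multiplier(1) pre_hilbert_L2 _ phase_multiplier(2) sym2_alt2_vecs(2) r])
    show "(\<lambda>p. phase p * alt2 i p) \<in> cs (\<lambda>i p. phase p * alt2 i p)" for i
      by (rule L2.closed_span_base[OF r]) blast
  qed (use h in auto)
  moreover have "heq (L2 M) (sym2 i) (\<lambda>p. phase p * (phase p * sym2 i p))"
  proof (rule heq_L2)
    show "AE p in M. sym2 i p = phase p * (phase p * sym2 i p)"
      using phase_square
    proof eventually_elim
      case (elim p)
      have "phase p * (phase p * sym2 i p) = (phase p * phase p) * sym2 i p" by (rule mult.assoc[symmetric])
      then show ?case by (simp only: elim mult_1_left)
    qed
  qed
  ultimately show ?thesis by (rule L2.closed_span_heq[OF r sym2_alt2_vecs(1)])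
qed

end

context averaging_square
begin

text \<open>
  Transport \<open>phase * alt2 i\<close>, which is a limit of symmetric functions, to a vector \<open>g i\<close> of the symmetric
  square. The families \<open>T2 i\<close> and \<open>(S2 i, g i) / 2\<close> have the same Gram matrix, because \<open>T2\<close> is the half sum
  of its symmetric and antisymmetric parts and \<open>phase\<close> is an isometry. Both families are total and are
  moved by \<open>shift\<close>, so the tensor square is equivalent to two copies of the symmetric square.
\<close>

theorem homogeneous_P: "homogeneous_spectrum_two P W"
proof -
  obtain \<sigma> where \<sigma>: "spectral_measure H U f \<sigma>" by (rule spectral_exists)
  interpret C: circle_square \<sigma> \<kappa>
    using \<sigma> corr decay \<kappa>_minus by unfold_locales (auto simp: spectral_measure_def)
  interpret Q: hilbert_space Sq by (rule Sq_hilbert)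
  let ?L = "L2 C.M"
  note cv = C.sym2_alt2_vecs C.mono2_vecs
  have S_gram: "ip Sq (S2 i) (S2 j) = ip ?L (C.sym2 i) (C.sym2 j)" for i j
  proof -
    obtain a b a' b' where ij: "i = (a, b)" "j = (a', b')" by (cases i, cases j)
    show ?thesis using cv
      by (simp add: ij S2_apply C.sym2_def P.ip_add P.ip_add_right L2.ip_add L2.ip_add_right L2.vecs_add T2_ip C.mono2_ip del: L2_simps)
  qed
  interpret G: gram_pair Sq ?L S2 C.sym2
    by (intro gram_pair.intro gram_pair_axioms.intro Q.pre_hilbert_axioms pre_hilbert_L2 S2_Sq cv S_gram)
  define k where "k i = (\<lambda>p. C.phase p * C.alt2 i p)" for i
  have kv: "k i \<in> vecs ?L" for i unfolding k_def by (rule C.phase_vecs[OF cv(2)])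
  have "k i \<in> closed_span ?L (range C.sym2)" for i
    unfolding k_def by (intro C.phase_exchange(2) L2.closed_span_base[OF C.range_vecs(2)]) simp
  then have "\<exists>x. G.corr x (k i)" for i using G.corr_left_total[OF Sq_hilbert] by metis
  then obtain g where g: "\<And>i. G.corr (g i) (k i)" by metis
  have gv [simp]: "g i \<in> vecs Sq" for i using G.corr_vecs(1)[OF g] .
  have SP [simp]: "x \<in> vecs Sq \<Longrightarrow> x \<in> vecs P" for x by (rule Sq_vecs_P)
  have g_ip: "ip P (g i) (g j) = ip ?L (C.alt2 i) (C.alt2 j)" for i j
    using G.corr_ip[OF g g, of i j] C.phase_isometry[OF cv(2) cv(2), of i j] by (simp add: k_def del: L2_simps)
  have k_swap: "k (a, b) + k (b, a) = 0" for a b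
    by (rule ext) (simp add: k_def C.alt2_def algebra_simps)
  have g_swap: "heq P (g (a, b) + g (b, a)) 0" for a b
  proof -
    have "hnorm P (g (a, b) + g (b, a)) = hnorm ?L (k (a, b) + k (b, a))"
      using G.corr_norm[OF G.corr_add[OF g g]] by simp
    then show ?thesis unfolding k_swap by (simp add: heq_def)
  qed
  have S_from_g: "S2 i \<in> closed_span Sq (range g)" for i
  proof -
    interpret G2: gram_pair Sq ?L g k
      using G.corr_ip[OF g g]
      by (intro gram_pair.intro gram_pair_axioms.intro Q.pre_hilbert_axioms pre_hilbert_L2 gv kv) auto
    show ?thesis
      unfolding Q.closed_span_iff_lincomb
    proof (intro conjI allI impI S2_Sq)
      fix e :: real assume "e > 0"
      then obtain xs where xs: "hnorm ?L (C.sym2 i - lincomb ?L k xs) < e"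
        using C.sym2_from_phase[of i] unfolding L2.closed_span_iff_lincomb k_def by blast
      have "G.corr (S2 i - lincomb Sq g xs) (C.sym2 i - lincomb ?L k xs)"
        by (intro G.corr_diff G.corr_base G.corr_lincomb_of_corr g)
      from G.corr_norm[OF this] xs show "\<exists>xs. hnorm Sq (S2 i - lincomb Sq g xs) < e"
        by (intro exI[of _ xs]) simp
    qed
  qed
  have W_g: "heq P (W (g i)) (g (shift i))" for i
  proof -
    \<comment> \<open>multiplication by \<open>z w\<close>, the spectral form of \<open>W\<close>; it commutes with \<open>phase\<close>\<close>
    define mul where "mul = (\<lambda>(q::complex \<times> complex \<Rightarrow> complex) p. C.mono2 (1, 1) p * q p)"
    have m1: "C.mono2 (1, 1) \<in> borel_measurable C.M" using cv(3)[of "(1,1)"] by simp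
    have "cmod (C.mono2 (1, 1) p) \<le> 1" if "p \<in> space C.M" for p using C.mono2_bound[OF that] by simp
    note mult = C.bounded_multiplier[OF m1 this]
    have mb: "bounded_op ?L mul"
      unfolding bounded_op_def mul_def using mult by blast
    have mono: "C.mono2 (1, 1) p * C.mono2 i p = C.mono2 (shift i) p" if "p \<in> space C.M" for i p
    proof -
      have "fst p \<noteq> 0" "snd p \<noteq> 0" using that by (auto simp: C.space_M)
      then show ?thesis by (cases i) (simp add: C.mono2_def power_int_add mult_ac)
    qed
    have sym: "heq ?L (mul (C.sym2 i)) (C.sym2 (shift i))" for i
      using mono by (intro heq_L2 AE_I2, cases i) (simp add: mul_def C.sym2_def distrib_left)
    have alt: "heq ?L (mul (k i)) (k (shift i))" for i
    proof (intro heq_L2 AE_I2)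
      fix p assume p: "p \<in> space C.M"
      have "C.mono2 (1, 1) p * C.alt2 i p = C.alt2 (shift i) p"
        using mono[OF p] by (cases i) (simp add: C.alt2_def right_diff_distrib)
      moreover have "C.mono2 (1, 1) p * (C.phase p * C.alt2 i p) = C.phase p * (C.mono2 (1, 1) p * C.alt2 i p)"
        by (rule mult.left_commute)
      ultimately show "mul (k i) p = k (shift i) p" by (simp only: mul_def k_def)
    qed
    have "G.corr (W (g i)) (mul (k i))"
      by (rule G.corr_shift[OF W_bounded_Sq mb _ sym g]) (simp add: W_S2)
    from G.corr_left_unique[OF this g alt] show ?thesis by simp
  qed
  let ?D = "direct_sum Sq Sq"
  have Dh: "hilbert_space ?D" by (rule hilbert_direct_sum[OF Sq_hilbert Sq_hilbert])
  interpret D: hilbert_space ?D by (rule Dh)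
  define d where "d i = (scal P (1/2) (S2 i), scal P (1/2) (g i))" for i
  have hv: "scal P (1/2) x \<in> vecs Sq" if "x \<in> vecs Sq" for x using Q.vecs_scal[OF that, of "1/2"] by simp
  have dv: "d i \<in> vecs ?D" for i by (simp add: d_def hv)
  have d_ip: "ip P (T2 i) (T2 j) = ip ?D (d i) (d j)" for i j
  proof -
    obtain a b a' b' where ij: "i = (a, b)" "j = (a', b')" by (cases i, cases j)
    have "ip ?D (d i) (d j) = 1/4 * (ip ?L (C.sym2 i) (C.sym2 j) + ip ?L (C.alt2 i) (C.alt2 j))"
      using S_gram[of i j] g_ip[of i j] by (simp add: d_def P.ip_scal P.ip_scal_right field_simps del: L2_simps)
    also have "\<dots> = ip P (T2 i) (T2 j)"
      using cv by (simp add: ij C.sym2_def C.alt2_def L2.ip_add L2.ip_add_right L2.ip_diff L2.ip_diff_right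
          L2.vecs_add L2.vecs_diff T2_ip C.mono2_ip mult.commute del: L2_simps)
    finally show ?thesis by simp
  qed
  interpret G3: gram_pair P ?D T2 d
    by (intro gram_pair.intro gram_pair_axioms.intro P.pre_hilbert_axioms D.pre_hilbert_axioms T2_vecs dv d_ip)
  have rd: "range d \<subseteq> vecs ?D" using dv by blast
  have dm: "d i \<in> closed_span ?D (range d)" for i by (rule D.closed_span_base[OF rd]) simp
  have lin1: "linear_op Sq ?D (\<lambda>x. (x, 0))" and lin2: "linear_op Sq ?D (\<lambda>x. (0, x))"
    by (auto simp: linear_op_def heq_def)
  have n1: "hnorm ?D (x, 0) \<le> 1 * hnorm Sq x" and n2: "hnorm ?D (0, x) \<le> 1 * hnorm Sq x" if "x \<in> vecs Sq" for x
    using that by (simp_all add: hnorm_direct_sum hnorm_def)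
  have SqT: "x \<in> closed_span Sq (range S2)" if "x \<in> vecs Sq" for x
    using that by (subst closed_span_Sq) (auto simp: Sq_vecs[symmetric])
  \<comment> \<open>swapping the indices fixes \<open>S2\<close> and changes the sign of \<open>g\<close>\<close>
  have S1: "(S2 i, 0) \<in> closed_span ?D (range d)" for i
  proof -
    obtain a b where i: "i = (a, b)" by (cases i)
    have e: "scal P (1/2) x + scal P (1/2) x = x" for x
      by (simp add: P.V.scale_left_distrib[symmetric])
    have S: "S2 (b, a) = S2 (a, b)" by (simp add: S2_apply add.commute)
    have dd: "d (a, b) + d (b, a) = (S2 (a, b), scal P (1/2) (g (a, b) + g (b, a)))"
      by (simp add: d_def S e P.V.scale_right_distrib)
    have hh: "heq ?D (S2 (a, b), 0) (S2 (a, b), scal P (1/2) (g (a, b) + g (b, a)))"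
    proof -
      have "heq P (scal P (1/2) (g (a, b) + g (b, a))) (scal P (1/2) 0)"
        using g_swap by (intro P.heq_scal) auto
      from P.heq_sym[OF _ _ this] have "heq P 0 (scal P (1/2) (g (a, b) + g (b, a)))" by simp
      then show ?thesis using Q.vecs_add[OF gv gv, of "(a,b)" "(b,a)"] hv
        by (subst heq_direct_sum[OF Q.pre_hilbert_axioms Q.pre_hilbert_axioms]) auto
    qed
    have m: "d (a, b) + d (b, a) \<in> closed_span ?D (range d)" by (intro D.closed_span_add rd dm)
    show ?thesis unfolding i by (rule D.closed_span_heq[OF rd _ m[unfolded dd] hh]) simp
  qed
  have x0: "(x, 0) \<in> closed_span ?D (range d)" if "x \<in> vecs Sq" for x
    by (rule Q.linear_image_closed_span[OF lin1 D.pre_hilbert_axioms _ n1 S2_Sq rd S1 SqT[OF that]]) auto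
  have g0: "(0, g i) \<in> closed_span ?D (range d)" for i
  proof -
    have "scal ?D 2 (d i - scal ?D (1/2) (S2 i, 0)) \<in> closed_span ?D (range d)"
      by (intro D.closed_span_scal D.closed_span_diff rd dm S1)
    then show ?thesis by (simp add: d_def)
  qed
  have y0: "(0, y) \<in> closed_span ?D (range d)" if "y \<in> vecs Sq" for y
  proof -
    have "closed_span Sq (range S2) \<subseteq> closed_span Sq (range g)"
      using S_from_g by (intro Q.closed_span_minimal) auto
    then have "y \<in> closed_span Sq (range g)" using SqT[OF that] by blast
    then show ?thesis
      by (intro Q.linear_image_closed_span[OF lin2 D.pre_hilbert_axioms _ n2 gv rd g0]) auto
  qed
  have "vecs ?D \<subseteq> closed_span ?D (range d)"
  proof clarsimp
    fix x y assume "x \<in> vecs Sq" "y \<in> vecs Sq"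
    from D.closed_span_add[OF rd x0[OF this(1)] y0[OF this(2)]]
    show "(x, y) \<in> closed_span ?D (range d)" by simp
  qed
  then have d_total: "closed_span ?D (range d) = vecs ?D" using D.closed_span_subset by blast
  obtain \<Phi> where \<Phi>: "hilbert_iso P ?D \<Phi>" "\<And>x. x \<in> vecs P \<Longrightarrow> G3.corr x (\<Phi> x)"
    using G3.gram_iso[OF P.hilbert_space_axioms Dh T2_total d_total] by blast
  have WD: "bounded_op ?D (map_prod W W)"
  proof -
    have sv: "scal P c x \<in> vecs Sq" if "x \<in> vecs Sq" for c x using Q.vecs_scal[OF that] by simp
    have "linear_op ?D ?D (map_prod W W)"
      using W_bounded_Sq
      by (auto simp: sv linear_op_def bounded_op_def W_Sq heq_direct_sum[OF Q.pre_hilbert_axioms Q.pre_hilbert_axioms])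
    moreover have "hnorm ?D (map_prod W W p) \<le> 1 * hnorm ?D p" if "p \<in> vecs ?D" for p
    proof -
      have "ip P (W x) (W x) = ip P x x" if "x \<in> vecs P" for x
        using W_unitary that by (simp add: unitary_op_def hilbert_iso_def)
      then show ?thesis using that by (cases p) (simp add: hnorm_direct_sum)
    qed
    ultimately show ?thesis unfolding bounded_op_def by blast
  qed
  have Wd: "heq ?D (map_prod W W (d i)) (d (shift i))" for i
  proof -
    have half: "heq P (W (scal P (1/2) x)) (scal P (1/2) y)" if "x \<in> vecs P" "y \<in> vecs P" "heq P (W x) y" for x y
    proof -
      have "heq P (W (scal P (1/2) x)) (scal P (1/2) (W x))" using W_linear that by (simp add: linear_op_def)
      moreover have "heq P (scal P (1/2) (W x)) (scal P (1/2) y)" using that by (intro P.heq_scal) auto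
      ultimately show ?thesis by (rule P.heq_trans[rotated 3]) (use that in auto)
    qed
    show ?thesis
      using half[OF _ _ W_S2] half[OF _ _ W_g] hv W_Sq
      by (simp add: d_def heq_direct_sum[OF Q.pre_hilbert_axioms Q.pre_hilbert_axioms])
  qed
  have "unitarily_equivalent P W ?D (map_prod W W)"
    unfolding unitarily_equivalent_def
  proof (intro exI conjI ballI)
    fix x assume x: "x \<in> vecs P"
    have "G3.corr (W x) (map_prod W W (\<Phi> x))"
      by (rule G3.corr_shift[OF W_bounded WD W_T2 Wd \<Phi>(2)[OF x]])
    then show "heq ?D (\<Phi> (W x)) (map_prod W W (\<Phi> x))"
      by (rule G3.corr_unique[OF \<Phi>(2)[OF W_vecs[OF x]]])
  qed (rule \<Phi>(1))
  then show ?thesis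
    unfolding homogeneous_spectrum_two_def using W_unitary Sq_hilbert simple_Sq by blast
qed

end

section \<open>Correlations of the base of the first tower\<close>

locale cutting_parameters =
  fixes h r :: "nat \<Rightarrow> nat" and s :: "nat \<Rightarrow> nat \<Rightarrow> nat"
  assumes h_one: "4 \<le> h 1"
    and h_step: "j \<ge> 1 \<Longrightarrow> h (Suc j) = h j * r j + (\<Sum>i=1..r j. s j i)"
    and T2: "class_T2 h r s"
begin

lemma T2_conditions:
  shows "4 < r 1" and "\<forall>j\<ge>1. r j \<le> r (Suc j)" and "r ` {1..} = {r 1..}"
    and "\<forall>n\<ge>1. limsup (\<lambda>q. ereal (real (card (J r s q n)) / real q ^ 4)) = \<infinity>"
    and "\<forall>j\<ge>1. 4 * h j \<le> s j 1 \<and> (\<forall>i\<in>{2..r j - 3}. 4 * s j (i - 1) \<le> s j i)"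
    and "\<forall>j\<ge>1. s j (r j - 2) = 0 \<and> 4 * s j (r j - 3) \<le> s j (r j)"
  using T2 unfolding class_T2_def by blast+

lemma r_mono: "1 \<le> i \<Longrightarrow> i \<le> j \<Longrightarrow> r i \<le> r j"
proof (induction j)
  case (Suc j)
  show ?case
  proof (cases "i = Suc j")
    case False
    then have "r i \<le> r j" "1 \<le> j" using Suc by auto
    moreover from this have "r j \<le> r (Suc j)" using T2_conditions(2) by blast
    ultimately show ?thesis by simp
  qed simp
qed simp

lemma r_ge: "1 \<le> j \<Longrightarrow> 5 \<le> r j"
  using r_mono[of 1 j] T2_conditions(1) by simp

lemma r_onto: "r 1 \<le> q \<Longrightarrow> \<exists>j\<ge>1. r j = q"
proof -
  assume "r 1 \<le> q"
  then have "q \<in> r ` {1..}" using T2_conditions(3) by simp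
  then show ?thesis by auto
qed

lemma s_first: "1 \<le> j \<Longrightarrow> 4 * h j \<le> s j 1"
  and s_step: "1 \<le> j \<Longrightarrow> i \<in> {2..r j - 3} \<Longrightarrow> 4 * s j (i - 1) \<le> s j i"
  and s_second_last: "1 \<le> j \<Longrightarrow> s j (r j - 2) = 0"
  and s_last: "1 \<le> j \<Longrightarrow> 4 * s j (r j - 3) \<le> s j (r j)"
  using T2_conditions(5,6) by blast+

text \<open>
  The level of the tower of stage \<open>j + 1\<close> at which its \<open>i\<close>-th column, a copy of the tower of stage \<open>j\<close>,
  starts.
\<close>

definition pos :: "nat \<Rightarrow> nat \<Rightarrow> nat" where
  "pos j i = (\<Sum>l\<in>{1..<i}. h j + s j l)"

lemma pos_one [simp]: "pos j (Suc 0) = 0"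
  by (simp add: pos_def)

lemma pos_Suc: "1 \<le> i \<Longrightarrow> pos j (Suc i) = pos j i + h j + s j i"
  by (simp add: pos_def sum.atLeastLessThan_Suc)

lemma pos_gap: 
  assumes "1 \<le> i" "i \<le> i'" shows "pos j i + (i' - i) * h j \<le> pos j i'"
  using assms(2,1)
proof (induction i' rule: dec_induct)
  case (step k)
  then show ?case using pos_Suc[of k j] by (simp add: Suc_diff_le)
qed simp

lemma pos_mono: "1 \<le> i \<Longrightarrow> i \<le> i' \<Longrightarrow> pos j i \<le> pos j i'"
  using pos_gap[of i i' j] by simp

lemma h_Suc: "1 \<le> j \<Longrightarrow> h (Suc j) = pos j (r j) + h j + s j (r j)"
proof -
  assume j: "1 \<le> j"
  have "{1..<Suc (r j)} = {1..r j}" by auto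
  then have "pos j (Suc (r j)) = h (Suc j)"
    using h_step[OF j] by (simp add: pos_def sum.distrib mult.commute)
  then show ?thesis using pos_Suc[of "r j" j] r_ge[OF j] by simp
qed

text \<open>
  By the growth of the spacers, those above column \<open>l\<close> outnumber all levels below that column.
\<close>

lemma s_large:
  assumes j: "1 \<le> j" and l: "1 \<le> l" "l \<le> r j - 3"
  shows "pos j l + 2 * h j \<le> s j l \<and> 4 * h j \<le> s j l"
  using l
proof (induction l rule: dec_induct)
  case base then show ?case using s_first[OF j] by simp
next
  case (step l)
  then have "4 * s j l \<le> s j (Suc l)" using s_step[OF j, of "Suc l"] by simp
  then show ?case using step pos_Suc[of l j] by simp
qed

lemma s_top: "1 \<le> j \<Longrightarrow> 16 * h j \<le> s j (r j)"
proof -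
  assume j: "1 \<le> j"
  have "1 \<le> r j - 3" using r_ge[OF j] by simp
  then show ?thesis using s_large[OF j, of "r j - 3"] s_last[OF j] by simp
qed

lemma h_grow: "1 \<le> j \<Longrightarrow> 17 * h j \<le> h (Suc j)"
  using h_Suc[of j] s_top[of j] by simp

lemma h_pos: "1 \<le> j \<Longrightarrow> 4 \<le> h j \<and> j \<le> h j"
proof (induction j rule: dec_induct)
  case base then show ?case using h_one by simp
next
  case (step j) then show ?case using h_grow[of j] by simp
qed

lemma h_mono: "1 \<le> i \<Longrightarrow> i < j \<Longrightarrow> h i < h j"
proof (induction j)
  case (Suc j)
  then show ?case using h_grow[of j] h_pos[of j] by (cases "i = j") auto
qed simp

text \<open>The levels of the tower of stage \<open>j\<close> that make up the base of the first tower; stage 0 is a dummy.\<close>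

fun levels :: "nat \<Rightarrow> nat set" where
  "levels 0 = {0}"
| "levels (Suc j) = (if j = 0 then {0} else (\<Union>i\<in>{1..r j}. (\<lambda>a. pos j i + a) ` levels j))"

text \<open>A lower bound for the part of the tower of stage \<open>j\<close> that lies above these levels.\<close>

fun gap :: "nat \<Rightarrow> nat" where
  "gap 0 = 0"
| "gap (Suc j) = (if j = 0 then h 1 else gap j + s j (r j))"

lemma gap_pos: "1 \<le> j \<Longrightarrow> 0 < gap j"
proof (induction j rule: dec_induct)
  case base then show ?case using h_one by simp
qed simp

lemma gap_Suc: "1 \<le> j \<Longrightarrow> gap (Suc j) = gap j + s j (r j)"
  by simp

lemma finite_levels [simp]: "finite (levels j)"
  by (induction j) auto

lemma levels_gap: "1 \<le> j \<Longrightarrow> a \<in> levels j \<Longrightarrow> a + gap j \<le> h j"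
proof (induction j arbitrary: a rule: dec_induct)
  case (step j)
  then obtain i b where i: "i \<in> {1..r j}" "b \<in> levels j" "a = pos j i + b" by auto
  have j: "1 \<le> j" using step by simp
  have "b + gap j \<le> h j" "pos j i \<le> pos j (r j)" using step i pos_mono by auto
  then show ?case unfolding gap_Suc[OF j] h_Suc[OF j] using i(3) by linarith
qed simp

lemma levels_less: "1 \<le> j \<Longrightarrow> a \<in> levels j \<Longrightarrow> a < h j"
  using levels_gap[of j a] gap_pos[of j] by simp

lemma sum_levels_Suc:
  assumes j: "1 \<le> j"
  shows "(\<Sum>a\<in>levels (Suc j). F a) = (\<Sum>i=1..r j. \<Sum>a\<in>levels j. F (pos j i + a))"
proof -
  have disj: "pos j i + a \<noteq> pos j i' + a'" if "i \<in> {1..r j}" "i' \<in> {1..r j}" "i \<noteq> i'" "a \<in> levels j" "a' \<in> levels j" for i i' a a'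
  proof -
    have *: "pos j i + a < pos j i' + a'" if "1 \<le> i" "i < i'" "a \<in> levels j" for i i' a a'
      using pos_gap[of i "Suc i" j] pos_mono[of "Suc i" i' j] levels_less[OF j that(3)] that by simp
    show ?thesis using *[of i i' a a'] *[of i' i a' a] that by (cases "i < i'") auto
  qed
  have "(\<Sum>a\<in>levels (Suc j). F a) = (\<Sum>i=1..r j. \<Sum>a\<in>(\<lambda>a. pos j i + a) ` levels j. F a)"
  proof -
    have "levels (Suc j) = (\<Union>i\<in>{1..r j}. (\<lambda>a. pos j i + a) ` levels j)" using j by simp
    then show ?thesis using disj by (simp only:) (rule sum.UNION_disjoint, auto)
  qed
  also have "\<dots> = (\<Sum>i=1..r j. \<Sum>a\<in>levels j. F (pos j i + a))"
    by (rule sum.cong[OF refl]) (simp add: sum.reindex)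
  finally show ?thesis .
qed

definition R :: "nat \<Rightarrow> real" where
  "R j = real (card (levels j))"

lemma R_Suc: "1 \<le> j \<Longrightarrow> R (Suc j) = real (r j) * R j"
  using sum_levels_Suc[of j "\<lambda>_. 1 :: real"] by (simp add: R_def del: levels.simps)

lemma R_pos: "1 \<le> j \<Longrightarrow> 0 < R j"
proof (induction j rule: dec_induct)
  case (step j) then show ?case using R_Suc[of j] r_ge[of j] by (simp del: levels.simps)
qed (simp add: R_def)

text \<open>
  The correlation of the base of the first tower with its translate by \<open>m\<close>, as far as it is seen within
  the tower of stage \<open>j\<close>, in units of the measure of that base.
\<close>

definition K :: "nat \<Rightarrow> int \<Rightarrow> real" where
  "K j m = (\<Sum>a\<in>levels j. \<Sum>b\<in>levels j. if int a - int b = m then 1 else 0) / R j"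

lemma K_Suc:
  assumes j: "1 \<le> j"
  shows "K (Suc j) m = (\<Sum>i=1..r j. \<Sum>i'=1..r j. K j (m - int (pos j i) + int (pos j i'))) / real (r j)"
proof -
  have "(\<Sum>a\<in>levels (Suc j). \<Sum>b\<in>levels (Suc j). if int a - int b = m then 1 else 0 :: real) =
    (\<Sum>i=1..r j. \<Sum>a\<in>levels j. \<Sum>i'=1..r j. \<Sum>b\<in>levels j. if int (pos j i + a) - int (pos j i' + b) = m then 1 else 0)"
    unfolding sum_levels_Suc[OF j] ..
  also have "\<dots> = (\<Sum>i=1..r j. \<Sum>i'=1..r j. \<Sum>a\<in>levels j. \<Sum>b\<in>levels j. if int (pos j i + a) - int (pos j i' + b) = m then 1 else 0)"
    by (intro sum.cong refl sum.swap)
  also have "\<dots> = (\<Sum>i=1..r j. \<Sum>i'=1..r j. R j * K j (m - int (pos j i) + int (pos j i')))"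
    using R_pos[OF j] by (intro sum.cong refl) (auto simp: K_def algebra_simps intro!: sum.cong)
  finally show ?thesis
    unfolding K_def[of "Suc j"] R_Suc[OF j] using R_pos[OF j] by (simp add: sum_distrib_left[symmetric] del: levels.simps)
qed

lemma K_one: "K (Suc 0) m = (if m = 0 then 1 else 0)"
  by (simp add: K_def R_def)

lemma K_minus: "K j (- m) = K j m"
proof -
  have "(\<Sum>a\<in>levels j. \<Sum>b\<in>levels j. if int a - int b = - m then 1 else 0 :: real) = (\<Sum>a\<in>levels j. \<Sum>b\<in>levels j. if int b - int a = m then 1 else 0)"
    by (intro sum.cong refl) auto
  also have "\<dots> = (\<Sum>a\<in>levels j. \<Sum>b\<in>levels j. if int a - int b = m then 1 else 0)" by (rule sum.swap)
  finally show ?thesis by (simp add: K_def)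
qed

lemma K_nonneg: "0 \<le> K j m"
  by (auto simp: K_def R_def intro!: divide_nonneg_nonneg sum_nonneg)

lemma K_le_1: "1 \<le> j \<Longrightarrow> K j m \<le> 1"
proof -
  assume j: "1 \<le> j"
  have "(\<Sum>b\<in>levels j. if int a - int b = m then 1 else 0 :: real) \<le> 1" for a
  proof -
    have "(\<Sum>b\<in>levels j. if int a - int b = m then 1 else 0 :: real) \<le> (\<Sum>b\<in>levels j. if b = nat (int a - m) then 1 else 0)"
      by (intro sum_mono) auto
    then show ?thesis by (simp add: sum.delta split: if_splits)
  qed
  then have "(\<Sum>a\<in>levels j. \<Sum>b\<in>levels j. if int a - int b = m then 1 else 0 :: real) \<le> R j"
    using sum_mono[of "levels j" "\<lambda>a. \<Sum>b\<in>levels j. if int a - int b = m then 1 else 0 :: real" "\<lambda>_. 1"] by (simp add: R_def)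
  then show ?thesis using R_pos[OF j] by (simp add: K_def)
qed

lemma K_zero:
  assumes j: "1 \<le> j" and m: "int (h j) - int (gap j) < \<bar>m\<bar>" shows "K j m = 0"
proof -
  have "int a - int b \<noteq> m" if "a \<in> levels j" "b \<in> levels j" for a b
    using levels_gap[OF j that(1)] levels_gap[OF j that(2)] m by linarith
  then show ?thesis by (simp add: K_def)
qed

lemma pos_far:
  assumes j: "1 \<le> j" and i: "1 \<le> i'" "i' < i" "i \<le> r j" and ne: "(i, i') \<noteq> (r j - 1, r j - 2)" "(i, i') \<noteq> (r j, r j - 1)"
  shows "pos j i' + 2 * h j \<le> pos j i"
proof (cases "i = Suc i'")
  case True
  then have "i' \<le> r j - 3" using i ne r_ge[OF j] by (auto simp: prod_eq_iff)
  then show ?thesis using s_large[OF j i(1)] pos_Suc[OF i(1), of j] True by simp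
next
  case False
  then have "2 * h j \<le> (i - i') * h j" using i by (intro mult_right_mono) auto
  then have "pos j i' + 2 * h j \<le> pos j i' + (i - i') * h j" by simp
  also have "\<dots> \<le> pos j i" using i by (intro pos_gap) auto
  finally show ?thesis .
qed

text \<open>
  Only the two close pairs of columns contribute at distance about \<open>h j\<close>: from column \<open>r j - 2\<close> to
  \<open>r j - 1\<close> without spacers and from \<open>r j - 1\<close> to \<open>r j\<close> with \<open>s j (r j - 1)\<close> spacers.
\<close>

lemma K_close_columns:
  assumes j: "1 \<le> j" and k: "\<bar>k\<bar> < int (gap j)"
  shows "real (r j) * K (Suc j) (int (h j) - k) = K j (- k) + K j (- k - int (s j (r j - 1)))"
proof -
  let ?F = "\<lambda>(i, i'). K j (int (h j) - k - int (pos j i) + int (pos j i'))"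
  have r: "5 \<le> r j" by (rule r_ge[OF j])
  have "real (r j) * K (Suc j) (int (h j) - k) = (\<Sum>p\<in>{1..r j} \<times> {1..r j}. ?F p)"
    using r by (simp add: K_Suc[OF j] sum.cartesian_product)
  also have "\<dots> = (\<Sum>p\<in>{(r j - 1, r j - 2), (r j, r j - 1)}. ?F p)"
  proof (rule sum.mono_neutral_right)
    show "\<forall>p\<in>{1..r j} \<times> {1..r j} - {(r j - 1, r j - 2), (r j, r j - 1)}. ?F p = 0"
    proof
      fix p assume p: "p \<in> {1..r j} \<times> {1..r j} - {(r j - 1, r j - 2), (r j, r j - 1)}"
      obtain i i' where ii: "p = (i, i')" by (cases p)
      show "?F p = 0"
      proof (cases "i' < i")
        case True
        then have "pos j i' + 2 * h j \<le> pos j i" using p ii by (intro pos_far j) auto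
        then have "K j (int (h j) - k - int (pos j i) + int (pos j i')) = 0"
          using k by (intro K_zero j) linarith
        then show ?thesis by (simp add: ii)
      next
        case False
        then have "pos j i \<le> pos j i'" using p ii by (intro pos_mono) auto
        then have "K j (int (h j) - k - int (pos j i) + int (pos j i')) = 0"
          using k by (intro K_zero j) linarith
        then show ?thesis by (simp add: ii)
      qed
    qed
  qed (use r in auto)
  also have "\<dots> = K j (- k) + K j (- k - int (s j (r j - 1)))"
  proof -
    have 1: "pos j (r j - 1) = pos j (r j - 2) + h j"
      using pos_Suc[of "r j - 2" j] r s_second_last[OF j] by (simp add: Suc_diff_Suc numeral_2_eq_2)
    have 2: "pos j (r j) = pos j (r j - 1) + h j + s j (r j - 1)"
      using pos_Suc[of "r j - 1" j] r by simp
    have "(r j - 1, r j - 2) \<noteq> (r j, r j - 1)" using r by simp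
    moreover have "?F (r j - 1, r j - 2) = K j (- k)" by (simp only: prod.case 1) simp
    moreover have "?F (r j, r j - 1) = K j (- k - int (s j (r j - 1)))"
      by (simp only: prod.case 2) (simp add: algebra_simps)
    ultimately show ?thesis by simp
  qed
  finally show ?thesis .
qed

text \<open>
  The distances between distinct columns are lacunary, so few of them are within \<open>h j\<close> of a given
  positive \<open>m\<close>.
\<close>

lemma few_column_pairs:
  assumes j: "1 \<le> j" and m: "0 < m"
  defines "B \<equiv> {(i, i'). i \<in> {1..r j} \<and> i' \<in> {1..r j} \<and> i \<noteq> i' \<and> \<bar>m - int (pos j i) + int (pos j i')\<bar> < int (h j)}"
  shows "finite B" "card B \<le> 6"
proof -
  have hp: "4 \<le> h j" using h_pos[OF j] by simp
  have order: "i' < i" if "(i, i') \<in> B" for i i'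
  proof (rule ccontr)
    assume "\<not> i' < i"
    then have "pos j i + h j \<le> pos j i'"
      using that pos_gap[of i "Suc i" j] pos_mono[of "Suc i" i' j] by (auto simp: B_def)
    then show False using that m by (auto simp: B_def)
  qed
  have unique: "i1 = i2" if "(i1, k1) \<in> B" "(i2, k2) \<in> B" "i1 \<le> r j - 2" "i2 \<le> r j - 2" for i1 i2 k1 k2
  proof -
    have no: False if b: "(i1, k1) \<in> B" "(i2, k2) \<in> B" "i2 \<le> r j - 2" "i1 < i2" for i1 i2 k1 k2
    proof -
      have k: "1 \<le> k2" "k2 < i2" "1 \<le> i1" using order[OF b(2)] b by (auto simp: B_def)
      have "m < int (pos j i1) + int (h j)" using b(1) by (auto simp: B_def)
      moreover have "int (s j (i2 - 1)) < m"
      proof -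
        have "pos j k2 \<le> pos j (i2 - 1)" using k by (intro pos_mono) auto
        moreover have "pos j i2 = pos j (i2 - 1) + h j + s j (i2 - 1)" using pos_Suc[of "i2 - 1" j] k by simp
        ultimately show ?thesis using b(2) by (auto simp: B_def)
      qed
      moreover have "pos j i1 \<le> pos j (i2 - 1)" using k b(4) by (intro pos_mono) auto
      moreover have "pos j (i2 - 1) + 2 * h j \<le> s j (i2 - 1)"
        using s_large[OF j, of "i2 - 1"] k b(3) by simp
      ultimately show False by linarith
    qed
    show ?thesis using no[of i1 k1 i2 k2] no[of i2 k2 i1 k1] that by (meson linorder_neqE_nat)
  qed
  \<comment> \<open>at most one upper column outside the last two; for each upper column at most two lower ones\<close>
  define i0 where "i0 = (SOME i. i \<le> r j - 2 \<and> (\<exists>k. (i, k) \<in> B))"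
  have fst: "i \<in> {i0, r j - 1, r j}" if "(i, k) \<in> B" for i k
  proof (cases "i \<le> r j - 2")
    case True
    then have "i0 \<le> r j - 2 \<and> (\<exists>k. (i0, k) \<in> B)"
      unfolding i0_def using that by (intro someI[of "\<lambda>i. i \<le> r j - 2 \<and> (\<exists>k. (i, k) \<in> B)" i]) auto
    then show ?thesis using unique that True by blast
  next
    case False
    then show ?thesis using that by (auto simp: B_def)
  qed
  define c where "c i = (LEAST k. (i, k) \<in> B)" for i
  have snd: "k \<in> {c i, Suc (c i)}" if b: "(i, k) \<in> B" for i k
  proof (rule ccontr)
    assume n: "k \<notin> {c i, Suc (c i)}"
    have cb: "(i, c i) \<in> B" "c i \<le> k" unfolding c_def using b by (rule LeastI, rule Least_le)
    then have "2 \<le> k - c i" using n by auto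
    then have "2 * h j \<le> (k - c i) * h j" by (rule mult_right_mono) simp
    then have "pos j (c i) + 2 * h j \<le> pos j (c i) + (k - c i) * h j" by simp
    also have "\<dots> \<le> pos j k" using cb by (intro pos_gap) (auto simp: B_def)
    finally show False using b cb(1) by (auto simp: B_def)
  qed
  let ?C = "(\<lambda>i. (i, c i)) ` {i0, r j - 1, r j} \<union> (\<lambda>i. (i, Suc (c i))) ` {i0, r j - 1, r j}"
  have sub: "B \<subseteq> ?C"
  proof (rule subrelI)
    fix i k assume "(i, k) \<in> B"
    from fst[OF this] snd[OF this] show "(i, k) \<in> ?C" by blast
  qed
  then show "finite B" by (rule finite_subset) simp
  have "card B \<le> card ?C" by (intro card_mono sub) simp
  also have "\<dots> \<le> card {i0, r j - 1, r j} + card {i0, r j - 1, r j}"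
    by (intro order_trans[OF card_Un_le] add_mono card_image_le) auto
  also have "\<dots> \<le> 3 + 3" by (intro add_mono) (simp_all add: card_insert_if)
  finally show "card B \<le> 6" by simp
qed

text \<open>
  Pairs in the same column reproduce \<open>K j m\<close>. Of the other pairs of columns at most 6 contribute, each at
  most \<open>1 / r j\<close>.
\<close>

lemma K_Suc_le:
  assumes j: "1 \<le> j" and m: "0 < m"
  shows "K (Suc j) m \<le> K j m + 6 / real (r j)"
proof -
  define B where "B = {(i, i'). i \<in> {1..r j} \<and> i' \<in> {1..r j} \<and> i \<noteq> i' \<and> \<bar>m - int (pos j i) + int (pos j i')\<bar> < int (h j)}"
  note B = few_column_pairs[OF j m, folded B_def]
  let ?F = "\<lambda>i i'. K j (m - int (pos j i) + int (pos j i'))"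
  let ?I = "{1..r j} \<times> {1..r j}"
  have r: "0 < real (r j)" using r_ge[OF j] by simp
  have le: "?F i i' \<le> (if i = i' then K j m else 0) + (if (i, i') \<in> B then 1 else 0)" if "i \<in> {1..r j}" "i' \<in> {1..r j}" for i i'
  proof -
    consider "i = i'" | "i \<noteq> i'" "(i, i') \<in> B" | "i \<noteq> i'" "(i, i') \<notin> B" by blast
    then show ?thesis
    proof cases
      case 1 then show ?thesis by simp
    next
      case 2 then show ?thesis using K_le_1[OF j, of "m - int (pos j i) + int (pos j i')"] by simp
    next
      case 3
      then have "\<not> \<bar>m - int (pos j i) + int (pos j i')\<bar> < int (h j)" using that by (auto simp: B_def)
      then have "?F i i' = 0" using gap_pos[OF j] by (intro K_zero j) linarith
      then show ?thesis using 3 by simp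
    qed
  qed
  have "real (r j) * K (Suc j) m = (\<Sum>i=1..r j. \<Sum>i'=1..r j. ?F i i')"
    using r by (simp add: K_Suc[OF j])
  also have "\<dots> \<le> (\<Sum>i=1..r j. \<Sum>i'=1..r j. (if i = i' then K j m else 0) + (if (i, i') \<in> B then 1 else 0))"
    by (intro sum_mono le)
  also have "\<dots> = real (r j) * K j m + (\<Sum>p\<in>?I. if p \<in> B then 1 else 0)"
    by (simp add: sum.distrib sum.cartesian_product)
  also have "(\<Sum>p\<in>?I. if p \<in> B then 1 else 0) = real (card B)"
  proof -
    have "?I \<inter> B = B" by (auto simp: B_def)
    then show ?thesis by (simp add: sum.If_cases)
  qed
  also have "real (r j) * K j m + real (card B) \<le> real (r j) * K j m + 6" using B(2) by simp
  finally have "K (Suc j) m \<le> (real (r j) * K j m + 6) / real (r j)"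
    using r by (simp add: pos_le_divide_eq mult.commute)
  then show ?thesis using r by (simp add: add_divide_distrib)
qed

end

locale tower_correlations = cutting_parameters +
  fixes \<kappa> :: "int \<Rightarrow> real" and e :: real
  assumes e_pos: "0 < e"
    and \<kappa>: "1 \<le> j \<Longrightarrow> \<bar>m\<bar> < int (gap j) \<Longrightarrow> \<kappa> m = e * K j m"
begin

lemma gap_large: "2 \<le> j \<Longrightarrow> 16 * h (j - 1) < gap j"
proof -
  assume "2 \<le> j"
  then obtain i where i: "j = Suc i" "1 \<le> i" by (cases j) auto
  show ?thesis unfolding i(1) gap_Suc[OF i(2)] using s_top[OF i(2)] gap_pos[OF i(2)] by simp
qed

lemma gap_eventually: "1 \<le> j \<Longrightarrow> j \<le> gap (Suc j)"
  using gap_large[of "Suc j"] h_pos[of j] by simp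

lemma \<kappa>_zero: "\<kappa> 0 = e"
proof -
  have "\<kappa> 0 = e * K 1 0" using h_one by (intro \<kappa>) auto
  then show ?thesis by (simp add: K_one)
qed

lemma \<kappa>_minus: "\<kappa> (- m) = \<kappa> m"
proof -
  let ?j = "Suc (Suc (nat \<bar>m\<bar>))"
  have "\<bar>m\<bar> < int (gap ?j)" using gap_eventually[of "Suc (nat \<bar>m\<bar>)"] by linarith
  then show ?thesis using \<kappa>[of ?j m] \<kappa>[of ?j "- m"] by (simp add: K_minus)
qed

lemma return_correlation:
  assumes j: "1 \<le> j" and k: "\<bar>k\<bar> + int (s j (r j - 1)) < int (gap j)"
  shows "real (r j) * \<kappa> (int (h j) - k) = \<kappa> k + \<kappa> (k + int (s j (r j - 1)))"
proof -
  have "\<bar>int (h j) - k\<bar> < int (gap (Suc j))"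
    using gap_Suc[OF j] s_top[OF j] h_pos[OF j] k by linarith
  then have "real (r j) * \<kappa> (int (h j) - k) = e * (real (r j) * K (Suc j) (int (h j) - k))"
    using \<kappa>[of "Suc j"] by simp
  also have "real (r j) * K (Suc j) (int (h j) - k) = K j (- k) + K j (- k - int (s j (r j - 1)))"
    using k by (intro K_close_columns j) linarith
  also have "\<dots> = K j k + K j (k + int (s j (r j - 1)))"
    using K_minus[of j k] K_minus[of j "k + int (s j (r j - 1))"] by simp
  also have "e * \<dots> = \<kappa> k + \<kappa> (k + int (s j (r j - 1)))"
  proof -
    have "\<bar>k\<bar> < int (gap j)" "\<bar>k + int (s j (r j - 1))\<bar> < int (gap j)" using k by linarith+
    then show ?thesis using \<kappa>[OF j] by (simp add: distrib_left)
  qed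
  finally show ?thesis .
qed

text \<open>
  For \<open>h j \<le> m < h (j + 1)\<close> stage \<open>j\<close> contributes nothing, later stages than \<open>j + 2\<close> do not change the
  correlation at \<open>m\<close>, and each of the two steps in between adds at most \<open>6 / r j\<close>.
\<close>

lemma \<kappa>_decay: "(\<lambda>k. \<kappa> (int k)) \<longlonglongrightarrow> 0"
proof (rule LIMSEQ_I)
  fix d :: real assume d: "0 < d"
  obtain q where q: "12 * e / d < real q" using reals_Archimedean2 by blast
  obtain j0 where j0: "1 \<le> j0" "r j0 = max q (r 1)" using r_onto[of "max q (r 1)"] by auto
  have "norm (\<kappa> (int m)) < d" if m: "h j0 \<le> m" for m
  proof -
    define j where "j = (GREATEST j. j0 \<le> j \<and> h j \<le> m)"
    have bound: "j \<le> m" if "j0 \<le> j \<and> h j \<le> m" for j using h_pos[of j] that j0 by linarith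
    have j: "j0 \<le> j \<and> h j \<le> m"
      unfolding j_def by (rule GreatestI_nat[of _ j0 m]) (use m bound in auto)
    have "\<not> h (Suc j) \<le> m"
    proof
      assume "h (Suc j) \<le> m"
      then have "Suc j \<le> j" unfolding j_def
        by (intro Greatest_le_nat[of _ _ m]) (use j bound in \<open>auto simp: j_def\<close>)
      then show False by simp
    qed
    then have m2: "m < h (Suc j)" by simp
    have j1: "1 \<le> j" using j j0 by simp
    have m0: "0 < int m" using j h_pos[OF j1] by simp
    have rj: "0 < real (r j)" using r_ge[OF j1] by simp
    have "\<kappa> (int m) = e * K (Suc (Suc j)) (int m)"
      using gap_large[of "Suc (Suc j)"] m2 by (intro \<kappa>) auto
    moreover have "K (Suc (Suc j)) (int m) \<le> 12 / real (r j)"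
    proof -
      have "K (Suc (Suc j)) (int m) \<le> K (Suc j) (int m) + 6 / real (r (Suc j))"
        using m0 by (intro K_Suc_le) auto
      also have "K (Suc j) (int m) \<le> K j (int m) + 6 / real (r j)" using m0 by (intro K_Suc_le j1)
      also have "K j (int m) = 0" using j gap_pos[OF j1] by (intro K_zero j1) linarith
      also have "6 / real (r (Suc j)) \<le> 6 / real (r j)"
        using r_mono[of j "Suc j"] j1 rj by (intro divide_left_mono) auto
      finally show ?thesis by simp
    qed
    ultimately have "\<kappa> (int m) \<le> e * (12 / real (r j))"
      using mult_left_mono[of "K (Suc (Suc j)) (int m)" "12 / real (r j)" e] e_pos by simp
    also have "\<dots> < d"
    proof -
      have "real q \<le> real (r j)" using r_mono[of j0 j] j j0 by simp
      then have "12 * e < d * real (r j)" using q d rj by (simp add: pos_divide_less_eq mult.commute order_less_le_trans)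
      then show ?thesis using rj by (simp add: pos_divide_less_eq mult.commute)
    qed
    finally have "\<kappa> (int m) < d" .
    moreover have "0 \<le> \<kappa> (int m)" using \<open>\<kappa> (int m) = _\<close> e_pos K_nonneg by simp
    ultimately show ?thesis by simp
  qed
  then show "\<exists>N. \<forall>m\<ge>N. norm (\<kappa> (int m) - 0) < d" by auto
qed

text \<open>
  Take for \<open>F\<close> the heights \<open>h j\<close> with \<open>j\<close> in \<open>J r s q n\<close>, for suitable large \<open>q\<close>. A distance
  \<open>h j' - h j\<close> with \<open>j < j'\<close> is a return to stage \<open>j'\<close> with \<open>k = h j\<close>, so \<open>return_correlation\<close> applies to it
  twice and gives the factor \<open>q\<^sup>2\<close>.
\<close>

lemma averaging_sets:
  assumes n: "n \<ge> (1::int)"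
  shows "\<exists>F q. finite F \<and> F \<noteq> {} \<and> M \<le> q \<and> 1 \<le> q \<and> M * q ^ 4 \<le> real (card F) \<and>
        (\<forall>a\<in>F. q * \<kappa> a = \<kappa> 0 + \<kappa> n \<and> q * \<kappa> (a + n) = \<kappa> 0 + \<kappa> n) \<and>
        (\<forall>a\<in>F. \<forall>b\<in>F. a \<noteq> b \<longrightarrow> q\<^sup>2 * \<kappa> (a - b) = 2 * \<kappa> 0 + 2 * \<kappa> n)"
proof -
  define N where "N = nat n"
  have N: "1 \<le> N" "n = int N" using n by (auto simp: N_def)
  \<comment> \<open>\<open>r j = q\<close> with \<open>q\<close> above this bound forces \<open>j\<close>, and with it \<open>gap j\<close>, to be large compared with \<open>n\<close>\<close>
  define Q where "Q = max (nat \<lceil>M\<rceil>) (r (2 * N + 2) + 1)"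
  define M' where "M' = max M 0"
  have "\<exists>q\<ge>Q. M' < real (card (J r s q N)) / real q ^ 4"
  proof (rule ccontr)
    assume "\<not> ?thesis"
    then have "\<forall>\<^sub>F q in sequentially. ereal (real (card (J r s q N)) / real q ^ 4) \<le> ereal M'"
      by (auto simp: eventually_sequentially not_less)
    then have "limsup (\<lambda>q. ereal (real (card (J r s q N)) / real q ^ 4)) \<le> ereal M'"
      by (rule Limsup_bounded)
    moreover have "limsup (\<lambda>q. ereal (real (card (J r s q N)) / real q ^ 4)) = \<infinity>"
      using T2_conditions(4) N(1) by blast
    ultimately show False by simp
  qed
  then obtain q where q: "Q \<le> q" "M' < real (card (J r s q N)) / real q ^ 4" by blast
  have q1: "1 \<le> q" "M \<le> real q" using q(1) by (auto simp: Q_def nat_le_iff ceiling_le_iff)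
  have q4: "0 < real q ^ 4" using q1 by simp
  have cJ: "M * real q ^ 4 \<le> card (J r s q N)" "0 < card (J r s q N)"
  proof -
    have *: "M' * real q ^ 4 < card (J r s q N)" "M \<le> M'" "0 \<le> M'"
      using q(2) q4 by (auto simp: pos_less_divide_eq M'_def)
    then show "M * real q ^ 4 \<le> card (J r s q N)"
      using mult_right_mono[OF *(2), of "real q ^ 4"] q4 by linarith
    have "0 \<le> M' * real q ^ 4" using * q4 by simp
    then have "0 < real (card (J r s q N))" using *(1) by linarith
    then show "0 < card (J r s q N)" by simp
  qed
  then have fJ: "finite (J r s q N)" "J r s q N \<noteq> {}" using card_gt_0_iff by blast+
  have Jj: "1 \<le> j" "r j = q" "s j (r j - 1) = N" "2 * N + 2 < j" if "j \<in> J r s q N" for j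
  proof -
    show "1 \<le> j" "r j = q" "s j (r j - 1) = N" using that by (auto simp: J_def)
    then show "2 * N + 2 < j" using r_mono[of j "2 * N + 2"] q(1) by (cases "j \<le> 2 * N + 2") (auto simp: Q_def)
  qed
  define F where "F = (\<lambda>j. int (h j)) ` J r s q N"
  have inj: "inj_on (\<lambda>j. int (h j)) (J r s q N)"
    using h_mono Jj(1) by (intro inj_onI) (metis linorder_neqE_nat less_irrefl of_nat_eq_iff)
  have cF: "card F = card (J r s q N)" unfolding F_def by (rule card_image[OF inj])
  have gapJ: "2 * N < gap j" if "j \<in> J r s q N" for j
  proof -
    have "2 \<le> j" "1 \<le> j - 1" "2 * N \<le> j - 1" using Jj[OF that] by auto
    then show ?thesis using gap_large[of j] h_pos[of "j - 1"] by linarith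
  qed
  have first: "real q * \<kappa> (int (h j)) = \<kappa> 0 + \<kappa> n" "real q * \<kappa> (int (h j) + n) = \<kappa> 0 + \<kappa> n" if jJ: "j \<in> J r s q N" for j
  proof -
    show "real q * \<kappa> (int (h j)) = \<kappa> 0 + \<kappa> n"
      using return_correlation[of j 0] gapJ[OF jJ] Jj[OF jJ] N by simp
    show "real q * \<kappa> (int (h j) + n) = \<kappa> 0 + \<kappa> n"
      using return_correlation[of j "- n"] gapJ[OF jJ] Jj[OF jJ] N \<kappa>_minus[of n] by simp
  qed
  have second: "(real q)\<^sup>2 * \<kappa> (int (h j') - int (h j)) = 2 * \<kappa> 0 + 2 * \<kappa> n" if jj: "j \<in> J r s q N" "j' \<in> J r s q N" "j < j'" for j j'
  proof -
    have "h j \<le> h (j' - 1)" 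
    proof (cases "j = j' - 1")
      case False
      then have "j < j' - 1" using jj(3) by linarith
      then show ?thesis using h_mono[OF Jj(1)[OF jj(1)]] by (auto intro: less_imp_le)
    qed simp
    then have "h j + N < gap j'"
      using gap_large[of j'] Jj[OF jj(2)] h_pos[of j] Jj[OF jj(1)] by linarith
    then have "real q * \<kappa> (int (h j') - int (h j)) = \<kappa> (int (h j)) + \<kappa> (int (h j) + n)"
      using return_correlation[of j' "int (h j)"] Jj[OF jj(2)] N by simp
    then have "(real q)\<^sup>2 * \<kappa> (int (h j') - int (h j)) = real q * \<kappa> (int (h j)) + real q * \<kappa> (int (h j) + n)"
      by (simp add: power2_eq_square distrib_left mult.assoc)
    then show ?thesis using first[OF jj(1)] by simp
  qed
  have "q\<^sup>2 * \<kappa> (a - b) = 2 * \<kappa> 0 + 2 * \<kappa> n" if ab: "a \<in> F" "b \<in> F" "a \<noteq> b" for a b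
  proof -
    obtain j j' where jj: "j \<in> J r s q N" "j' \<in> J r s q N" "a = int (h j)" "b = int (h j')" using ab(1,2) unfolding F_def by blast
    consider "j < j'" | "j' < j" using ab(3) jj by (metis linorder_neqE_nat)
    then show ?thesis
    proof cases
      case 1 then show ?thesis using second[OF jj(1,2)] \<kappa>_minus[of "a - b"] jj by simp
    next
      case 2 then show ?thesis using second[OF jj(2,1)] jj by simp
    qed
  qed
  then show ?thesis
    using fJ cF cJ q1 first by (intro exI[of _ F] exI[of _ "real q"]) (auto simp: F_def)
qed

end

section \<open>The transformation and its Koopman operator\<close>

lemma lebesgue_translation:
  assumes "S \<in> sets lebesgue"
  shows "(\<lambda>x. x + a) ` S \<in> sets (lebesgue :: real measure)" "emeasure lebesgue ((\<lambda>x. x + a) ` S) = emeasure lebesgue (S :: real set)"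
  using lebesgue_sets_translation[OF assms, of a] emeasure_lebesgue_affine[of 1 a S] by (simp_all add: add.commute)

text \<open>
  Cut a set along the disjointed pieces \<open>I n\<close>: by injectivity the image is the disjoint union of translates
  of the parts.
\<close>

lemma piecewise_translation:
  fixes f :: "real \<Rightarrow> real" and I :: "nat \<Rightarrow> real set"
  assumes I: "\<And>n. I n \<in> sets lebesgue" and tr: "\<And>n x. x \<in> I n \<Longrightarrow> f x = x + c n"
    and inj: "inj_on f (\<Union>n. I n)"
  shows "A \<in> sets lebesgue \<Longrightarrow> A \<subseteq> (\<Union>n. I n) \<Longrightarrow> f ` A \<in> sets lebesgue"
    and "A \<in> sets lebesgue \<Longrightarrow> A \<subseteq> (\<Union>n. I n) \<Longrightarrow> emeasure lebesgue (f ` A) = emeasure lebesgue A"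
    and "B \<in> sets lebesgue \<Longrightarrow> f -` B \<inter> (\<Union>n. I n) \<in> sets lebesgue"
proof -
  define D where "D A n = disjointed I n \<inter> A" for A n
  have D: "D A n \<in> sets lebesgue" if "A \<in> sets lebesgue" for A n
  proof -
    have "range (disjointed I) \<subseteq> sets lebesgue"
      using I by (intro sets.range_disjointed_sets) auto
    then show ?thesis using that unfolding D_def by blast
  qed
  have DI: "D A n \<subseteq> I n" for A n using disjointed_subset[of I n] by (auto simp: D_def)
  have DA: "(\<Union>n. D A n) = A" if "A \<subseteq> (\<Union>n. I n)" for A
    using UN_disjointed_eq[of I] that by (auto simp: D_def)
  have Dd: "disjoint_family (D A)" for A
    using disjoint_family_disjointed[of I] by (auto simp: D_def disjoint_family_on_def)
  have fD: "f ` D A n = (\<lambda>x. x + c n) ` D A n" for A n using tr[OF subsetD[OF DI]] by (intro image_cong refl)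
  { assume A: "A \<in> sets lebesgue" "A \<subseteq> (\<Union>n. I n)"
    have fA: "f ` A = (\<Union>n. f ` D A n)" using DA[OF A(2)] by (metis image_UN)
    have m: "f ` D A n \<in> sets lebesgue" for n unfolding fD by (rule lebesgue_translation[OF D[OF A(1)]])
    then show "f ` A \<in> sets lebesgue" unfolding fA by blast
    have dis: "disjoint_family (\<lambda>n. f ` D A n)"
      unfolding disjoint_family_on_def
    proof (intro ballI impI)
      fix m n :: nat assume "m \<noteq> n"
      then have "D A m \<inter> D A n = {}" using Dd[of A] by (auto simp: disjoint_family_on_def)
      moreover have "D A m \<subseteq> (\<Union>n. I n)" "D A n \<subseteq> (\<Union>n. I n)" using DI by blast+
      ultimately show "f ` D A m \<inter> f ` D A n = {}" using inj_on_image_Int[OF inj] by (metis image_empty)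
    qed
    have "emeasure lebesgue (f ` A) = (\<Sum>n. emeasure lebesgue (f ` D A n))"
      unfolding fA using m dis by (intro suminf_emeasure[symmetric]) auto
    also have "\<dots> = (\<Sum>n. emeasure lebesgue (D A n))"
      unfolding fD by (simp add: lebesgue_translation(2)[OF D[OF A(1)]])
    also have "\<dots> = emeasure lebesgue (\<Union>n. D A n)"
      using D[OF A(1)] Dd by (intro suminf_emeasure) auto
    finally show "emeasure lebesgue (f ` A) = emeasure lebesgue A" using DA[OF A(2)] by simp }
  { assume B: "B \<in> sets lebesgue"
    have "f -` B \<inter> (\<Union>n. I n) = (\<Union>n. I n \<inter> (\<lambda>x. x + (- c n)) ` B)"
    proof (intro equalityI subsetI)
      fix x assume "x \<in> f -` B \<inter> (\<Union>n. I n)"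
      then obtain n where "x \<in> I n" "f x \<in> B" by auto
      then show "x \<in> (\<Union>n. I n \<inter> (\<lambda>x. x + (- c n)) ` B)" using tr[of x n] by (force intro!: image_eqI[of _ _ "f x"])
    next
      fix x assume "x \<in> (\<Union>n. I n \<inter> (\<lambda>x. x + (- c n)) ` B)"
      then obtain n y where "x \<in> I n" "y \<in> B" "x = y - c n" by auto
      then show "x \<in> f -` B \<inter> (\<Union>n. I n)" using tr[of x n] by auto
    qed
    also have "\<dots> \<in> sets lebesgue" using I lebesgue_translation(1)[OF B] by blast
    finally show "f -` B \<inter> (\<Union>n. I n) \<in> sets lebesgue" . }
qed

locale rank_one_T2 = rank_one h r s E S T for h r s E S T +
  assumes T2: "class_T2 h r s"

sublocale rank_one_T2 \<subseteq> cutting_parameters h r s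
  by unfold_locales (fact h_one h_step T2)+

context rank_one_T2
begin

definition L :: "nat \<Rightarrow> nat \<Rightarrow> real set" where
  "L j k = (T ^^ k) ` E j"

definition len :: "nat \<Rightarrow> real" where
  "len j = measure lborel (E j)"

definition X :: "real set" where
  "X = rank_one_space h E T"

definition Xs :: "nat \<Rightarrow> real set" where
  "Xs j = (\<Union>k<h j. L j k)"

lemma X_eq: "X = (\<Union>j\<in>{1..}. Xs j)"
  by (simp add: X_def rank_one_space_def Xs_def L_def)

lemma level_X: "1 \<le> j \<Longrightarrow> k < h j \<Longrightarrow> L j k \<subseteq> X"
  by (auto simp: X_eq Xs_def)

lemma level_translation:
  assumes j: "1 \<le> j" shows "k < h j \<Longrightarrow> \<exists>c. \<forall>x\<in>E j. (T ^^ k) x = x + c"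
proof (induction k)
  case 0 then show ?case by (intro exI[of _ 0]) simp
next
  case (Suc k)
  then obtain c where c: "\<And>x. x \<in> E j \<Longrightarrow> (T ^^ k) x = x + c" by auto
  obtain d where d: "\<And>y. y \<in> (T ^^ k) ` E j \<Longrightarrow> T y = y + d"
    using tower_translation[OF j Suc.prems] by (auto simp: translates_def)
  have "(T ^^ Suc k) x = x + (c + d)" if "x \<in> E j" for x
    using d[OF imageI[OF that]] c[OF that] by simp
  then show ?case by blast
qed

lemma level_interval:
  assumes j: "1 \<le> j" and k: "k < h j"
  obtains u where "L j k = {u..<u + len j}" "0 < len j"
proof -
  obtain a b where ab: "a < b" "E j = {a..<b}" using base[OF j] by (auto simp: half_interval_def)
  obtain c where c: "\<And>x. x \<in> E j \<Longrightarrow> (T ^^ k) x = x + c" using level_translation[OF j k] by auto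
  have "L j k = (\<lambda>x. x + c) ` {a..<b}" unfolding L_def ab(2)[symmetric] using c by (intro image_cong) auto
  also have "\<dots> = {a + c..<b + c}" by simp
  finally show thesis using ab by (intro that[of "a + c"]) (auto simp: len_def)
qed

lemma len_pos: "1 \<le> j \<Longrightarrow> 0 < len j"
  using level_interval[of j 0] h_pos[of j] by auto

lemma level_measurable: "1 \<le> j \<Longrightarrow> k < h j \<Longrightarrow> L j k \<in> sets borel"
  using level_interval[of j k] by (metis atLeastLessThan_borel)

lemma level_emeasure:
  assumes "1 \<le> j" "k < h j" shows "emeasure lebesgue (L j k) = ennreal (len j)"
proof -
  obtain u where "L j k = {u..<u + len j}" "0 < len j" using level_interval[OF assms] by blast
  then show ?thesis by (simp add: emeasure_completion)
qed

lemma piece_level: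
  assumes j: "1 \<le> j" and i: "1 \<le> i" "i \<le> r j"
  shows "S j i = L (Suc j) (pos j i)"
  using i(1,2)
proof (induction i rule: dec_induct)
  case base then show ?case using next_base[OF j] by (simp add: L_def)
next
  case (step i)
  then have "S j (Suc i) = (T ^^ (h j + s j i)) ` S j i" using stack[OF j, of i] by simp
  also have "\<dots> = (T ^^ (h j + s j i)) ` (T ^^ pos j i) ` E (Suc j)" using step by (simp add: L_def)
  also have "\<dots> = (T ^^ (h j + s j i + pos j i)) ` E (Suc j)" by (simp add: image_comp funpow_add)
  finally show ?case using pos_Suc[OF step(1), of j] by (simp add: L_def add_ac)
qed

lemma pos_below_top:
  assumes j: "1 \<le> j" and i: "1 \<le> i" "i \<le> r j" and k: "k < h j"
  shows "Suc (pos j i + k) < h (Suc j)"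
  using pos_mono[OF i, of j] h_Suc[OF j] s_top[OF j] h_pos[OF j] k by linarith

lemma level_split:
  assumes j: "1 \<le> j"
  shows "L j k = (\<Union>i\<in>{1..r j}. L (Suc j) (pos j i + k))"
proof -
  have "L j k = (\<Union>i\<in>{1..r j}. (T ^^ k) ` S j i)"
    unfolding L_def piece_union[OF j, symmetric] by (simp add: image_UN)
  also have "\<dots> = (\<Union>i\<in>{1..r j}. L (Suc j) (pos j i + k))"
    using piece_level[OF j] by (intro SUP_cong refl) (simp add: L_def image_comp funpow_add[symmetric] add.commute)
  finally show ?thesis .
qed

lemma level_refine:
  assumes j: "1 \<le> j" and k: "k < h j" and jj: "j \<le> j'"
  shows "\<exists>Q\<subseteq>{..<h j'}. L j k = (\<Union>q\<in>Q. L j' q)"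
  using jj
proof (induction j' rule: dec_induct)
  case base then show ?case using k by (intro exI[of _ "{k}"]) auto
next
  case (step j')
  then obtain Q where Q: "Q \<subseteq> {..<h j'}" "L j k = (\<Union>q\<in>Q. L j' q)" by auto
  have j': "1 \<le> j'" using j step by simp
  let ?Q = "(\<lambda>(q, i). pos j' i + q) ` (Q \<times> {1..r j'})"
  have "?Q \<subseteq> {..<h (Suc j')}"
  proof
    fix p assume "p \<in> ?Q"
    then obtain q i where q: "q \<in> Q" "i \<in> {1..r j'}" "p = pos j' i + q" by auto
    then have "q < h j'" "1 \<le> i" "i \<le> r j'" using Q(1) by auto
    from pos_below_top[OF j' this(2,3,1)] show "p \<in> {..<h (Suc j')}" using q(3) by simp
  qed
  moreover have "L j k = (\<Union>q\<in>?Q. L (Suc j') q)" unfolding Q(2) level_split[OF j'] by auto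
  ultimately show ?case by blast
qed

lemma Xs_refine:
  assumes "1 \<le> j" "j \<le> j'" shows "\<exists>Q\<subseteq>{..<h j'}. Xs j = (\<Union>q\<in>Q. L j' q)"
proof -
  have "\<forall>k<h j. \<exists>Q\<subseteq>{..<h j'}. L j k = (\<Union>q\<in>Q. L j' q)" using level_refine assms by blast
  then obtain Q where "\<forall>k<h j. Q k \<subseteq> {..<h j'} \<and> L j k = (\<Union>q\<in>Q k. L j' q)" by metis
  then show ?thesis by (intro exI[of _ "\<Union>k<h j. Q k"]) (auto simp: Xs_def)
qed

lemma Xs_mono: "1 \<le> j \<Longrightarrow> j \<le> j' \<Longrightarrow> Xs j \<subseteq> Xs j'"
proof -
  assume "1 \<le> j" "j \<le> j'"
  from Xs_refine[OF this] obtain Q where Q: "Q \<subseteq> {..<h j'}" "Xs j = (\<Union>q\<in>Q. L j' q)" by auto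
  show ?thesis unfolding Q(2) Xs_def[of j'] using Q(1) by blast
qed

lemma X_common:
  assumes "x \<in> X" obtains j where "1 \<le> j" "\<And>j'. j \<le> j' \<Longrightarrow> x \<in> Xs j'"
  using assms Xs_mono unfolding X_eq by (metis (no_types, lifting) UN_E atLeast_iff subsetD)

text \<open>No point of the space stays in the top level, because new top spacers are added at every stage.\<close>

lemma below_top:
  assumes "1 \<le> j" "x \<in> Xs j" obtains k where "x \<in> L (Suc j) k" "Suc k < h (Suc j)"
proof -
  obtain k where k: "k < h j" "x \<in> L j k" using assms by (auto simp: Xs_def)
  then obtain i where "i \<in> {1..r j}" "x \<in> L (Suc j) (pos j i + k)" using level_split[OF assms(1)] by auto
  then show thesis using pos_below_top[OF assms(1) _ _ k(1)] by (intro that) auto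
qed

lemma level_disjoint: "1 \<le> j \<Longrightarrow> k < h j \<Longrightarrow> k' < h j \<Longrightarrow> x \<in> L j k \<Longrightarrow> x \<in> L j k' \<Longrightarrow> k = k'"
  using tower_disjoint[of j] unfolding disjoint_family_on_def L_def by blast

lemma T_level: "T ` L j k = L j (Suc k)"
  by (simp add: L_def image_comp)

lemma T_X: "x \<in> X \<Longrightarrow> T x \<in> X"
  using self_map by (auto simp: X_def)

lemma Tn_X: "x \<in> X \<Longrightarrow> (T ^^ n) x \<in> X"
  by (induction n) (auto intro: T_X)

lemma T_inj: "inj_on T X"
proof (rule inj_onI)
  fix x y assume x: "x \<in> X" and y: "y \<in> X" and eq: "T x = T y"
  obtain j1 where j1: "1 \<le> j1" "\<And>j'. j1 \<le> j' \<Longrightarrow> x \<in> Xs j'" using X_common[OF x] by blast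
  obtain j2 where j2: "1 \<le> j2" "\<And>j'. j2 \<le> j' \<Longrightarrow> y \<in> Xs j'" using X_common[OF y] by blast
  define j where "j = max j1 j2"
  have j: "1 \<le> j" "x \<in> Xs j" "y \<in> Xs j" using j1 j2 by (auto simp: j_def)
  obtain k where k: "x \<in> L (Suc j) k" "Suc k < h (Suc j)" using below_top[OF j(1,2)] by blast
  obtain l where l: "y \<in> L (Suc j) l" "Suc l < h (Suc j)" using below_top[OF j(1,3)] by blast
  have "T x \<in> L (Suc j) (Suc k)" "T x \<in> L (Suc j) (Suc l)"
    using imageI[OF k(1), of T] imageI[OF l(1), of T] unfolding T_level eq .
  then have "k = l" using level_disjoint[of "Suc j" "Suc k" "Suc l"] k l by auto
  moreover obtain c where "\<And>z. z \<in> L (Suc j) k \<Longrightarrow> T z = z + c"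
    using tower_translation[OF _ k(2)] by (auto simp: translates_def L_def)
  ultimately show "x = y" using k l eq by simp
qed

lemma Tn_inj: "inj_on (T ^^ n) X"
proof (induction n)
  case (Suc n)
  have "(T ^^ n) ` X \<subseteq> X" using Tn_X by auto
  then have "inj_on (T \<circ> (T ^^ n)) X" by (intro comp_inj_on Suc inj_on_subset[OF T_inj])
  then show ?case by (simp add: comp_def)
qed simp

text \<open>The space as a sequence of half-intervals on each of which \<open>T\<close> is a translation.\<close>

definition cell :: "nat \<Rightarrow> real set" where
  "cell n = (let (j, k) = prod_decode n in if 1 \<le> j \<and> Suc k < h j then L j k else {})"

lemma cell_union: "(\<Union>n. cell n) = X"
proof
  show "(\<Union>n. cell n) \<subseteq> X"
    by (auto simp: cell_def X_eq Xs_def split: prod.splits if_splits intro!: bexI)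
  show "X \<subseteq> (\<Union>n. cell n)"
  proof
    fix x assume "x \<in> X"
    then obtain j where "1 \<le> j" "x \<in> Xs j" by (auto simp: X_eq)
    then obtain k where k: "x \<in> L (Suc j) k" "Suc k < h (Suc j)" using below_top by blast
    then have "x \<in> cell (prod_encode (Suc j, k))" by (simp add: cell_def)
    then show "x \<in> (\<Union>n. cell n)" by blast
  qed
qed

lemma cell_measurable: "cell n \<in> sets lebesgue"
proof -
  have "cell n \<in> sets borel" using level_measurable by (auto simp: cell_def split: prod.splits)
  then show ?thesis by simp
qed

lemma cell_translation: "\<exists>c. \<forall>n. \<forall>x\<in>cell n. T x = x + c n"
proof -
  have "\<forall>n. \<exists>c. \<forall>x\<in>cell n. T x = x + c"
  proof
    fix n obtain j k where jk: "prod_decode n = (j, k)" by fastforce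
    show "\<exists>c. \<forall>x\<in>cell n. T x = x + c"
      using tower_translation[of j k] by (auto simp: cell_def jk translates_def L_def)
  qed
  then show ?thesis by metis
qed

lemma X_lebesgue: "X \<in> sets lebesgue"
  unfolding cell_union[symmetric] using cell_measurable by blast

lemma T_image:
  assumes "A \<in> sets lebesgue" "A \<subseteq> X"
  shows "T ` A \<in> sets lebesgue" "emeasure lebesgue (T ` A) = emeasure lebesgue A"
proof -
  obtain c where c: "\<And>n x. x \<in> cell n \<Longrightarrow> T x = x + c n" using cell_translation by blast
  have inj: "inj_on T (\<Union>n. cell n)" using T_inj by (simp add: cell_union)
  show "T ` A \<in> sets lebesgue" "emeasure lebesgue (T ` A) = emeasure lebesgue A"
    using piecewise_translation(1,2)[where I = cell and c = c and f = T and A = A, OF cell_measurable c inj] assms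
    unfolding cell_union by blast+
qed

lemma T_preimage: "B \<in> sets lebesgue \<Longrightarrow> T -` B \<inter> X \<in> sets lebesgue"
proof -
  assume B: "B \<in> sets lebesgue"
  obtain c where c: "\<And>n x. x \<in> cell n \<Longrightarrow> T x = x + c n" using cell_translation by blast
  have inj: "inj_on T (\<Union>n. cell n)" using T_inj by (simp add: cell_union)
  show ?thesis using piecewise_translation(3)[where I = cell and c = c and f = T, OF cell_measurable c inj B] unfolding cell_union .
qed

lemma Tn_image:
  assumes "A \<in> sets lebesgue" "A \<subseteq> X" shows "(T ^^ n) ` A \<in> sets lebesgue \<and> (T ^^ n) ` A \<subseteq> X"
proof (induction n)
  case (Suc n)
  have "(T ^^ Suc n) ` A = T ` (T ^^ n) ` A" by (simp add: image_comp)
  then show ?case using T_image(1)[of "(T ^^ n) ` A"] Suc T_X by auto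
qed (use assms in simp)

lemma len_Suc: assumes j: "1 \<le> j" shows "len j = real (r j) * len (Suc j)"
proof -
  have meas: "S j i \<in> sets borel \<and> measure lborel (S j i) = len (Suc j) \<and> emeasure lborel (S j i) \<noteq> \<infinity>" if i: "i \<in> {1..r j}" for i
  proof -
    have "measure lborel (S j i) = measure lborel (S j 1)" by (rule piece_length[OF j i])
    moreover obtain a b where "S j i = {a..<b}" "a < b" using piece[OF j i] by (auto simp: half_interval_def)
    ultimately show ?thesis using next_base[OF j] by (simp add: len_def)
  qed
  have "len j = measure lborel (\<Union>i\<in>{1..r j}. S j i)" unfolding len_def piece_union[OF j] ..
  also have "\<dots> = (\<Sum>i\<in>{1..r j}. measure lborel (S j i))"
    using meas piece_disjoint[OF j] by (intro measure_finite_Union) auto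
  also have "\<dots> = (\<Sum>i\<in>{1..r j}. len (Suc j))" using meas by (intro sum.cong) auto
  finally show ?thesis by simp
qed

lemma len_R: "1 \<le> j \<Longrightarrow> len j * R j = len 1"
proof (induction j rule: dec_induct)
  case base then show ?case by (simp add: R_def)
next
  case (step j)
  then show ?case using len_Suc[of j] R_Suc[of j] by (simp add: mult_ac del: levels.simps)
qed

lemma len_small: "0 < e \<Longrightarrow> \<exists>j0\<ge>1. \<forall>j\<ge>j0. len j < e"
proof -
  assume e: "0 < e"
  have le: "len j * real j \<le> len 1" if "1 \<le> j" for j
    using that
  proof (induction j rule: dec_induct)
    case (step j)
    have "real (Suc j) \<le> real (r j) * real j"
    proof -
      have "5 * real j \<le> real (r j) * real j" using r_ge[OF step(1)] by (intro mult_right_mono) auto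
      moreover have "real (Suc j) \<le> 5 * real j" using step(1) by simp
      ultimately show ?thesis by (rule order_trans[rotated])
    qed
    then have "len (Suc j) * real (Suc j) \<le> len (Suc j) * (real (r j) * real j)"
      using len_pos[of "Suc j"] by (intro mult_left_mono) auto
    also have "\<dots> = len j * real j" using len_Suc[OF step(1)] by simp
    finally show ?case using step by simp
  qed simp
  obtain n where n: "len 1 / e < real n" using reals_Archimedean2 by blast
  have "len j < e" if "j \<ge> Suc n" for j
  proof -
    have "len 1 < e * real n" using n e by (simp add: pos_divide_less_eq mult.commute)
    also have "\<dots> \<le> e * real j" using that e by simp
    finally have *: "len 1 < e * real j" .
    have "len j * real j \<le> len 1" using le[of j] that by simp
    from this * have "len j * real j < e * real j" by (rule le_less_trans)
    then show ?thesis by (rule mult_right_less_imp_less) simp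
  qed
  then show ?thesis by (intro exI[of _ "Suc n"]) auto
qed

text \<open>A point without preimage lies in the base of every tower, and the lengths of the bases tend to zero.\<close>

lemma T_onto: "emeasure lebesgue (X - T ` X) = 0"
proof -
  have m: "X - T ` X \<in> sets lebesgue" using X_lebesgue T_image(1)[OF X_lebesgue] by auto
  have mono: "E j \<subseteq> E i" if "1 \<le> i" "i \<le> j" for i j
    using that(2)
  proof (induction j rule: dec_induct)
    case (step j)
    then show ?case using next_base[of j] piece_union[of j] r_ge[of j] that by fastforce
  qed simp
  have sub: "X - T ` X \<subseteq> E i" if i: "1 \<le> i" for i
  proof
    fix x assume x: "x \<in> X - T ` X"
    then obtain j where j: "1 \<le> j" "\<And>j'. j \<le> j' \<Longrightarrow> x \<in> Xs j'" using X_common by blast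
    let ?j = "max i j"
    obtain k where k: "k < h ?j" "x \<in> L ?j k" using j(2)[of ?j] by (auto simp: Xs_def)
    have "k = 0"
    proof (rule ccontr)
      assume "k \<noteq> 0"
      then have "x \<in> T ` L ?j (k - 1)" using k T_level[of ?j "k - 1"] by simp
      moreover have "L ?j (k - 1) \<subseteq> X" using k i j(1) by (intro level_X) auto
      ultimately show False using x by auto
    qed
    then show "x \<in> E i" using k mono[OF i, of ?j] by (auto simp: L_def)
  qed
  have "emeasure lebesgue (X - T ` X) \<le> ennreal e" if e: "0 < e" for e
  proof -
    obtain j where j: "1 \<le> j" "len j < e" using len_small[OF e] by blast
    have "X - T ` X \<subseteq> L j 0" using sub[OF j(1)] by (simp add: L_def)
    then have "emeasure lebesgue (X - T ` X) \<le> emeasure lebesgue (L j 0)"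
      using level_measurable[OF j(1), of 0] h_pos[OF j(1)] by (intro emeasure_mono) auto
    also have "\<dots> = ennreal (len j)" using level_emeasure[OF j(1), of 0] h_pos[OF j(1)] by simp
    also have "\<dots> \<le> ennreal e" using j by (intro ennreal_leI) simp
    finally show ?thesis .
  qed
  then show ?thesis by (metis ennreal_zero_less_top ennreal_le_epsilon add_0 le_zero_eq)
qed

definition \<mu> :: "real measure" where
  "\<mu> = lebesgue_on X"

lemma space_\<mu> [simp]: "space \<mu> = X"
  by (simp add: \<mu>_def)

lemma sets_\<mu>: "A \<in> sets \<mu> \<longleftrightarrow> A \<in> sets lebesgue \<and> A \<subseteq> X"
  using X_lebesgue by (auto simp: \<mu>_def sets_restrict_space_iff)

lemma emeasure_\<mu>: "A \<subseteq> X \<Longrightarrow> emeasure \<mu> A = emeasure lebesgue A"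
  using X_lebesgue by (simp add: \<mu>_def emeasure_restrict_space)

lemma T_measurable [measurable]: "T \<in> measurable \<mu> \<mu>"
proof (rule measurableI)
  show "T x \<in> space \<mu>" if "x \<in> space \<mu>" for x using that T_X by simp
  show "T -` B \<inter> space \<mu> \<in> sets \<mu>" if "B \<in> sets \<mu>" for B
    using that T_preimage by (auto simp: sets_\<mu>)
qed

lemma T_preserves: "distr \<mu> \<mu> T = \<mu>"
proof (rule measure_eqI)
  fix B assume "B \<in> sets (distr \<mu> \<mu> T)"
  then have B: "B \<in> sets lebesgue" "B \<subseteq> X" by (auto simp: sets_\<mu>)
  have p: "T -` B \<inter> X \<in> sets lebesgue" by (rule T_preimage[OF B(1)])
  have TX: "T ` X \<in> sets lebesgue" by (rule T_image[OF X_lebesgue]) simp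
  have "emeasure (distr \<mu> \<mu> T) B = emeasure \<mu> (T -` B \<inter> X)"
    using B by (subst emeasure_distr) (auto simp: sets_\<mu>)
  also have "\<dots> = emeasure lebesgue (T -` B \<inter> X)" by (simp add: emeasure_\<mu>)
  also have "\<dots> = emeasure lebesgue (T ` (T -` B \<inter> X))" by (rule T_image(2)[symmetric]) (use p in auto)
  also have "T ` (T -` B \<inter> X) = B - (X - T ` X)" using B by auto
  also have "emeasure lebesgue \<dots> = emeasure lebesgue B"
    using B TX T_onto X_lebesgue by (intro emeasure_Diff_null_set) (auto simp: null_sets_def)
  finally show "emeasure (distr \<mu> \<mu> T) B = emeasure \<mu> B" using B by (simp add: emeasure_\<mu>)
qed simp

lemma heq_\<mu>: "(\<And>x. x \<in> X \<Longrightarrow> f x = g x) \<Longrightarrow> heq (L2 \<mu>) f g"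
  by (intro heq_L2 AE_I2) simp

lemma koopman_vecs: "f \<in> vecs (L2 \<mu>) \<Longrightarrow> koopman T f \<in> vecs (L2 \<mu>)"
proof -
  assume f: "f \<in> vecs (L2 \<mu>)"
  then have [measurable]: "f \<in> borel_measurable \<mu>" by simp
  have "integrable (distr \<mu> \<mu> T) (\<lambda>x. (cmod (f x))\<^sup>2)" using f by (simp add: T_preserves)
  then have "integrable \<mu> (\<lambda>x. (cmod (f (T x)))\<^sup>2)" by (rule integrable_distr[OF T_measurable])
  moreover have "(\<lambda>x. f (T x)) \<in> borel_measurable \<mu>" by measurable
  ultimately show ?thesis by (simp add: koopman_def comp_def)
qed

text \<open>
  Surjectivity: compose with a measurable left inverse of \<open>T\<close>. By \<open>T_onto\<close> its values off the image of
  \<open>T\<close> concern a null set.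
\<close>

lemma koopman_unitary: "unitary_op (L2 \<mu>) (koopman T)"
  unfolding unitary_op_def hilbert_iso_def linear_op_def
proof (intro conjI ballI allI)
  fix f g c assume f: "f \<in> vecs (L2 \<mu>)"
  show "koopman T f \<in> vecs (L2 \<mu>)" by (rule koopman_vecs[OF f])
  show "heq (L2 \<mu>) (koopman T (scal (L2 \<mu>) c f)) (scal (L2 \<mu>) c (koopman T f))"
    by (rule heq_\<mu>) (simp add: koopman_def)
  assume g: "g \<in> vecs (L2 \<mu>)"
  show "heq (L2 \<mu>) (koopman T (f + g)) (koopman T f + koopman T g)"
    by (rule heq_\<mu>) (simp add: koopman_def)
  have [measurable]: "f \<in> borel_measurable \<mu>" "g \<in> borel_measurable \<mu>" using f g by auto
  have "(LINT x|distr \<mu> \<mu> T. f x * cnj (g x)) = (LINT x|\<mu>. f (T x) * cnj (g (T x)))"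
    by (rule integral_distr) measurable
  then show "ip (L2 \<mu>) (koopman T f) (koopman T g) = ip (L2 \<mu>) f g"
    by (simp add: koopman_def T_preserves)
next
  fix y assume y: "y \<in> vecs (L2 \<mu>)"
  define T' where "T' z = (if z \<in> T ` X then inv_into X T z else z)" for z
  have T'T: "T' (T x) = x" if "x \<in> X" for x using that T_inj by (simp add: T'_def)
  have TX: "T ` X \<in> sets lebesgue" by (rule T_image[OF X_lebesgue]) simp
  have T': "T' \<in> measurable \<mu> \<mu>"
  proof (rule measurableI)
    show "T' z \<in> space \<mu>" if "z \<in> space \<mu>" for z using that by (auto simp: T'_def inv_into_into)
    fix B assume "B \<in> sets \<mu>"
    then have B: "B \<in> sets lebesgue" "B \<subseteq> X" by (auto simp: sets_\<mu>)
    have "T' -` B \<inter> X = T ` B \<union> (B - T ` X)"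
    proof (intro equalityI subsetI)
      fix z assume z: "z \<in> T' -` B \<inter> X"
      show "z \<in> T ` B \<union> (B - T ` X)"
      proof (cases "z \<in> T ` X")
        case True
        then have "T (inv_into X T z) = z" "inv_into X T z \<in> B" using z by (auto simp: T'_def f_inv_into_f)
        then show ?thesis by (metis UnI1 image_eqI)
      qed (use z in \<open>auto simp: T'_def\<close>)
    next
      fix z assume z: "z \<in> T ` B \<union> (B - T ` X)"
      then consider b where "b \<in> B" "z = T b" | "z \<in> B" "z \<notin> T ` X" by blast
      then show "z \<in> T' -` B \<inter> X"
      proof cases
        case 1
        then have "b \<in> X" using B by blast
        then show ?thesis using 1 T'T[of b] T_X[of b] by simp
      next
        case 2
        then show ?thesis using B by (auto simp: T'_def)
      qed
    qed
    then show "T' -` B \<inter> space \<mu> \<in> sets \<mu>"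
      using T_image(1)[OF B] B TX T_X by (auto simp: sets_\<mu>)
  qed
  have [measurable]: "y \<in> borel_measurable \<mu>" using y by simp
  have m: "(\<lambda>z. y (T' z)) \<in> borel_measurable \<mu>" using T' by measurable
  have "integrable \<mu> (\<lambda>x. (cmod (y (T' (T x))))\<^sup>2)"
    using y by (subst Bochner_Integration.integrable_cong[OF refl, of _ _ "\<lambda>x. (cmod (y x))\<^sup>2"]) (auto simp: T'T)
  then have "integrable (distr \<mu> \<mu> T) (\<lambda>z. (cmod (y (T' z)))\<^sup>2)"
    using m by (subst integrable_distr_eq[OF T_measurable]) auto
  then have "(\<lambda>z. y (T' z)) \<in> vecs (L2 \<mu>)" using m by (simp add: T_preserves)
  moreover have "heq (L2 \<mu>) (koopman T (\<lambda>z. y (T' z))) y"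
    by (rule heq_\<mu>) (simp add: koopman_def T'T)
  ultimately show "\<exists>x\<in>vecs (L2 \<mu>). heq (L2 \<mu>) (koopman T x) y" by blast
qed

end

sublocale rank_one_T2 \<subseteq> Koop: unitary_pre "L2 \<mu>" "koopman T"
  by (intro unitary_pre.intro unitary_pre_axioms.intro pre_hilbert_L2 koopman_unitary)

section \<open>Cyclicity and mixing\<close>

definition ind :: "'a set \<Rightarrow> 'a \<Rightarrow> complex" where
  "ind A = (\<lambda>x. of_real (indicator A x))"

context rank_one_T2
begin

abbreviation "HL \<equiv> L2 \<mu>"

lemma ind_measurable: "A \<in> sets \<mu> \<Longrightarrow> ind A \<in> borel_measurable \<mu>"
  unfolding ind_def by (intro measurable_compose[OF borel_measurable_indicator]) simp_all

lemma ind_norm: "(cmod (ind A x))\<^sup>2 = indicator A x"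
  by (simp add: ind_def indicator_def)

lemma ind_vecs:
  assumes "A \<in> sets \<mu>" "emeasure \<mu> A < \<infinity>" shows "ind A \<in> vecs HL"
  using ind_measurable[OF assms(1)] integrable_real_indicator[OF assms] by (simp add: ind_norm)

lemma ind_ip:
  assumes "A \<in> sets \<mu>" "B \<in> sets \<mu>"
  shows "ip HL (ind A) (ind B) = of_real (measure \<mu> (A \<inter> B))"
proof -
  have "ind A x * cnj (ind B x) = of_real (indicator (A \<inter> B) x)" for x
    by (simp add: ind_def indicator_inter_arith)
  then have "ip HL (ind A) (ind B) = (LINT x|\<mu>. of_real (indicator (A \<inter> B) x))" by simp
  also have "\<dots> = of_real (measure \<mu> (A \<inter> B))"
  proof -
    have "A \<inter> B \<inter> X = A \<inter> B" using sets.sets_into_space[OF assms(1)] by auto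
    then show ?thesis using assms by simp
  qed
  finally show ?thesis .
qed

lemma level_sets: "1 \<le> j \<Longrightarrow> k < h j \<Longrightarrow> L j k \<in> sets \<mu>"
  using level_measurable level_X by (auto simp: sets_\<mu>)

lemma level_measure: "1 \<le> j \<Longrightarrow> k < h j \<Longrightarrow> emeasure \<mu> (L j k) = ennreal (len j)"
  using level_emeasure level_X by (simp add: emeasure_\<mu>)

lemma level_vecs: "1 \<le> j \<Longrightarrow> k < h j \<Longrightarrow> ind (L j k) \<in> vecs HL"
  using level_measure by (intro ind_vecs level_sets) auto

lemma Xs_sets: "1 \<le> j \<Longrightarrow> Xs j \<in> sets \<mu>"
  unfolding Xs_def using level_sets by blast

lemma ind_disjoint_sum:
  assumes "finite Q" "\<And>q q'. q \<in> Q \<Longrightarrow> q' \<in> Q \<Longrightarrow> q \<noteq> q' \<Longrightarrow> F q \<inter> F q' = {}"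
  shows "ind (\<Union>q\<in>Q. F q) = (\<Sum>q\<in>Q. ind (F q))"
proof
  fix x
  have "indicator (\<Union>q\<in>Q. F q) x = (\<Sum>q\<in>Q. indicator (F q) x :: real)"
    using assms by (intro indicator_UN_disjoint) (auto simp: disjoint_family_on_def)
  then show "ind (\<Union>q\<in>Q. F q) x = (\<Sum>q\<in>Q. ind (F q)) x" by (simp add: L2_sum ind_def)
qed

lemma level_sum:
  assumes j: "1 \<le> j" and Q: "Q \<subseteq> {..<h j}"
  shows "ind (\<Union>q\<in>Q. L j q) = (\<Sum>q\<in>Q. ind (L j q))"
  using level_disjoint[OF j] Q by (intro ind_disjoint_sum finite_subset[OF Q]) blast+

lemma koopman_power: "(koopman T ^^ n) f = f \<circ> (T ^^ n)"
  by (induction n arbitrary: f) (simp_all add: koopman_def fun_eq_iff funpow_swap1)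

lemma orb_ind_image:
  assumes A: "A \<in> sets \<mu>" "ind A \<in> vecs HL" and TA: "ind ((T ^^ n) ` A) \<in> vecs HL"
  shows "heq HL (Koop.orb (ind ((T ^^ n) ` A)) (int n)) (ind A)"
    and "heq HL (Koop.orb (ind A) (- int n)) (ind ((T ^^ n) ` A))"
proof -
  have AX: "A \<subseteq> X" using A sets_\<mu> by auto
  show 1: "heq HL (Koop.orb (ind ((T ^^ n) ` A)) (int n)) (ind A)"
  proof (rule heq_\<mu>)
    fix x assume "x \<in> X"
    then have "(T ^^ n) x \<in> (T ^^ n) ` A \<longleftrightarrow> x \<in> A" using inj_on_image_mem_iff[OF Tn_inj _ AX] by blast
    then show "Koop.orb (ind ((T ^^ n) ` A)) (int n) x = ind A x"
      by (simp add: Koop.orb_nonneg koopman_power ind_def indicator_def)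
  qed
  let ?B = "ind ((T ^^ n) ` A)"
  have v: "Koop.orb ?B (int n) \<in> vecs HL" "Koop.orb (ind A) (- int n) \<in> vecs HL"
    using A TA by (auto simp del: L2_simps)
  have a: "heq HL (Koop.orb (Koop.orb ?B (int n)) (- int n)) (Koop.orb (ind A) (- int n))"
    by (rule Koop.orb_heq[OF v(1) A(2) 1])
  have b: "heq HL (Koop.orb (Koop.orb ?B (int n)) (- int n)) ?B"
    using Koop.orb_orb[OF TA, of "- int n" "int n"] Koop.orb_orb[OF TA, of "int n" "- int n"] by (simp del: L2_simps)
  have c: "Koop.orb (Koop.orb ?B (int n)) (- int n) \<in> vecs HL" using v by (simp del: L2_simps)
  show "heq HL (Koop.orb (ind A) (- int n)) ?B"
    by (rule L2.heq_trans[OF v(2) c TA L2.heq_sym[OF c v(2) a] b])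
qed

definition g :: "nat \<Rightarrow> real \<Rightarrow> complex" where
  "g j = ind (E j)"

lemma g_vecs [simp]: "1 \<le> j \<Longrightarrow> g j \<in> vecs HL"
  using level_vecs[of j 0] h_pos[of j] by (simp add: g_def L_def del: L2_simps)

lemma E_sets: "1 \<le> j \<Longrightarrow> E j \<in> sets \<mu>"
  using level_sets[of j 0] h_pos[of j] by (simp add: L_def)

lemma orb_level: 
  assumes "1 \<le> j" "k < h j" shows "heq HL (Koop.orb (g j) (- int k)) (ind (L j k))"
  using orb_ind_image(2)[OF E_sets[OF assms(1)], of k] g_vecs[OF assms(1)] level_vecs[OF assms]
  by (simp add: g_def L_def del: L2_simps)

lemma g_ip_nonneg: 
  assumes j: "1 \<le> j" 
  shows "ip HL (Koop.orb (g j) (int m)) (g j) = of_real (measure \<mu> (((T ^^ m) -` E j \<inter> X) \<inter> E j))"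
    and "((T ^^ m) -` E j \<inter> X) \<inter> E j \<in> sets \<mu>"
proof -
  have [measurable]: "(T ^^ m) \<in> measurable \<mu> \<mu>"
    by (induction m) (auto simp: id_def comp_def intro: measurable_comp)
  have m: "(T ^^ m) -` E j \<inter> X \<in> sets \<mu>"
    using measurable_sets[OF \<open>(T ^^ m) \<in> measurable \<mu> \<mu>\<close> E_sets[OF j]] by simp
  then show "((T ^^ m) -` E j \<inter> X) \<inter> E j \<in> sets \<mu>" using E_sets[OF j] by blast
  have "ip HL (Koop.orb (g j) (int m)) (g j) = ip HL (ind ((T ^^ m) -` E j \<inter> X)) (ind (E j))"
    unfolding L2_simps by (intro Bochner_Integration.integral_cong) (auto simp: Koop.orb_nonneg koopman_power g_def ind_def indicator_def)
  then show "ip HL (Koop.orb (g j) (int m)) (g j) = of_real (measure \<mu> (((T ^^ m) -` E j \<inter> X) \<inter> E j))"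
    using ind_ip[OF m E_sets[OF j]] by simp
qed

lemma g_ip:
  assumes j: "1 \<le> j" and m: "\<bar>m\<bar> < int (h j)"
  shows "ip HL (Koop.orb (g j) m) (g j) = (if m = 0 then of_real (len j) else 0)"
proof -
  have main: "ip HL (Koop.orb (g j) (int n)) (g j) = (if n = 0 then of_real (len j) else 0)" if n: "n < h j" for n
  proof (cases "n = 0")
    case True
    have "measure \<mu> (E j) = len j"
      using level_measure[OF j, of 0] h_pos[OF j] len_pos[OF j] by (simp add: L_def Sigma_Algebra.measure_def)
    then show ?thesis using True ind_ip[OF E_sets[OF j] E_sets[OF j]] by (simp add: g_def del: L2_simps)
  next
    case False
    have "((T ^^ n) -` E j \<inter> X) \<inter> E j = {}"
    proof (rule ccontr)
      assume "((T ^^ n) -` E j \<inter> X) \<inter> E j \<noteq> {}"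
      then obtain x where "(T ^^ n) x \<in> L j 0" "(T ^^ n) x \<in> L j n" by (auto simp: L_def)
      then show False using level_disjoint[OF j _ n] h_pos[OF j] False by (metis gr_zeroI not_less_zero n)
    qed
    then show ?thesis using g_ip_nonneg[OF j, of n] False by (simp del: L2_simps)
  qed
  show ?thesis
  proof (cases "0 \<le> m")
    case True
    then show ?thesis using main[of "nat m"] m by (simp del: L2_simps)
  next
    case False
    have "ip HL (Koop.orb (g j) m) (g j) = ip HL (g j) (Koop.orb (g j) (- m))"
      using Koop.orb_ip_shift[OF g_vecs[OF j] g_vecs[OF j], of m "- m" 0] by (simp del: L2_simps)
    also have "\<dots> = cnj (ip HL (Koop.orb (g j) (- m)) (g j))"
      by (rule L2.ip_cnj) (use j in \<open>auto simp del: L2_simps\<close>)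
    finally show ?thesis using main[of "nat (- m)"] m False by (simp del: L2_simps)
  qed
qed

lemma base_levels: "1 \<le> j \<Longrightarrow> E 1 = (\<Union>a\<in>levels j. L j a)"
proof (induction j rule: dec_induct)
  case base then show ?case by (simp add: L_def)
next
  case (step j)
  then have j: "1 \<le> j" by simp
  have "E 1 = (\<Union>a\<in>levels j. \<Union>i\<in>{1..r j}. L (Suc j) (pos j i + a))"
    unfolding step(3) using level_split[OF j] by (intro SUP_cong refl)
  also have "\<dots> = (\<Union>a\<in>levels (Suc j). L (Suc j) a)" using j by auto
  finally show ?case .
qed

definition f :: "real \<Rightarrow> complex" where
  "f = g 1"

lemma f_vecs: "f \<in> vecs HL"
  unfolding f_def by (rule g_vecs) simp

lemma f_levels:
  assumes j: "1 \<le> j"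
  shows "heq HL f (\<Sum>a\<in>levels j. scal HL 1 (Koop.orb (g j) (- int a)))"
proof -
  have Q: "levels j \<subseteq> {..<h j}" using levels_less[OF j] by auto
  have "f = (\<Sum>a\<in>levels j. ind (L j a))"
    unfolding f_def g_def base_levels[OF j] by (rule level_sum[OF j Q])
  moreover have "heq HL (\<Sum>a\<in>levels j. ind (L j a)) (\<Sum>a\<in>levels j. Koop.orb (g j) (- int a))"
  proof (rule L2.heq_sum)
    fix a assume a: "a \<in> levels j"
    then have k: "a < h j" using Q by auto
    show "ind (L j a) \<in> vecs HL" by (rule level_vecs[OF j k])
    show "Koop.orb (g j) (- int a) \<in> vecs HL" using g_vecs[OF j] by (rule Koop.orb_vecs)
    show "heq HL (ind (L j a)) (Koop.orb (g j) (- int a))"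
      by (rule L2.heq_sym[OF _ _ orb_level[OF j k]]) (use level_vecs[OF j k] g_vecs[OF j] in \<open>auto simp del: L2_simps\<close>)
  qed
  ultimately show ?thesis by simp
qed

definition \<kappa> :: "int \<Rightarrow> real" where
  "\<kappa> m = Re (ip HL (Koop.orb f m) f)"

text \<open>
  \<open>f\<close> is a sum of translates of \<open>g j\<close>. The range of \<open>m\<close> is such that the differences of two levels and
  \<open>m\<close> together stay below the height, where distinct levels are disjoint.
\<close>

lemma f_corr_K:
  assumes j: "1 \<le> j" and m: "\<bar>m\<bar> < int (gap j)"
  shows "ip HL (Koop.orb f m) f = of_real (len 1 * K j m)"
proof -
  let ?s = "\<lambda>n. \<Sum>a\<in>levels j. scal HL 1 (Koop.orb (g j) (n + - int a))"
  note gv = g_vecs[OF j]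
  have sv: "?s n \<in> vecs HL" for n by (intro L2.vecs_sum L2.vecs_scal Koop.orb_vecs gv)
  have h0: "heq HL f (?s 0)" using f_levels[OF j] by (simp del: L2_simps)
  have "heq HL (Koop.orb f m) (Koop.orb (?s 0) m)" by (rule Koop.orb_heq[OF f_vecs sv h0])
  moreover have "heq HL (Koop.orb (?s 0) m) (?s m)"
    using Koop.orb_sum_scal[OF gv, where f = "\<lambda>_. 1" and g = "\<lambda>a. - int a" and A = "levels j" and n = m] by (simp del: L2_simps)
  ultimately have hm: "heq HL (Koop.orb f m) (?s m)"
    by (rule L2.heq_trans[OF Koop.orb_vecs[OF f_vecs] Koop.orb_vecs[OF sv] sv])
  have "ip HL (Koop.orb f m) f = ip HL (?s m) (?s 0)"
    using L2.heq_ip_left[OF Koop.orb_vecs[OF f_vecs] sv f_vecs hm] L2.heq_ip_right[OF f_vecs sv sv h0] by simp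
  also have "\<dots> = (\<Sum>a\<in>levels j. \<Sum>b\<in>levels j. ip HL (Koop.orb (g j) (m + - int a)) (Koop.orb (g j) (0 + - int b)))"
  proof -
    have ov: "scal HL 1 (Koop.orb (g j) n) = Koop.orb (g j) n" for n by simp
    show ?thesis unfolding ov
      by (subst L2.ip_sum) (auto simp del: L2_simps simp: L2.ip_sum_right gv intro!: L2.vecs_sum)
  qed
  also have "\<dots> = (\<Sum>a\<in>levels j. \<Sum>b\<in>levels j. of_real (len j * (if int a - int b = m then 1 else 0)))"
  proof (intro sum.cong refl)
    fix a b assume "a \<in> levels j" "b \<in> levels j"
    then have "\<bar>m - (int a - int b)\<bar> < int (h j)" using levels_gap[OF j, of a] levels_gap[OF j, of b] m by linarith
    then show "ip HL (Koop.orb (g j) (m + - int a)) (Koop.orb (g j) (0 + - int b)) = of_real (len j * (if int a - int b = m then 1 else 0))"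
      using g_ip[OF j, of "m - (int a - int b)"] Koop.orb_ip[OF gv gv, of "m + - int a" "0 + - int b"]
      by (auto simp del: L2_simps simp: algebra_simps)
  qed
  also have "\<dots> = of_real (len j * (K j m * R j))"
    using R_pos[OF j] by (simp add: K_def sum_distrib_left)
  also have "len j * (K j m * R j) = len 1 * K j m" using len_R[OF j] by (simp add: mult_ac)
  finally show ?thesis .
qed

lemma f_corr: "ip HL (Koop.orb f m) f = of_real (\<kappa> m)"
proof -
  let ?j = "Suc (Suc (nat \<bar>m\<bar>))"
  have "16 * h (Suc (nat \<bar>m\<bar>)) \<le> s (Suc (nat \<bar>m\<bar>)) (r (Suc (nat \<bar>m\<bar>)))" by (rule s_top) simp
  moreover have "Suc (nat \<bar>m\<bar>) \<le> h (Suc (nat \<bar>m\<bar>))" using h_pos[of "Suc (nat \<bar>m\<bar>)"] by simp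
  moreover have "gap ?j = gap (Suc (nat \<bar>m\<bar>)) + s (Suc (nat \<bar>m\<bar>)) (r (Suc (nat \<bar>m\<bar>)))"
    by (rule gap_Suc) simp
  ultimately have "\<bar>m\<bar> < int (gap ?j)" by linarith
  from f_corr_K[OF _ this] show ?thesis by (simp add: \<kappa>_def del: L2_simps)
qed

end

sublocale rank_one_T2 \<subseteq> tower_correlations h r s \<kappa> "len 1"
proof unfold_locales
  show "0 < len 1" by (rule len_pos) simp
  show "\<kappa> m = len 1 * K j m" if "1 \<le> j" "\<bar>m\<bar> < int (gap j)" for j m
    using f_corr_K[OF that] by (simp add: \<kappa>_def del: L2_simps)
qed

context rank_one_T2
begin

text \<open>
  The bases decrease, so these correlations are dominated by those of the first base.
\<close>

lemma g_decay: assumes j: "1 \<le> j" shows "(\<lambda>k. ip HL (Koop.orb (g j) (int k)) (g j)) \<longlonglongrightarrow> 0"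
proof (rule Lim_null_comparison[OF always_eventually \<kappa>_decay], rule allI)
  fix k
  have mono: "E j \<subseteq> E 1"
    using j
  proof (induction j rule: dec_induct)
    case (step j)
    have "S j 1 \<subseteq> E j" using piece_union[of j] r_ge[of j] step by fastforce
    then show ?case using next_base[of j] step by auto
  qed simp
  have "measure \<mu> (((T ^^ k) -` E j \<inter> X) \<inter> E j) \<le> measure \<mu> (((T ^^ k) -` E 1 \<inter> X) \<inter> E 1)"
  proof (rule measure_mono_fmeasurable)
    have "emeasure \<mu> (((T ^^ k) -` E 1 \<inter> X) \<inter> E 1) \<le> emeasure \<mu> (E 1)"
      using E_sets[of 1] by (intro emeasure_mono) auto
    also have "\<dots> < \<infinity>" using level_measure[of 1 0] h_one by (simp add: L_def)
    finally show "((T ^^ k) -` E 1 \<inter> X) \<inter> E 1 \<in> fmeasurable \<mu>" using g_ip_nonneg(2)[of 1 k] by (intro fmeasurableI) auto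
  qed (use mono g_ip_nonneg(2)[OF j, of k] in auto)
  moreover have "of_real (\<kappa> (int k)) = complex_of_real (measure \<mu> (((T ^^ k) -` E 1 \<inter> X) \<inter> E 1))"
    using g_ip_nonneg(1)[of 1 k] f_corr[of "int k"] by (simp add: f_def del: L2_simps)
  ultimately show "cmod (ip HL (Koop.orb (g j) (int k)) (g j)) \<le> \<kappa> (int k)"
    unfolding g_ip_nonneg(1)[OF j] by simp
qed

text \<open>
  Up to a translate, the base of a tower is the image of the base of the next one under a polynomial in
  the Koopman operator, and such polynomials have dense range.
\<close>

lemma next_base_cyclic: assumes j: "1 \<le> j" shows "g (Suc j) \<in> Koop.cyc (g j)"
proof -
  let ?g = "g (Suc j)"
  have gv: "?g \<in> vecs HL" "g j \<in> vecs HL" using j by (auto simp del: L2_simps)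
  \<comment> \<open>the exponents \<open>- pos j i\<close> become nonnegative after a shift by the largest of them\<close>
  define N where "N = pos j (r j)"
  define d where "d i = N - pos j i" for i
  define p :: "complex poly" where "p = (\<Sum>i\<in>{1..r j}. monom 1 (d i))"
  have posN: "pos j i \<le> N" if "i \<in> {1..r j}" for i using that pos_mono by (auto simp: N_def)
  have cp: "coeff p k = of_nat (card {i \<in> {1..r j}. d i = k})" for k
    by (simp add: p_def coeff_sum sum.If_cases Int_def)
  have "coeff p 0 \<noteq> 0"
  proof -
    have "r j \<in> {i \<in> {1..r j}. d i = 0}" using r_ge[OF j] by (simp add: d_def N_def)
    then show ?thesis unfolding cp by (auto simp: card_eq_0_iff)
  qed
  then have p0: "p \<noteq> 0" by auto
  have deg: "degree p \<le> N"
  proof (rule degree_le, intro allI impI)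
    fix i assume "N < i"
    then have "{k \<in> {1..r j}. d k = i} = {}" by (auto simp: d_def)
    then show "coeff p i = 0" unfolding cp by simp
  qed
  have "Koop.poly_orb p ?g = (\<Sum>k\<le>N. \<Sum>i\<in>{1..r j}. if d i = k then Koop.orb ?g (int k) else 0)"
    unfolding Koop.poly_orb_eq[OF deg]
  proof (intro sum.cong refl)
    fix k
    have "scal HL (coeff p k) (Koop.orb ?g (int k)) = (\<Sum>i\<in>{1..r j}. scal HL (if d i = k then 1 else 0) (Koop.orb ?g (int k)))"
      by (simp add: p_def coeff_sum fun_eq_iff L2_sum sum_distrib_right)
    also have "\<dots> = (\<Sum>i\<in>{1..r j}. if d i = k then Koop.orb ?g (int k) else 0)"
      by (intro sum.cong refl) (auto simp: fun_eq_iff)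
    finally show "scal HL (coeff p k) (Koop.orb ?g (int k)) = (\<Sum>i\<in>{1..r j}. if d i = k then Koop.orb ?g (int k) else 0)" .
  qed
  also have "\<dots> = (\<Sum>i\<in>{1..r j}. \<Sum>k\<le>N. if d i = k then Koop.orb ?g (int k) else 0)" by (rule sum.swap)
  also have "\<dots> = (\<Sum>i\<in>{1..r j}. scal HL 1 (Koop.orb ?g (int N + - int (pos j i))))"
    using posN by (intro sum.cong refl) (auto simp: sum.delta' d_def of_nat_diff)
  finally have poly: "Koop.poly_orb p ?g = (\<Sum>i\<in>{1..r j}. scal HL 1 (Koop.orb ?g (int N + - int (pos j i))))" .
  have lt: "pos j i < h (Suc j)" if "i \<in> {1..r j}" for i
    using pos_below_top[OF j, of i 0] h_pos[OF j] that by auto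
  have eq: "g j = (\<Sum>i\<in>{1..r j}. ind (L (Suc j) (pos j i)))"
  proof -
    have "E j = (\<Union>i\<in>{1..r j}. L (Suc j) (pos j i))" using level_split[OF j, of 0] by (simp add: L_def)
    moreover have "ind (\<Union>i\<in>{1..r j}. L (Suc j) (pos j i)) = (\<Sum>i\<in>{1..r j}. ind (L (Suc j) (pos j i)))"
    proof (rule ind_disjoint_sum)
      fix i i' assume "i \<in> {1..r j}" "i' \<in> {1..r j}" "i \<noteq> i'"
      moreover from this have "pos j i \<noteq> pos j i'"
        using pos_gap[of i i' j] pos_gap[of i' i j] h_pos[OF j] by (cases "i < i'") auto
      ultimately show "L (Suc j) (pos j i) \<inter> L (Suc j) (pos j i') = {}"
        using level_disjoint[of "Suc j" "pos j i" "pos j i'"] lt by auto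
    qed simp
    ultimately show ?thesis by (simp add: g_def)
  qed
  have h1: "heq HL (g j) (\<Sum>i\<in>{1..r j}. scal HL 1 (Koop.orb ?g (- int (pos j i))))"
    unfolding eq
  proof (rule L2.heq_sum)
    fix i assume i: "i \<in> {1..r j}"
    show "ind (L (Suc j) (pos j i)) \<in> vecs HL" using lt[OF i] by (intro level_vecs) auto
    show "scal HL 1 (Koop.orb ?g (- int (pos j i))) \<in> vecs HL" by (intro L2.vecs_scal Koop.orb_vecs gv)
    have "heq HL (Koop.orb ?g (- int (pos j i))) (ind (L (Suc j) (pos j i)))" using lt[OF i] by (intro orb_level) auto
    from L2.heq_sym[OF _ _ this] show "heq HL (ind (L (Suc j) (pos j i))) (scal HL 1 (Koop.orb ?g (- int (pos j i))))"
      using lt[OF i] gv level_vecs[of "Suc j" "pos j i"] by (auto simp del: L2_simps(1,3))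
  qed
  let ?s = "\<Sum>i\<in>{1..r j}. scal HL 1 (Koop.orb ?g (- int (pos j i)))"
  have sv: "?s \<in> vecs HL" by (intro L2.vecs_sum L2.vecs_scal Koop.orb_vecs gv)
  have h2: "heq HL (Koop.orb (g j) (int N)) (Koop.orb ?s (int N))" by (rule Koop.orb_heq[OF gv(2) sv h1])
  have h3: "heq HL (Koop.orb ?s (int N)) (Koop.poly_orb p ?g)" unfolding poly by (rule Koop.orb_sum_scal[OF gv(1)])
  have pv: "Koop.poly_orb p ?g \<in> vecs HL" using gv(1) by (rule Koop.poly_orb_vecs)
  have h4: "heq HL (Koop.orb (g j) (int N)) (Koop.poly_orb p ?g)"
    by (rule L2.heq_trans[OF Koop.orb_vecs[OF gv(2)] Koop.orb_vecs[OF sv] pv h2 h3])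
  have "Koop.poly_orb p ?g \<in> Koop.cyc (g j)"
    by (rule L2.closed_span_heq[OF Koop.orb_range_vecs[OF gv(2)] pv Koop.orb_in_cyc[OF gv(2)]
      L2.heq_sym[OF Koop.orb_vecs[OF gv(2)] pv h4]])
  then have "Koop.cyc (Koop.poly_orb p ?g) \<subseteq> Koop.cyc (g j)" by (rule Koop.cyc_minimal[OF gv(2)])
  moreover have "?g \<in> Koop.cyc (Koop.poly_orb p ?g)"
    by (rule Koop.polynomial_dense[OF gv(1) g_decay p0]) simp
  ultimately show ?thesis by blast
qed

lemma g_in_cyc: "1 \<le> j \<Longrightarrow> g j \<in> Koop.cyc f"
proof (induction j rule: dec_induct)
  case base then show ?case using Koop.orb_in_cyc[OF f_vecs, of 0] by (simp add: f_def)
next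
  case (step j)
  then show ?case using next_base_cyclic[of j] Koop.cyc_minimal[OF f_vecs, of "g j"] by auto
qed

lemma level_in_cyc: assumes "1 \<le> j" "k < h j" shows "ind (L j k) \<in> Koop.cyc f"
proof -
  have "Koop.orb (g j) (- int k) \<in> Koop.cyc f" by (rule Koop.cyc_orb[OF f_vecs g_in_cyc[OF assms(1)]])
  then show ?thesis
    by (rule L2.closed_span_heq[OF Koop.orb_range_vecs[OF f_vecs] level_vecs[OF assms] _ L2.heq_sym[OF _ level_vecs[OF assms] orb_level[OF assms]]])
      (rule Koop.orb_vecs[OF g_vecs[OF assms(1)]])
qed

text \<open>The levels of all towers form a generator of the Borel sets that is stable under intersection.\<close>

definition lev :: "real set set" where
  "lev = insert {} {L j k |j k. 1 \<le> j \<and> k < h j}"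

lemma lev_X: "lev \<subseteq> Pow X"
  using level_X by (auto simp: lev_def)

lemma lev_Int_stable: "Int_stable lev"
proof (rule Int_stableI)
  have main: "L j k \<inter> L j' k' \<in> lev" if t: "1 \<le> j" "k < h j" "j \<le> j'" "k' < h j'" for j k j' k'
  proof -
    obtain Q where Q: "Q \<subseteq> {..<h j'}" "L j k = (\<Union>q\<in>Q. L j' q)" using level_refine[OF t(1-3)] by blast
    have "L j k \<inter> L j' k' = (if k' \<in> Q then L j' k' else {})"
      unfolding Q(2) using level_disjoint[of j'] Q(1) t by auto
    then show ?thesis using t by (auto simp: lev_def)
  qed
  fix a b assume "a \<in> lev" "b \<in> lev"
  then consider "a = {} \<or> b = {}" | j k j' k' where "a = L j k" "b = L j' k'" "1 \<le> j" "k < h j" "1 \<le> j'" "k' < h j'"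
    by (auto simp: lev_def)
  then show "a \<inter> b \<in> lev"
  proof cases
    case 2
    then show ?thesis using main[of j k j' k'] main[of j' k' j k] by (cases "j \<le> j'") (auto simp: Int_commute)
  qed (auto simp: lev_def)
qed

lemma sigma_lev_borel:
  assumes "B \<in> sets borel" shows "X \<inter> B \<in> sigma_sets X lev"
proof -
  interpret sa: sigma_algebra X "sigma_sets X lev" using lev_X by (rule sigma_algebra_sigma_sets)
  have cl: "countable lev"
  proof -
    have "lev \<subseteq> insert {} ((\<lambda>(j, k). L j k) ` UNIV)" by (auto simp: lev_def)
    then show ?thesis by (rule countable_subset) auto
  qed
  have lt: "X \<inter> {..<a} \<in> sigma_sets X lev" for a
  proof -
    have "X \<inter> {..<a} = \<Union>{l \<in> lev. l \<subseteq> {..<a}}"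
    proof (intro equalityI subsetI)
      fix x assume x: "x \<in> X \<inter> {..<a}"
      obtain j where j: "1 \<le> j" "\<And>j'. j \<le> j' \<Longrightarrow> x \<in> Xs j'" using X_common x by blast
      obtain j0 where j0: "1 \<le> j0" "\<And>j. j0 \<le> j \<Longrightarrow> len j < a - x" using len_small[of "a - x"] x by auto
      let ?j = "max j j0"
      obtain k where k: "k < h ?j" "x \<in> L ?j k" using j(2)[of ?j] by (auto simp: Xs_def)
      obtain u where u: "L ?j k = {u..<u + len ?j}" using level_interval[of ?j k] j k by (metis le_max_iff_disj)
      have "L ?j k \<subseteq> {..<a}" using u k j0(2)[of ?j] by auto
      then show "x \<in> \<Union>{l \<in> lev. l \<subseteq> {..<a}}" using k j(1) by (auto simp: lev_def intro!: exI[of _ "L ?j k"])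
    next
      fix x assume "x \<in> \<Union>{l \<in> lev. l \<subseteq> {..<a}}"
      then show "x \<in> X \<inter> {..<a}" using lev_X by blast
    qed
    also have "\<dots> \<in> sigma_sets X lev"
      using cl by (intro sa.countable_Union countable_Collect) (auto intro: sigma_sets.Basic simp: countable_Collect)
    finally show ?thesis .
  qed
  have "B \<in> sigma_sets UNIV (range (\<lambda>a::real. {..<a}))"
    using assms unfolding borel_Iio by simp
  then show ?thesis
  proof induction
    case (Basic a) then show ?case using lt by auto
  next
    case Empty then show ?case by (simp add: sigma_sets.Empty)
  next
    case (Compl a)
    have "X \<inter> (UNIV - a) = X - (X \<inter> a)" by auto
    then show ?case using Compl sigma_sets.Compl by metis
  next
    case (Union a)
    have "X \<inter> \<Union>(range a) = (\<Union>i. X \<inter> a i)" by auto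
    then show ?case using Union sigma_sets.Union[of "\<lambda>i. X \<inter> a i"] by metis
  qed
qed

lemma cyc_limit:
  assumes F: "\<And>n. F n \<in> Koop.cyc f" and x: "x \<in> vecs HL" and lim: "(\<lambda>n. hnorm HL (F n - x)) \<longlonglongrightarrow> 0"
  shows "x \<in> Koop.cyc f"
proof (rule L2.closed_span_limit[OF Koop.orb_range_vecs[OF f_vecs] x])
  fix e :: real assume "0 < e"
  from order_tendstoD(2)[OF lim this] obtain n where n: "hnorm HL (F n - x) < e" by (auto simp: eventually_sequentially)
  have "F n \<in> vecs HL" using F L2.closed_span_subset by blast
  then have "hnorm HL (x - F n) < e" using n L2.hnorm_minus_commute[of x \<mu> "F n"] x by (simp del: L2_simps)
  then show "\<exists>y\<in>Koop.cyc f. hnorm HL (x - y) < e" using F by blast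
qed

lemma sigma_lev_sets: "A \<in> sigma_sets X lev \<Longrightarrow> A \<in> sets \<mu>"
proof -
  have "lev \<subseteq> sets \<mu>" using level_sets by (auto simp: lev_def)
  then have "sigma_sets X lev \<subseteq> sets \<mu>" using sets.sigma_sets_subset[of lev \<mu>] by simp
  then show "A \<in> sigma_sets X lev \<Longrightarrow> A \<in> sets \<mu>" by blast
qed

lemma cut_vecs:
  assumes "A \<in> sets \<mu>" "1 \<le> j" shows "ind (A \<inter> Xs j) \<in> vecs HL"
proof (rule ind_vecs)
  show "A \<inter> Xs j \<in> sets \<mu>" using assms Xs_sets by blast
  have "emeasure \<mu> (A \<inter> Xs j) \<le> emeasure \<mu> (Xs j)" using assms Xs_sets by (intro emeasure_mono) auto
  also have "\<dots> \<le> (\<Sum>k<h j. emeasure \<mu> (L j k))"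
    unfolding Xs_def using level_sets[OF assms(2)] by (intro emeasure_subadditive_finite) auto
  also have "\<dots> < \<infinity>" using level_measure[OF assms(2)] by (simp add: ennreal_mult_less_top of_nat_less_top)
  finally show "emeasure \<mu> (A \<inter> Xs j) < \<infinity>" .
qed

lemma union_in_cyc:
  assumes j: "1 \<le> j" and Q: "Q \<subseteq> {..<h j}" shows "ind (\<Union>q\<in>Q. L j q) \<in> Koop.cyc f"
  unfolding level_sum[OF j Q]
  using Q level_in_cyc[OF j] by (intro L2.closed_span_sum Koop.orb_range_vecs f_vecs) auto

text \<open>
  A Dynkin argument over the levels. Cutting with the union of one tower keeps complements and countable
  unions inside the sets of finite measure.
\<close>

lemma cut_in_cyc:
  assumes A: "A \<in> sigma_sets X lev" and j: "1 \<le> j" shows "ind (A \<inter> Xs j) \<in> Koop.cyc f"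
  using lev_Int_stable lev_X A
proof (induction rule: sigma_sets_induct_disjoint)
  case (basic A)
  have zero: "ind {} \<in> Koop.cyc f" using union_in_cyc[OF j, of "{}"] by simp
  show ?case
  proof (cases "A = {}")
    case False
    then obtain i k where A: "A = L i k" "1 \<le> i" "k < h i" using basic by (auto simp: lev_def)
    show ?thesis
    proof (cases "i \<le> j")
      case True
      then have "A \<subseteq> Xs j" using Xs_mono[OF A(2) True] A by (auto simp: Xs_def)
      then show ?thesis using level_in_cyc[OF A(2,3)] A(1) by (simp add: Int_absorb2)
    next
      case False
      then obtain Q where Q: "Q \<subseteq> {..<h i}" "Xs j = (\<Union>q\<in>Q. L i q)" using Xs_refine[OF j, of i] by auto
      have "A \<inter> Xs j = (if k \<in> Q then L i k else {})"
        unfolding Q(2) A(1) using level_disjoint[OF A(2)] Q(1) A(3) by auto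
      then show ?thesis using zero level_in_cyc[OF A(2,3)] by simp
    qed
  qed (use zero in simp)
next
  case empty then show ?case using union_in_cyc[OF j, of "{}"] by simp
next
  case (compl A)
  have "A \<subseteq> X" "Xs j \<subseteq> X" using sigma_lev_sets[OF compl(1)] j by (auto simp: sets_\<mu> X_eq)
  then have "ind ((X - A) \<inter> Xs j) = ind (Xs j) - ind (A \<inter> Xs j)"
    by (auto simp: fun_eq_iff ind_def indicator_def)
  moreover have "ind (Xs j) \<in> Koop.cyc f" unfolding Xs_def by (rule union_in_cyc[OF j]) simp
  ultimately show ?case using compl(2) L2.closed_span_diff[OF Koop.orb_range_vecs[OF f_vecs]] by (simp only: )
next
  case (union A)
  have As: "A i \<in> sets \<mu>" for i using union(2) sigma_lev_sets by blast
  have UA: "(\<Union>i. A i) \<in> sets \<mu>" using As by blast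
  let ?F = "\<lambda>n. \<Sum>i<n. ind (A i \<inter> Xs j)"
  have Feq: "?F n = ind ((\<Union>i<n. A i) \<inter> Xs j)" for n
  proof -
    have "ind (\<Union>i<n. A i \<inter> Xs j) = ?F n"
      using union(1) by (intro ind_disjoint_sum) (auto simp: disjoint_family_on_def)
    moreover have "(\<Union>i<n. A i \<inter> Xs j) = (\<Union>i<n. A i) \<inter> Xs j" by auto
    ultimately show ?thesis by simp
  qed
  have Fc: "?F n \<in> Koop.cyc f" for n using union(3) by (intro L2.closed_span_sum Koop.orb_range_vecs f_vecs) auto
  have Uv: "ind ((\<Union>i. A i) \<inter> Xs j) \<in> vecs HL" by (rule cut_vecs[OF UA j])
  show ?case
  proof (rule cyc_limit[OF Fc Uv], rule L2_dominated_limit[OF _ Uv _ Uv])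
    show "?F n \<in> vecs HL" for n using Fc L2.closed_span_subset by blast
    show "AE x in \<mu>. (\<lambda>n. ?F n x) \<longlonglongrightarrow> ind ((\<Union>i. A i) \<inter> Xs j) x"
    proof (rule AE_I2)
      fix x
      show "(\<lambda>n. ?F n x) \<longlonglongrightarrow> ind ((\<Union>i. A i) \<inter> Xs j) x"
      proof (cases "x \<in> (\<Union>i. A i) \<inter> Xs j")
        case True
        then obtain i where "x \<in> A i" "x \<in> Xs j" by auto
        then have "\<forall>\<^sub>F n in sequentially. ?F n x = ind ((\<Union>i. A i) \<inter> Xs j) x"
          unfolding Feq by (intro eventually_sequentiallyI[of "Suc i"]) (auto simp: ind_def indicator_def)
        then show ?thesis by (rule tendsto_eventually)
      next
        case False
        then have "\<forall>\<^sub>F n in sequentially. ?F n x = ind ((\<Union>i. A i) \<inter> Xs j) x"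
          unfolding Feq by (intro always_eventually) (auto simp: ind_def indicator_def)
        then show ?thesis by (rule tendsto_eventually)
      qed
    qed
    show "AE x in \<mu>. cmod (?F n x) \<le> cmod (ind ((\<Union>i. A i) \<inter> Xs j) x)" for n
      unfolding Feq by (intro AE_I2) (auto simp: ind_def indicator_def)
  qed
qed

text \<open>
  A Lebesgue set is a Borel set up to a null set, and it is the limit of its parts in the towers.
\<close>

lemma ind_in_cyc:
  assumes A: "A \<in> sets \<mu>" and v: "ind A \<in> vecs HL" shows "ind A \<in> Koop.cyc f"
proof -
  have "A \<in> sets lebesgue" using A by (simp add: sets_\<mu>)
  then obtain C N where CN: "fsigma C" "N \<in> null_sets lebesgue" "C \<union> N = A"
    by (rule lebesgue_set_almost_fsigma)
  have CX: "C \<subseteq> X" "N \<subseteq> X" using CN(3) A by (auto simp: sets_\<mu>)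
  have "C \<in> sets borel" using CN(1) by (induction) auto
  then have C: "C \<in> sigma_sets X lev" using sigma_lev_borel[of C] CX by (simp add: Int_absorb1)
  note Cs = sigma_lev_sets[OF C]
  have "AE x in \<mu>. x \<notin> N"
    using CN(2) CX by (intro AE_not_in) (auto simp: null_sets_def sets_\<mu> emeasure_\<mu>)
  then have ae: "AE x in \<mu>. ind C x = ind A x"
    by eventually_elim (use CN(3) in \<open>auto simp: ind_def indicator_def\<close>)
  show ?thesis
  proof (rule cyc_limit[where F = "\<lambda>n. ind (C \<inter> Xs (Suc n))"])
    show "ind (C \<inter> Xs (Suc n)) \<in> Koop.cyc f" for n by (rule cut_in_cyc[OF C]) simp
    show "(\<lambda>n. hnorm HL (ind (C \<inter> Xs (Suc n)) - ind A)) \<longlonglongrightarrow> 0"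
    proof (rule L2_dominated_limit[OF _ v _ v])
      show "ind (C \<inter> Xs (Suc n)) \<in> vecs HL" for n by (rule cut_vecs[OF Cs]) simp
      show "AE x in \<mu>. (\<lambda>n. ind (C \<inter> Xs (Suc n)) x) \<longlonglongrightarrow> ind A x"
        using ae AE_space
      proof eventually_elim
        case (elim x)
        then obtain j where j: "1 \<le> j" "\<And>j'. j \<le> j' \<Longrightarrow> x \<in> Xs j'" using X_common[of x] by auto
        have "\<forall>\<^sub>F n in sequentially. ind (C \<inter> Xs (Suc n)) x = ind A x"
          using eventually_ge_at_top[of j]
        proof eventually_elim
          case (elim n)
          then have "x \<in> Xs (Suc n)" using j(2) by simp
          then show ?case using \<open>ind C x = ind A x\<close> by (simp add: ind_def indicator_def)
        qed
        then show ?case by (rule tendsto_eventually)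
      qed
      show "AE x in \<mu>. cmod (ind (C \<inter> Xs (Suc n)) x) \<le> cmod (ind A x)" for n
        using CN(3) by (intro AE_I2) (auto simp: ind_def indicator_def)
    qed
  qed (rule v)
qed

theorem f_cyclic: "Koop.cyc f = vecs HL"
proof
  show "vecs HL \<subseteq> Koop.cyc f"
  proof
    fix q assume q: "q \<in> vecs HL"
    then have qm: "q \<in> borel_measurable \<mu>" by simp
    obtain F where F: "\<And>i. simple_function \<mu> (F i)" "\<And>x. x \<in> X \<Longrightarrow> (\<lambda>i. F i x) \<longlonglongrightarrow> q x"
      "\<And>i x. x \<in> X \<Longrightarrow> cmod (F i x) \<le> 2 * cmod (q x)"
      using borel_measurable_implies_sequence_metric[OF qm, of 0] by (auto simp: dist_norm) blast
    have Fm: "F i \<in> borel_measurable \<mu>" for i using F(1) by (rule borel_measurable_simple_function)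
    have w: "scal HL 2 q \<in> vecs HL" using q by (rule L2.vecs_scal)
    have Fv: "F i \<in> vecs HL" for i
    proof -
      have [measurable]: "F i \<in> borel_measurable \<mu>" by (rule Fm)
      have "integrable \<mu> (\<lambda>x. (cmod (F i x))\<^sup>2)"
      proof (rule Bochner_Integration.integrable_bound)
        show "integrable \<mu> (\<lambda>x. (cmod (scal HL 2 q x))\<^sup>2)" using w by (simp only: L2_simps)
        show "AE x in \<mu>. norm ((cmod (F i x))\<^sup>2) \<le> norm ((cmod (scal HL 2 q x))\<^sup>2)"
        proof (rule AE_I2)
          fix x assume "x \<in> space \<mu>"
          then have "cmod (F i x) \<le> cmod (scal HL 2 q x)" using F(3) by (simp add: norm_mult)
          from power_mono[OF this norm_ge_zero, of 2]
          show "norm ((cmod (F i x))\<^sup>2) \<le> norm ((cmod (scal HL 2 q x))\<^sup>2)"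
            unfolding real_norm_def abs_power2 .
        qed
      qed measurable
      then show ?thesis using Fm by simp
    qed
    have Fc: "F i \<in> Koop.cyc f" for i
    proof -
      let ?Y = "F i ` X - {0}"
      let ?A = "\<lambda>y. {x \<in> X. F i x = y}"
      have fin: "finite ?Y" using F(1)[of i] by (simp add: simple_function_def)
      have As: "?A y \<in> sets \<mu>" for y
      proof -
        have "F i -` {y} \<inter> space \<mu> \<in> sets \<mu>" using Fm[of i] by (rule measurable_sets) simp
        moreover have "F i -` {y} \<inter> space \<mu> = ?A y" by auto
        ultimately show ?thesis by simp
      qed
      have Av: "ind (?A y) \<in> vecs HL" if "y \<in> ?Y" for y
      proof -
        have y: "y \<noteq> 0" using that by simp
        have [measurable]: "F i \<in> borel_measurable \<mu>" "ind (?A y) \<in> borel_measurable \<mu>" by (rule Fm, rule ind_measurable[OF As])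
        have "integrable \<mu> (\<lambda>x. (cmod (ind (?A y) x))\<^sup>2)"
        proof (rule Bochner_Integration.integrable_bound)
          show "integrable \<mu> (\<lambda>x. (1 / cmod y)\<^sup>2 * (cmod (F i x))\<^sup>2)" using Fv[of i] by simp
          show "AE x in \<mu>. norm ((cmod (ind (?A y) x))\<^sup>2) \<le> norm ((1 / cmod y)\<^sup>2 * (cmod (F i x))\<^sup>2)"
            using y by (intro AE_I2) (auto simp: ind_def indicator_def power_divide)
        qed measurable
        then show ?thesis using ind_measurable[OF As] by simp
      qed
      have "(\<Sum>y\<in>?Y. scal HL y (ind (?A y))) \<in> Koop.cyc f"
        using Av by (intro L2.closed_span_sum L2.closed_span_scal Koop.orb_range_vecs f_vecs ind_in_cyc As) auto
      moreover have "heq HL (F i) (\<Sum>y\<in>?Y. scal HL y (ind (?A y)))"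
      proof (rule heq_\<mu>)
        fix x assume x: "x \<in> X"
        have "(\<Sum>y\<in>?Y. scal HL y (ind (?A y))) x = (\<Sum>y\<in>?Y. if F i x = y then y else 0)"
          unfolding L2_sum using x by (intro sum.cong refl) (simp add: ind_def)
        also have "\<dots> = F i x" using fin x by (auto simp: sum.delta')
        finally show "F i x = (\<Sum>y\<in>?Y. scal HL y (ind (?A y))) x" by simp
      qed
      ultimately show ?thesis by (rule L2.closed_span_heq[OF Koop.orb_range_vecs[OF f_vecs] Fv])
    qed
    show "q \<in> Koop.cyc f"
    proof (rule cyc_limit[OF Fc q], rule L2_dominated_limit[OF Fv q _ w])
      show "AE x in \<mu>. (\<lambda>n. F n x) \<longlonglongrightarrow> q x" using F(2) by (intro AE_I2) simp
      show "AE x in \<mu>. cmod (F n x) \<le> cmod (scal HL 2 q x)" for n using F(3) by (intro AE_I2) (simp add: norm_mult)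
    qed
  qed
qed (rule L2.closed_span_subset)

theorem mixing_\<mu>: "mixing \<mu> T"
  unfolding mixing_def
proof (intro ballI impI conjI allI)
  fix A B assume A: "A \<in> sets \<mu>" and B: "B \<in> sets \<mu>" and fin: "emeasure \<mu> A < \<infinity>" "emeasure \<mu> B < \<infinity>"
  have T: "(T ^^ m) ` B \<in> sets \<mu>" for m using Tn_image[of B m] B by (auto simp: sets_\<mu>)
  then show "(T ^^ m) ` B \<in> sets \<mu>" for m .
  note Av = ind_vecs[OF A fin(1)] and Bv = ind_vecs[OF B fin(2)]
  have BX: "B \<subseteq> X" using B by (simp add: sets_\<mu>)
  have Tv: "ind ((T ^^ m) ` B) \<in> vecs HL" for m
  proof (rule ind_vecs[OF T])
    have "emeasure lebesgue ((T ^^ m) ` B) = emeasure lebesgue B"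
    proof (induction m)
      case (Suc m)
      have "(T ^^ Suc m) ` B = T ` (T ^^ m) ` B" by (simp add: image_comp)
      then show ?case using T_image(2)[of "(T ^^ m) ` B"] Tn_image[of B m] B Suc by (simp only: sets_\<mu>)
    qed simp
    then show "emeasure \<mu> ((T ^^ m) ` B) < \<infinity>"
      using fin(2) BX T[of m] by (simp add: emeasure_\<mu> sets_\<mu>)
  qed
  have "(\<lambda>m. ip HL (Koop.orb (ind A) (int m)) (ind B)) \<longlonglongrightarrow> 0"
  proof (rule Koop.correlations_decay[OF f_vecs])
    show "(\<lambda>k. ip HL (Koop.orb f (int k)) f) \<longlonglongrightarrow> 0"
      unfolding f_corr using tendsto_of_real[OF \<kappa>_decay] by simp
  qed (use Av Bv f_cyclic in auto)
  moreover have "ip HL (Koop.orb (ind A) (int m)) (ind B) = of_real (measure \<mu> (A \<inter> (T ^^ m) ` B))" for m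
  proof -
    have v: "Koop.orb (ind A) (int m) \<in> vecs HL" "Koop.orb (ind ((T ^^ m) ` B)) (int m) \<in> vecs HL"
      using Koop.orb_vecs[OF Av] Koop.orb_vecs[OF Tv] by blast+
    have "ip HL (Koop.orb (ind A) (int m)) (ind B) = ip HL (Koop.orb (ind A) (int m)) (Koop.orb (ind ((T ^^ m) ` B)) (int m))"
      by (rule L2.heq_ip_right[OF Bv v(2) v(1) L2.heq_sym[OF v(2) Bv orb_ind_image(1)[OF B Bv Tv]]])
    also have "\<dots> = ip HL (ind A) (ind ((T ^^ m) ` B))" by (rule Koop.orb_ip_same[OF Av Tv])
    finally show ?thesis using ind_ip[OF A T] by simp
  qed
  ultimately have "(\<lambda>m. complex_of_real (measure \<mu> (A \<inter> (T ^^ m) ` B))) \<longlonglongrightarrow> 0" by simp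
  then show "(\<lambda>m. measure \<mu> (A \<inter> (T ^^ m) ` B)) \<longlonglongrightarrow> 0"
    using tendsto_of_real_iff[where 'a = complex, of _ 0] by fastforce
qed

end

sublocale rank_one_T2 \<subseteq> averaging_unitary "L2 \<mu>" "koopman T" f \<kappa>
proof unfold_locales
  show "f \<in> vecs (L2 \<mu>)" by (rule f_vecs)
  show "Koop.cyc f = vecs (L2 \<mu>)" by (rule f_cyclic)
  show "ip (L2 \<mu>) (Koop.orb f m) f = of_real (\<kappa> m)" for m by (rule f_corr)
  show "0 < \<kappa> 0" using \<kappa>_zero e_pos by simp
  show "(\<lambda>k. \<kappa> (int k)) \<longlonglongrightarrow> 0" by (rule \<kappa>_decay)
qed (rule averaging_sets)

theorem mainTheorem1:
  fixes h r :: "nat \<Rightarrow> nat" and s :: "nat \<Rightarrow> nat \<Rightarrow> nat"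
    and E :: "nat \<Rightarrow> real set" and S :: "nat \<Rightarrow> nat \<Rightarrow> real set"
    and T :: "real \<Rightarrow> real" and \<mu> :: "real measure"
  assumes "rank_one h r s E S T"
    and "class_T2 h r s"
    and "\<mu> = lebesgue_on (rank_one_space h E T)"
  shows "mixing \<mu> T \<and>
    \<not> kolmogorov_group_property (L2 \<mu>) (koopman T) \<and>
    (\<forall>(P :: 'p::ab_group_add hilb) t W.
       tensor_product (L2 \<mu>) (L2 \<mu>) P t \<and>
       tensor_op (L2 \<mu>) (L2 \<mu>) P t (koopman T) (koopman T) W \<longrightarrow>
         simple_spectrum (symmetric_square (L2 \<mu>) P t) W \<and>
         homogeneous_spectrum_two P W)"
proof -
  interpret R1: rank_one_T2 h r s E S T
    using assms(1,2) by (intro rank_one_T2.intro rank_one_T2_axioms.intro)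
  have \<mu>: "\<mu> = R1.\<mu>"
    unfolding assms(3) R1.\<mu>_def R1.X_def ..
  show ?thesis
    unfolding \<mu>
  proof (intro conjI allI impI)
    show "mixing R1.\<mu> T" by (rule R1.mixing_\<mu>)
    show "\<not> kolmogorov_group_property (L2 R1.\<mu>) (koopman T)" by (rule R1.no_group_property)
    fix P :: "'p hilb" and t W
    assume tensor: "tensor_product (L2 R1.\<mu>) (L2 R1.\<mu>) P t \<and>
      tensor_op (L2 R1.\<mu>) (L2 R1.\<mu>) P t (koopman T) (koopman T) W"
    interpret Sq: averaging_square "L2 R1.\<mu>" "koopman T" R1.f R1.\<kappa> P t W
      by unfold_locales (use tensor in blast)+
    show "simple_spectrum (symmetric_square (L2 R1.\<mu>) P t) W" by (rule Sq.simple_Sq)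
    show "homogeneous_spectrum_two P W" by (rule Sq.homogeneous_P)
  qed
qed


end
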